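(* Let $1\le p<n$ be integers and let $(x_1,y_1),\dots,(x_n,y_n)$ be i.i.d. random pairs in $\mathbb{R}^p\times\{-1,+1\}$ with $x_j\sim\mathcal{N}(0,I_p)$. Suppose that for some $\beta^*\in\mathbb{R}^p\setminus\{0\}$ the distribution of $y_j$ depends on $x_j$ only through $x_j^T\beta^*$, i.e. $\mathbb{P}[y_j=1\mid x_j]=\mathbb{P}[y_j=1\mid x_j^T\beta^*]$. Let $\delta:=\mathbb{P}[y_1x_1^T\beta^*>0]$, $v_j:=y_jx_j^T\beta^*/\|\beta^*\|_2$, $v:=(v_1,\dots,v_n)$ and $P:=\operatorname{span}\{v\}\oplus[0,\infty)^n\subset\mathbb{R}^n$. For $N\in\{1,\dots,n-1\}$ let $A_N$ be the event that $v_1,\dots,v_N>0$ and $v_{N+1},\dots,v_n<0$, and let $\nu_k(P|A_N):=\mathbb{E}[\nu_k(P)\mid A_N]$ be the expected $k$-th intrinsic volume of $P$ given $A_N$. Then the probability of linear separability without intercept, $S(n,p)$, equals $$ S(n,p)=\delta^n+(1-\delta)^n+2\sum_{N=1}^{n-1}\ \sum_{j\ge 1\text{ odd}}\binom{n}{N}\delta^N(1-\delta)^{n-N}\,\nu_{n-p+1+j}(P|A_N). $$ Moreover $\nu_0(P|A_N)=0$; for $k\in\{1,\dots,n-1\}$, $$ \nu_{n-k}(P|A_N)=\sum_{\substack{L\subset\{1,\dots,N\},\,R\subset\{N+1,\dots,n\}\\ |L|+|R|=k+1}}\mathbb{E}\left[\prod_{j\in L\cup R}\Phi\left(\frac{i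 g v_j}{\|v\|_{LR}}\right)\prod_{j\in\{1,\dots,n\}\setminus(L\cup R)}\Phi\left(\frac{g'v_j}{\|v\|_{LR}}\right)\Bigg|\,A_N\right], $$ where $(g,g')\sim\mathcal{N}(0,I_2)$ is independent of $(x_j,y_j)_{j}$; and $$ \nu_n(P|A_N)=\mathbb{P}\left[\min_{1\le l\le N}\frac{g_l}{v_l}\ge\max_{N+1\le r\le n}\frac{g_r}{v_r}\,\Bigg|\,A_N\right]=1-\sum_{k=1}^{n-1}\nu_k(P|A_N), $$ where $(g_1,\dots,g_n)\sim\mathcal{N}(0,I_n)$ is independent of $(x_j,y_j)_j$.
   Context: The probability of linear separability without intercept is $S(n,p):=\mathbb{P}\big[\bigcup_{\beta\in\mathbb{R}^p}\bigcap_{j=1}^n\{y_jx_j^T\beta>0\}\big]$. $A\oplus B:=\{a+b:a\in A,b\in B\}$ is the Minkowski sum. For a polyhedral cone $C\subset\mathbb{R}^n$ and $k\in\{0,\dots,n\}$, the $k$-th intrinsic volume $\nu_k(C)$ is the probability that the Euclidean projection of a standard Gaussian vector in $\mathbb{R}^n$ onto $C$ lies in the relative interior of a $k$-dimensional face of $C$; $\nu_k:=0$ for $k>n$. $i=\sqrt{-1}$, and $\Phi:\mathbb{C}\to\mathbb{C}$, $\Phi(z):=\frac12+\frac{1}{\sqrt{2\pi}}\int_0^z e^{-t^2/2}\,dt$ is the complex Gaussian cumulative distribution function. $\|v\|_{LR}^2:=\sum_{j\in L\cup R}v_j^2$. If $\mathbb{P}[A_N]=0$ (that is, $\delta\in\{0,1\}$),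 the corresponding terms in the formula for $S(n,p)$ have coefficient $0$ and are read as $0$; the formulas for $\nu_k(P|A_N)$ concern the case $\mathbb{P}[A_N]>0$. *)

theory Defs
  imports "HOL-Probability.Probability" "HOL-Complex_Analysis.Complex_Analysis"
    "HOL-Library.Set_Algebras"
begin

definition std_gaussian :: "'a::euclidean_space measure" where
  "std_gaussian = density lborel (\<lambda>z. \<Prod>b\<in>Basis. std_normal_density (z \<bullet> b))"

text \<open>The conditional probability of an event given (the sigma-algebra generated by) a
  random variable. It is determined only up to null sets.\<close>

definition cond_prob_rv ::
  "'w measure \<Rightarrow> ('w \<Rightarrow> 'b::topological_space) \<Rightarrow> 'w set \<Rightarrow> 'w \<Rightarrow> real" where
  "cond_prob_rv M X E = real_cond_exp M (vimage_algebra (space M) X borel) (indicator E)"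

text \<open>The elementary conditional expectation given an event; it is 0 if the event is null.\<close>

definition cond_exp_event ::
  "'w measure \<Rightarrow> 'w set \<Rightarrow> ('w \<Rightarrow> 'b::{banach, second_countable_topology}) \<Rightarrow> 'b" where
  "cond_exp_event M A X = set_lebesgue_integral M A X /\<^sub>R measure M A"

text \<open>Intended for (closed) polyhedral cones, on which \<^const>\<open>closest_point\<close> is the
  Euclidean projection. For \<open>k > DIM('a)\<close> there are no \<open>k\<close>-dimensional faces,
  so the value is 0.\<close>

definition intrinsic_volume :: "nat \<Rightarrow> 'a::euclidean_space set \<Rightarrow> real" where
  "intrinsic_volume k C =
     \<P>(z in std_gaussian. \<exists>F. F face_of C \<and> aff_dim F = int k \<and> closest_point C z \<in> rel_interior F)"

definition complex_Phi :: "complex \<Rightarrow> complex" where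
  "complex_Phi z =
     1 / 2 + 1 / of_real (sqrt (2 * pi)) * contour_integral (linepath 0 z) (\<lambda>t. exp (- (t\<^sup>2 / 2)))"

definition separation_prob ::
  "'w measure \<Rightarrow> nat \<Rightarrow> (nat \<Rightarrow> 'w \<Rightarrow> 'b::real_inner) \<Rightarrow> (nat \<Rightarrow> 'w \<Rightarrow> real) \<Rightarrow> real" where
  "separation_prob M n x y = \<P>(\<omega> in M. \<exists>\<beta>. \<forall>j\<in>{1..n}. y j \<omega> * (x j \<omega> \<bullet> \<beta>) > 0)"

end

theory Submission
  imports Defs "HOL-Real_Asymp.Real_Asymp"
begin

text \<open>Let \<open>v\<close> have nonzero coordinates. Up to null sets, Gaussian space is the disjoint union of the interior of
  \<open>P = span {v} + [0,\<infinity>)^n\<close> and of the pieces \<open>tile v S\<close> of the points \<open>z\<close> for which \<open>z\<close> minus its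
  projection to \<open>P\<close> is supported, with negative entries, on \<open>S\<close>; these are the points projected to a face of
  dimension \<open>n - card S + 1\<close>, so \<open>\<nu>\<^sub>n\<^sub>-\<^sub>k\<close> is the total weight of the tiles with \<open>card S = k + 1\<close>.

  Let \<open>C(V)\<close> be the open cone \<open>span V + (0,\<infinity>)^n\<close>. Enlarging the lineality space by an independent Gaussian vector
  \<open>g\<close> does not change the probability of a tile with \<open>card S\<close> at least \<open>dim V + 2\<close>: it replaces the residual of \<open>z\<close> by that of
  \<open>z - \<tau> g\<close>, where \<open>\<tau>\<close> depends only on the components of \<open>z\<close> and \<open>g\<close> in the space of vectors supported on \<open>S\<close> and orthogonal
  to \<open>V\<close>. The component of \<open>z - \<tau> g\<close> there has a rotation invariant law, and given \<open>\<tau>\<close> the remaining components are a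
  multiple of a Gaussian vector, while the tile only depends on signs. Together with
  \<open>[0 \<in> C(V \<union> {g})] + [0 \<in> C(V)] = [g \<in> C(V)] + [-g \<in> C(V)]\<close> this computes, by induction on \<open>d\<close>,
  the probability that the span of \<open>v\<close> and \<open>d\<close> Gaussian vectors meets the open orthant as twice a sum of
  every second intrinsic volume.

  Conditionally on the projections \<open>v\<^sub>j\<close>, the vectors \<open>y\<^sub>j x\<^sub>j\<close> are \<open>v\<^sub>j \<beta>*/|\<beta>*|\<close> plus independent Gaussian vectors in
  the orthogonal complement of \<open>\<beta>*\<close>. Passing from rows to columns, separability says that the span of \<open>v\<close>
  and \<open>p - 1\<close> independent Gaussian vectors in \<open>n\<close>-space meets the open orthant.

  Finally a tile probability is the product of an outer angle, which is an average of values of \<open>\<Phi>\<close> after conditioning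
  on the component along \<open>v\<close>, and of an inner angle. For the latter, \<open>exp (-x\<^sup>2/2) \<Phi>(i x)\<close> is the characteristic
  function of the negative half of a Gaussian, so that the formula is a Fourier inversion; it is regularised by the factor
  \<open>exp (-(e g)\<^sup>2/2)\<close> with \<open>e \<rightarrow> 0\<close>.\<close>

text \<open>Two difficulties shape the argument. An extra generator is subtracted with a coefficient
  that depends on the vectors themselves, so the residual on \<open>S\<close> is no longer Gaussian;
  what survives is invariance under reflections, and this suffices because tiles are cones. The
  bound \<open>dim V + 2\<close> on \<open>card S\<close> leaves room for a nonzero residual after
  the new generator has been used. The other difficulty is that \<Phi> grows on the imaginary axis
  like the reciprocal of a Gaussian density. Division by the norm of \<open>v\<close> on
  \<open>S\<close> makes the growth of the product cancel the density of \<open>g\<close> exactly,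
  and only the decay of the half characteristic functions remains, of order
  \<open>1 / \<bar>x\<bar>\<close> each. Two such factors are integrable, one is not guaranteed to
  be, which is where \<open>k \<ge> 1\<close> enters. The bound must also have a finite mean over
  the data: a factor \<open>1 / \<bar>v j\<bar>\<close> would not, so the two factors are balanced
  until each entry occurs with exponent \<open>- 1 / 2\<close> only. The law of \<open>v j\<close>
  depends on the labels, but that of its absolute value does not.\<close>

no_notation fps_nth (infixl "$" 75)

section \<open>Standard Gaussian measures\<close>

text \<open>The uniqueness argument for Haar measure: \<open>f (x + y) * g x\<close> is integrated
  over \<open>\<mu>\<close> and Lebesgue measure in both orders, and each order exploits the
  invariance of the inner measure. With \<open>g\<close> the indicator of a ball, the identity makes
  \<open>\<mu>\<close> proportional to Lebesgue measure.\<close>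

lemma translation_invariant_unique:
  fixes \<mu> :: "'a::euclidean_space measure"
  assumes sets[measurable_cong]: "sets \<mu> = sets borel" and sf: "sigma_finite_measure \<mu>"
    and inv: "\<And>c. distr \<mu> borel ((+) c) = \<mu>"
    and f[measurable]: "f \<in> borel_measurable borel" and g[measurable]: "g \<in> borel_measurable borel"
  shows "(\<integral>\<^sup>+x. f x \<partial>lborel) * (\<integral>\<^sup>+x. g x \<partial>\<mu>) = (\<integral>\<^sup>+x. f x \<partial>\<mu>) * (\<integral>\<^sup>+x. g (- x) \<partial>lborel)"
    (is "?A * ?B = ?C * ?D")
proof -
  interpret m: sigma_finite_measure \<mu> by fact
  interpret P: pair_sigma_finite \<mu> lborel ..
  have l: "(\<integral>\<^sup>+y. h (c + y) \<partial>lborel) = (\<integral>\<^sup>+y. h y \<partial>lborel)"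
    if [measurable]: "h \<in> borel_measurable borel" for h :: "'a \<Rightarrow> ennreal" and c
  proof -
    have "(\<integral>\<^sup>+y. h y \<partial>lborel) = (\<integral>\<^sup>+y. h y \<partial>(distr lborel borel ((+) c)))"
      by (simp only: lborel_distr_plus)
    also have "\<dots> = (\<integral>\<^sup>+y. h (c + y) \<partial>lborel)" by (subst nn_integral_distr) auto
    finally show ?thesis ..
  qed
  have m: "(\<integral>\<^sup>+y. h (c + y) \<partial>\<mu>) = (\<integral>\<^sup>+y. h y \<partial>\<mu>)"
    if [measurable]: "h \<in> borel_measurable borel" for h :: "'a \<Rightarrow> ennreal" and c
  proof -
    have "(\<integral>\<^sup>+y. h y \<partial>\<mu>) = (\<integral>\<^sup>+y. h y \<partial>(distr \<mu> borel ((+) c)))"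
      by (simp only: inv)
    also have "\<dots> = (\<integral>\<^sup>+y. h (c + y) \<partial>\<mu>)" by (subst nn_integral_distr) auto
    finally show ?thesis ..
  qed
  have "?A * ?B = (\<integral>\<^sup>+x. (\<integral>\<^sup>+y. f (x + y) \<partial>lborel) * g x \<partial>\<mu>)"
    by (simp add: l nn_integral_cmult)
  also have "\<dots> = (\<integral>\<^sup>+x. (\<integral>\<^sup>+y. f (x + y) * g x \<partial>lborel) \<partial>\<mu>)"
    by (simp add: nn_integral_multc)
  also have "\<dots> = (\<integral>\<^sup>+y. (\<integral>\<^sup>+x. f (x + y) * g x \<partial>\<mu>) \<partial>lborel)"
    by (rule P.Fubini'[symmetric]) simp
  also have "\<dots> = (\<integral>\<^sup>+y. (\<integral>\<^sup>+x. f x * g (x - y) \<partial>\<mu>) \<partial>lborel)"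
    (is "(\<integral>\<^sup>+y. ?u y \<partial>_) = (\<integral>\<^sup>+y. ?w y \<partial>_)")
  proof (rule nn_integral_cong)
    fix y
    show "?u y = ?w y" using m[of "\<lambda>x. f x * g (x - y)" y] by (simp add: algebra_simps)
  qed
  also have "\<dots> = (\<integral>\<^sup>+x. (\<integral>\<^sup>+y. f x * g (x - y) \<partial>lborel) \<partial>\<mu>)"
    by (rule P.Fubini') simp
  also have "\<dots> = (\<integral>\<^sup>+x. f x * (\<integral>\<^sup>+y. g (x - y) \<partial>lborel) \<partial>\<mu>)"
    by (simp add: nn_integral_cmult)
  also have "\<dots> = (\<integral>\<^sup>+x. f x * ?D \<partial>\<mu>)"
  proof (rule nn_integral_cong)
    fix x
    show "f x * (\<integral>\<^sup>+y. g (x - y) \<partial>lborel) = f x * ?D"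
      using l[of "\<lambda>y. g (- y)" "- x"] by (simp add: algebra_simps)
  qed
  also have "\<dots> = ?C * ?D" by (simp add: nn_integral_multc)
  finally show ?thesis .
qed

text \<open>The push-forward is translation invariant, since \<open>c + U x = U (V c + x)\<close>
  for the inverse \<open>V\<close>, and finite on balls because \<open>V\<close> is bounded;
  uniqueness makes it a multiple of Lebesgue measure. The factor is not computed: for the scaling of
  a subspace it is enough that it is positive and finite.\<close>

lemma distr_linear_lborel:
  fixes U :: "'a::euclidean_space \<Rightarrow> 'b::euclidean_space"
  assumes lin: "linear U" and "bij U"
  shows "\<exists>c. 0 < c \<and> c < \<infinity> \<and> distr lborel borel U = scale_measure c lborel"
proof -
  have [measurable]: "U \<in> borel_measurable borel"
    using lin by (intro borel_measurable_continuous_onI linear_continuous_on) (simp add: linear_conv_bounded_linear)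
  let ?\<mu> = "distr lborel borel U"
  obtain V where V: "linear V" "V \<circ> U = id"
    using linear_injective_left_inverse[OF lin bij_is_inj[OF \<open>bij U\<close>]] by blast
  have V2: "V (U x) = x" for x using V(2) by (metis comp_apply id_apply)
  have V3: "U (V y) = y" for y using V2 \<open>bij U\<close> by (metis bij_pointE)
  note V = V(1) V2 V3
  have [measurable]: "V \<in> borel_measurable borel"
    using V(1) by (intro borel_measurable_continuous_onI linear_continuous_on) (simp add: linear_conv_bounded_linear)
  obtain K where K: "K > 0" "\<And>x. norm (U x) \<le> K * norm x"
    using linear_bounded_pos[OF lin] by (auto simp: mult.commute)
  obtain L where L: "L > 0" "\<And>x. norm (V x) \<le> L * norm x"
    using linear_bounded_pos[OF V(1)] by (auto simp: mult.commute)
  have fin: "emeasure ?\<mu> (ball 0 r) < \<infinity>" if "r > 0" for r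
  proof -
    have "emeasure ?\<mu> (ball 0 r) = emeasure lborel (U -` ball 0 r)" by (simp add: emeasure_distr)
    also have "\<dots> \<le> emeasure lborel (cball (0::'a) (L * r))"
    proof (intro emeasure_mono)
      show "U -` ball 0 r \<subseteq> cball 0 (L * r)"
      proof
        fix x assume "x \<in> U -` ball 0 r"
        then have "norm (U x) \<le> r" by simp
        then have "L * norm (U x) \<le> L * r" using L(1) by (intro mult_left_mono) auto
        then have "norm x \<le> L * r" using L(2)[of "U x"] unfolding V(2) by linarith
        then show "x \<in> cball 0 (L * r)" by simp
      qed
    qed auto
    also have "\<dots> < \<infinity>" by (rule emeasure_lborel_cball_finite)
    finally show ?thesis .
  qed
  have pos: "emeasure ?\<mu> (ball 0 1) > 0"
  proof -
    have "0 < emeasure lborel (ball (0::'a) (1 / (2*K)))" using K(1)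
      by (subst emeasure_ball) (auto simp: unit_ball_vol_pos)
    also have "\<dots> \<le> emeasure lborel (U -` ball 0 1)"
    proof (intro emeasure_mono)
      show "ball 0 (1 / (2*K)) \<subseteq> U -` ball 0 1"
      proof
        fix x :: 'a assume "x \<in> ball 0 (1 / (2*K))"
        then have "norm x < 1 / (2*K)" by simp
        then have "K * norm x < 1" using K(1) by (simp add: field_simps)
        then show "x \<in> U -` ball 0 1" using K(2)[of x] by simp
      qed
    qed (use measurable_sets[of U borel borel "ball 0 1"] in auto)
    also have "\<dots> = emeasure ?\<mu> (ball 0 1)" by (simp add: emeasure_distr)
    finally show ?thesis .
  qed
  have sf: "sigma_finite_measure ?\<mu>"
  proof
    show "\<exists>A. countable A \<and> A \<subseteq> sets ?\<mu> \<and> \<Union> A = space ?\<mu> \<and> (\<forall>a\<in>A. emeasure ?\<mu> a \<noteq> \<infinity>)"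
    proof (intro exI[of _ "range (\<lambda>n. ball 0 (real (Suc n)))"] conjI ballI)
      show "\<Union> (range (\<lambda>n. ball 0 (real (Suc n)))) = space ?\<mu>"
      proof (auto)
        fix x :: 'b
        obtain k where "norm x < real k" using reals_Archimedean2 by blast
        then have "norm x < 1 + real k" by linarith
        then show "\<exists>xa. norm x < 1 + real xa" ..
      qed
      fix a assume "a \<in> range (\<lambda>n. ball (0::'b) (real (Suc n)))"
      then obtain k where "a = ball 0 (real (Suc k))" by blast
      then show "emeasure ?\<mu> a \<noteq> \<infinity>" using fin[of "real (Suc k)"] by simp
    qed auto
  qed
  have inv: "distr ?\<mu> borel ((+) c) = ?\<mu>" for c
  proof -
    have "distr ?\<mu> borel ((+) c) = distr lborel borel (\<lambda>x. c + U x)"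
      by (simp add: distr_distr comp_def)
    also have "\<dots> = distr lborel borel (\<lambda>x. U (V c + x))"
      by (simp add: linear_add[OF lin] V)
    also have "\<dots> = distr (distr lborel borel ((+) (V c))) borel U"
      by (simp add: distr_distr comp_def)
    also have "\<dots> = ?\<mu>" by (simp only: lborel_distr_plus)
    finally show ?thesis .
  qed
  define c where "c = emeasure ?\<mu> (ball 0 1) / emeasure lborel (ball (0::'b) 1)"
  have lb: "emeasure lborel (ball (0::'b) 1) = ennreal (unit_ball_vol (DIM('b)))" by (simp add: emeasure_ball)
  have ub: "0 < unit_ball_vol (DIM('b))" by simp
  have e: "emeasure ?\<mu> A = c * emeasure lborel A" if [measurable]: "A \<in> sets borel" for A
  proof -
    have "(\<integral>\<^sup>+x. indicator A x \<partial>lborel) * (\<integral>\<^sup>+x. indicator (ball 0 1) x \<partial>?\<mu>) =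
      (\<integral>\<^sup>+x. indicator A x \<partial>?\<mu>) * (\<integral>\<^sup>+x. indicator (ball 0 1) (- x) \<partial>(lborel :: 'b measure))"
      using translation_invariant_unique[where f="indicator A :: 'b \<Rightarrow> ennreal" and g="indicator (ball 0 1) :: 'b \<Rightarrow> ennreal", OF _ sf inv]
      by (simp add: borel_measurable_indicator)
    also have "(\<integral>\<^sup>+x. indicator (ball 0 1) (- x) \<partial>(lborel :: 'b measure)) = (\<integral>\<^sup>+x. indicator (ball 0 1) x \<partial>(lborel :: 'b measure))"
      by (intro nn_integral_cong) (auto split: split_indicator)
    finally have *: "emeasure lborel A * emeasure ?\<mu> (ball 0 1) = emeasure ?\<mu> A * emeasure lborel (ball (0::'b) 1)"
      by (simp add: nn_integral_indicator)
    have "emeasure ?\<mu> A = emeasure ?\<mu> A * (emeasure lborel (ball (0::'b) 1) / emeasure lborel (ball (0::'b) 1))"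
      unfolding lb by (subst ennreal_divide_self) (use ub in \<open>auto simp: less_le\<close>)
    also have "\<dots> = emeasure lborel A * emeasure ?\<mu> (ball 0 1) / emeasure lborel (ball (0::'b) 1)"
      by (simp add: * ennreal_times_divide)
    also have "\<dots> = c * emeasure lborel A" by (simp add: c_def ennreal_times_divide ac_simps)
    finally show ?thesis .
  qed
  show ?thesis
  proof (intro exI conjI)
    show "0 < c" using pos unfolding c_def lb by (auto simp: zero_less_iff_neq_zero)
    show "c < \<infinity>" unfolding c_def lb using fin[of 1] less_imp_neq[OF ub]
      by (auto simp: ennreal_divide_eq_top_iff simp flip: less_top)
    show "?\<mu> = scale_measure c lborel"
      by (rule measure_eqI) (simp_all add: e)
  qed
qed

text \<open>The preimage of the unit ball is the unit ball, which forces the scaling factor to be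
  1.\<close>

lemma distr_isometry_lborel:
  fixes U :: "'a::euclidean_space \<Rightarrow> 'b::euclidean_space"
  assumes lin: "linear U" and nrm: "\<And>x. norm (U x) = norm x" and "surj U"
  shows "distr lborel borel U = lborel" and "DIM('a) = DIM('b)"
proof -
  have [measurable]: "U \<in> borel_measurable borel"
    using lin by (intro borel_measurable_continuous_onI linear_continuous_on) (simp add: linear_conv_bounded_linear)
  have inj: "inj U"
    using lin nrm by (metis linear_injective_0 norm_eq_zero)
  then have "bij U" using \<open>surj U\<close> by (simp add: bij_def)
  show D: "DIM('a) = DIM('b)"
    using inj \<open>surj U\<close> lin by (metis dim_UNIV dim_image_eq injD inj_on_def)
  obtain c where c: "0 < c" "c < \<infinity>" "distr lborel borel U = scale_measure c lborel"
    using distr_linear_lborel[OF lin \<open>bij U\<close>] by blast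
  have "emeasure (distr lborel borel U) (ball 0 1) = emeasure lborel (ball (0::'a) 1)"
    by (subst emeasure_distr) (auto simp: nrm intro!: arg_cong2[where f=emeasure])
  also have "\<dots> = emeasure lborel (ball (0::'b) 1)" by (simp add: emeasure_ball D)
  finally have "c * ennreal (unit_ball_vol (DIM('b))) = ennreal (unit_ball_vol (DIM('b)))"
    by (simp add: c(3) emeasure_ball)
  then have "ennreal (enn2real c * unit_ball_vol (DIM('b))) = ennreal (unit_ball_vol (DIM('b)))"
    using c(2) by (simp add: ennreal_mult)
  moreover have "unit_ball_vol (DIM('b)) > 0" by simp
  ultimately have "enn2real c = 1" by (subst (asm) ennreal_inj) auto
  then have "c = 1" using c(2) by (metis ennreal_1 ennreal_enn2real infinity_ennreal_def)
  then show "distr lborel borel U = lborel" by (simp add: c(3) scale_measure_1)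
qed

section \<open>The density, products and null sets of the standard Gaussian\<close>

lemma std_normal_density_alt: "std_normal_density t = exp (- (t\<^sup>2 / 2)) / sqrt (2 * pi)"
  by (simp add: std_normal_density_def)

lemma std_gaussian_density:
  "(\<Prod>b\<in>Basis. std_normal_density (z \<bullet> b)) = exp (- (norm z)\<^sup>2 / 2) / sqrt (2 * pi) ^ DIM('a)"
  for z :: "'a::euclidean_space"
proof -
  have "(\<Prod>b\<in>Basis. std_normal_density (z \<bullet> b)) = (\<Prod>b\<in>Basis. exp (- ((z \<bullet> b)\<^sup>2 / 2))) / sqrt (2 * pi) ^ DIM('a)"
    by (simp add: std_normal_density_alt prod_dividef)
  also have "(\<Prod>b\<in>Basis. exp (- ((z \<bullet> b)\<^sup>2 / 2))) = exp (\<Sum>b\<in>Basis. - ((z \<bullet> b)\<^sup>2 / 2))"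
    by (simp add: exp_sum)
  also have "(\<Sum>b\<in>Basis. - ((z \<bullet> b)\<^sup>2 / 2)) = - (norm z)\<^sup>2 / 2"
    by (simp add: norm_eq_sqrt_inner euclidean_inner[of z z] sum_negf sum_divide_distrib[symmetric] power2_eq_square sum_nonneg)
  finally show ?thesis .
qed

lemma std_gaussian_eq:
  "(std_gaussian :: 'a::euclidean_space measure) =
     density lborel (\<lambda>z. ennreal (exp (- (norm z)\<^sup>2 / 2) / sqrt (2 * pi) ^ DIM('a)))"
  by (simp add: std_gaussian_def std_gaussian_density)

lemma sets_std_gaussian[simp, measurable_cong]: "sets std_gaussian = sets borel"
  by (simp add: std_gaussian_def)

lemma space_std_gaussian[simp]: "space std_gaussian = UNIV"
  by (simp add: std_gaussian_def)

lemma nn_integral_std_gaussian_prod: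
  assumes [measurable]: "\<And>b. b \<in> Basis \<Longrightarrow> f b \<in> borel_measurable borel"
  shows "(\<integral>\<^sup>+x. (\<Prod>b\<in>Basis. f b (x \<bullet> b)) \<partial>(std_gaussian :: 'a::euclidean_space measure)) =
    (\<Prod>b\<in>Basis. (\<integral>\<^sup>+t. f b t \<partial>(density lborel std_normal_density)))"
proof -
  have "(\<integral>\<^sup>+x. (\<Prod>b\<in>Basis. f b (x \<bullet> b)) \<partial>(std_gaussian :: 'a::euclidean_space measure)) =
    (\<integral>\<^sup>+x. (\<Prod>b\<in>Basis. ennreal (std_normal_density (x \<bullet> b)) * f b (x \<bullet> b)) \<partial>(lborel :: 'a::euclidean_space measure))"
    unfolding std_gaussian_def
    by (subst nn_integral_density) (auto simp: prod.distrib prod_ennreal)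
  also have "\<dots> = (\<Prod>b\<in>Basis. (\<integral>\<^sup>+t. ennreal (std_normal_density t) * f b t \<partial>lborel))"
    by (subst nn_integral_lborel_prod) auto
  finally show ?thesis by (simp add: nn_integral_density)
qed

lemma prob_space_std_gaussian: "prob_space (std_gaussian :: 'a::euclidean_space measure)"
proof
  have "prob_space (density lborel std_normal_density)" by (rule prob_space_normal_density) simp
  then have "(\<integral>\<^sup>+t. 1 \<partial>(density lborel std_normal_density)) = 1"
    using prob_space.emeasure_space_1 by fastforce
  then show "emeasure std_gaussian (space (std_gaussian :: 'a measure)) = 1"
    using nn_integral_std_gaussian_prod[where f="\<lambda>_ _. 1" and ?'a='a] by simp
qed

lemma std_gaussian_real: "std_gaussian = density lborel std_normal_density"
  by (simp add: std_gaussian_def)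

lemma distr_isometry_std_gaussian:
  fixes U :: "'a::euclidean_space \<Rightarrow> 'b::euclidean_space"
  assumes lin: "linear U" and nrm: "\<And>x. norm (U x) = norm x" and "surj U"
  shows "distr std_gaussian borel U = std_gaussian"
proof -
  have [measurable]: "U \<in> borel_measurable borel"
    using lin by (intro borel_measurable_continuous_onI linear_continuous_on) (simp add: linear_conv_bounded_linear)
  note D = distr_isometry_lborel[OF assms]
  have "std_gaussian = density (distr lborel borel U) (\<lambda>z. ennreal (exp (- (norm z)\<^sup>2 / 2) / sqrt (2 * pi) ^ DIM('b)))"
    by (simp add: D std_gaussian_eq)
  also have "\<dots> = distr (density lborel (\<lambda>z. ennreal (exp (- (norm (U z))\<^sup>2 / 2) / sqrt (2 * pi) ^ DIM('b)))) borel U"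
    by (subst density_distr) auto
  also have "\<dots> = distr std_gaussian borel U"
    by (simp add: nrm std_gaussian_eq D(2))
  finally show ?thesis ..
qed

lemma nn_integral_isometry_std_gaussian:
  fixes U :: "'a::euclidean_space \<Rightarrow> 'b::euclidean_space"
  assumes lin: "linear U" and nrm: "\<And>x. norm (U x) = norm x" and "surj U"
    and [measurable]: "f \<in> borel_measurable borel"
  shows "(\<integral>\<^sup>+x. f (U x) \<partial>std_gaussian) = (\<integral>\<^sup>+x. f x \<partial>std_gaussian)"
proof -
  have [measurable]: "U \<in> borel_measurable borel"
    using lin by (intro borel_measurable_continuous_onI linear_continuous_on) (simp add: linear_conv_bounded_linear)
  have "(\<integral>\<^sup>+x. f x \<partial>std_gaussian) = (\<integral>\<^sup>+x. f x \<partial>(distr std_gaussian borel U))"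
    by (simp only: distr_isometry_std_gaussian[OF assms(1-3)])
  then show ?thesis by (simp add: nn_integral_distr)
qed

lemma std_gaussian_pair:
  "(std_gaussian :: 'a::euclidean_space measure) \<Otimes>\<^sub>M (std_gaussian :: 'b::euclidean_space measure) = std_gaussian"
proof -
  interpret b: prob_space "std_gaussian :: 'b measure" by (rule prob_space_std_gaussian)
  have "(std_gaussian :: 'a::euclidean_space measure) \<Otimes>\<^sub>M (std_gaussian :: 'b::euclidean_space measure) =
    density (lborel \<Otimes>\<^sub>M lborel) (\<lambda>(x::'a,y::'b). ennreal (exp (- (norm x)\<^sup>2 / 2) / sqrt (2 * pi) ^ DIM('a)) *
       ennreal (exp (- (norm y)\<^sup>2 / 2) / sqrt (2 * pi) ^ DIM('b)))"
    unfolding std_gaussian_eq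
    by (rule pair_measure_density)
       (use b.sigma_finite_measure_axioms[unfolded std_gaussian_eq] in \<open>auto intro: sigma_finite_lborel\<close>)
  also have "\<dots> = std_gaussian"
    unfolding lborel_prod std_gaussian_eq
    by (intro density_cong)
      (auto simp: norm_prod_def power_add ennreal_mult[symmetric] mult_exp_exp add_divide_distrib split_beta'
         intro!: borel_measurable_continuous_onI continuous_intros measurable_ennreal[THEN measurable_compose_rev])
  finally show ?thesis .
qed

text \<open>The entries may be vectors themselves, because random matrices are later read as
  families of Gaussian rows. Lebesgue measure on the product is identified on boxes; what remains is
  the factorisation of the density.\<close>

lemma std_gaussian_vec:
  "distr (\<Pi>\<^sub>M i\<in>UNIV. std_gaussian) borel vec_lambda = (std_gaussian :: ('a::euclidean_space ^ 'n::finite) measure)"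
proof -
  interpret product_sigma_finite "\<lambda>_::'n. lborel :: 'a measure" by standard
  interpret G: prob_space "std_gaussian :: 'a measure" by (rule prob_space_std_gaussian)
  interpret Gs: product_sigma_finite "\<lambda>_::'n. std_gaussian :: 'a measure" ..
  have V[measurable]: "vec_lambda \<in> borel_measurable (\<Pi>\<^sub>M i\<in>UNIV. borel :: 'a measure)"
    by (subst borel_measurable_euclidean_space) (auto simp: Basis_vec_def inner_axis)
  have lb: "distr (\<Pi>\<^sub>M i\<in>UNIV. lborel) borel vec_lambda = (lborel :: ('a ^ 'n) measure)"
  proof (rule lborel_eqI[symmetric])
    fix l u :: "'a^'n" assume le: "\<And>b. b \<in> Basis \<Longrightarrow> l \<bullet> b \<le> u \<bullet> b"
    have le': "l $ i \<bullet> b \<le> u $ i \<bullet> b" if "b \<in> Basis" for i b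
      using le[of "axis i b"] that by (auto simp: inner_axis Basis_vec_def)
    have "emeasure (distr (\<Pi>\<^sub>M i\<in>UNIV. lborel) borel vec_lambda) (box l u) =
      emeasure (\<Pi>\<^sub>M i\<in>UNIV. lborel) (\<Pi>\<^sub>E i\<in>UNIV. box (l $ i) (u $ i))"
    proof (subst emeasure_distr)
      show "box l u \<in> sets borel" by simp
    qed (auto simp: space_PiM box_def Basis_vec_def inner_axis intro!: arg_cong2[where f=emeasure])
    also have "\<dots> = (\<Prod>i\<in>UNIV. emeasure lborel (box (l $ i) (u $ i)))"
      by (rule emeasure_PiM) auto
    also have "\<dots> = (\<Prod>i\<in>UNIV. \<Prod>b\<in>Basis. ennreal ((u $ i - l $ i) \<bullet> b))"
      by (simp add: le' inner_diff_left prod_ennreal)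
    also have "\<dots> = (\<Prod>(i, b)\<in>UNIV \<times> Basis. ennreal ((u $ i - l $ i) \<bullet> b))"
      by (simp add: prod.cartesian_product)
    also have "\<dots> = (\<Prod>b\<in>Basis. ennreal ((u - l) \<bullet> b))"
    proof -
      have B: "(Basis :: ('a^'n) set) = (\<lambda>(i, b). axis i b) ` (UNIV \<times> Basis)"
        by (auto simp: Basis_vec_def)
      have i: "inj_on (\<lambda>(i::'n, b::'a). axis i b) (UNIV \<times> Basis)"
        by (auto simp: inj_on_def axis_eq_axis)
      show ?thesis unfolding B by (subst prod.reindex[OF i]) (auto simp: inner_axis intro!: prod.cong)
    qed
    also have "\<dots> = ennreal (\<Prod>b\<in>Basis. (u - l) \<bullet> b)"
      by (rule prod_ennreal) (simp add: le inner_diff_left)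
    finally show "emeasure (distr (\<Pi>\<^sub>M i\<in>UNIV. lborel) borel vec_lambda) (box l u) = ennreal (\<Prod>b\<in>Basis. (u - l) \<bullet> b)" .
  qed simp
  let ?f = "\<lambda>z::'a. ennreal (exp (- (norm z)\<^sup>2 / 2) / sqrt (2 * pi) ^ DIM('a))"
  have dens: "density (\<Pi>\<^sub>M i\<in>(UNIV::'n set). lborel) (\<lambda>x. \<Prod>i\<in>UNIV. ?f (x i)) = (\<Pi>\<^sub>M i\<in>UNIV. std_gaussian)"
  proof (rule Gs.PiM_eqI)
    fix A :: "'n \<Rightarrow> 'a set" assume "\<And>i. i \<in> UNIV \<Longrightarrow> A i \<in> sets std_gaussian"
    then have [measurable]: "\<And>i. A i \<in> sets borel" by simp
    have "emeasure (density (\<Pi>\<^sub>M i\<in>UNIV. lborel) (\<lambda>x. \<Prod>i\<in>UNIV. ?f (x i))) (Pi\<^sub>E UNIV A) =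
      (\<integral>\<^sup>+x. (\<Prod>i\<in>UNIV. ?f (x i)) * indicator (Pi\<^sub>E UNIV A) x \<partial>(\<Pi>\<^sub>M i\<in>UNIV. lborel))"
      by (rule emeasure_density) auto
    also have "\<dots> = (\<integral>\<^sup>+x. (\<Prod>i\<in>UNIV. ?f (x i) * indicator (A i) (x i)) \<partial>(\<Pi>\<^sub>M i\<in>UNIV. lborel))"
      by (intro nn_integral_cong) (auto simp: prod.distrib indicator_def PiE_def Pi_def split: if_splits)
    also have "\<dots> = (\<Prod>i\<in>UNIV. (\<integral>\<^sup>+x. ?f x * indicator (A i) x \<partial>lborel))"
      by (rule product_nn_integral_prod) auto
    also have "\<dots> = (\<Prod>i\<in>UNIV. emeasure std_gaussian (A i))"
      unfolding std_gaussian_eq by (intro prod.cong refl emeasure_density[symmetric]) auto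
    finally show "emeasure (density (\<Pi>\<^sub>M i\<in>UNIV. lborel) (\<lambda>x. \<Prod>i\<in>UNIV. ?f (x i))) (Pi\<^sub>E UNIV A) =
      (\<Prod>i\<in>UNIV. emeasure std_gaussian (A i))" .
  qed (auto intro!: sets_PiM_cong)
  have fv: "(\<Prod>i\<in>UNIV. ?f (x i)) = ennreal (exp (- (norm (vec_lambda x :: 'a^'n))\<^sup>2 / 2) / sqrt (2 * pi) ^ DIM('a^'n))" for x
  proof -
    have n: "(norm (vec_lambda x :: 'a^'n))\<^sup>2 = (\<Sum>i\<in>UNIV. (norm (x i))\<^sup>2)"
      by (simp add: norm_vec_def L2_set_def sum_nonneg)
    have "(\<Prod>i\<in>(UNIV::'n set). ?f (x i)) = ennreal (\<Prod>i\<in>(UNIV::'n set). exp (- (norm (x i))\<^sup>2 / 2) / sqrt (2 * pi) ^ DIM('a))"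
      by (rule prod_ennreal) simp
    also have "(\<Prod>i\<in>(UNIV::'n set). exp (- (norm (x i))\<^sup>2 / 2) / sqrt (2 * pi) ^ DIM('a)) =
       exp (\<Sum>i\<in>(UNIV::'n set). - (norm (x i))\<^sup>2 / 2) / (sqrt (2 * pi) ^ DIM('a)) ^ CARD('n)"
      by (simp only: prod_dividef exp_sum finite_class.finite_UNIV prod_constant)
    also have "(sqrt (2 * pi) ^ DIM('a)) ^ CARD('n) = sqrt (2 * pi) ^ DIM('a^'n)"
      by (simp only: power_mult[symmetric] DIM_cart mult.commute)
    also have "(\<Sum>i\<in>(UNIV::'n set). - (norm (x i))\<^sup>2 / 2) = - (norm (vec_lambda x :: 'a^'n))\<^sup>2 / 2"
      by (simp only: n sum_divide_distrib[symmetric] sum_negf)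
    finally show ?thesis .
  qed
  have "(std_gaussian :: ('a ^ 'n) measure) = density (distr (\<Pi>\<^sub>M i\<in>UNIV. lborel) borel vec_lambda)
      (\<lambda>z. ennreal (exp (- (norm z)\<^sup>2 / 2) / sqrt (2 * pi) ^ DIM('a^'n)))"
    by (simp only: lb std_gaussian_eq)
  also have "\<dots> = distr (density (\<Pi>\<^sub>M i\<in>UNIV. lborel) (\<lambda>x. \<Prod>i\<in>UNIV. ?f (x i))) borel vec_lambda"
    unfolding fv by (subst density_distr) simp_all
  also have "\<dots> = distr (\<Pi>\<^sub>M i\<in>UNIV. std_gaussian) borel vec_lambda" by (simp only: dens)
  finally show ?thesis ..
qed

lemma AE_std_gaussian_hyperplane:
  assumes "w \<noteq> (0::'a::euclidean_space)"
  shows "AE z in std_gaussian. z \<bullet> w \<noteq> 0"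
proof -
  have "negligible {x. w \<bullet> x = 0}" using assms by (intro negligible_hyperplane) auto
  then have "AE z in lebesgue. z \<notin> {x. w \<bullet> x = 0}"
    by (metis negligible_iff_null_sets AE_not_in)
  then have "AE z in lborel. z \<bullet> w \<noteq> 0"
    by (simp add: AE_completion_iff inner_commute)
  then show ?thesis
    unfolding std_gaussian_eq by (subst AE_density) auto
qed

lemma linear_borel_measurable:
  fixes f :: "'a::euclidean_space \<Rightarrow> 'b::euclidean_space"
  assumes "linear f"
  shows "f \<in> borel_measurable borel"
  using assms by (intro borel_measurable_continuous_onI linear_continuous_on) (simp add: linear_conv_bounded_linear)

lemma nn_integral_std_gaussian_pair:
  fixes F :: "'a::euclidean_space \<times> 'b::euclidean_space \<Rightarrow> ennreal"
  assumes [measurable]: "F \<in> borel_measurable borel"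
  shows "(\<integral>\<^sup>+z. \<integral>\<^sup>+g. F (z, g) \<partial>std_gaussian \<partial>std_gaussian) = (\<integral>\<^sup>+p. F p \<partial>std_gaussian)"
proof -
  interpret b: prob_space "std_gaussian :: 'b measure" by (rule prob_space_std_gaussian)
  have "F \<in> borel_measurable (std_gaussian \<Otimes>\<^sub>M std_gaussian)"
    unfolding std_gaussian_pair by (simp add: assms cong: measurable_cong_sets)
  from b.nn_integral_fst[OF this] show ?thesis unfolding std_gaussian_pair .
qed

lemma nn_integral_std_gaussian_fst:
  fixes f :: "'a::euclidean_space \<Rightarrow> ennreal"
  assumes [measurable]: "f \<in> borel_measurable borel"
  shows "(\<integral>\<^sup>+p. f (fst p) \<partial>(std_gaussian :: ('a \<times> 'b::euclidean_space) measure)) = (\<integral>\<^sup>+z. f z \<partial>std_gaussian)"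
proof -
  interpret b: prob_space "std_gaussian :: 'b measure" by (rule prob_space_std_gaussian)
  have "(\<integral>\<^sup>+p. f (fst p) \<partial>(std_gaussian :: ('a \<times> 'b) measure)) = (\<integral>\<^sup>+z. \<integral>\<^sup>+g. f (fst (z, g)) \<partial>(std_gaussian :: 'b measure) \<partial>std_gaussian)"
    by (subst nn_integral_std_gaussian_pair) (auto simp: borel_prod[symmetric])
  also have "\<dots> = (\<integral>\<^sup>+z. f z \<partial>std_gaussian)" using b.emeasure_space_1 by (simp add: b.emeasure_space_1)
  finally show ?thesis .
qed

section \<open>Splitting a Gaussian vector along an orthogonal projection\<close>

text \<open>A projection is described by its algebraic properties and not by its range. The locale
  serves for the projection to the coordinates in a set, for \<open>pr S V\<close> and for the
  projection to a line, all of which are given by formulas.\<close>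

locale orth_proj =
  fixes \<pi> :: "'a::euclidean_space \<Rightarrow> 'a"
  assumes linear: "linear \<pi>" and idem: "\<And>x. \<pi> (\<pi> x) = \<pi> x"
    and self_adj: "\<And>x y. \<pi> x \<bullet> y = x \<bullet> \<pi> y"
begin

lemma meas[measurable]: "\<pi> \<in> borel_measurable borel"
  by (rule linear_borel_measurable[OF linear])

lemma orth[simp]: "\<pi> x \<bullet> (y - \<pi> y) = 0" "(y - \<pi> y) \<bullet> \<pi> x = 0"
  by (simp_all add: inner_diff_right inner_diff_left self_adj idem)

lemma norm_decomp: "(norm x)\<^sup>2 = (norm (\<pi> x))\<^sup>2 + (norm (x - \<pi> x))\<^sup>2"
proof -
  have "(norm (\<pi> x + (x - \<pi> x)))\<^sup>2 = (norm (\<pi> x))\<^sup>2 + (norm (x - \<pi> x))\<^sup>2"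
    by (rule norm_add_Pythagorean) (simp add: orthogonal_def)
  then show ?thesis by simp
qed

text \<open>\<open>U\<close> exchanges the components outside the range of \<open>\<pi>\<close>
  between two independent copies. It is an isometric involution of the product space, so the range
  component of one copy together with the remainder of the other is standard Gaussian again.\<close>

lemma std_gaussian_split:
  assumes [measurable]: "f \<in> borel_measurable borel"
  shows "(\<integral>\<^sup>+z. f z \<partial>std_gaussian) = (\<integral>\<^sup>+z1. \<integral>\<^sup>+z2. f (\<pi> z1 + (z2 - \<pi> z2)) \<partial>std_gaussian \<partial>std_gaussian)"
proof -
  define U where "U = (\<lambda>p::'a \<times> 'a. (\<pi> (fst p) + (snd p - \<pi> (snd p)), (fst p - \<pi> (fst p)) + \<pi> (snd p)))"
  interpret p: linear \<pi> by (rule linear)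
  have lin: "linear U"
    by (rule linearI) (auto simp: U_def p.add p.scale algebra_simps)
  have UU: "U (U p) = p" for p
    by (simp add: U_def p.add p.diff idem)
  have s: "surj U" by (metis UU surjI)
  have nrm: "norm (U p) = norm p" for p
  proof -
    have "(norm (\<pi> a + (b - \<pi> b)))\<^sup>2 + (norm ((a - \<pi> a) + \<pi> b))\<^sup>2 = (norm a)\<^sup>2 + (norm b)\<^sup>2" for a b
      by (subst (1 2) norm_add_Pythagorean) (auto simp: orthogonal_def norm_decomp[of a] norm_decomp[of b])
    then show ?thesis
      by (simp add: norm_prod_def U_def)
  qed
  have "(\<integral>\<^sup>+z. f z \<partial>std_gaussian) = (\<integral>\<^sup>+p. f (fst p) \<partial>(std_gaussian :: ('a \<times> 'a) measure))"
    by (rule nn_integral_std_gaussian_fst[symmetric]) simp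
  also have "\<dots> = (\<integral>\<^sup>+p. f (fst (U p)) \<partial>(std_gaussian :: ('a \<times> 'a) measure))"
    by (rule nn_integral_isometry_std_gaussian[OF lin nrm s, symmetric]) (simp add: borel_prod[symmetric])
  also have "\<dots> = (\<integral>\<^sup>+z1. \<integral>\<^sup>+z2. f (fst (U (z1, z2))) \<partial>std_gaussian \<partial>std_gaussian)"
    by (rule nn_integral_std_gaussian_pair[symmetric]) (simp add: U_def borel_prod[symmetric])
  finally show ?thesis by (simp add: U_def)
qed

end

text \<open>With \<open>s = sqrt (1 + \<tau>\<^sup>2)\<close>, the vector
  \<open>(z - \<tau> g) / s\<close> is the first half of a rotation of the pair
  \<open>(z, g)\<close>, hence standard Gaussian.\<close>

lemma std_gaussian_comb:
  fixes f :: "'a::euclidean_space \<Rightarrow> ennreal"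
  assumes [measurable]: "f \<in> borel_measurable borel"
  shows "(\<integral>\<^sup>+z. \<integral>\<^sup>+g. f (z - \<tau> *\<^sub>R g) \<partial>std_gaussian \<partial>std_gaussian) =
    (\<integral>\<^sup>+z. f (sqrt (1 + \<tau>\<^sup>2) *\<^sub>R z) \<partial>std_gaussian)"
proof -
  define s where "s = sqrt (1 + \<tau>\<^sup>2)"
  have s: "s > 0" "s\<^sup>2 = 1 + \<tau>\<^sup>2" by (auto simp: s_def add_pos_nonneg)
  then have t: "1 + \<tau>\<^sup>2 \<noteq> 0" by (metis less_irrefl zero_less_power)
  define U where "U = (\<lambda>p::'a \<times> 'a. ((1/s) *\<^sub>R (fst p - \<tau> *\<^sub>R snd p), (1/s) *\<^sub>R (\<tau> *\<^sub>R fst p + snd p)))"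
  define W where "W = (\<lambda>p::'a \<times> 'a. ((1/s) *\<^sub>R (fst p + \<tau> *\<^sub>R snd p), (1/s) *\<^sub>R (snd p - \<tau> *\<^sub>R fst p)))"
  have lin: "linear U" by (rule linearI) (auto simp: U_def algebra_simps)
  have "U (W p) = p" for p
  proof -
    have "(1/s) *\<^sub>R ((1/s) *\<^sub>R (x + \<tau> *\<^sub>R y) - \<tau> *\<^sub>R ((1/s) *\<^sub>R (y - \<tau> *\<^sub>R x))) = ((1 + \<tau>\<^sup>2) / s\<^sup>2) *\<^sub>R x"
      for x y :: 'a by (simp add: algebra_simps power2_eq_square add_divide_distrib)
    moreover have "(1/s) *\<^sub>R (\<tau> *\<^sub>R ((1/s) *\<^sub>R (x + \<tau> *\<^sub>R y)) + ((1/s) *\<^sub>R (y - \<tau> *\<^sub>R x))) = ((1 + \<tau>\<^sup>2) / s\<^sup>2) *\<^sub>R y"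
      for x y :: 'a by (simp add: algebra_simps power2_eq_square add_divide_distrib)
    ultimately show ?thesis using s t by (simp add: U_def W_def)
  qed
  then have sj: "surj U" by (metis surjI)
  have nrm: "norm (U p) = norm p" for p
  proof -
    have "(norm ((1/s) *\<^sub>R (x - \<tau> *\<^sub>R y)))\<^sup>2 + (norm ((1/s) *\<^sub>R (\<tau> *\<^sub>R x + y)))\<^sup>2 =
       ((1 + \<tau>\<^sup>2) / s\<^sup>2) * ((norm x)\<^sup>2 + (norm y)\<^sup>2)" for x y :: 'a
      unfolding power2_norm_eq_inner using s(1)
      by (simp add: inner_add_left inner_add_right inner_diff_left inner_diff_right inner_commute field_simps power2_eq_square)
    then show ?thesis using s t by (simp add: norm_prod_def U_def)
  qed
  have m: "(\<lambda>p::'a \<times> 'a. f (s *\<^sub>R fst p)) \<in> borel_measurable borel" by (simp add: borel_prod[symmetric])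
  have "(\<integral>\<^sup>+z. f (s *\<^sub>R z) \<partial>std_gaussian) = (\<integral>\<^sup>+p. f (s *\<^sub>R fst p) \<partial>(std_gaussian :: ('a \<times> 'a) measure))"
    by (rule nn_integral_std_gaussian_fst[symmetric]) simp
  also have "\<dots> = (\<integral>\<^sup>+p. f (s *\<^sub>R fst (U p)) \<partial>(std_gaussian :: ('a \<times> 'a) measure))"
    by (rule nn_integral_isometry_std_gaussian[OF lin nrm sj m, symmetric])
  also have "\<dots> = (\<integral>\<^sup>+z1. \<integral>\<^sup>+z2. f (s *\<^sub>R fst (U (z1, z2))) \<partial>std_gaussian \<partial>std_gaussian)"
    by (rule nn_integral_std_gaussian_pair[symmetric]) (simp add: U_def borel_prod[symmetric])
  finally show ?thesis using s(1) by (simp add: U_def s_def)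
qed

text \<open>The Cameron--Martin formula: completing the square turns a translation into an
  exponential density.\<close>

lemma std_gaussian_shift:
  fixes f :: "'a::euclidean_space \<Rightarrow> ennreal"
  assumes [measurable]: "f \<in> borel_measurable borel"
  shows "(\<integral>\<^sup>+z. f (c + z) \<partial>std_gaussian) = (\<integral>\<^sup>+z. f z * ennreal (exp (c \<bullet> z - (norm c)\<^sup>2 / 2)) \<partial>std_gaussian)"
proof -
  let ?d = "\<lambda>z::'a. exp (- (norm z)\<^sup>2 / 2) / sqrt (2 * pi) ^ DIM('a)"
  have "(\<integral>\<^sup>+z. f (c + z) \<partial>std_gaussian) = (\<integral>\<^sup>+z. ennreal (?d ((c + z) - c)) * f (c + z) \<partial>lborel)"
    unfolding std_gaussian_eq by (subst nn_integral_density) auto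
  also have "\<dots> = (\<integral>\<^sup>+z. ennreal (?d (z - c)) * f z \<partial>(distr lborel borel ((+) c)))"
    by (subst nn_integral_distr) auto
  also have "\<dots> = (\<integral>\<^sup>+z. ennreal (?d (z - c)) * f z \<partial>lborel)" by (simp only: lborel_distr_plus)
  also have "\<dots> = (\<integral>\<^sup>+z. ennreal (?d z) * (f z * ennreal (exp (c \<bullet> z - (norm c)\<^sup>2 / 2))) \<partial>lborel)"
  proof (intro nn_integral_cong)
    fix z
    have "?d (z - c) = ?d z * exp (c \<bullet> z - (norm c)\<^sup>2 / 2)"
      by (simp add: mult_exp_exp power2_norm_eq_inner inner_diff_left inner_diff_right inner_commute field_simps)
    moreover have "ennreal (?d z * exp (c \<bullet> z - (norm c)\<^sup>2 / 2)) = ennreal (?d z) * ennreal (exp (c \<bullet> z - (norm c)\<^sup>2 / 2))"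
      by (rule ennreal_mult) auto
    ultimately show "ennreal (?d (z - c)) * f z = ennreal (?d z) * (f z * ennreal (exp (c \<bullet> z - (norm c)\<^sup>2 / 2)))"
      by (simp only: ac_simps)
  qed
  also have "\<dots> = (\<integral>\<^sup>+z. f z * ennreal (exp (c \<bullet> z - (norm c)\<^sup>2 / 2)) \<partial>std_gaussian)"
    unfolding std_gaussian_eq by (subst nn_integral_density) auto
  finally show ?thesis .
qed

section \<open>Reflections and one-dimensional marginals\<close>

text \<open>The reflection in the hyperplane orthogonal to \<open>d\<close>; for
  \<open>d = 0\<close> the division by zero makes it the identity. Reflections are sufficient
  symmetries: they carry a vector to any other of equal norm, and they commute with an orthogonal
  projection that fixes \<open>d\<close>.\<close>

definition householder :: "'a::euclidean_space \<Rightarrow> 'a \<Rightarrow> 'a" where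
  "householder d x = x - (2 * (x \<bullet> d) / (d \<bullet> d)) *\<^sub>R d"

lemma householder_linear: "linear (householder d)"
  by (rule linearI) (auto simp: householder_def algebra_simps inner_add_left add_divide_distrib)

lemma householder_norm: "norm (householder d x) = norm x"
proof (cases "d = 0")
  case False
  then have "(norm (householder d x))\<^sup>2 = (norm x)\<^sup>2"
    unfolding power2_norm_eq_inner householder_def
    by (simp add: inner_diff_left inner_diff_right inner_commute field_simps)
  then show ?thesis by simp
qed (simp add: householder_def)

lemma householder_invol: "householder d (householder d x) = x"
proof (cases "d = 0")
  case False
  then show ?thesis
    by (simp add: householder_def inner_diff_left field_simps)
qed (simp add: householder_def)

lemma householder_surj: "surj (householder d)"
  by (metis householder_invol surjI)

lemma householder_swap:
  assumes "norm a = norm b"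
  shows "householder (a - b) a = b"
proof (cases "a = b")
  case False
  have "a \<bullet> a = b \<bullet> b" using assms by (simp add: norm_eq)
  \<comment> \<open>For equal norms the squared distance is twice
    \<open>a \<bullet> (a - b)\<close>, so the coefficient of the reflection at \<open>a\<close> is
    exactly 1.\<close>
  then have e: "(a - b) \<bullet> (a - b) = 2 * (a \<bullet> (a - b))"
    by (simp add: inner_diff_left inner_diff_right inner_commute)
  have "(a - b) \<bullet> (a - b) \<noteq> 0" using False by simp
  then have "2 * (a \<bullet> (a - b)) / ((a - b) \<bullet> (a - b)) = 1" unfolding e[symmetric] by (rule divide_self)
  then have "householder (a - b) a = a - 1 *\<^sub>R (a - b)" by (simp only: householder_def)
  then show ?thesis by simp
qed (simp add: householder_def)

lemma nn_integral_std_gaussian_basis: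
  fixes h :: "real \<Rightarrow> ennreal"
  assumes [measurable]: "h \<in> borel_measurable borel" and b: "b \<in> Basis"
  shows "(\<integral>\<^sup>+x. h (x \<bullet> b) \<partial>(std_gaussian :: 'a::euclidean_space measure)) = (\<integral>\<^sup>+t. h t \<partial>std_gaussian)"
proof -
  interpret prob_space "std_gaussian :: real measure" by (rule prob_space_std_gaussian)
  have e: "(\<Prod>c\<in>Basis. if c = b then F else 1) = F" for F :: ennreal
    using b by (simp add: prod.delta)
  have "(\<integral>\<^sup>+x. h (x \<bullet> b) \<partial>(std_gaussian :: 'a measure)) = (\<integral>\<^sup>+x. (\<Prod>c\<in>Basis. if c = b then h (x \<bullet> c) else 1) \<partial>(std_gaussian :: 'a measure))"
    using b by (simp add: prod.delta)
  also have "\<dots> = (\<Prod>c\<in>Basis. (\<integral>\<^sup>+t. (if c = b then h t else 1) \<partial>std_gaussian))"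
    unfolding std_gaussian_real by (rule nn_integral_std_gaussian_prod[where f="\<lambda>c t. if c = b then h t else 1"]) auto
  also have "\<dots> = (\<Prod>c\<in>Basis. if c = b then (\<integral>\<^sup>+t. h t \<partial>std_gaussian) else 1)"
    using emeasure_space_1 by (intro prod.cong) (auto simp del: emeasure_space_1)
  finally show ?thesis by (simp only: e)
qed

text \<open>A reflection that takes a basis vector to \<open>u\<close> reduces the claim to a single
  coordinate.\<close>

lemma nn_integral_std_gaussian_inner:
  fixes h :: "real \<Rightarrow> ennreal"
  assumes [measurable]: "h \<in> borel_measurable borel" and u: "norm u = 1"
  shows "(\<integral>\<^sup>+x. h (x \<bullet> u) \<partial>(std_gaussian :: 'a::euclidean_space measure)) = (\<integral>\<^sup>+t. h t \<partial>std_gaussian)"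
proof -
  obtain b :: 'a where b: "b \<in> Basis" using nonempty_Basis by blast
  define U where "U = householder (b - u)"
  have Ub: "U b = u" unfolding U_def by (rule householder_swap) (simp add: u b)
  have in_: "U x \<bullet> U y = x \<bullet> y" for x y
    unfolding U_def using householder_linear[of "b - u"] householder_norm[of "b - u"]
    by (metis orthogonal_transformation orthogonal_transformation_def)
  have "(\<integral>\<^sup>+x. h (x \<bullet> u) \<partial>(std_gaussian :: 'a measure)) = (\<integral>\<^sup>+x. h (U x \<bullet> u) \<partial>(std_gaussian :: 'a measure))"
    unfolding U_def by (rule nn_integral_isometry_std_gaussian[symmetric, OF householder_linear householder_norm householder_surj]) simp
  also have "\<dots> = (\<integral>\<^sup>+x. h (x \<bullet> b) \<partial>(std_gaussian :: 'a measure))"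
    by (simp add: in_ flip: Ub)
  finally show ?thesis using nn_integral_std_gaussian_basis[OF assms(1) b] by simp
qed

lemma nn_integral_std_gaussian_uminus:
  fixes f :: "'a::euclidean_space \<Rightarrow> ennreal"
  assumes "f \<in> borel_measurable borel"
  shows "(\<integral>\<^sup>+x. f (- x) \<partial>std_gaussian) = (\<integral>\<^sup>+x. f x \<partial>std_gaussian)"
  by (rule nn_integral_isometry_std_gaussian)
    (auto simp: assms surj_def linear_uminus intro!: linearI exI[of _ "- _"])

section \<open>Radial independence and invariant measures on a subspace\<close>

context orth_proj
begin

text \<open>The law of \<open>norm (\<pi> z)\<close> on the cone \<open>A\<close> is determined up to a factor, since scaling the range of \<open>\<pi>\<close> multiplies
  Lebesgue measure by a constant that does not depend on \<open>A\<close>.\<close>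

lemma radial_independence:
  assumes A[measurable]: "A \<in> sets borel" and A\<pi>: "\<And>z. z \<in> A \<longleftrightarrow> \<pi> z \<in> A"
    and cone: "\<And>c z. 0 < c \<Longrightarrow> z \<in> A \<Longrightarrow> c *\<^sub>R z \<in> A"
    and \<psi>[measurable]: "\<psi> \<in> borel_measurable borel"
  shows "(\<integral>\<^sup>+z. \<psi> (norm (\<pi> z)) * indicator A z \<partial>std_gaussian) =
    emeasure std_gaussian A * (\<integral>\<^sup>+z. \<psi> (norm (\<pi> z)) \<partial>std_gaussian)"
proof -
  interpret p: linear \<pi> by (rule linear)
  \<comment> \<open>Gaussian density only in the directions orthogonal to the range of
    \<open>\<pi>\<close>, Lebesgue measure along the range: scaling the range then multiplies
    \<open>m\<close> by a constant.\<close>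
  define m where "m = density lborel (\<lambda>z::'a. ennreal (exp (- (norm (z - \<pi> z))\<^sup>2 / 2)))"
  have sets_m[measurable_cong, simp]: "sets m = sets borel" by (simp add: m_def)
  define I where "I = (\<lambda>B r. emeasure m (B \<inter> {z. norm (\<pi> z) < r}))"
  have I_fin: "I B r < \<infinity>" if [measurable]: "B \<in> sets borel" for B r
  proof -
    interpret G: prob_space "std_gaussian :: 'a measure" by (rule prob_space_std_gaussian)
    let ?C = "ennreal (exp (r\<^sup>2 / 2) * sqrt (2 * pi) ^ DIM('a))"
    have "I B r = (\<integral>\<^sup>+z. ennreal (exp (- (norm (z - \<pi> z))\<^sup>2 / 2)) * indicator (B \<inter> {z. norm (\<pi> z) < r}) z \<partial>lborel)"
      unfolding I_def m_def by (subst emeasure_density) auto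
    also have "\<dots> \<le> (\<integral>\<^sup>+z. ?C * ennreal (exp (- (norm z)\<^sup>2 / 2) / sqrt (2 * pi) ^ DIM('a)) \<partial>(lborel :: 'a measure))"
    proof (rule nn_integral_mono)
      fix z :: 'a
      show "ennreal (exp (- (norm (z - \<pi> z))\<^sup>2 / 2)) * indicator (B \<inter> {z. norm (\<pi> z) < r}) z
        \<le> ?C * ennreal (exp (- (norm z)\<^sup>2 / 2) / sqrt (2 * pi) ^ DIM('a))"
      proof (cases "norm (\<pi> z) < r")
        case True
        have "(norm (\<pi> z))\<^sup>2 \<le> r\<^sup>2" using True by (intro power_mono) auto
        then have "exp (- (norm (z - \<pi> z))\<^sup>2 / 2) \<le> exp (r\<^sup>2 / 2 + - (norm z)\<^sup>2 / 2)"
          using norm_decomp[of z] by (simp add: field_simps)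
        also have "\<dots> = exp (r\<^sup>2 / 2) * exp (- (norm z)\<^sup>2 / 2)" by (rule exp_add)
        finally show ?thesis
          by (auto simp: ennreal_mult[symmetric] split: split_indicator intro!: ennreal_leI)
      qed auto
    qed
    also have "\<dots> = ?C * (\<integral>\<^sup>+z. ennreal (exp (- (norm z)\<^sup>2 / 2) / sqrt (2 * pi) ^ DIM('a)) \<partial>(lborel :: 'a measure))"
      by (rule nn_integral_cmult) simp
    also have "(\<integral>\<^sup>+z. ennreal (exp (- (norm z)\<^sup>2 / 2) / sqrt (2 * pi) ^ DIM('a)) \<partial>(lborel :: 'a measure)) =
       emeasure (std_gaussian :: 'a measure) UNIV"
      unfolding std_gaussian_eq by (subst emeasure_density) auto
    also have "\<dots> = 1" using G.emeasure_space_1 by simp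
    finally show ?thesis by (simp add: less_top[symmetric] top_unique)
      (metis ennreal_less_top leD less_top mult.right_neutral top.not_eq_extremum)
  qed
  have I_pos: "I UNIV 1 > 0"
  proof (rule ccontr)
    assume "\<not> ?thesis"
    then have "{z. norm (\<pi> z) < 1} \<in> null_sets m" by (auto simp: I_def null_sets_def)
    then have "AE z in m. \<not> norm (\<pi> z) < 1" using AE_not_in by force
    then have "AE z in lborel. \<not> norm (\<pi> z) < 1" unfolding m_def by (subst (asm) AE_density) auto
    then have "AE z in lborel. z \<notin> ball (0::'a) 1"
    proof eventually_elim
      case (elim z)
      have "(norm (\<pi> z))\<^sup>2 \<le> (norm z)\<^sup>2" using norm_decomp[of z] by simp
      then have "norm (\<pi> z) \<le> norm z" by (rule power2_le_imp_le) simp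
      then show ?case using elim by simp
    qed
    then have "ball (0::'a) 1 \<in> null_sets lborel" by (subst AE_iff_null_sets) simp_all
    then have "emeasure lborel (ball (0::'a) 1) = 0" by (rule null_setsD1)
    moreover have "unit_ball_vol (DIM('a)) > 0" by simp
    ultimately show False by (simp add: emeasure_ball)
  qed
  \<comment> \<open>\<open>T\<close> stretches the range by \<open>r\<close> and leaves
    \<open>z - \<pi> z\<close> alone. Membership in the cone \<open>A\<close> is unaffected, so one
    factor \<open>c\<close> serves for \<open>A\<close> and for the whole space.\<close>
  have scale: "\<exists>c. 0 < c \<and> c < \<infinity> \<and> (\<forall>B \<in> {A, UNIV}. I B 1 = c * I B r)" if r: "r > 0" for r :: real
  proof -
    define T where "T = (\<lambda>z. r *\<^sub>R \<pi> z + (z - \<pi> z))"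
    have lin: "linear T" by (rule linearI) (auto simp: T_def p.add p.scale algebra_simps)
    have \<pi>T: "\<pi> (T z) = r *\<^sub>R \<pi> z" for z by (simp add: T_def p.add p.scale p.diff idem)
    define S where "S = (\<lambda>z. (1/r) *\<^sub>R \<pi> z + (z - \<pi> z))"
    have TS: "T (S z) = z" "S (T z) = z" for z
      using r by (simp_all add: T_def S_def p.add p.scale p.diff idem)
    have "bij T" by (rule o_bij[of S]) (auto simp: TS fun_eq_iff)
    then obtain c where c: "0 < c" "c < \<infinity>" "distr lborel borel T = scale_measure c lborel"
      using distr_linear_lborel[OF lin] by blast
    have [measurable]: "T \<in> borel_measurable borel" by (rule linear_borel_measurable[OF lin])
    have "I B 1 = c * I B r" if B: "B \<in> {A, UNIV}" for B
    proof -
      have [measurable]: "B \<in> sets borel" using B by auto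
      let ?h = "\<lambda>r z. ennreal (exp (- (norm (z - \<pi> z))\<^sup>2 / 2)) * indicator (B \<inter> {z. norm (\<pi> z) < r}) z"
      have *: "I B r = (\<integral>\<^sup>+z. ?h r z \<partial>lborel)" for r
        unfolding I_def m_def by (subst emeasure_density) auto
      have BT: "T z \<in> B \<longleftrightarrow> z \<in> B" for z
      proof -
        have "T z \<in> A \<longleftrightarrow> r *\<^sub>R \<pi> z \<in> A" using A\<pi>[of "T z"] by (simp add: \<pi>T)
        also have "\<dots> \<longleftrightarrow> \<pi> z \<in> A" using cone[of r "\<pi> z"] cone[of "1/r" "r *\<^sub>R \<pi> z"] r by auto
        also have "\<dots> \<longleftrightarrow> z \<in> A" using A\<pi> by simp
        finally show ?thesis using B by auto
      qed
      have h: "?h r (T z) = ?h 1 z" for z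
      proof -
        have "T z - \<pi> (T z) = z - \<pi> z" by (simp add: \<pi>T) (simp add: T_def)
        moreover have "norm (\<pi> (T z)) < r \<longleftrightarrow> norm (\<pi> z) < 1" using r by (simp add: \<pi>T)
        ultimately show ?thesis using BT[of z] by (auto split: split_indicator)
      qed
      have "I B 1 = (\<integral>\<^sup>+z. ?h r (T z) \<partial>lborel)" by (simp only: * h)
      also have "\<dots> = (\<integral>\<^sup>+z. ?h r z \<partial>(distr lborel borel T))" by (subst nn_integral_distr) auto
      also have "\<dots> = c * I B r" unfolding c(3) * by (rule nn_integral_scale_measure) auto
      finally show ?thesis .
    qed
    with c show ?thesis by blast
  qed
  have cross: "I UNIV 1 * I A r = I A 1 * I UNIV r" for r
  proof (cases "r > 0")
    case True
    obtain c where c: "0 < c" "c < \<infinity>" "I A 1 = c * I A r" "I UNIV 1 = c * I UNIV r"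
      using scale[OF True] by auto
    show ?thesis unfolding c by (simp add: ac_simps)
  next
    case False
    then have "{z. norm (\<pi> z) < r} = {}" by (auto simp: not_less intro: order_trans)
    then show ?thesis by (simp add: I_def)
  qed
  \<comment> \<open>The sign is reversed because measures are compared below on half lines
    \<open>{x<..}\<close>, which must have finite mass; with the minus sign they correspond to
    bounded values of \<open>norm (\<pi> z)\<close>.\<close>
  define N where "N = (\<lambda>B. distr (density m (indicator B)) borel (\<lambda>z. - norm (\<pi> z)))"
  have N_e: "emeasure (N B) {x<..} = I B (- x)" if [measurable]: "B \<in> sets borel" for B x
  proof -
    have "emeasure (N B) {x<..} = emeasure (density m (indicator B)) {z. norm (\<pi> z) < - x}"
      unfolding N_def by (subst emeasure_distr) (auto simp: m_def intro!: arg_cong2[where f=emeasure])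
    also have "\<dots> = (\<integral>\<^sup>+z. indicator (B \<inter> {z. norm (\<pi> z) < - x}) z \<partial>m)"
    proof (subst emeasure_density)
      show "(\<integral>\<^sup>+z. indicator B z * indicator {z. norm (\<pi> z) < - x} z \<partial>m) = (\<integral>\<^sup>+z. indicator (B \<inter> {z. norm (\<pi> z) < - x}) z \<partial>m)"
        by (intro nn_integral_cong) (auto split: split_indicator)
    qed auto
    finally show ?thesis by (simp add: I_def)
  qed
  have NN: "scale_measure (I UNIV 1) (N A) = scale_measure (I A 1) (N UNIV)"
  proof (rule measure_eqI_lessThan)
    show "emeasure (scale_measure (I UNIV 1) (N A)) {x<..} < \<infinity>" for x
      using I_fin[of UNIV 1] I_fin[of A "-x"] by (simp add: N_e ennreal_mult_less_top)
    show "emeasure (scale_measure (I UNIV 1) (N A)) {x<..} = emeasure (scale_measure (I A 1) (N UNIV)) {x<..}" for x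
      using cross by (simp add: N_e)
  qed (simp_all add: N_def)
  have fin: "I UNIV 1 * (\<integral>\<^sup>+z. f (norm (\<pi> z)) * indicator A z \<partial>std_gaussian) = I A 1 * (\<integral>\<^sup>+z. f (norm (\<pi> z)) \<partial>std_gaussian)"
    if [measurable]: "f \<in> borel_measurable borel" for f :: "real \<Rightarrow> ennreal"
  proof -
    \<comment> \<open>\<open>F\<close> undoes the sign and restores the Gaussian factor along the
      range that is missing from \<open>m\<close>.\<close>
    define F where "F = (\<lambda>x. f (- x) * ennreal (exp (- x\<^sup>2 / 2) / sqrt (2 * pi) ^ DIM('a)))"
    have [measurable]: "F \<in> borel_measurable borel" unfolding F_def by simp
    have Fi: "(\<integral>\<^sup>+x. F x \<partial>N B) = (\<integral>\<^sup>+z. f (norm (\<pi> z)) * indicator B z \<partial>std_gaussian)" if [measurable]: "B \<in> sets borel" for B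
    proof -
      have "(\<integral>\<^sup>+x. F x \<partial>N B) = (\<integral>\<^sup>+z. ennreal (exp (- (norm (z - \<pi> z))\<^sup>2 / 2)) * (indicator B z * F (- norm (\<pi> z))) \<partial>lborel)"
        unfolding N_def m_def by (simp add: nn_integral_distr nn_integral_density)
      also have "\<dots> = (\<integral>\<^sup>+z. ennreal (exp (- (norm z)\<^sup>2 / 2) / sqrt (2 * pi) ^ DIM('a)) * (f (norm (\<pi> z)) * indicator B z) \<partial>lborel)"
      proof (intro nn_integral_cong)
        fix z :: 'a
        have "exp (- (norm (z - \<pi> z))\<^sup>2 / 2) * (exp (- (norm (\<pi> z))\<^sup>2 / 2) / sqrt (2 * pi) ^ DIM('a)) =
           exp (- (norm z)\<^sup>2 / 2) / sqrt (2 * pi) ^ DIM('a)"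
          by (simp add: norm_decomp[of z] mult_exp_exp add_divide_distrib)
        then have "ennreal (exp (- (norm (z - \<pi> z))\<^sup>2 / 2)) * ennreal (exp (- (norm (\<pi> z))\<^sup>2 / 2) / sqrt (2 * pi) ^ DIM('a)) =
           ennreal (exp (- (norm z)\<^sup>2 / 2) / sqrt (2 * pi) ^ DIM('a))"
          by (subst ennreal_mult[symmetric]) auto
        then show "ennreal (exp (- (norm (z - \<pi> z))\<^sup>2 / 2)) * (indicator B z * F (- norm (\<pi> z))) =
          ennreal (exp (- (norm z)\<^sup>2 / 2) / sqrt (2 * pi) ^ DIM('a)) * (f (norm (\<pi> z)) * indicator B z)"
          by (simp add: F_def ac_simps)
      qed
      also have "\<dots> = (\<integral>\<^sup>+z. f (norm (\<pi> z)) * indicator B z \<partial>std_gaussian)"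
        unfolding std_gaussian_eq by (subst nn_integral_density) auto
      finally show ?thesis .
    qed
    have sN: "sets (N B) = sets borel" for B by (simp add: N_def)
    have "I UNIV 1 * (\<integral>\<^sup>+x. F x \<partial>N A) = (\<integral>\<^sup>+x. F x \<partial>scale_measure (I UNIV 1) (N A))"
      by (rule nn_integral_scale_measure[symmetric]) (simp add: sN cong: measurable_cong_sets)
    also have "\<dots> = (\<integral>\<^sup>+x. F x \<partial>scale_measure (I A 1) (N UNIV))" by (simp only: NN)
    also have "\<dots> = I A 1 * (\<integral>\<^sup>+x. F x \<partial>N UNIV)"
      by (rule nn_integral_scale_measure) (simp add: sN cong: measurable_cong_sets)
    finally show ?thesis by (simp add: Fi)
  qed
  interpret G: prob_space "std_gaussian :: 'a measure" by (rule prob_space_std_gaussian)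
  have IA: "I UNIV 1 * emeasure std_gaussian A = I A 1"
    using fin[of "\<lambda>_. 1"] G.emeasure_space_1 by simp
  have "I UNIV 1 * (\<integral>\<^sup>+z. \<psi> (norm (\<pi> z)) * indicator A z \<partial>std_gaussian) =
    I UNIV 1 * (emeasure std_gaussian A * (\<integral>\<^sup>+z. \<psi> (norm (\<pi> z)) \<partial>std_gaussian))"
    by (simp add: fin IA[symmetric] mult.assoc)
  then show ?thesis using I_pos I_fin[of UNIV 1]
    by (subst (asm) ennreal_mult_cancel_left) auto
qed

lemma householder_inner: "householder d x \<bullet> y = x \<bullet> householder d y"
  by (simp add: householder_def inner_diff_left inner_diff_right inner_commute)

text \<open>The law of \<open>x + \<eta> *\<^sub>R \<pi> z\<close>, for \<open>x\<close> distributed by \<open>Q\<close>, assigns to the cone the weight on the right by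
  invariance; then let \<open>\<eta>\<close> tend to 0.\<close>

lemma invariant_measure_cone:
  fixes Q :: "'a measure" and W :: "'a set"
  assumes Q: "prob_space Q" and sQ[measurable_cong, simp]: "sets Q = sets borel"
    and Q\<pi>: "AE x in Q. \<pi> x = x" and Q0: "AE x in Q. x \<noteq> 0"
    and inv: "\<And>d. \<pi> d = d \<Longrightarrow> distr Q borel (householder d) = Q"
    and W: "finite W" "\<And>w. w \<in> W \<Longrightarrow> \<pi> w \<noteq> 0" "W \<noteq> {}"
  shows "emeasure Q {x. \<forall>w\<in>W. x \<bullet> w < 0} = emeasure std_gaussian {z. \<forall>w\<in>W. \<pi> z \<bullet> w < 0}"
proof -
  interpret p: linear \<pi> by (rule linear)
  interpret Q: prob_space Q by fact
  interpret G: prob_space "std_gaussian :: 'a measure" by (rule prob_space_std_gaussian)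
  interpret QG: pair_prob_space Q "std_gaussian :: 'a measure" ..
  have [measurable]: "householder d \<in> borel_measurable borel" for d :: 'a
    by (rule linear_borel_measurable[OF householder_linear])
  have Qinv: "(\<integral>\<^sup>+x. f (householder d x) \<partial>Q) = (\<integral>\<^sup>+x. f x \<partial>Q)" if "\<pi> d = d" and [measurable]: "f \<in> borel_measurable borel" for f d
    by (subst (2) inv[OF that(1), symmetric]) (simp add: nn_integral_distr)
  \<comment> \<open>By reflection the mass of the hyperplane orthogonal to \<open>w\<close> is the
    same for all nonzero \<open>w\<close> in the range. So it equals its mean over a Gaussian
    direction, and after exchanging the integrals the inner one is the Gaussian mass of a
    hyperplane.\<close>
  have hyp: "AE x in Q. x \<bullet> w \<noteq> 0" if w: "\<pi> w = w" "w \<noteq> 0" for w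
  proof -
    define q where "q = (\<lambda>w. \<integral>\<^sup>+x. indicator {x. x \<bullet> w = 0} x \<partial>Q)"
    have qeq: "q w' = q w" if w': "\<pi> w' = w'" "w' \<noteq> 0" for w'
    proof -
      define c where "c = norm w / norm w'"
      have c: "c > 0" using w w' by (simp add: c_def)
      let ?H = "householder (w - c *\<^sub>R w')"
      have Hw: "?H w = c *\<^sub>R w'" by (rule householder_swap) (use w' in \<open>simp add: c_def\<close>)
      have "q w = (\<integral>\<^sup>+x. indicator {x. x \<bullet> w = 0} (?H x) \<partial>Q)"
        unfolding q_def by (rule Qinv[symmetric]) (simp_all add: p.diff p.scale w w')
      also have "\<dots> = q w'"
        unfolding q_def using c
        by (intro nn_integral_cong) (auto simp: householder_inner Hw split: split_indicator)
      finally show ?thesis ..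
    qed
    have "AE z in std_gaussian. z \<bullet> w \<noteq> 0" by (rule AE_std_gaussian_hyperplane) fact
    then have nz: "AE z in std_gaussian. \<pi> z \<noteq> 0"
      by eventually_elim (metis inner_zero_left self_adj w(1))
    have "q w = (\<integral>\<^sup>+z. q w \<partial>(std_gaussian :: 'a measure))" using G.emeasure_space_1 by simp
    also have "\<dots> = (\<integral>\<^sup>+z. q (\<pi> z) \<partial>std_gaussian)"
      by (rule nn_integral_cong_AE) (use nz in \<open>eventually_elim, simp add: qeq idem\<close>)
    also have "\<dots> = (\<integral>\<^sup>+x. \<integral>\<^sup>+z. indicator {p. fst p \<bullet> \<pi> (snd p) = 0} (x, z) \<partial>std_gaussian \<partial>Q)"
      unfolding q_def by (subst QG.Fubini') (auto intro!: nn_integral_cong split: split_indicator)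
    also have "\<dots> = (\<integral>\<^sup>+x. 0 \<partial>Q)"
    proof (rule nn_integral_cong_AE, use Q\<pi> Q0 in eventually_elim)
      fix x assume x: "\<pi> x = x" "x \<noteq> 0"
      have "AE z in std_gaussian. z \<bullet> x \<noteq> 0" by (rule AE_std_gaussian_hyperplane) fact
      then have "AE z in std_gaussian. indicator {p. fst p \<bullet> \<pi> (snd p) = 0} (x, z) = (0::ennreal)"
      proof eventually_elim
        case (elim z)
        have "x \<bullet> \<pi> z = z \<bullet> x" using self_adj[of x z] x by (simp add: inner_commute)
        then show ?case using elim by simp
      qed
      then show "(\<integral>\<^sup>+z. indicator {p. fst p \<bullet> \<pi> (snd p) = 0} (x, z) \<partial>std_gaussian) = (0::ennreal)"
        by (subst nn_integral_cong_AE) auto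
    qed
    finally have "emeasure Q {x. x \<bullet> w = 0} = 0" by (simp add: q_def)
    then show ?thesis by (subst AE_iff_measurable[of "{x. x \<bullet> w = 0}"]) (auto simp: sets_eq_imp_space_eq[OF sQ])
  qed
  define K where "K = {x. \<forall>w\<in>W. x \<bullet> w < 0}"
  have K[measurable]: "K \<in> sets borel"
  proof -
    have "K = (\<Inter>w\<in>W. {x. x \<bullet> w < 0})" by (auto simp: K_def)
    also have "\<dots> \<in> sets borel" using W by (intro sets.finite_INT) auto
    finally show ?thesis .
  qed
  define A where "A = {z. \<pi> z \<in> K}"
  have A[measurable]: "A \<in> sets borel" unfolding A_def by measurable
  have Kcone: "c *\<^sub>R z \<in> K \<longleftrightarrow> z \<in> K" if "c > 0" for c z using that
    by (auto simp: K_def mult_less_0_iff)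
  obtain w where w: "w \<in> W" using W by blast
  define w0 where "w0 = (1 / norm (\<pi> w)) *\<^sub>R \<pi> w"
  have w0: "norm w0 = 1" "\<pi> w0 = w0" using W w by (auto simp: w0_def p.scale idem)
  \<comment> \<open>Dividing by \<open>\<eta>\<close> turns the addition of \<open>x\<close> into a
    shift of a Gaussian vector. The resulting density, averaged over \<open>Q\<close>, depends only
    on \<open>norm (\<pi> z)\<close> by invariance of \<open>Q\<close>, so
    \<open>radial_independence\<close> separates it from the cone; its total mass is 1.\<close>
  have b: "(\<integral>\<^sup>+x. \<integral>\<^sup>+z. indicator K (x + \<eta> *\<^sub>R \<pi> z) \<partial>std_gaussian \<partial>Q) = emeasure std_gaussian A" if \<eta>: "\<eta> > 0" for \<eta>
  proof -
    let ?e = "\<lambda>x z. ennreal (exp (((1/\<eta>) *\<^sub>R x) \<bullet> z - (norm ((1/\<eta>) *\<^sub>R x))\<^sup>2 / 2))"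
    define \<Psi> where "\<Psi> = (\<lambda>z. \<integral>\<^sup>+x. ?e x z \<partial>Q)"
    have [measurable]: "\<Psi> \<in> borel_measurable borel" unfolding \<Psi>_def by measurable
    have \<Psi>: "\<Psi> z = \<Psi> (norm (\<pi> z) *\<^sub>R w0)" for z
    proof -
      let ?d = "\<pi> z - norm (\<pi> z) *\<^sub>R w0"
      let ?H = "householder ?d"
      have H: "?H (\<pi> z) = norm (\<pi> z) *\<^sub>R w0" by (rule householder_swap) (simp add: w0)
      have "\<Psi> z = (\<integral>\<^sup>+x. ?e x (\<pi> z) \<partial>Q)"
        unfolding \<Psi>_def
      proof (rule nn_integral_cong_AE, use Q\<pi> in eventually_elim)
        fix x assume "\<pi> x = x"
        then have "x \<bullet> \<pi> z = x \<bullet> z" using self_adj[of x z] by simp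
        then show "?e x z = ?e x (\<pi> z)" by simp
      qed
      also have "\<dots> = (\<integral>\<^sup>+x. ?e (?H x) (\<pi> z) \<partial>Q)"
        by (rule Qinv[symmetric]) (auto simp: p.diff p.scale w0 idem)
      also have "\<dots> = \<Psi> (norm (\<pi> z) *\<^sub>R w0)"
        unfolding \<Psi>_def by (simp add: householder_norm householder_inner H)
      finally show ?thesis .
    qed
    have "(\<integral>\<^sup>+x. \<integral>\<^sup>+z. indicator K (x + \<eta> *\<^sub>R \<pi> z) \<partial>std_gaussian \<partial>Q) =
      (\<integral>\<^sup>+x. \<integral>\<^sup>+z. indicator A z * ?e x z \<partial>std_gaussian \<partial>Q)"
    proof (rule nn_integral_cong_AE, use Q\<pi> in eventually_elim)
      fix x assume x: "\<pi> x = x"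
      have "x + \<eta> *\<^sub>R \<pi> z = \<eta> *\<^sub>R \<pi> ((1/\<eta>) *\<^sub>R x + z)" for z
        using \<eta> by (simp add: p.add p.scale x algebra_simps)
      then have "indicator K (x + \<eta> *\<^sub>R \<pi> z) = (indicator A ((1/\<eta>) *\<^sub>R x + z) :: ennreal)" for z
        using Kcone[OF \<eta>] by (simp add: A_def indicator_def)
      then have "(\<integral>\<^sup>+z. indicator K (x + \<eta> *\<^sub>R \<pi> z) \<partial>std_gaussian) = (\<integral>\<^sup>+z. indicator A ((1/\<eta>) *\<^sub>R x + z) \<partial>std_gaussian)"
        by simp
      also have "\<dots> = (\<integral>\<^sup>+z. indicator A z * ?e x z \<partial>std_gaussian)"
        by (rule std_gaussian_shift) simp
      finally show "(\<integral>\<^sup>+z. indicator K (x + \<eta> *\<^sub>R \<pi> z) \<partial>std_gaussian) = (\<integral>\<^sup>+z. indicator A z * ?e x z \<partial>std_gaussian)" .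
    qed
    also have "\<dots> = (\<integral>\<^sup>+z. \<integral>\<^sup>+x. indicator A z * ?e x z \<partial>Q \<partial>std_gaussian)"
      by (rule QG.Fubini'[symmetric]) simp
    also have "\<dots> = (\<integral>\<^sup>+z. \<Psi> (norm (\<pi> z) *\<^sub>R w0) * indicator A z \<partial>std_gaussian)"
      by (simp add: nn_integral_cmult \<Psi>[symmetric]) (simp add: \<Psi>_def mult.commute)
    also have "\<dots> = emeasure std_gaussian A * (\<integral>\<^sup>+z. \<Psi> (norm (\<pi> z) *\<^sub>R w0) \<partial>std_gaussian)"
      by (rule radial_independence[where \<psi>="\<lambda>r. \<Psi> (r *\<^sub>R w0)"])
         (auto simp: A_def idem p.scale Kcone)
    also have "(\<integral>\<^sup>+z. \<Psi> (norm (\<pi> z) *\<^sub>R w0) \<partial>std_gaussian) = (\<integral>\<^sup>+z. \<integral>\<^sup>+x. ?e x z \<partial>Q \<partial>std_gaussian)"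
      unfolding \<Psi>[symmetric] by (simp add: \<Psi>_def)
    also have "\<dots> = (\<integral>\<^sup>+x. \<integral>\<^sup>+z. ?e x z \<partial>std_gaussian \<partial>Q)"
      by (rule QG.Fubini') simp
    also have "\<dots> = 1"
    proof -
      have one: "(\<integral>\<^sup>+z. ennreal (exp (c \<bullet> z - (norm c)\<^sup>2 / 2)) \<partial>std_gaussian) = 1" for c :: 'a
        using std_gaussian_shift[of "\<lambda>_::'a. 1", symmetric] G.emeasure_space_1 by simp
      have "(\<integral>\<^sup>+z. ?e x z \<partial>std_gaussian) = 1" for x :: 'a by (rule one)
      then show ?thesis using Q.emeasure_space_1 by (simp only: nn_integral_const mult_1)
    qed
    finally show ?thesis by simp
  qed
  \<comment> \<open>Almost surely none of the inner products is 0. The indicator of the open cone is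
    then locally constant at \<open>x\<close>, which allows the limit of vanishing noise under the
    integral.\<close>
  have nz: "AE x in Q. \<forall>w\<in>W. x \<bullet> w \<noteq> 0"
  proof (subst AE_finite_all[OF W(1)], rule ballI)
    fix w assume w: "w \<in> W"
    have "AE x in Q. x \<bullet> \<pi> w \<noteq> 0" by (rule hyp) (simp_all add: idem W w)
    with Q\<pi> show "AE x in Q. x \<bullet> w \<noteq> 0" by eventually_elim (metis self_adj)
  qed
  have lim: "(\<lambda>m. \<integral>\<^sup>+p. indicator K (fst p + (1 / real (Suc m)) *\<^sub>R \<pi> (snd p)) \<partial>(Q \<Otimes>\<^sub>M std_gaussian))
    \<longlonglongrightarrow> (\<integral>\<^sup>+p. indicator K (fst p) \<partial>(Q \<Otimes>\<^sub>M (std_gaussian :: 'a measure)))"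
  proof (rule nn_integral_dominated_convergence[where w="\<lambda>_. 1"])
    show "(\<integral>\<^sup>+p. 1 \<partial>(Q \<Otimes>\<^sub>M (std_gaussian :: 'a measure))) < \<infinity>"
      using QG.emeasure_space_1 by simp
    have hp: "{p. fst p \<bullet> y \<noteq> 0} \<in> sets (borel \<Otimes>\<^sub>M borel :: ('a \<times> 'a) measure)" for y
    proof -
      have "{p \<in> space (borel \<Otimes>\<^sub>M borel :: ('a \<times> 'a) measure). fst p \<bullet> y \<noteq> 0} \<in> sets (borel \<Otimes>\<^sub>M borel)"
        by measurable
      then show ?thesis by (simp add: space_pair_measure)
    qed
    have "AE p in Q \<Otimes>\<^sub>M (std_gaussian :: 'a measure). \<forall>w\<in>W. fst p \<bullet> w \<noteq> 0"
      using nz unfolding AE_finite_all[OF W(1)]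
      by (auto intro!: QG.AE_pair_measure simp: hp space_pair_measure sets_eq_imp_space_eq[OF sQ])
    then show "AE p in Q \<Otimes>\<^sub>M std_gaussian. (\<lambda>m. indicator K (fst p + (1 / real (Suc m)) *\<^sub>R \<pi> (snd p)) :: ennreal) \<longlonglongrightarrow> indicator K (fst p)"
    proof eventually_elim
      case (elim p)
      have *: "(\<lambda>m. (fst p + (1 / real (Suc m)) *\<^sub>R \<pi> (snd p)) \<bullet> w) \<longlonglongrightarrow> fst p \<bullet> w" for w
      proof -
        have "(\<lambda>m. (fst p + (1 / real (Suc m)) *\<^sub>R \<pi> (snd p)) \<bullet> w) \<longlonglongrightarrow> (fst p + 0 *\<^sub>R \<pi> (snd p)) \<bullet> w"
          by (intro tendsto_intros LIMSEQ_Suc[OF lim_1_over_n])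
        then show ?thesis by simp
      qed
      have "eventually (\<lambda>m. fst p + (1 / real (Suc m)) *\<^sub>R \<pi> (snd p) \<in> K \<longleftrightarrow> fst p \<in> K) sequentially"
      proof (cases "fst p \<in> K")
        case True
        then have "\<forall>w\<in>W. eventually (\<lambda>m. (fst p + (1 / real (Suc m)) *\<^sub>R \<pi> (snd p)) \<bullet> w < 0) sequentially"
          unfolding K_def using order_tendstoD(2)[OF *] by blast
        then have "eventually (\<lambda>m. \<forall>w\<in>W. (fst p + (1 / real (Suc m)) *\<^sub>R \<pi> (snd p)) \<bullet> w < 0) sequentially"
          using W by (subst eventually_ball_finite_distrib) auto
        then show ?thesis using True by (auto elim!: eventually_mono simp: K_def)
      next
        case False
        then obtain w where w: "w \<in> W" "fst p \<bullet> w > 0" using elim by (force simp: K_def not_less)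
        then have "eventually (\<lambda>m. (fst p + (1 / real (Suc m)) *\<^sub>R \<pi> (snd p)) \<bullet> w > 0) sequentially"
          using order_tendstoD(1)[OF *] by blast
        then show ?thesis using False w by (auto elim!: eventually_mono simp: K_def not_less intro: less_imp_le)
      qed
      then have "eventually (\<lambda>m. indicator K (fst p + (1 / real (Suc m)) *\<^sub>R \<pi> (snd p)) = (indicator K (fst p) :: ennreal)) sequentially"
        by eventually_elim (simp add: indicator_def)
      then show ?case by (rule tendsto_eventually)
    qed
  qed (auto intro!: AE_I2 simp: indicator_le_1 split: split_indicator)
  have "(\<integral>\<^sup>+p. indicator K (fst p + (1 / real (Suc m)) *\<^sub>R \<pi> (snd p)) \<partial>(Q \<Otimes>\<^sub>M std_gaussian)) = emeasure std_gaussian A" for m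
    using b[of "1 / real (Suc m)"] by (subst G.nn_integral_fst[symmetric]) auto
  moreover have "(\<integral>\<^sup>+p. indicator K (fst p) \<partial>(Q \<Otimes>\<^sub>M (std_gaussian :: 'a measure))) = emeasure Q K"
    using G.emeasure_space_1 by (subst G.nn_integral_fst[symmetric]) auto
  ultimately have "(\<lambda>m::nat. emeasure std_gaussian A) \<longlonglongrightarrow> emeasure Q K" using lim by simp
  then have "emeasure Q K = emeasure std_gaussian A" by (simp add: LIMSEQ_const_iff)
  then show ?thesis by (simp add: K_def A_def)
qed

end

section \<open>Gram--Schmidt residuals on a set of coordinates\<close>

context orth_proj
begin

text \<open>Reflecting \<open>z\<close> and \<open>g\<close> together, inside the range of
  \<open>\<pi>\<close>, reflects the difference; so its law is invariant, and \<open>ex\<close>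
  keeps it away from 0 almost surely. Hence its cone probabilities agree with those of
  \<open>\<pi> z\<close>, although its norm is in general smaller.\<close>

lemma perp_component_cone:
  fixes W :: "'a set"
  assumes W: "finite W" "W \<noteq> {}"
    and ex: "\<And>g. \<exists>w. w \<noteq> 0 \<and> \<pi> w = w \<and> w \<bullet> g = 0"
  shows "(\<integral>\<^sup>+g. \<integral>\<^sup>+z. indicator {x. \<forall>w\<in>W. x \<bullet> w < 0} (\<pi> z - ((\<pi> z \<bullet> \<pi> g) / (\<pi> g \<bullet> \<pi> g)) *\<^sub>R \<pi> g) \<partial>std_gaussian \<partial>std_gaussian)
    = emeasure std_gaussian {z. \<forall>w\<in>W. \<pi> z \<bullet> w < 0}"
proof -
  interpret p: linear \<pi> by (rule linear)
  define K where "K = {x. \<forall>w\<in>W. x \<bullet> w < 0}"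
  have K[measurable]: "K \<in> sets borel"
  proof -
    have "K = (\<Inter>w\<in>W. {x. x \<bullet> w < 0})" by (auto simp: K_def)
    also have "\<dots> \<in> sets borel" using W by (intro sets.finite_INT) auto
    finally show ?thesis .
  qed
  define X where "X = (\<lambda>(g, z). \<pi> z - ((\<pi> z \<bullet> \<pi> g) / (\<pi> g \<bullet> \<pi> g)) *\<^sub>R \<pi> g)"
  have X[measurable]: "X \<in> borel_measurable borel" unfolding X_def borel_prod[symmetric] by measurable
  have \<pi>X: "\<pi> (X p) = X p" for p by (cases p) (simp add: X_def p.diff p.scale idem)
  have lhs: "(\<integral>\<^sup>+g. \<integral>\<^sup>+z. indicator K (X (g, z)) \<partial>std_gaussian \<partial>std_gaussian) =
    emeasure std_gaussian (X -` K)"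
    using measurable_sets_borel[OF X K]
    by (subst nn_integral_std_gaussian_pair) (simp_all add: indicator_vimage[symmetric] nn_integral_indicator borel_measurable_indicator)
  show ?thesis
  proof (cases "\<forall>w\<in>W. \<pi> w \<noteq> 0")
    \<comment> \<open>A vector \<open>w\<close> that \<open>\<pi>\<close> maps to 0 is orthogonal to
      the range, so its strict inequality fails on both sides.\<close>
    case False
    then obtain w where w: "w \<in> W" "\<pi> w = 0" by blast
    have no: "\<pi> x \<bullet> w = 0" for x using w by (simp add: self_adj)
    then have no': "X p \<bullet> w = 0" for p using \<pi>X[of p] by metis
    have "X p \<notin> K" for p using bspec[OF _ w(1), of "\<lambda>w. X p \<bullet> w < 0"] no'[of p] by (auto simp: K_def)
    then have "X -` K = {}" by blast
    with lhs have "(\<integral>\<^sup>+g. \<integral>\<^sup>+z. indicator K (X (g, z)) \<partial>std_gaussian \<partial>std_gaussian) = 0" by simp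
    moreover have e2: "{z. \<forall>w\<in>W. \<pi> z \<bullet> w < 0} = {}"
      using bspec[OF _ w(1), of "\<lambda>w. \<pi> z \<bullet> w < 0" for z] no by auto
    ultimately show ?thesis unfolding e2 by (simp add: K_def X_def)
  next
    case True
    define Q where "Q = distr (std_gaussian :: ('a \<times> 'a) measure) borel X"
    interpret G: prob_space "std_gaussian :: ('a \<times> 'a) measure" by (rule prob_space_std_gaussian)
    interpret g: prob_space "std_gaussian :: 'a measure" by (rule prob_space_std_gaussian)
    interpret gg: pair_prob_space "std_gaussian :: 'a measure" "std_gaussian :: 'a measure" ..
    have Qp: "prob_space Q" unfolding Q_def by (rule G.prob_space_distr) (simp cong: measurable_cong_sets)
    have n0: "AE p in std_gaussian. X p \<noteq> 0"
    proof -
      have "AE p in std_gaussian \<Otimes>\<^sub>M std_gaussian. X p \<noteq> 0"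
      proof (rule gg.AE_pair_measure)
        show "{p \<in> space (std_gaussian \<Otimes>\<^sub>M std_gaussian). X p \<noteq> 0} \<in> sets (std_gaussian \<Otimes>\<^sub>M std_gaussian)"
          unfolding std_gaussian_pair by measurable
        show "AE g in std_gaussian. AE z in std_gaussian. X (g, z) \<noteq> 0"
        proof (rule AE_I2)
          fix g :: 'a
          \<comment> \<open>In a direction of the range that is orthogonal to \<open>g\<close>, the
            subtracted multiple of \<open>\<pi> g\<close> is invisible; the difference can vanish
            only if \<open>z\<close> lies in the hyperplane orthogonal to \<open>w\<close>.\<close>
          obtain w where w: "w \<noteq> 0" "\<pi> w = w" "w \<bullet> g = 0" using ex by blast
          have "\<pi> g \<bullet> w = 0" using w by (metis inner_commute self_adj)
          have "AE z in std_gaussian. z \<bullet> w \<noteq> 0" by (rule AE_std_gaussian_hyperplane) fact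
          then show "AE z in std_gaussian. X (g, z) \<noteq> 0"
          proof eventually_elim
            case (elim z)
            have "X (g, z) \<bullet> w = z \<bullet> w"
              using \<open>\<pi> g \<bullet> w = 0\<close> w self_adj[of z w] by (simp add: X_def inner_diff_left)
            then show ?case using elim by auto
          qed
        qed
      qed
      then show ?thesis unfolding std_gaussian_pair .
    qed
    have inv: "distr Q borel (householder d) = Q" if d: "\<pi> d = d" for d
    proof -
      define H where "H = (\<lambda>p::'a \<times> 'a. (householder d (fst p), householder d (snd p)))"
      have [measurable]: "householder d \<in> borel_measurable borel"
        by (rule linear_borel_measurable[OF householder_linear])
      have linH: "linear H" unfolding H_def
        by (rule linearI) (auto simp: linear_add[OF householder_linear] linear_scale[OF householder_linear])
      have [measurable]: "H \<in> borel_measurable borel" by (rule linear_borel_measurable[OF linH])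
      have HH: "distr (std_gaussian :: ('a \<times> 'a) measure) borel H = std_gaussian"
      proof (rule distr_isometry_std_gaussian[OF linH])
        show "norm (H p) = norm p" for p by (simp add: H_def norm_prod_def householder_norm)
        show "surj H" by (rule surjI[of H H]) (simp add: H_def householder_invol)
      qed
      have comm: "\<pi> (householder d x) = householder d (\<pi> x)" for x
        using self_adj[of x d] by (simp add: householder_def p.diff p.scale d)
      have hin: "householder d x \<bullet> householder d y = x \<bullet> y" for x y
        by (simp add: householder_inner householder_invol)
      have XH: "X (H p) = householder d (X p)" for p
        by (cases p) (simp add: X_def H_def comm hin linear_diff[OF householder_linear] linear_scale[OF householder_linear])
      have "distr Q borel (householder d) = distr (std_gaussian :: ('a \<times> 'a) measure) borel (\<lambda>p. X (H p))"
        by (simp add: Q_def distr_distr comp_def XH cong: measurable_cong_sets)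
      also have "\<dots> = distr (distr (std_gaussian :: ('a \<times> 'a) measure) borel H) borel X"
        by (simp add: distr_distr comp_def cong: measurable_cong_sets)
      finally show ?thesis by (simp add: HH Q_def)
    qed
    have "emeasure Q {x. \<forall>w\<in>W. x \<bullet> w < 0} = emeasure std_gaussian {z. \<forall>w\<in>W. \<pi> z \<bullet> w < 0}"
    proof (rule invariant_measure_cone[OF Qp])
      show "AE x in Q. \<pi> x = x" unfolding Q_def by (subst AE_distr_iff) (auto simp: \<pi>X cong: measurable_cong_sets)
      show "AE x in Q. x \<noteq> 0" unfolding Q_def using n0 by (subst AE_distr_iff) (auto cong: measurable_cong_sets)
    qed (use True W inv in \<open>auto simp: Q_def\<close>)
    moreover have "emeasure Q K = emeasure std_gaussian (X -` K)"
      unfolding Q_def by (subst emeasure_distr) (auto cong: measurable_cong_sets)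
    ultimately show ?thesis using lhs by (simp add: K_def X_def)
  qed
qed

end

section \<open>Restriction to coordinates, residuals and the projections
  \<open>pr S V\<close>\<close>

definition restr :: "'n set \<Rightarrow> real ^ 'n \<Rightarrow> real ^ 'n" where
  "restr S x = (\<chi> i. if i \<in> S then x $ i else 0)"

definition sip :: "'n::finite set \<Rightarrow> real ^ 'n \<Rightarrow> real ^ 'n \<Rightarrow> real" where
  "sip S x y = (\<Sum>i\<in>S. x $ i * y $ i)"

text \<open>The Gram--Schmidt residual of \<open>z\<close> with respect to the semi-inner product \<open>sip S\<close>. A vector \<open>g\<close> whose own residual
  vanishes on \<open>S\<close> is skipped, because the quotient is then \<open>0 / 0 = 0\<close>.\<close>

fun res :: "'n::finite set \<Rightarrow> (real ^ 'n) list \<Rightarrow> real ^ 'n \<Rightarrow> real ^ 'n" where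
  "res S [] z = z"
| "res S (g # V) z = res S V z - (sip S (res S V z) (res S V g) / sip S (res S V g) (res S V g)) *\<^sub>R res S V g"

text \<open>The sign pattern of a tile: on \<open>S\<close> the vector lies below its fit from the
  lineality space, elsewhere above it.\<close>

definition negpos :: "'n set \<Rightarrow> (real ^ 'n) set" where
  "negpos S = {w. (\<forall>i\<in>S. w $ i < 0) \<and> (\<forall>i. i \<notin> S \<longrightarrow> 0 < w $ i)}"

lemma restr_nth[simp]: "restr S x $ i = (if i \<in> S then x $ i else 0)"
  by (simp add: restr_def)

lemma restr_restr[simp]: "restr S (restr S x) = restr S x"
  by (simp add: vec_eq_iff)

lemma restr_linear: "linear (restr S)"
  by (rule linearI) (auto simp: vec_eq_iff)

lemma restr_measurable[measurable]: "restr (S::'n::finite set) \<in> borel_measurable borel"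
  by (rule linear_borel_measurable[OF restr_linear])

lemma sip_restr: "sip S x y = restr S x \<bullet> y"
  by (simp add: sip_def inner_vec_def if_distrib[of "\<lambda>a. a * _"] sum.If_cases)

lemma sip_commute: "sip S x y = sip S y x"
  by (simp add: sip_def mult.commute)

lemma sip_restr2: "sip S x y = restr S x \<bullet> restr S y"
  by (metis sip_restr sip_commute restr_restr inner_commute)

lemma sip_linear:
  "sip S (x + x') y = sip S x y + sip S x' y" "sip S (c *\<^sub>R x) y = c * sip S x y" "sip S (x - x') y = sip S x y - sip S x' y"
  "sip S y (x + x') = sip S y x + sip S y x'" "sip S y (c *\<^sub>R x) = c * sip S y x" "sip S y (x - x') = sip S y x - sip S y x'"
  by (simp_all add: sip_def algebra_simps sum.distrib sum_subtractf sum_distrib_left)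

lemma sip_self_0: "sip S x x = 0 \<longleftrightarrow> restr S x = 0"
  by (simp add: sip_restr2)

lemma sip_restr_arg[simp]: "sip S (restr S x) y = sip S x y" "sip S y (restr S x) = sip S y x"
  by (simp_all add: sip_def)

lemma sip_restr0: "restr S x = 0 \<Longrightarrow> sip S x y = 0" "restr S x = 0 \<Longrightarrow> sip S y x = 0"
  by (simp_all add: sip_restr2)

lemma res_linear: "linear (res S V)"
proof (induction V)
  case (Cons g V)
  show ?case
    by (rule linearI)
      (simp_all add: linear_add[OF Cons] linear_scale[OF Cons] sip_linear algebra_simps add_divide_distrib)
qed (auto intro: linearI)

lemma res_diff_span: "z - res S V z \<in> span (set V)"
proof (induction V arbitrary: z)
  case (Cons g V)
  have mono: "span (set V) \<subseteq> span (set (g # V))" by (intro span_mono) auto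
  have g: "res S V g \<in> span (set (g # V))"
  proof -
    have "g - (g - res S V g) \<in> span (set (g # V))"
      by (rule span_diff[OF span_base subsetD[OF mono Cons]]) simp
    then show ?thesis by simp
  qed
  have "z - res S (g # V) z = (z - res S V z) + (sip S (res S V z) (res S V g) / sip S (res S V g) (res S V g)) *\<^sub>R res S V g"
    by simp
  also have "\<dots> \<in> span (set (g # V))" using Cons[of z] mono g by (intro span_add span_scale) auto
  finally show ?case .
qed (simp add: span_zero)

lemma sip_span_0:
  assumes "\<And>u. u \<in> A \<Longrightarrow> sip S x u = 0" "u \<in> span A"
  shows "sip S x u = 0"
  using assms(2)
proof (induction rule: span_induct_alt)
  case base
  show ?case by (simp add: sip_def)
qed (simp add: sip_linear assms(1))

text \<open>In the induction step the residual of \<open>g\<close> either has a nonzero norm on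
  \<open>S\<close>, and its component is removed, or it vanishes on \<open>S\<close>, and every
  product with it is 0.\<close>

lemma res_orth: "u \<in> span (set V) \<Longrightarrow> sip S (res S V z) u = 0"
proof -
  have "u \<in> set V \<Longrightarrow> sip S (res S V z) u = 0" for u
  proof (induction V arbitrary: z u)
    case (Cons g V)
    let ?a = "res S V z" and ?r = "res S V g"
    let ?x = "?a - (sip S ?a ?r / sip S ?r ?r) *\<^sub>R ?r"
    have V: "sip S ?x u = 0" if "u \<in> set V" for u
      using Cons.IH[OF that] by (simp add: sip_linear)
    have r: "sip S ?x ?r = 0"
      by (cases "sip S ?r ?r = 0") (simp_all add: sip_linear sip_self_0 sip_restr0)
    have "sip S ?x (g - ?r) = 0" by (rule sip_span_0[OF V res_diff_span])
    then have "sip S ?x g = 0" using r by (simp add: sip_linear)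
    then show ?case using V Cons.prems by auto
  qed simp
  then show "u \<in> span (set V) \<Longrightarrow> sip S (res S V z) u = 0" by (rule sip_span_0)
qed

lemma res_idem: "res S V (res S V z) = res S V z"
proof (induction V arbitrary: z)
  case (Cons g V)
  interpret l: linear "res S V" by (rule res_linear)
  let ?a = "res S V z" and ?r = "res S V g"
  let ?x = "?a - (sip S ?a ?r / sip S ?r ?r) *\<^sub>R ?r"
  have x: "res S V ?x = ?x" by (simp add: l.diff l.scale Cons)
  have "sip S ?x ?r = 0"
    by (cases "sip S ?r ?r = 0") (simp_all add: sip_linear sip_self_0 sip_restr0)
  then show ?case using x by simp
qed simp

text \<open>The fitted coefficients only see the coordinates in \<open>S\<close>, so
  \<open>z\<close> and \<open>restr S z\<close> have the same fit
  \<open>z - res S V z\<close>.\<close>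

lemma res_restr: "res S V (restr S z) = restr S z - (z - res S V z)"
proof (induction V arbitrary: z)
  case (Cons g V)
  have "sip S (restr S z - (z - res S V z)) y = sip S (res S V z) y" for y
    by (simp add: sip_linear)
  then show ?case by (simp add: Cons)
qed simp

lemma res_eq_self:
  assumes "\<And>u. u \<in> set V \<Longrightarrow> sip S w u = 0"
  shows "res S V w = w"
  using assms
proof (induction V)
  case (Cons g V)
  have "res S V w = w" using Cons by simp
  moreover have "sip S w (g - res S V g) = 0"
    by (rule sip_span_0[OF _ res_diff_span]) (use Cons in auto)
  ultimately show ?case using Cons.prems[of g] by (simp add: sip_linear)
qed simp

lemma res_sym: "sip S (res S V x) y = sip S (res S V x) (res S V y)"
  using res_orth[OF res_diff_span, of S V x y] by (simp add: sip_linear)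

text \<open>The orthogonal projection onto the vectors that are supported on \<open>S\<close> and
  orthogonal to \<open>V\<close>. These are the directions in which a tile on \<open>S\<close>
  leaves the cone.\<close>

definition pr :: "'n::finite set \<Rightarrow> (real ^ 'n) list \<Rightarrow> real ^ 'n \<Rightarrow> real ^ 'n" where
  "pr S V z = restr S (res S V z)"

lemma res_pr: "res S V (pr S V z) = pr S V z"
  by (simp add: pr_def res_restr res_idem)

lemma pr_eq_self:
  assumes "restr S w = w" "\<And>u. u \<in> set V \<Longrightarrow> w \<bullet> u = 0"
  shows "pr S V w = w"
  using assms unfolding pr_def by (subst res_eq_self) (auto simp: sip_restr)

interpretation pr: orth_proj "pr S V" for S V
proof (rule orth_proj.intro)
  show "linear (pr S V)" unfolding pr_def using linear_compose[OF res_linear restr_linear] by (simp add: comp_def)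
  show "pr S V (pr S V x) = pr S V x" for x unfolding pr_def[of S V "pr S V x"] res_pr by (simp add: pr_def)
  show "pr S V x \<bullet> y = x \<bullet> pr S V y" for x y
  proof -
    have *: "pr S V x \<bullet> y = sip S (res S V x) (res S V y)" for x y
      unfolding pr_def sip_restr[symmetric] by (rule res_sym)
    have "x \<bullet> pr S V y = pr S V y \<bullet> x" by (rule inner_commute)
    also have "\<dots> = sip S (res S V x) (res S V y)" unfolding * by (rule sip_commute)
    finally show ?thesis unfolding * ..
  qed
qed

lemma dim_coordinate_subspace: "dim {x::real^'n::finite. \<forall>i. i \<notin> S \<longrightarrow> x $ i = 0} = card S" (is "dim ?R = _")
proof -
  let ?d = "(\<lambda>i. axis i (1::real)) ` S"
  have "?R = {x. \<forall>i\<in>Basis. i \<notin> ?d \<longrightarrow> x \<bullet> i = 0}"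
  proof (intro set_eqI iffI; unfold mem_Collect_eq)
    fix x :: "real^'n" assume x: "\<forall>i. i \<notin> S \<longrightarrow> x $ i = 0"
    show "\<forall>i\<in>Basis. i \<notin> ?d \<longrightarrow> x \<bullet> i = 0"
    proof (intro ballI impI)
      fix b :: "real^'n" assume b: "b \<in> Basis" "b \<notin> ?d"
      then obtain k where k: "b = axis k 1" by (auto simp: Basis_vec_def)
      with b have "k \<notin> S" by blast
      then show "x \<bullet> b = 0" using x by (simp add: k inner_axis)
    qed
  next
    fix x :: "real^'n" assume x: "\<forall>i\<in>Basis. i \<notin> ?d \<longrightarrow> x \<bullet> i = 0"
    show "\<forall>i. i \<notin> S \<longrightarrow> x $ i = 0"
    proof (intro allI impI)
      fix k assume "k \<notin> S"
      then have "axis k (1::real) \<notin> ?d" by (auto simp: axis_eq_axis)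
      moreover have "axis k (1::real) \<in> Basis" by (auto simp: Basis_vec_def)
      ultimately have "x \<bullet> axis k 1 = 0" using x by blast
      then show "x $ k = 0" by (simp add: inner_axis)
    qed
  qed
  also have "dim \<dots> = card ?d" by (rule dim_substandard) (auto simp: Basis_vec_def)
  also have "\<dots> = card S" by (rule card_image) (auto simp: inj_on_def axis_eq_axis)
  finally show ?thesis .
qed

text \<open>A dimension count inside the coordinate subspace of \<open>S\<close>: the restrictions
  of fewer than \<open>card S\<close> vectors cannot span it.\<close>

lemma exists_orthogonal_supported:
  fixes U :: "(real ^ 'n::finite) list"
  assumes "length U < card S"
  shows "\<exists>w. w \<noteq> 0 \<and> restr S w = w \<and> (\<forall>u\<in>set U. w \<bullet> u = 0)"
proof -
  let ?R = "{x::real^'n. \<forall>i. i \<notin> S \<longrightarrow> x $ i = 0}"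
  have subR: "subspace ?R" by (auto simp: subspace_def)
  have dR: "dim ?R = card S" by (rule dim_coordinate_subspace)
  have "restr S ` set U \<subseteq> ?R" by force
  then have sub: "span (restr S ` set U) \<subseteq> span ?R" by (rule span_mono)
  have "dim (span (restr S ` set U)) \<le> card (restr S ` set U)"
    unfolding dim_span by (rule dim_le_card') simp
  also have "\<dots> \<le> length U" by (rule le_trans[OF card_image_le[OF finite_set] card_length])
  finally have "dim (span (restr S ` set U)) < dim ?R" using dR assms by linarith
  then have "span (restr S ` set U) \<noteq> span ?R" unfolding dim_span[of ?R, symmetric] by (auto simp del: dim_span)
  with sub have "span (restr S ` set U) \<subset> span ?R" by blast
  then have "\<exists>w. w \<noteq> 0 \<and> w \<in> span ?R \<and> (\<forall>y\<in>span (restr S ` set U). orthogonal w y)"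
  proof (rule orthogonal_to_subspace_exists_gen)
    fix x assume x: "x \<noteq> 0" "x \<in> span ?R" "\<And>y. y \<in> span (restr S ` set U) \<Longrightarrow> orthogonal x y"
    show ?thesis by (intro exI[of _ x] conjI ballI x)
  qed
  then obtain w where w: "w \<noteq> 0" "w \<in> span ?R" "\<And>y. y \<in> span (restr S ` set U) \<Longrightarrow> orthogonal w y"
    by (elim exE conjE) (rule that, assumption, assumption, erule bspec)
  have wR: "w \<in> ?R" using w(2) unfolding span_eq_iff[THEN iffD2, OF subR] .
  then have rw: "restr S w = w" by (auto simp: vec_eq_iff)
  have "w \<bullet> u = 0" if "u \<in> set U" for u
    using w(3)[OF span_base, of "restr S u"] that sip_restr2[of S w u] sip_restr[of S w u] rw by (simp add: orthogonal_def)
  then show ?thesis using w(1) rw by blast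
qed

section \<open>Measurability of residuals, and the effect of one more Gaussian generator\<close>

lemma negpos_borel[measurable]: "negpos (S :: 'n::finite set) \<in> sets borel"
proof -
  have "negpos S = (\<Inter>i. {w. if i \<in> S then w $ i < 0 else 0 < w $ i})" by (auto simp: negpos_def split: if_splits)
  also have "\<dots> \<in> sets borel"
    by (intro sets.finite_INT) auto
  finally show ?thesis .
qed

lemma res_measurable_const[measurable]: "res S V \<in> borel_measurable borel"
  by (rule linear_borel_measurable[OF res_linear])

text \<open>The generators are given as functions of the sample point because they are random as
  well.\<close>

lemma res_measurable:
  assumes "\<And>f. f \<in> set fs \<Longrightarrow> f \<in> borel_measurable M" "z \<in> borel_measurable M"
  shows "(\<lambda>\<omega>. res S (map (\<lambda>f. f \<omega>) fs) (z \<omega>)) \<in> borel_measurable M"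
  using assms
proof (induction fs arbitrary: z)
  case (Cons f fs)
  have *: "(\<lambda>\<omega>. res S (map (\<lambda>f. f \<omega>) fs) (z \<omega>)) \<in> borel_measurable M" if "z \<in> borel_measurable M" for z
    using Cons.IH[OF _ that] Cons.prems by simp
  note [measurable] = *[OF Cons.prems(2)] *[OF Cons.prems(1)[of f]]
  have "f \<in> borel_measurable M" using Cons.prems by simp
  note this[measurable]
  show ?case by (simp add: sip_restr)
qed simp

text \<open>The bound on \<open>card S\<close> provides, for every \<open>g\<close>, a nonzero
  vector supported on \<open>S\<close> and orthogonal to both \<open>V\<close> and \<open>g\<close>.
  This is the nondegeneracy that \<open>perp_component_cone\<close> asks for.\<close>

lemma res_step:
  fixes V :: "(real ^ 'n::finite) list"
  assumes card: "length V + 2 \<le> card S"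
  shows "(\<integral>\<^sup>+g. \<integral>\<^sup>+z. indicator (negpos S) (res S (g # V) z) \<partial>std_gaussian \<partial>std_gaussian) =
    (\<integral>\<^sup>+z. indicator (negpos S) (res S V z) \<partial>std_gaussian)"
proof -
  interpret G: prob_space "std_gaussian :: (real^'n) measure" by (rule prob_space_std_gaussian)
  interpret GG: pair_prob_space "std_gaussian :: (real^'n) measure" "std_gaussian :: (real^'n) measure" ..
  let ?\<pi> = "pr S V" and ?L = "res S V"
  interpret l: linear ?L by (rule res_linear)
  interpret p: linear ?\<pi> by (rule pr.linear)
  have [measurable]: "?\<pi> \<in> borel_measurable borel" by (rule pr.meas)
  \<comment> \<open>The residual of \<open>z\<close> is the sum of \<open>?\<pi> z\<close>, which
    lives on \<open>S\<close>, and \<open>m z\<close>, which lives off \<open>S\<close>. The two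
    depend on complementary components of \<open>z\<close>, so the sign condition becomes a product
    of two events.\<close>
  define m where "m = (\<lambda>z. ?L z - ?\<pi> z)"
  have m_lin: "m (z - \<tau> *\<^sub>R g) = m z - \<tau> *\<^sub>R m g" "m (c *\<^sub>R z) = c *\<^sub>R m z" for z g \<tau> c
    by (simp_all add: m_def l.diff l.scale p.diff p.scale algebra_simps)
  have [measurable]: "m \<in> borel_measurable borel" unfolding m_def by measurable
  have m_S: "m z $ i = 0" if "i \<in> S" for z i using that by (simp add: m_def pr_def)
  have p_S: "?\<pi> z $ i = 0" if "i \<notin> S" for z i using that by (simp add: pr_def)
  have split: "?L (?\<pi> z1 + (z2 - ?\<pi> z2)) = ?\<pi> z1 + m z2" for z1 z2
    by (simp add: l.add l.diff res_pr m_def)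
  have rm: "restr S (m z) = 0" for z by (simp add: vec_eq_iff m_S)
  have rp: "restr S (?\<pi> z) = ?\<pi> z" for z by (simp add: pr_def)
  have sip: "sip S (?\<pi> z1 + m z2) (?\<pi> g1 + m g2) = ?\<pi> z1 \<bullet> ?\<pi> g1" for z1 z2 g1 g2
    by (simp add: sip_linear sip_restr0 rm) (simp add: sip_restr2 rp)
  define W where "W = (\<lambda>i. axis i (1::real)) ` S"
  have W: "finite W" "W \<noteq> {}" using card by (auto simp: W_def)
  define K where "K = {x::real^'n. \<forall>w\<in>W. x \<bullet> w < 0}"
  have K_alt: "K = {x. \<forall>i\<in>S. x $ i < 0}" by (auto simp: K_def W_def inner_axis)
  define Qs where "Qs = {z. \<forall>i. i \<notin> S \<longrightarrow> 0 < m z $ i}"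
  have K[measurable]: "K \<in> sets borel"
  proof -
    have "K = (\<Inter>i. {x. i \<in> S \<longrightarrow> x $ i < 0})" by (auto simp: K_alt)
    also have "\<dots> \<in> sets borel" by (intro sets.finite_INT) auto
    finally show ?thesis .
  qed
  have Qs[measurable]: "Qs \<in> sets borel"
  proof -
    have "Qs = (\<Inter>i. {x. i \<notin> S \<longrightarrow> 0 < m x $ i})" by (auto simp: Qs_def)
    also have "\<dots> \<in> sets borel" by (intro sets.finite_INT) (auto simp: cart_eq_inner_axis)
    finally show ?thesis .
  qed
  have ind: "indicator (negpos S) (x + m z) = (indicator K x * indicator Qs z :: ennreal)" if "?\<pi> x = x" for x z
  proof -
    have "x $ i = 0" if "i \<notin> S" for i using \<open>?\<pi> x = x\<close> p_S that by metis
    then have "x + m z \<in> negpos S \<longleftrightarrow> x \<in> K \<and> z \<in> Qs"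
      by (auto simp: negpos_def K_alt Qs_def m_S)
    then show ?thesis by (auto simp: indicator_def)
  qed
  \<comment> \<open>The Gram--Schmidt coefficient. By \<open>sip\<close> it depends on the
    components in the range of \<open>?\<pi>\<close> only and is a constant as far as
    \<open>z2\<close> and \<open>g2\<close> are concerned.\<close>
  define \<tau> where "\<tau> = (\<lambda>z1 g1. (?\<pi> z1 \<bullet> ?\<pi> g1) / (?\<pi> g1 \<bullet> ?\<pi> g1))"
  define X where "X = (\<lambda>z1 g1. ?\<pi> z1 - \<tau> z1 g1 *\<^sub>R ?\<pi> g1)"
  have full: "indicator (negpos S) (res S ((?\<pi> g1 + (g2 - ?\<pi> g2)) # V) (?\<pi> z1 + (z2 - ?\<pi> z2))) =
     (indicator K (X z1 g1) * indicator Qs (z2 - \<tau> z1 g1 *\<^sub>R g2) :: ennreal)" for g1 g2 z1 z2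
  proof -
    have "res S ((?\<pi> g1 + (g2 - ?\<pi> g2)) # V) (?\<pi> z1 + (z2 - ?\<pi> z2)) = X z1 g1 + m (z2 - \<tau> z1 g1 *\<^sub>R g2)"
      unfolding res.simps split sip X_def m_lin \<tau>_def by (simp add: scaleR_add_right)
    moreover have "?\<pi> (X z1 g1) = X z1 g1" by (simp add: X_def p.diff p.scale pr.idem)
    ultimately show ?thesis by (simp add: ind)
  qed
  have [measurable]: "(\<lambda>p. \<tau> (fst p) (snd p)) \<in> borel_measurable (borel \<Otimes>\<^sub>M borel)" unfolding \<tau>_def by measurable
  \<comment> \<open>For a fixed coefficient the combination is a positive multiple of a Gaussian
    vector, and \<open>Qs\<close> is a cone.\<close>
  have Q1: "(\<integral>\<^sup>+g2. \<integral>\<^sup>+z2. indicator Qs (z2 - t *\<^sub>R g2) \<partial>std_gaussian \<partial>std_gaussian) = emeasure std_gaussian Qs" for t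
  proof -
    have "(\<integral>\<^sup>+g2. \<integral>\<^sup>+z2. indicator Qs (z2 - t *\<^sub>R g2) \<partial>std_gaussian \<partial>std_gaussian) =
      (\<integral>\<^sup>+z2. \<integral>\<^sup>+g2. indicator Qs (z2 - t *\<^sub>R g2) \<partial>(std_gaussian :: (real^'n) measure) \<partial>std_gaussian)"
      by (rule GG.Fubini') simp
    also have "\<dots> = (\<integral>\<^sup>+z. indicator Qs (sqrt (1 + t\<^sup>2) *\<^sub>R z) \<partial>std_gaussian)"
      by (rule std_gaussian_comb) simp
    also have "\<dots> = (\<integral>\<^sup>+z. indicator Qs z \<partial>std_gaussian)"
    proof (intro nn_integral_cong)
      fix z
      have "sqrt (1 + t\<^sup>2) > 0" "\<not> 1 + t\<^sup>2 < 0" by (simp_all add: add_pos_nonneg not_less)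
      then have "sqrt (1 + t\<^sup>2) *\<^sub>R z \<in> Qs \<longleftrightarrow> z \<in> Qs" by (simp add: Qs_def m_lin zero_less_mult_iff del: real_sqrt_gt_0_iff)
      then show "indicator Qs (sqrt (1 + t\<^sup>2) *\<^sub>R z) = (indicator Qs z :: ennreal)" by (simp add: indicator_def)
    qed
    finally show ?thesis by simp
  qed
  have [measurable]: "(\<lambda>p. res S (fst p # V) (snd p)) \<in> borel_measurable (borel \<Otimes>\<^sub>M borel)"
    by (simp add: sip_restr)
  have [measurable]: "(\<lambda>z. res S (g # V) z) \<in> borel_measurable borel" for g by measurable
  have mi: "(\<lambda>g. \<integral>\<^sup>+z. indicator (negpos S) (res S (g # V) z) \<partial>std_gaussian) \<in> borel_measurable borel"
  proof -
    have "(\<lambda>p. indicator (negpos S) (res S (fst p # V) (snd p)) :: ennreal) \<in> borel_measurable (borel \<Otimes>\<^sub>M std_gaussian)"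
      by measurable
    from G.borel_measurable_nn_integral_fst[OF this] show ?thesis by simp
  qed
  have "(\<integral>\<^sup>+g. \<integral>\<^sup>+z. indicator (negpos S) (res S (g # V) z) \<partial>std_gaussian \<partial>std_gaussian) =
    (\<integral>\<^sup>+g1. \<integral>\<^sup>+g2. \<integral>\<^sup>+z1. \<integral>\<^sup>+z2. indicator K (X z1 g1) * indicator Qs (z2 - \<tau> z1 g1 *\<^sub>R g2)
       \<partial>std_gaussian \<partial>std_gaussian \<partial>std_gaussian \<partial>std_gaussian)"
    by (subst pr.std_gaussian_split[OF mi, of S V]) (simp add: pr.std_gaussian_split[of "\<lambda>z. indicator _ (res S _ z)" S V] full del: res.simps)
  also have "\<dots> = (\<integral>\<^sup>+g1. \<integral>\<^sup>+z1. \<integral>\<^sup>+g2. \<integral>\<^sup>+z2. indicator K (X z1 g1) * indicator Qs (z2 - \<tau> z1 g1 *\<^sub>R g2)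
       \<partial>std_gaussian \<partial>std_gaussian \<partial>std_gaussian \<partial>std_gaussian)"
    by (intro nn_integral_cong GG.Fubini') (simp add: X_def \<tau>_def)
  also have "\<dots> = (\<integral>\<^sup>+g1. \<integral>\<^sup>+z1. indicator K (X z1 g1) * emeasure std_gaussian Qs \<partial>std_gaussian \<partial>std_gaussian)"
    by (simp add: nn_integral_cmult Q1)
  also have "\<dots> = (\<integral>\<^sup>+g1. \<integral>\<^sup>+z1. indicator K (X z1 g1) \<partial>std_gaussian \<partial>std_gaussian) * emeasure std_gaussian Qs"
    by (simp add: nn_integral_multc X_def \<tau>_def)
  also have "(\<integral>\<^sup>+g1. \<integral>\<^sup>+z1. indicator K (X z1 g1) \<partial>std_gaussian \<partial>std_gaussian) = emeasure std_gaussian {z. \<forall>w\<in>W. ?\<pi> z \<bullet> w < 0}"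
    unfolding X_def \<tau>_def K_def
  proof (rule pr.perp_component_cone[OF W])
    fix g
    obtain w where "w \<noteq> 0" "restr S w = w" "\<forall>u\<in>set (g # V). w \<bullet> u = 0"
      using exists_orthogonal_supported[of "g # V" S] card by auto
    then show "\<exists>w. w \<noteq> 0 \<and> pr S V w = w \<and> w \<bullet> g = 0" by (intro exI[of _ w]) (auto intro!: pr_eq_self)
  qed
  also have "\<dots> * emeasure std_gaussian Qs = (\<integral>\<^sup>+z1. \<integral>\<^sup>+z2. indicator K (?\<pi> z1) * indicator Qs z2 \<partial>std_gaussian \<partial>std_gaussian)"
  proof -
    have "{z. \<forall>w\<in>W. ?\<pi> z \<bullet> w < 0} = ?\<pi> -` K" by (auto simp: K_def)
    moreover have "?\<pi> -` K \<in> sets borel" by (rule measurable_sets_borel[OF _ K]) simp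
    then have "(\<integral>\<^sup>+z1. indicator K (?\<pi> z1) \<partial>std_gaussian) = emeasure std_gaussian (?\<pi> -` K)"
      by (simp add: indicator_vimage[symmetric])
    ultimately show ?thesis by (simp add: nn_integral_cmult nn_integral_multc)
  qed
  also have "\<dots> = (\<integral>\<^sup>+z. indicator (negpos S) (res S V z) \<partial>std_gaussian)"
    by (subst (3) pr.std_gaussian_split[of _ S V]) (auto simp: split ind pr.idem)
  finally show ?thesis .
qed

section \<open>The cone over the orthant generated by a subspace\<close>

definition upper_cone :: "(real ^ 'n::finite) set \<Rightarrow> (real ^ 'n) set" where
  "upper_cone V = {z. \<exists>u\<in>span V. \<forall>i. u $ i \<le> z $ i}"

text \<open>It contains 0 iff \<open>span V\<close> has a vector with only negative, equivalently
  only positive, coordinates. Membership of 0 is therefore the form in which separability is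
  treated.\<close>

definition upper_cone_int :: "(real ^ 'n::finite) set \<Rightarrow> (real ^ 'n) set" where
  "upper_cone_int V = {z. \<exists>u\<in>span V. \<forall>i. u $ i < z $ i}"

lemma upper_cone_int_subset: "upper_cone_int V \<subseteq> upper_cone V"
  unfolding upper_cone_int_def upper_cone_def by (auto intro: less_imp_le)

lemma upper_cone_convex_cone: "convex_cone (upper_cone V)"
  unfolding convex_cone_iff
proof (intro conjI ballI allI impI)
  show "0 \<in> upper_cone V" by (auto simp: upper_cone_def intro!: bexI[of _ 0] span_zero)
  fix x y assume "x \<in> upper_cone V" "y \<in> upper_cone V"
  then obtain u w where "u \<in> span V" "w \<in> span V" "\<forall>i. u $ i \<le> x $ i" "\<forall>i. w $ i \<le> y $ i"
    by (auto simp: upper_cone_def)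
  then show "x + y \<in> upper_cone V"
    by (auto simp: upper_cone_def intro!: bexI[of _ "u + w"] span_add add_mono)
next
  fix x and c :: real assume "x \<in> upper_cone V" "0 \<le> c"
  then obtain u where "u \<in> span V" "\<forall>i. u $ i \<le> x $ i" "0 \<le> c"
    by (auto simp: upper_cone_def)
  then show "c *\<^sub>R x \<in> upper_cone V"
    by (auto simp: upper_cone_def intro!: bexI[of _ "c *\<^sub>R u"] span_scale mult_left_mono)
qed

lemma convex_cone_sum:
  assumes "convex_cone K" "finite I" "\<And>i. i \<in> I \<Longrightarrow> f i \<in> K"
  shows "sum f I \<in> K"
  using assms(2,3)
  by (induction I rule: finite_induct) (auto intro: convex_cone_contains_0[OF assms(1)] convex_cone_add[OF assms(1)])

text \<open>Opposite pairs of vectors generate the lineality space as a cone. For finite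
  \<open>V\<close> the generating set is finite, so the cone is a polyhedron: closed, with finitely
  many faces.\<close>

lemma upper_cone_hull:
  "upper_cone V = convex_cone hull (V \<union> uminus ` V \<union> range (\<lambda>i. axis i 1))" (is "_ = convex_cone hull ?H")
proof
  have nn: "b \<in> convex_cone hull ?H" if "\<forall>i. 0 \<le> b $ i" for b
  proof -
    have "b = (\<Sum>i\<in>UNIV. b $ i *\<^sub>R axis i 1)"
      by (simp add: vec_eq_iff axis_def if_distrib[of "\<lambda>x. _ * x"] cong: if_cong)
    also have "\<dots> \<in> convex_cone hull ?H"
    proof (rule convex_cone_sum[OF convex_cone_convex_cone_hull finite_class.finite_UNIV])
      fix i
      show "b $ i *\<^sub>R axis i 1 \<in> convex_cone hull ?H" using that
        by (intro convex_cone_hull_mul hull_inc) auto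
    qed
    finally show ?thesis .
  qed
  have sp: "u \<in> convex_cone hull ?H" if "u \<in> span V" for u
    using that
  proof (induction rule: span_induct_alt)
    case base
    show ?case by (rule convex_cone_hull_contains_0)
  next
    case (step c x y)
    have "c *\<^sub>R x \<in> convex_cone hull ?H"
    proof (cases "c \<ge> 0")
      case True
      then show ?thesis using step by (intro convex_cone_hull_mul hull_inc) auto
    next
      case False
      then have "(- c) *\<^sub>R (- x) \<in> convex_cone hull ?H" using step by (intro convex_cone_hull_mul hull_inc) auto
      then show ?thesis by simp
    qed
    then show ?case using step by (intro convex_cone_hull_add) auto
  qed
  show "upper_cone V \<subseteq> convex_cone hull ?H"
  proof
    fix z assume "z \<in> upper_cone V"
    then obtain u where u: "u \<in> span V" "\<forall>i. u $ i \<le> z $ i" by (auto simp: upper_cone_def)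
    then have "u + (z - u) \<in> convex_cone hull ?H" by (intro convex_cone_hull_add sp nn) auto
    then show "z \<in> convex_cone hull ?H" by simp
  qed
  show "convex_cone hull ?H \<subseteq> upper_cone V"
  proof (rule hull_minimal)
    show "?H \<subseteq> upper_cone V"
    proof
      fix h assume "h \<in> ?H"
      then consider "h \<in> V" | x where "x \<in> V" "h = - x" | i where "h = axis i 1" by blast
      then show "h \<in> upper_cone V"
      proof cases
        case 1
        then show ?thesis by (auto simp: upper_cone_def intro!: bexI[of _ h] span_base)
      next
        case 2
        have "h \<in> span V" unfolding 2(2) by (rule span_neg[OF span_base[OF 2(1)]])
        then show ?thesis by (auto simp: upper_cone_def intro!: bexI[of _ h])
      next
        case 3
        then show ?thesis by (auto simp: upper_cone_def axis_def intro!: bexI[of _ 0] span_zero)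
      qed
    qed
  qed (rule upper_cone_convex_cone)
qed

lemma polyhedron_upper_cone: "finite V \<Longrightarrow> polyhedron (upper_cone V)"
  unfolding upper_cone_hull by (rule polyhedron_convex_cone_hull) auto

lemma closed_upper_cone: "finite V \<Longrightarrow> closed (upper_cone V)"
  by (rule polyhedron_imp_closed[OF polyhedron_upper_cone])

lemma convex_upper_cone: "convex (upper_cone V)"
  using upper_cone_convex_cone[of V] by (simp add: convex_cone_def)

lemma upper_cone_nonempty: "upper_cone V \<noteq> {}"
  using upper_cone_convex_cone[of V] by (simp add: convex_cone_def)

text \<open>The optimality conditions of the projection, with lineality part \<open>u\<close>, slack
  \<open>b\<close> and multiplier \<open>a\<close>. The variational inequality is tested in the
  directions of \<open>span V\<close> with both signs, in the coordinate directions, and at the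
  point \<open>u\<close>; the last test gives complementary slackness.\<close>

lemma upper_cone_closest:
  fixes z :: "real ^ 'n::finite"
  assumes "finite V"
  obtains u b a :: "real ^ 'n" where "closest_point (upper_cone V) z = u + b" "u \<in> span V" "\<And>i. 0 \<le> b $ i"
    "z = u + b - a" "\<And>i. 0 \<le> a $ i" "\<And>x. x \<in> span V \<Longrightarrow> a \<bullet> x = 0" "\<And>i. a $ i * b $ i = 0"
proof -
  let ?C = "upper_cone V"
  define y where "y = closest_point ?C z"
  have "y \<in> ?C" unfolding y_def by (rule closest_point_in_set[OF closed_upper_cone[OF assms] upper_cone_nonempty])
  then obtain u where u: "u \<in> span V" "\<And>i. u $ i \<le> y $ i" by (auto simp: upper_cone_def)
  define b where "b = y - u"
  define a where "a = y - z"
  have dot: "(- a) \<bullet> (x - y) \<le> 0" if "x \<in> ?C" for x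
    using closest_point_dot[OF convex_upper_cone closed_upper_cone[OF assms] that, of z] by (simp add: y_def a_def)
  have yb: "y = u + b" by (simp add: b_def)
  have b0: "0 \<le> b $ i" for i using u by (simp add: b_def)
  have orth: "a \<bullet> x = 0" if x: "x \<in> span V" for x
  proof -
    have "y + x \<in> ?C" unfolding upper_cone_def using u x by (auto intro!: bexI[of _ "u + x"] span_add)
    moreover have "y - x \<in> ?C" unfolding upper_cone_def using u x by (auto intro!: bexI[of _ "u - x"] span_diff)
    ultimately have "y + x \<in> ?C" "y - x \<in> ?C" by auto
    from dot[OF this(1)] dot[OF this(2)] show ?thesis by simp
  qed
  have a0: "0 \<le> a $ i" for i
  proof -
    have "u $ j \<le> (y + axis i 1) $ j" for j using u(2)[of j] u(2)[of i] by (simp add: axis_def)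
    then have "y + axis i 1 \<in> ?C" unfolding upper_cone_def using u(1) by blast
    from dot[OF this] show ?thesis by (simp add: inner_axis)
  qed
  have "u \<in> ?C" using u by (auto simp: upper_cone_def)
  from dot[OF this] have "a \<bullet> b \<le> 0" by (simp add: yb)
  moreover have "a \<bullet> b = (\<Sum>i\<in>UNIV. a $ i * b $ i)" by (simp add: inner_vec_def)
  moreover have "(\<Sum>i\<in>UNIV. a $ i * b $ i) \<ge> 0" by (intro sum_nonneg mult_nonneg_nonneg a0 b0)
  ultimately have "(\<Sum>i\<in>UNIV. a $ i * b $ i) = 0" by linarith
  then have ab: "a $ i * b $ i = 0" for i
    by (subst (asm) sum_nonneg_eq_0_iff) (use a0 b0 in auto)
  have "closest_point ?C z = u + b" using yb y_def by simp
  moreover have "z = u + b - a" by (simp add: a_def yb[symmetric])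
  ultimately show thesis by (rule that[OF _ u(1) b0 _ a0 orth ab])
qed

text \<open>Sufficiency of the optimality conditions: the functional \<open>sip S w\<close> is
  nonpositive on the cone and 0 at the candidate, so moving away from the candidate within the cone
  cannot shorten the distance to \<open>z\<close>.\<close>

lemma upper_cone_closest_eq:
  assumes "finite V" and w: "w \<in> negpos S" and zw: "z - w \<in> span V"
    and orth: "\<And>u. u \<in> span V \<Longrightarrow> sip S w u = 0"
  shows "closest_point (upper_cone V) z = z - restr S w"
proof (rule closest_point_unique[OF convex_upper_cone closed_upper_cone[OF assms(1)], symmetric])
  let ?y = "z - restr S w"
  show yC: "?y \<in> upper_cone V" unfolding upper_cone_def using zw w
    by (auto intro!: bexI[of _ "z - w"] simp: negpos_def not_le intro: less_imp_le)
  have sy: "sip S w ?y = 0"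
  proof -
    have "sip S w (z - w) = 0" by (rule orth[OF zw])
    then show ?thesis by (simp add: sip_linear)
  qed
  show "\<forall>x\<in>upper_cone V. dist z ?y \<le> dist z x"
  proof
    fix x assume "x \<in> upper_cone V"
    then obtain u where u: "u \<in> span V" "\<And>i. u $ i \<le> x $ i" by (auto simp: upper_cone_def)
    have "sip S w (x - u) \<le> 0" unfolding sip_def
      by (rule sum_nonpos) (use w u in \<open>auto simp: negpos_def intro!: mult_nonpos_nonneg intro: less_imp_le\<close>)
    then have sx: "sip S w x \<le> 0" using orth[OF u(1)] by (simp add: sip_linear)
    have "restr S w \<bullet> (?y - x) \<ge> 0" using sx sy by (simp add: sip_restr[symmetric] sip_linear)
    moreover have "(norm a)\<^sup>2 \<le> (norm (a + d))\<^sup>2" if "a \<bullet> d \<ge> 0" for a d :: "real ^ 'n"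
      using that by (simp add: power2_norm_eq_inner inner_add_left inner_add_right inner_commute)
    ultimately have "(norm (restr S w))\<^sup>2 \<le> (norm (restr S w + (?y - x)))\<^sup>2" by blast
    then have "norm (restr S w) \<le> norm (restr S w + (?y - x))" by (rule power2_le_imp_le) simp
    then show "dist z ?y \<le> dist z x" by (simp add: dist_norm algebra_simps)
  qed
qed

section \<open>General position and the decomposition into tiles\<close>

text \<open>General position stated one vector at a time, so that, given the tail \<open>V\<close>,
  almost every \<open>g\<close> satisfies the new condition. The rank statements that it stands for
  are extracted in \<open>generic_rank\<close>.\<close>

fun generic :: "(real ^ 'n::finite) list \<Rightarrow> bool" where
  "generic [] = True"
| "generic (g # V) = (generic V \<and> (\<forall>S. length V < card S \<longrightarrow> pr S V g \<noteq> 0))"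

lemma pr_orth: "u \<in> span (set V) \<Longrightarrow> pr S V z \<bullet> u = 0"
  using res_orth[of u V S z] by (simp add: pr_def sip_restr)

lemma res_0_on_restr: "restr S x = 0 \<Longrightarrow> pr S V x = 0"
  using res_restr[of S V x] linear_0[OF res_linear[of S V]] linear_0[OF restr_linear[of S]]
  by (simp add: pr_def)

lemma pr_span_0:
  assumes "u \<in> span (set V)" shows "pr S V u = 0"
proof -
  have "res S V u = u - (u - res S V u)" by simp
  also have "\<dots> \<in> span (set V)" by (rule span_diff[OF assms res_diff_span])
  finally have "sip S (res S V u) (res S V u) = 0" by (rule res_orth)
  then show ?thesis by (simp add: sip_self_0 pr_def)
qed

text \<open>One induction over the list proves both claims, with the set kept arbitrary: the first
  claim refers to the tail on \<open>S\<close> and on \<open>S\<close> without one element, the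
  second to the tail on the same \<open>S\<close>.\<close>

lemma generic_rank:
  assumes "generic V"
  shows "card S \<le> length V \<Longrightarrow> restr S x = x \<Longrightarrow> (\<And>u. u \<in> set V \<Longrightarrow> x \<bullet> u = 0) \<Longrightarrow> x = 0"
    and "length V \<le> card S \<Longrightarrow> u \<in> span (set V) \<Longrightarrow> restr S u = 0 \<Longrightarrow> u = 0"
proof -
  have "(card S \<le> length V \<longrightarrow> restr S x = x \<longrightarrow> (\<forall>u\<in>set V. x \<bullet> u = 0) \<longrightarrow> x = 0) \<and>
    (length V \<le> card S \<longrightarrow> u \<in> span (set V) \<longrightarrow> restr S u = 0 \<longrightarrow> u = 0)" for x u S
    using assms
  proof (induction V arbitrary: x u S)
    case Nil
    have "x = 0" if "card S = 0" "restr S x = x" using that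
      by (simp add: vec_eq_iff)
    then show ?case by auto
  next
    case (Cons g V)
    then have gen: "generic V" and pr: "\<And>S. length V < card S \<Longrightarrow> pr S V g \<noteq> 0" by auto
    have A: "x = 0" if "card S \<le> length V" "restr S x = x" "\<And>u. u \<in> set V \<Longrightarrow> x \<bullet> u = 0" for S x
      using Cons.IH[OF gen, of S x] that by simp
    have B: "u = 0" if "length V \<le> card S" "u \<in> span (set V)" "restr S u = 0" for S u
      using Cons.IH[OF gen, of S _ u] that by simp
    have 1: "x = 0" if c: "card S \<le> length (g # V)" and x: "restr S x = x" "\<forall>u\<in>set (g # V). x \<bullet> u = 0"
    proof (cases "card S \<le> length V")
      case True
      then show ?thesis using A x by auto
    next
      case False
      then have cS: "card S = Suc (length V)" using c by simp
      define r where "r = pr S V g"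
      have r0: "r \<noteq> 0" using pr[of S] cS by (simp add: r_def)
      have rr: "restr S r = r" by (simp add: r_def pr_def)
      have rx: "r \<bullet> x = 0"
      proof -
        have "r \<bullet> x = g \<bullet> pr S V x" unfolding r_def by (rule pr.self_adj)
        also have "pr S V x = x" by (rule pr_eq_self) (use x in auto)
        finally show ?thesis using x by (simp add: inner_commute)
      qed
      \<comment> \<open>The combination cancels coordinate \<open>j\<close>, so it is supported on
        \<open>length V\<close> elements and vanishes by the induction hypothesis. Pairing it with
        \<open>r\<close>, which is orthogonal to \<open>x\<close>, isolates
        \<open>x $ j\<close>.\<close>
      have e: "(x $ j) *\<^sub>R r - (r $ j) *\<^sub>R x = 0" if j: "j \<in> S" for j
      proof (rule A[of "S - {j}"])
        show "card (S - {j}) \<le> length V" using cS j by simp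
        have "r $ i = 0" "x $ i = 0" if "i \<notin> S" for i using that rr x(1) by (metis restr_nth)+
        then show "restr (S - {j}) ((x $ j) *\<^sub>R r - (r $ j) *\<^sub>R x) = (x $ j) *\<^sub>R r - (r $ j) *\<^sub>R x"
          by (auto simp: vec_eq_iff)
        fix u assume u: "u \<in> set V"
        then have "r \<bullet> u = 0" unfolding r_def by (intro pr_orth span_base)
        then show "((x $ j) *\<^sub>R r - (r $ j) *\<^sub>R x) \<bullet> u = 0" using u x by (simp add: inner_diff_left)
      qed
      have "x $ j = 0" for j
      proof (cases "j \<in> S")
        case True
        have "0 = r \<bullet> ((x $ j) *\<^sub>R r - (r $ j) *\<^sub>R x)" by (simp add: e[OF True])
        also have "\<dots> = x $ j * (r \<bullet> r)" using rx by (simp add: inner_diff_right)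
        finally show ?thesis using r0 by simp
      next
        case False
        then show ?thesis using x(1) by (metis restr_nth)
      qed
      then show ?thesis by (simp add: vec_eq_iff)
    qed
    have 2: "u = 0" if c: "length (g # V) \<le> card S" and u: "u \<in> span (set (g # V))" "restr S u = 0"
    proof -
      obtain k where k: "u - k *\<^sub>R g \<in> span (set V)" using u(1) by (auto simp: span_breakdown_eq)
      \<comment> \<open>\<open>pr S V\<close> vanishes on \<open>span V\<close> and on vectors that
        are 0 on \<open>S\<close>; only the coefficient \<open>k\<close> of \<open>g\<close>
        survives.\<close>
      have "pr S V (u - k *\<^sub>R g) = 0" by (rule pr_span_0[OF k])
      moreover have "pr S V u = 0" by (rule res_0_on_restr[OF u(2)])
      ultimately have "k *\<^sub>R pr S V g = 0" by (simp add: linear_diff[OF pr.linear] linear_scale[OF pr.linear])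
      then have "k = 0" using pr[of S] c by auto
      then show ?thesis using B[of S u] k u(2) c by simp
    qed
    show ?case by (intro conjI impI; (rule 1 2); assumption)
  qed
  note * = this
  show "card S \<le> length V \<Longrightarrow> restr S x = x \<Longrightarrow> (\<And>u. u \<in> set V \<Longrightarrow> x \<bullet> u = 0) \<Longrightarrow> x = 0"
    using *[of S x] by simp
  show "length V \<le> card S \<Longrightarrow> u \<in> span (set V) \<Longrightarrow> restr S u = 0 \<Longrightarrow> u = 0" using *[of S _ u] by simp
qed

lemma generic_single: "generic [v] \<longleftrightarrow> (\<forall>i. v $ i \<noteq> 0)"
proof
  assume "generic [v]"
  then show "\<forall>i. v $ i \<noteq> 0"
  proof (intro allI notI)
    fix i assume g: "generic [v]" and "v $ i = 0"
    then have "pr {i} [] v = 0" by (auto simp: pr_def vec_eq_iff)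
    then show False using g by auto
  qed
next
  assume v: "\<forall>i. v $ i \<noteq> 0"
  have "pr S [] v \<noteq> 0" if "0 < card S" for S
  proof -
    have "S \<noteq> {}" using that by auto
    then obtain i where "i \<in> S" by blast
    then have "pr S [] v $ i \<noteq> 0" using v by (simp add: pr_def)
    then show ?thesis by (metis zero_index)
  qed
  then show "generic [v]" by simp
qed

lemma res_negpos_closest:
  assumes "res S V z \<in> negpos S"
  shows "closest_point (upper_cone (set V)) z = z - restr S (res S V z)"
  by (rule upper_cone_closest_eq) (use assms res_diff_span res_orth in auto)

lemma negpos_support:
  assumes "w \<in> negpos S" shows "S = {i. (restr S w) $ i < 0}"
  using assms by (auto simp: negpos_def split: if_splits)

text \<open>The set can be read off from the projection: it consists of the negative coordinates of
  \<open>z\<close> minus its closest point.\<close>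

lemma tile_disjoint:
  assumes "res S V z \<in> negpos S" "res S' V z \<in> negpos S'"
  shows "S = S'"
proof -
  have e: "restr S (res S V z) = restr S' (res S' V z)"
    using res_negpos_closest[OF assms(1)] res_negpos_closest[OF assms(2)] by simp
  have "S = {i. (restr S (res S V z)) $ i < 0}" by (rule negpos_support[OF assms(1)])
  also have "\<dots> = {i. (restr S' (res S' V z)) $ i < 0}" by (simp only: e)
  also have "\<dots> = S'" by (rule negpos_support[OF assms(2), symmetric])
  finally show ?thesis .
qed

lemma tile_disjoint_int:
  assumes "res S V z \<in> negpos S" "S \<noteq> {}"
  shows "z \<notin> upper_cone (set V)"
proof
  assume "z \<in> upper_cone (set V)"
  then have "closest_point (upper_cone (set V)) z = z" by (rule closest_point_self)
  then have "restr S (res S V z) = 0" using res_negpos_closest[OF assms(1)] by simp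
  then have "S = {}" using negpos_support[OF assms(1)] by simp
  then show False using assms(2) by simp
qed

text \<open>\<open>S\<close> is the support of the multiplier \<open>a\<close>. Since
  \<open>a\<close> is nonzero and orthogonal to \<open>V\<close>, general position excludes a small
  support; it also makes the fit on \<open>S\<close> unique, which identifies \<open>b - a\<close>
  with the residual. The hypothesis \<open>nz\<close> turns weak inequalities into strict
  ones.\<close>

lemma tile_cover:
  fixes z :: "real ^ 'n::finite"
  assumes gen: "generic V" and nz: "\<And>S i. i \<notin> S \<Longrightarrow> res S V z $ i \<noteq> 0"
    and z: "z \<notin> upper_cone (set V)"
  obtains S where "length V < card S" "res S V z \<in> negpos S"
proof (rule upper_cone_closest[OF finite_set[of V], of z])
  fix u b a :: "real ^ 'n"
  assume *: "closest_point (upper_cone (set V)) z = u + b" "u \<in> span (set V)" "\<And>i. 0 \<le> b $ i"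
    "z = u + b - a" "\<And>i. 0 \<le> a $ i" "\<And>x. x \<in> span (set V) \<Longrightarrow> a \<bullet> x = 0" "\<And>i. a $ i * b $ i = 0"
  define S where "S = {i. a $ i > 0}"
  define w where "w = b - a"
  have aS: "a $ i = 0" if "i \<notin> S" for i using that *(5)[of i] by (auto simp: S_def)
  have bS: "b $ i = 0" if "i \<in> S" for i using that *(7)[of i] by (auto simp: S_def)
  have ra: "restr S a = a" by (auto simp: vec_eq_iff aS)
  have rw: "restr S w = - a" by (auto simp: vec_eq_iff aS bS w_def)
  have zw: "z - w \<in> span (set V)" using *(2) by (simp add: *(4) w_def)
  have "a \<noteq> 0"
  proof
    assume "a = 0"
    then have "z \<in> upper_cone (set V)" using *(2,3) by (auto simp: upper_cone_def *(4) intro!: bexI[of _ u])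
    then show False using z by simp
  qed
  have c: "length V < card S"
  proof (rule ccontr)
    assume "\<not> ?thesis"
    then have "a = 0" by (intro generic_rank(1)[OF gen, of S a]) (auto simp: ra *(6) span_base)
    then show False using \<open>a \<noteq> 0\<close> by simp
  qed
  have rw': "res S V z = w"
  proof -
    let ?d = "res S V z - w"
    have "?d = (z - w) - (z - res S V z)" by simp
    also have "\<dots> \<in> span (set V)" by (rule span_diff[OF zw res_diff_span])
    finally have d: "?d \<in> span (set V)" .
    have "sip S w ?d = (- a) \<bullet> ?d" by (simp only: sip_restr rw)
    also have "\<dots> = 0" using *(6)[OF d] by simp
    finally have "sip S ?d ?d = 0" using res_orth[OF d, of S z] by (simp add: sip_linear(3))
    then have "restr S ?d = 0" by (simp add: sip_self_0)
    then have "?d = 0" by (rule generic_rank(2)[OF gen less_imp_le[OF c] d])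
    then show ?thesis by simp
  qed
  have "w \<in> negpos S"
    unfolding negpos_def
  proof (intro CollectI conjI ballI allI impI)
    fix i assume "i \<in> S" then show "w $ i < 0" using bS by (simp add: w_def) (simp add: S_def)
  next
    fix i assume i: "i \<notin> S"
    then have "w $ i \<ge> 0" using aS *(3)[of i] by (simp add: w_def)
    moreover have "w $ i \<noteq> 0" using nz[OF i] by (simp add: rw')
    ultimately show "0 < w $ i" by simp
  qed
  then have "res S V z \<in> negpos S" by (simp only: rw')
  with c show thesis by (rule that)
qed

section \<open>The open cone: scaling, recursion and measurability\<close>

lemma upper_cone_int_scale:
  fixes z :: "real ^ 'n::finite"
  shows "0 < c \<Longrightarrow> c *\<^sub>R z \<in> upper_cone_int V \<longleftrightarrow> z \<in> upper_cone_int V"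
proof -
  have "c *\<^sub>R z \<in> upper_cone_int V" if c: "0 < c" and z: "z \<in> upper_cone_int V" for c and z :: "real ^ 'n"
  proof -
    obtain u where "u \<in> span V" "\<forall>i. u $ i < z $ i" using z by (auto simp: upper_cone_int_def)
    then show ?thesis using c by (auto simp: upper_cone_int_def intro!: bexI[of _ "c *\<^sub>R u"] span_scale)
  qed
  from this[of c z] this[of "1/c" "c *\<^sub>R z"] show "0 < c \<Longrightarrow> ?thesis" by auto
qed

lemma upper_cone_int_add: "x \<in> upper_cone_int V \<Longrightarrow> y \<in> upper_cone_int V \<Longrightarrow> x + y \<in> upper_cone_int V"
proof -
  assume "x \<in> upper_cone_int V" "y \<in> upper_cone_int V"
  then obtain u w where "u \<in> span V" "w \<in> span V" "\<forall>i. u $ i < x $ i" "\<forall>i. w $ i < y $ i"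
    by (auto simp: upper_cone_int_def)
  then show ?thesis by (auto simp: upper_cone_int_def intro!: bexI[of _ "u + w"] span_add add_strict_mono)
qed

lemma upper_cone_int_0:
  assumes "0 \<in> upper_cone_int V" shows "z \<in> upper_cone_int V"
proof -
  obtain u where u: "u \<in> span V" "\<And>i. u $ i < 0" using assms by (auto simp: upper_cone_int_def)
  \<comment> \<open>Larger than every quotient \<open>\<bar>z $ i / u $ i\<bar>\<close>, so that
    \<open>N *\<^sub>R u\<close>, whose entries are negative, lies below \<open>z\<close>.\<close>
  define N where "N = (\<Sum>i\<in>UNIV. \<bar>z $ i / u $ i\<bar>) + 1"
  have "N * u $ i < z $ i" for i
  proof -
    have "\<bar>z $ i / u $ i\<bar> \<le> (\<Sum>i\<in>UNIV. \<bar>z $ i / u $ i\<bar>)" by (rule member_le_sum) auto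
    then have "z $ i / u $ i < N" unfolding N_def using abs_ge_self[of "z $ i / u $ i"] by linarith
    then show ?thesis using u(2)[of i] by (simp add: field_simps)
  qed
  then show ?thesis using u by (auto simp: upper_cone_int_def intro!: bexI[of _ "N *\<^sub>R u"] span_scale)
qed

lemma upper_cone_int_insert: "z \<in> upper_cone_int (insert g V) \<longleftrightarrow> (\<exists>k. z - k *\<^sub>R g \<in> upper_cone_int V)"
proof
  assume "z \<in> upper_cone_int (insert g V)"
  then obtain u where u: "u \<in> span (insert g V)" "\<And>i. u $ i < z $ i" by (auto simp: upper_cone_int_def)
  then obtain k where "u - k *\<^sub>R g \<in> span V" by (auto simp: span_breakdown_eq)
  then show "\<exists>k. z - k *\<^sub>R g \<in> upper_cone_int V" using u(2)
    by (auto simp: upper_cone_int_def intro!: exI[of _ k] bexI[of _ "u - k *\<^sub>R g"])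
next
  assume "\<exists>k. z - k *\<^sub>R g \<in> upper_cone_int V"
  then obtain k u where u: "u \<in> span V" "\<And>i. u $ i < z $ i - k * g $ i" by (auto simp: upper_cone_int_def)
  have "u + k *\<^sub>R g \<in> span (insert g V)" using u(1) by (subst span_breakdown_eq) (auto intro!: exI[of _ k])
  then show "z \<in> upper_cone_int (insert g V)" using u(2)
    by (auto simp: upper_cone_int_def less_diff_eq intro!: bexI[of _ "u + k *\<^sub>R g"])
qed

text \<open>After adjoining \<open>z\<close>, the open cone contains 0 iff it contained 0,
  \<open>z\<close> or \<open>- z\<close> before. If it did not contain 0, it cannot contain both
  \<open>z\<close> and \<open>- z\<close>, whose sum is 0; if it did, it is the whole space and both
  sides are 2.\<close>

lemma separation_recursion:
  "indicator (upper_cone_int (insert z V)) 0 + indicator (upper_cone_int V) 0 =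
   (indicator (upper_cone_int V) z + indicator (upper_cone_int V) (- z) :: ennreal)"
proof -
  have "0 \<in> upper_cone_int (insert z V) \<longleftrightarrow> (\<exists>k. (- k) *\<^sub>R z \<in> upper_cone_int V)"
    by (subst upper_cone_int_insert) simp
  also have "\<dots> \<longleftrightarrow> 0 \<in> upper_cone_int V \<or> z \<in> upper_cone_int V \<or> - z \<in> upper_cone_int V"
  proof
    assume "\<exists>k. (- k) *\<^sub>R z \<in> upper_cone_int V"
    then obtain k where k: "(- k) *\<^sub>R z \<in> upper_cone_int V" ..
    consider "k = 0" | "k > 0" | "k < 0" by linarith
    then show "0 \<in> upper_cone_int V \<or> z \<in> upper_cone_int V \<or> - z \<in> upper_cone_int V"
    proof cases
      case 2
      then show ?thesis using k upper_cone_int_scale[of k "- z" V] by simp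
    next
      case 3
      then show ?thesis using k upper_cone_int_scale[of "- k" "z" V] by simp
    qed (use k in auto)
  next
    assume "0 \<in> upper_cone_int V \<or> z \<in> upper_cone_int V \<or> - z \<in> upper_cone_int V"
    then show "\<exists>k. (- k) *\<^sub>R z \<in> upper_cone_int V"
      by (elim disjE) (intro exI[of _ 0], simp, intro exI[of _ "-1"], simp, intro exI[of _ 1], simp)
  qed
  finally have 1: "0 \<in> upper_cone_int (insert z V) \<longleftrightarrow> 0 \<in> upper_cone_int V \<or> z \<in> upper_cone_int V \<or> - z \<in> upper_cone_int V" .
  show ?thesis
  proof (cases "0 \<in> upper_cone_int V")
    case True
    then show ?thesis using upper_cone_int_0[OF True] by (simp add: 1)
  next
    case False
    then have "\<not> (z \<in> upper_cone_int V \<and> - z \<in> upper_cone_int V)" using upper_cone_int_add[of z V "- z"] by auto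
    then show ?thesis using False by (auto simp: 1 indicator_def)
  qed
qed

lemma open_upper_cone_int: "open (upper_cone_int (V :: (real ^ 'n::finite) set))"
proof -
  have "upper_cone_int V = (\<Union>u\<in>span V. \<Inter>i. {z. u $ i < z $ i})" by (auto simp: upper_cone_int_def)
  also have "open \<dots>"
    by (intro open_UN ballI open_INT finite_class.finite_UNIV open_Collect_less continuous_intros)
  finally show ?thesis .
qed

text \<open>The quantifier over the span is removed one generator at a time. Since the cone is open,
  a real coefficient may be replaced by a rational one, and a countable union remains.\<close>

lemma upper_cone_int_measurable:
  assumes "\<And>f. f \<in> set fs \<Longrightarrow> f \<in> borel_measurable M" "z \<in> borel_measurable M"
  shows "{\<omega> \<in> space M. z \<omega> \<in> upper_cone_int ((\<lambda>f. f \<omega>) ` set fs)} \<in> sets M"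
  using assms
proof (induction fs arbitrary: z)
  case Nil
  have "upper_cone_int {} \<in> sets borel" by (simp add: open_upper_cone_int)
  from measurable_sets[OF Nil(2) this] show ?case by (simp add: vimage_def Int_def conj_commute)
next
  case (Cons f fs)
  have [measurable]: "f \<in> borel_measurable M" "z \<in> borel_measurable M" using Cons.prems by auto
  have "z \<omega> \<in> upper_cone_int ((\<lambda>f. f \<omega>) ` set (f # fs)) \<longleftrightarrow>
     (\<exists>k\<in>\<rat>. z \<omega> - k *\<^sub>R f \<omega> \<in> upper_cone_int ((\<lambda>f. f \<omega>) ` set fs))" (is "?l = ?r") for \<omega>
  proof
    assume ?l
    then obtain k where k: "z \<omega> - k *\<^sub>R f \<omega> \<in> upper_cone_int ((\<lambda>f. f \<omega>) ` set fs)"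
      by (auto simp: upper_cone_int_insert)
    have "open ((\<lambda>k. z \<omega> - k *\<^sub>R f \<omega>) -` upper_cone_int ((\<lambda>f. f \<omega>) ` set fs))"
      by (intro open_vimage open_upper_cone_int continuous_intros)
    with k obtain e where e: "e > 0" "\<And>k'. dist k' k < e \<Longrightarrow> z \<omega> - k' *\<^sub>R f \<omega> \<in> upper_cone_int ((\<lambda>f. f \<omega>) ` set fs)"
      unfolding open_dist by auto
    obtain q where "q \<in> \<rat>" "k < q" "q < k + e" using Rats_dense_in_real[of k "k + e"] e by auto
    then show ?r using e(2)[of q] by (auto simp: dist_real_def)
  qed (auto simp: upper_cone_int_insert)
  then have "{\<omega> \<in> space M. z \<omega> \<in> upper_cone_int ((\<lambda>f. f \<omega>) ` set (f # fs))} =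
    (\<Union>k\<in>\<rat>. {\<omega> \<in> space M. z \<omega> - k *\<^sub>R f \<omega> \<in> upper_cone_int ((\<lambda>f. f \<omega>) ` set fs)})" by auto
  also have "\<dots> \<in> sets M"
  proof (rule sets.countable_UN''[OF countable_rat])
    fix k :: real assume "k \<in> \<rat>"
    have "(\<lambda>\<omega>. z \<omega> - k *\<^sub>R f \<omega>) \<in> borel_measurable M" by measurable
    then show "{\<omega> \<in> space M. z \<omega> - k *\<^sub>R f \<omega> \<in> upper_cone_int ((\<lambda>f. f \<omega>) ` set fs)} \<in> sets M"
      using Cons.prems(1) by (intro Cons.IH) auto
  qed
  finally show ?case .
qed

section \<open>Gaussian subspaces meeting the positive orthant\<close>

text \<open>Residuals need an ordered list of generators, product measures an index set; the lemmas
  below therefore use distinct lists of indices and the family over the set of their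
  entries.\<close>

abbreviation (input) gauss_fam :: "'i set \<Rightarrow> ('i \<Rightarrow> 'a::euclidean_space) measure" where
  "gauss_fam I \<equiv> \<Pi>\<^sub>M i\<in>I. std_gaussian"

lemma prob_space_gauss_fam: "prob_space (gauss_fam I)"
  by (rule prob_space_PiM) (rule prob_space_std_gaussian)

lemma gauss_fam_measurable_comp: "i \<in> I \<Longrightarrow> (\<lambda>G. G i) \<in> borel_measurable (gauss_fam I)"
  using measurable_component_singleton[of i I "\<lambda>_. std_gaussian"] by (simp cong: measurable_cong_sets)

lemma res_measurable_fam:
  assumes "set is \<subseteq> I" "z \<in> borel_measurable M" "h \<in> measurable M (gauss_fam I)"
  shows "(\<lambda>\<omega>. res S (map (h \<omega>) is @ [v]) (z \<omega>)) \<in> borel_measurable M"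
proof -
  let ?fs = "map (\<lambda>i \<omega>. h \<omega> i) is @ [\<lambda>_. v]"
  have "(\<lambda>\<omega>. res S (map (\<lambda>f. f \<omega>) ?fs) (z \<omega>)) \<in> borel_measurable M"
  proof (rule res_measurable[OF _ assms(2)])
    fix f assume "f \<in> set ?fs"
    then consider i where "i \<in> I" "f = (\<lambda>\<omega>. h \<omega> i)" | "f = (\<lambda>_. v)" using assms(1) by auto
    then show "f \<in> borel_measurable M"
    proof cases
      case (1 i)
      then show ?thesis using measurable_compose[OF assms(3) gauss_fam_measurable_comp[of i I]] by simp
    qed simp
  qed
  then show ?thesis by (simp add: comp_def)
qed

lemma upper_cone_int_measurable_fam:
  assumes "set is \<subseteq> I" "z \<in> borel_measurable M" "h \<in> measurable M (gauss_fam I)"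
  shows "{\<omega> \<in> space M. z \<omega> \<in> upper_cone_int (set (map (h \<omega>) is @ [v]))} \<in> sets M"
proof -
  let ?fs = "map (\<lambda>i \<omega>. h \<omega> i) is @ [\<lambda>_. v]"
  have "{\<omega> \<in> space M. z \<omega> \<in> upper_cone_int ((\<lambda>f. f \<omega>) ` set ?fs)} \<in> sets M"
  proof (rule upper_cone_int_measurable[OF _ assms(2)])
    fix f assume "f \<in> set ?fs"
    then consider i where "i \<in> I" "f = (\<lambda>\<omega>. h \<omega> i)" | "f = (\<lambda>_. v)" using assms(1) by auto
    then show "f \<in> borel_measurable M"
    proof cases
      case (1 i)
      then show ?thesis using measurable_compose[OF assms(3) gauss_fam_measurable_comp[of i I]] by simp
    qed simp
  qed
  moreover have "(\<lambda>f. f \<omega>) ` set ?fs = set (map (h \<omega>) is @ [v])" for \<omega> by (auto simp: image_iff)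
  ultimately show ?thesis by simp
qed

lemma generic_measurable:
  assumes "set is \<subseteq> I"
  shows "{G \<in> space (gauss_fam I). generic (map G is @ [v :: real ^ 'n::finite])} \<in> sets (gauss_fam I)"
  using assms
proof (induction "is")
  case (Cons i "is")
  let ?M = "gauss_fam I :: ('a \<Rightarrow> real ^ 'n) measure"
  have "{G \<in> space ?M. generic (map G (i # is) @ [v])} =
    {G \<in> space ?M. generic (map G is @ [v])} \<inter>
    (\<Inter>S. {G \<in> space ?M. Suc (length is) < card S \<longrightarrow> pr S (map G is @ [v]) (G i) \<noteq> 0})"
    by auto
  also have "\<dots> \<in> sets ?M"
  proof (intro sets.Int sets.finite_INT)
    show "{G \<in> space ?M. generic (map G is @ [v])} \<in> sets ?M" using Cons by simp
    fix S
    have "(\<lambda>G. G i) \<in> borel_measurable ?M" using Cons.prems by (intro gauss_fam_measurable_comp) auto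
    then have "(\<lambda>G. res S (map G is @ [v]) (G i)) \<in> borel_measurable ?M"
      using Cons.prems by (intro res_measurable_fam[where h="\<lambda>G. G" and I=I]) auto
    then have [measurable]: "(\<lambda>G. pr S (map G is @ [v]) (G i)) \<in> borel_measurable ?M"
      unfolding pr_def by measurable
    show "{G \<in> space ?M. Suc (length is) < card S \<longrightarrow> pr S (map G is @ [v]) (G i) \<noteq> 0} \<in> sets ?M"
      by measurable
  qed auto
  finally show ?case .
qed (simp add: sets.sets_into_space)

lemma nn_integral_gauss_fam_insert:
  fixes F :: "('i \<Rightarrow> 'a::euclidean_space) \<Rightarrow> ennreal"
  assumes "finite I" "i \<notin> I" "F \<in> borel_measurable (gauss_fam (insert i I))"
  shows "(\<integral>\<^sup>+G. F G \<partial>gauss_fam (insert i I)) = (\<integral>\<^sup>+G. \<integral>\<^sup>+g. F (G(i := g)) \<partial>std_gaussian \<partial>gauss_fam I)"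
proof -
  interpret g: prob_space "std_gaussian :: 'a measure" by (rule prob_space_std_gaussian)
  interpret product_sigma_finite "\<lambda>_::'i. std_gaussian :: 'a measure" ..
  show ?thesis by (rule product_nn_integral_insert[OF assms])
qed

lemma map_upd_notin: "i \<notin> set is \<Longrightarrow> map (G(i := g)) is = map G is"
  by (induction "is") auto

text \<open>For each large \<open>S\<close> there is a nonzero \<open>w\<close> supported on
  \<open>S\<close> and orthogonal to the generators already drawn. If the projection of the next
  vector vanished, that vector would lie in the hyperplane orthogonal to \<open>w\<close>.\<close>

lemma AE_generic:
  fixes v :: "real ^ 'n::finite"
  assumes "distinct is" "\<And>i. v $ i \<noteq> 0"
  shows "AE G in gauss_fam (set is). generic (map G is @ [v])"
  using assms(1)
proof (induction "is")
  case Nil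
  show ?case using assms(2) by (simp add: generic_single[simplified])
next
  case (Cons i "is")
  let ?B = "\<lambda>is. {G \<in> space (gauss_fam (set is)). \<not> generic (map G is @ [v])}"
  have meas: "{G \<in> space (gauss_fam I). \<not> generic (map G is @ [v])} \<in> sets (gauss_fam I)" if "set is \<subseteq> I" for I "is"
  proof -
    have "{G \<in> space (gauss_fam I). \<not> generic (map G is @ [v])} = space (gauss_fam I) - {G \<in> space (gauss_fam I). generic (map G is @ [v])}" by auto
    then show ?thesis using generic_measurable[OF that] by auto
  qed
  define F where "F = (\<lambda>G. indicator {G \<in> space (gauss_fam (set (i # is))). \<not> generic (map G (i # is) @ [v])} G :: ennreal)"
  have "(\<integral>\<^sup>+G. F G \<partial>gauss_fam (insert i (set is))) = (\<integral>\<^sup>+G. \<integral>\<^sup>+g. F (G(i := g)) \<partial>std_gaussian \<partial>gauss_fam (set is))"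
    using Cons.prems meas[of "i # is" "set (i # is)"]
    by (intro nn_integral_gauss_fam_insert) (auto simp: F_def)
  also have "\<dots> = (\<integral>\<^sup>+G. 0 \<partial>(gauss_fam (set is) :: ('a \<Rightarrow> real ^ 'n) measure))"
  proof (rule nn_integral_cong_AE)
    have "AE G in gauss_fam (set is). generic (map G is @ [v])" using Cons by simp
    then show "AE G in gauss_fam (set is). (\<integral>\<^sup>+g. F (G(i := g)) \<partial>std_gaussian) = 0"
    proof eventually_elim
      case (elim G)
      note gen = elim
      have "AE g in std_gaussian. \<forall>S\<in>UNIV. Suc (length is) < card S \<longrightarrow> pr S (map G is @ [v]) g \<noteq> 0"
      proof (subst AE_finite_all[OF finite_class.finite_UNIV], intro ballI)
        fix S :: "'n set"
        show "AE g in std_gaussian. Suc (length is) < card S \<longrightarrow> pr S (map G is @ [v]) g \<noteq> 0"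
        proof (cases "Suc (length is) < card S")
          case True
          then obtain w where w: "w \<noteq> 0" "restr S w = w" "\<forall>u\<in>set (map G is @ [v]). w \<bullet> u = 0"
            using exists_orthogonal_supported[of "map G is @ [v]" S] by auto
          have pw: "pr S (map G is @ [v]) w = w" by (rule pr_eq_self) (use w in auto)
          have "AE g in std_gaussian. g \<bullet> w \<noteq> 0" by (rule AE_std_gaussian_hyperplane) fact
          then show ?thesis
          proof eventually_elim
            case (elim g)
            have "g \<bullet> w = pr S (map G is @ [v]) g \<bullet> w" unfolding pr.self_adj by (simp only: pw)
            then show ?case using elim by auto
          qed
        qed simp
      qed
      then have "AE g in std_gaussian. F (G(i := g)) = 0"
      proof eventually_elim
        case (elim g)
        then show ?case using gen Cons.prems by (simp add: F_def map_upd_notin)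
      qed
      then show ?case by (subst nn_integral_cong_AE[where v="\<lambda>_. 0"]) auto
    qed
  qed
  finally have "emeasure (gauss_fam (set (i # is))) (?B (i # is)) = 0"
    using meas[of "i # is" "set (i # is)"] by (simp add: F_def)
  then show ?case using meas[of "i # is" "set (i # is)"] by (subst AE_iff_measurable[OF _ refl]) auto
qed

lemma AE_std_gaussian_negligible:
  assumes "negligible N" shows "AE z in std_gaussian. z \<notin> N"
proof -
  have "AE z in lebesgue. z \<notin> N"
    using assms by (metis negligible_iff_null_sets AE_not_in)
  then have "AE z in lborel. z \<notin> N" by (simp add: AE_completion_iff)
  then show ?thesis unfolding std_gaussian_eq by (subst AE_density) auto
qed

lemma AE_linear_functional:
  fixes f :: "'a::euclidean_space \<Rightarrow> real"
  assumes "linear f" "f x \<noteq> 0"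
  shows "AE z in std_gaussian. f z \<noteq> 0"
proof -
  have e: "f z = z \<bullet> adjoint f 1" for z using adjoint_works[OF assms(1), of z 1] by simp
  then have "adjoint f 1 \<noteq> 0" using assms(2) by (metis inner_zero_right)
  then show ?thesis using AE_std_gaussian_hyperplane[of "adjoint f 1"] by (simp add: e)
qed

text \<open>For \<open>i\<close> outside \<open>S\<close> the functional is not identically 0: at
  \<open>axis i 1\<close>, which vanishes on \<open>S\<close>, nothing is subtracted and its value
  is 1.\<close>

lemma AE_res_nonzero:
  "AE z in std_gaussian. \<forall>S. \<forall>i. i \<notin> S \<longrightarrow> res S V z $ i \<noteq> 0"
proof -
  have "AE z in std_gaussian. i \<notin> S \<longrightarrow> res S V z $ i \<noteq> 0" for S i
  proof (cases "i \<in> S")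
    case False
    let ?e = "axis i 1"
    have "restr S ?e = 0" using False by (auto simp: vec_eq_iff axis_def)
    then have "0 = - (?e - res S V ?e)"
      using res_restr[of S V ?e] linear_0[OF res_linear[of S V]] by simp
    then have "res S V ?e $ i = 1" by (simp add: axis_def)
    moreover have "linear (\<lambda>z. res S V z $ i)"
      by (rule linearI) (simp_all add: linear_add[OF res_linear] linear_scale[OF res_linear])
    ultimately have "AE z in std_gaussian. res S V z $ i \<noteq> 0" by (intro AE_linear_functional[of _ ?e]) auto
    then show ?thesis by simp
  qed simp
  then have "AE z in std_gaussian. \<forall>S\<in>UNIV. \<forall>i\<in>UNIV. i \<notin> S \<longrightarrow> res S V z $ i \<noteq> 0"
    by (intro AE_finite_allI finite_class.finite_UNIV)
  then show ?thesis by simp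
qed

text \<open>The frontier of a convex set is negligible. From an interior point one can step down
  along the all-ones vector without leaving the cone, which makes all the inequalities
  strict.\<close>

lemma AE_upper_cone_int:
  assumes "finite V"
  shows "AE z in std_gaussian. z \<in> upper_cone V \<longrightarrow> z \<in> upper_cone_int (V :: (real ^ 'n::finite) set)"
proof -
  have "AE z in std_gaussian. z \<notin> frontier (upper_cone V)"
    by (intro AE_std_gaussian_negligible negligible_convex_frontier convex_upper_cone)
  then show ?thesis
  proof eventually_elim
   case (elim z)
   show ?case
   proof
    assume "z \<in> upper_cone V"
    then have z: "z \<in> interior (upper_cone V)"
      using elim closed_upper_cone[OF assms] by (simp add: frontier_def)
    have "open ((\<lambda>t. z - t *\<^sub>R (1 :: real ^ 'n)) -` interior (upper_cone V))"
      by (intro open_vimage open_interior continuous_intros)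
    moreover have "0 \<in> (\<lambda>t. z - t *\<^sub>R (1 :: real ^ 'n)) -` interior (upper_cone V)" using z by simp
    ultimately have "\<exists>e>0. \<forall>t. dist t 0 < e \<longrightarrow> t \<in> (\<lambda>t. z - t *\<^sub>R (1 :: real ^ 'n)) -` interior (upper_cone V)"
      unfolding open_dist by (rule bspec)
    then obtain e where e: "e > 0" "\<And>t. dist t 0 < e \<Longrightarrow> z - t *\<^sub>R 1 \<in> interior (upper_cone V)"
      by auto
    have "z - (e/2) *\<^sub>R 1 \<in> interior (upper_cone V)" using e(1) by (intro e(2)) (simp add: dist_real_def)
    then obtain u where u: "u \<in> span V" "\<And>i. u $ i \<le> z $ i - e/2"
      using interior_subset by (fastforce simp: upper_cone_def)
    have "u $ i < z $ i" for i using u(2)[of i] e(1) by linarith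
    then show "z \<in> upper_cone_int V" using u(1) by (auto simp: upper_cone_int_def)
   qed
  qed
qed

text \<open>Outside a null set a point is either in the open cone or in exactly one tile, by
  \<open>tile_cover\<close> and \<open>tile_disjoint\<close>.\<close>

lemma tile_sum:
  fixes V :: "(real ^ 'n::finite) list"
  assumes "generic V"
  shows "emeasure std_gaussian (upper_cone_int (set V)) +
    (\<Sum>S\<in>{S. length V < card S}. \<integral>\<^sup>+z. indicator (negpos S) (res S V z) \<partial>std_gaussian) = 1"
proof -
  interpret g: prob_space "std_gaussian :: (real^'n) measure" by (rule prob_space_std_gaussian)
  have [measurable]: "upper_cone_int (set V) \<in> sets borel" by (simp add: open_upper_cone_int)
  have "AE z in std_gaussian. (indicator (upper_cone_int (set V)) z :: ennreal) +
    (\<Sum>S\<in>{S. length V < card S}. indicator (negpos S) (res S V z)) = 1"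
    using AE_res_nonzero[of V] AE_upper_cone_int[OF finite_set[of V]]
  proof eventually_elim
    case (elim z)
    show ?case
    proof (cases "z \<in> upper_cone (set V)")
      case True
      with elim(2) have z: "z \<in> upper_cone_int (set V)" by simp
      have "indicator (negpos S) (res S V z) = (0::ennreal)" if "length V < card S" for S
      proof -
        have "S \<noteq> {}" using that by auto
        then have "res S V z \<notin> negpos S" using tile_disjoint_int[of S V z] True by blast
        then show ?thesis by simp
      qed
      then show ?thesis using z by simp
    next
      case False
      then have z: "z \<notin> upper_cone_int (set V)" using upper_cone_int_subset[of "set V"] by blast
      have "\<exists>S. length V < card S \<and> res S V z \<in> negpos S"
      proof (rule tile_cover[OF assms _ False])
        show "res S V z $ i \<noteq> 0" if "i \<notin> S" for S i using elim(1) that by simp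
        fix S assume "length V < card S" "res S V z \<in> negpos S"
        then show ?thesis by blast
      qed
      then obtain S where S: "length V < card S" "res S V z \<in> negpos S" by blast
      have "(\<Sum>S\<in>{S. length V < card S}. indicator (negpos S) (res S V z)) =
        (\<Sum>S'\<in>{S. length V < card S}. if S' = S then 1 else (0::ennreal))"
      proof (intro sum.cong refl)
        fix S' :: "'n set"
        have "res S' V z \<in> negpos S' \<longleftrightarrow> S' = S" using S(2) tile_disjoint[OF _ S(2), of S'] by blast
        then show "indicator (negpos S') (res S' V z) = (if S' = S then 1 else (0::ennreal))" by (simp add: indicator_def)
      qed
      also have "\<dots> = 1" using S by (simp add: sum.delta)
      finally show ?thesis using z by simp
    qed
  qed
  then have "(\<integral>\<^sup>+z. (indicator (upper_cone_int (set V)) z :: ennreal) +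
    (\<Sum>S\<in>{S. length V < card S}. indicator (negpos S) (res S V z)) \<partial>std_gaussian) = (\<integral>\<^sup>+z. 1 \<partial>(std_gaussian :: (real^'n) measure))"
    by (rule nn_integral_cong_AE)
  then show ?thesis using g.emeasure_space_1
    by (simp add: nn_integral_add nn_integral_sum)
qed

text \<open>The bound on \<open>card S\<close> is that of \<open>res_step\<close> for the removal of
  the first generator, \<open>v\<close> being counted in the list; for the later removals it only
  gets weaker.\<close>

lemma res_multi:
  fixes v :: "real ^ 'n::finite"
  assumes "distinct is" "length is + 2 \<le> card S"
  shows "(\<integral>\<^sup>+G. \<integral>\<^sup>+z. indicator (negpos S) (res S (map G is @ [v]) z) \<partial>std_gaussian \<partial>gauss_fam (set is)) =
    (\<integral>\<^sup>+z. indicator (negpos S) (res S [v] z) \<partial>std_gaussian)"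
  using assms
proof (induction "is")
  case Nil
  interpret e: prob_space "gauss_fam {} :: ('a \<Rightarrow> real ^ 'n) measure" by (rule prob_space_gauss_fam)
  show ?case using e.emeasure_space_1 by simp
next
  case (Cons i "is")
  interpret g: prob_space "std_gaussian :: (real^'n) measure" by (rule prob_space_std_gaussian)
  let ?F = "\<lambda>G. \<integral>\<^sup>+z. indicator (negpos S) (res S (map G (i # is) @ [v]) z) \<partial>std_gaussian"
  have "?F \<in> borel_measurable (gauss_fam (insert i (set is)))"
  proof -
    have "(\<lambda>p. res S (map (fst p) (i # is) @ [v]) (snd p)) \<in> borel_measurable (gauss_fam (insert i (set is)) \<Otimes>\<^sub>M std_gaussian)"
      by (rule res_measurable_fam[where I="insert i (set is)"]) (auto cong: measurable_cong_sets)
    then have "(\<lambda>p. indicator (negpos S) (res S (map (fst p) (i # is) @ [v]) (snd p)) :: ennreal) \<in> borel_measurable (gauss_fam (insert i (set is)) \<Otimes>\<^sub>M std_gaussian)"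
      by (rule measurable_compose) simp
    from g.borel_measurable_nn_integral_fst[OF this] show ?thesis by simp
  qed
  then have "(\<integral>\<^sup>+G. ?F G \<partial>gauss_fam (set (i # is))) = (\<integral>\<^sup>+G. \<integral>\<^sup>+g. ?F (G(i := g)) \<partial>std_gaussian \<partial>gauss_fam (set is))"
    using Cons.prems by (simp only: list.set) (intro nn_integral_gauss_fam_insert, auto)
  also have "\<dots> = (\<integral>\<^sup>+G. \<integral>\<^sup>+g. \<integral>\<^sup>+z. indicator (negpos S) (res S (g # (map G is @ [v])) z) \<partial>std_gaussian \<partial>std_gaussian \<partial>gauss_fam (set is))"
    using Cons.prems by (simp add: map_upd_notin del: res.simps)
  also have "\<dots> = (\<integral>\<^sup>+G. \<integral>\<^sup>+z. indicator (negpos S) (res S (map G is @ [v]) z) \<partial>std_gaussian \<partial>gauss_fam (set is))"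
    using Cons.prems by (intro nn_integral_cong res_step) simp
  also have "\<dots> = (\<integral>\<^sup>+z. indicator (negpos S) (res S [v] z) \<partial>std_gaussian)" using Cons by simp
  finally show ?case .
qed

section \<open>Tile weights and the recursion for the separation probability\<close>

definition tile :: "real ^ 'n::finite \<Rightarrow> 'n set \<Rightarrow> real" where
  "tile v S = measure std_gaussian {z. res S [v] z \<in> negpos S}"

text \<open>The index is the codimension of the face. One active coordinate merely fixes the
  multiple of \<open>v\<close>, so codimension \<open>k > 0\<close> means \<open>Suc k\<close>
  active coordinates, and codimension 0 is the interior of the cone.\<close>

definition tile_sum_k :: "real ^ 'n::finite \<Rightarrow> nat \<Rightarrow> real" where
  "tile_sum_k v k = (if k = 0 then measure std_gaussian (upper_cone_int {v}) else (\<Sum>S | card S = Suc k. tile v S))"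

definition sep_prob :: "real ^ 'n::finite \<Rightarrow> 'i list \<Rightarrow> real" where
  "sep_prob v is = measure (gauss_fam (set is)) {G \<in> space (gauss_fam (set is)). 0 \<in> upper_cone_int (set (map G is @ [v]))}"

lemma tile_eq: "(\<integral>\<^sup>+z. indicator (negpos S) (res S [v] z) \<partial>std_gaussian) = ennreal (tile v S)" for v :: "real ^ 'n::finite"
proof -
  interpret g: prob_space "std_gaussian :: (real^'n) measure" by (rule prob_space_std_gaussian)
  have m: "{z. res S [v] z \<in> negpos S} \<in> sets borel"
    using measurable_sets_borel[OF res_measurable_const[of S "[v]"] negpos_borel[of S]] by (simp add: vimage_def)
  have "(\<integral>\<^sup>+z. indicator (negpos S) (res S [v] z) \<partial>std_gaussian) = (\<integral>\<^sup>+z. indicator {z. res S [v] z \<in> negpos S} z \<partial>std_gaussian)"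
    by (intro nn_integral_cong) (simp add: indicator_def)
  also have "\<dots> = ennreal (tile v S)" using m by (simp add: tile_def g.emeasure_eq_measure)
  finally show ?thesis .
qed

lemma emeasure_cone_measurable:
  fixes v :: "real ^ 'n::finite"
  shows "(\<lambda>G. emeasure std_gaussian (upper_cone_int (set (map G is @ [v])))) \<in> borel_measurable (gauss_fam (set is))"
proof -
  interpret g: prob_space "std_gaussian :: (real^'n) measure" by (rule prob_space_std_gaussian)
  have mc: "(\<lambda>p. indicator {p \<in> space (gauss_fam (set is) \<Otimes>\<^sub>M std_gaussian). snd p \<in> upper_cone_int (set (map (fst p) is @ [v]))} p :: ennreal)
     \<in> borel_measurable (gauss_fam (set is) \<Otimes>\<^sub>M std_gaussian)"
    by (intro borel_measurable_indicator upper_cone_int_measurable_fam[where I="set is"]) (auto cong: measurable_cong_sets)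
    have "(\<integral>\<^sup>+z. indicator {p \<in> space (gauss_fam (set is) \<Otimes>\<^sub>M std_gaussian). snd p \<in> upper_cone_int (set (map (fst p) is @ [v]))} (G, z) \<partial>std_gaussian)
       = emeasure std_gaussian (upper_cone_int (set (map G is @ [v])))" if G: "G \<in> space (gauss_fam (set is))" for G
    proof -
      have "(\<integral>\<^sup>+z. indicator {p \<in> space (gauss_fam (set is) \<Otimes>\<^sub>M std_gaussian). snd p \<in> upper_cone_int (set (map (fst p) is @ [v]))} (G, z) \<partial>std_gaussian)
         = (\<integral>\<^sup>+z. indicator (upper_cone_int (set (map G is @ [v]))) z \<partial>std_gaussian)"
        by (intro nn_integral_cong) (use G in \<open>auto simp: indicator_def space_pair_measure\<close>)
      then show ?thesis by (simp add: open_upper_cone_int)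
    qed
    then show ?thesis using g.borel_measurable_nn_integral_fst[OF mc] by (subst (asm) measurable_cong) auto
qed

text \<open>The partition of the space for the random list, averaged over the generators: by
  \<open>res_multi\<close> the weight of a tile is the one for \<open>v\<close> alone, and only the
  range of \<open>S\<close> depends on the number of generators.\<close>

lemma cone_prob:
  fixes v :: "real ^ 'n::finite"
  assumes "distinct is" "\<And>i. v $ i \<noteq> 0"
  shows "(\<integral>\<^sup>+G. emeasure std_gaussian (upper_cone_int (set (map G is @ [v]))) \<partial>gauss_fam (set is)) +
    (\<Sum>S | length is + 2 \<le> card S. ennreal (tile v S)) = 1"
proof -
  interpret f: prob_space "gauss_fam (set is) :: ('a \<Rightarrow> real^'n) measure" by (rule prob_space_gauss_fam)
  interpret g: prob_space "std_gaussian :: (real^'n) measure" by (rule prob_space_std_gaussian)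
  have ms: "(\<lambda>p. indicator (negpos S) (res S (map (fst p) is @ [v]) (snd p)) :: ennreal) \<in> borel_measurable (gauss_fam (set is) \<Otimes>\<^sub>M std_gaussian)" for S
  proof -
    have "(\<lambda>p. res S (map (fst p) is @ [v]) (snd p)) \<in> borel_measurable (gauss_fam (set is) \<Otimes>\<^sub>M std_gaussian)"
      by (rule res_measurable_fam[where I="set is"]) (auto cong: measurable_cong_sets)
    then show ?thesis by (rule measurable_compose) simp
  qed
  note mc' = emeasure_cone_measurable[of "is" v]
  have "1 = (\<integral>\<^sup>+G. 1 \<partial>(gauss_fam (set is) :: ('a \<Rightarrow> real^'n) measure))" using f.emeasure_space_1 by simp
  also have "\<dots> = (\<integral>\<^sup>+G. emeasure std_gaussian (upper_cone_int (set (map G is @ [v]))) +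
    (\<Sum>S | length is + 2 \<le> card S. \<integral>\<^sup>+z. indicator (negpos S) (res S (map G is @ [v]) z) \<partial>std_gaussian) \<partial>gauss_fam (set is))"
  proof (rule nn_integral_cong_AE, use AE_generic[OF assms] in eventually_elim)
    fix G assume "generic (map G is @ [v])"
    from tile_sum[OF this]
    show "1 = emeasure std_gaussian (upper_cone_int (set (map G is @ [v]))) +
    (\<Sum>S | length is + 2 \<le> card S. \<integral>\<^sup>+z. indicator (negpos S) (res S (map G is @ [v]) z) \<partial>std_gaussian)"
      by (simp add: Suc_le_eq)
  qed
  also have "\<dots> = (\<integral>\<^sup>+G. emeasure std_gaussian (upper_cone_int (set (map G is @ [v]))) \<partial>gauss_fam (set is)) +
    (\<Sum>S | length is + 2 \<le> card S. \<integral>\<^sup>+G. \<integral>\<^sup>+z. indicator (negpos S) (res S (map G is @ [v]) z) \<partial>std_gaussian \<partial>gauss_fam (set is))"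
    using mc' g.borel_measurable_nn_integral_fst[OF ms]
    by (simp add: nn_integral_add nn_integral_sum)
  also have "(\<Sum>S | length is + 2 \<le> card S. \<integral>\<^sup>+G. \<integral>\<^sup>+z. indicator (negpos S) (res S (map G is @ [v]) z) \<partial>std_gaussian \<partial>gauss_fam (set is))
     = (\<Sum>S | length is + 2 \<le> card S. ennreal (tile v S))"
    by (intro sum.cong refl) (simp add: res_multi[OF assms(1)] tile_eq del: res.simps)
  finally show ?thesis by simp
qed

text \<open>\<open>separation_recursion\<close> integrated over the new generator; the two terms on
  the right have equal means because \<open>g\<close> and \<open>- g\<close> have the same
  law.\<close>

lemma sep_prob_Cons:
  fixes v :: "real ^ 'n::finite"
  assumes "distinct (i # is)" "\<And>i. v $ i \<noteq> 0"
  shows "ennreal (sep_prob v (i # is)) + ennreal (sep_prob v is) =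
     2 * (\<integral>\<^sup>+G. emeasure std_gaussian (upper_cone_int (set (map G is @ [v]))) \<partial>gauss_fam (set is))"
proof -
  interpret f: prob_space "gauss_fam I :: ('a \<Rightarrow> real^'n) measure" for I by (rule prob_space_gauss_fam)
  interpret g: prob_space "std_gaussian :: (real^'n) measure" by (rule prob_space_std_gaussian)
  have m0: "{G \<in> space (gauss_fam I). 0 \<in> upper_cone_int (set (map G is @ [v]))} \<in> sets (gauss_fam I)" if "set is \<subseteq> I" for I :: "'a set" and "is"
    using upper_cone_int_measurable_fam[OF that, of "\<lambda>_. 0" "gauss_fam I" "\<lambda>G. G" v] by simp
  have s: "ennreal (sep_prob v is) = (\<integral>\<^sup>+G. indicator (upper_cone_int (set (map G is @ [v]))) 0 \<partial>gauss_fam (set is))" for "is" :: "'a list"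
  proof -
    have "ennreal (sep_prob v is) = emeasure (gauss_fam (set is)) {G \<in> space (gauss_fam (set is)). 0 \<in> upper_cone_int (set (map G is @ [v]))}"
      by (simp add: sep_prob_def f.emeasure_eq_measure)
    also have "\<dots> = (\<integral>\<^sup>+G. indicator {G \<in> space (gauss_fam (set is)). 0 \<in> upper_cone_int (set (map G is @ [v]))} G \<partial>gauss_fam (set is))"
      using m0[OF order_refl] by simp
    also have "\<dots> = (\<integral>\<^sup>+G. indicator (upper_cone_int (set (map G is @ [v]))) 0 \<partial>gauss_fam (set is))"
      by (intro nn_integral_cong) (simp add: indicator_def)
    finally show ?thesis .
  qed
  have mi: "(\<lambda>G. indicator (upper_cone_int (set (map G is @ [v]))) 0 :: ennreal) \<in> borel_measurable (gauss_fam I)" if "set is \<subseteq> I" for I and "is" :: "'a list"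
  proof -
    have "(\<lambda>G. indicator {G \<in> space (gauss_fam I). 0 \<in> upper_cone_int (set (map G is @ [v]))} G :: ennreal) \<in> borel_measurable (gauss_fam I)"
      using m0[OF that] by simp
    then show ?thesis by (rule measurable_cong[THEN iffD1, rotated]) (simp add: indicator_def)
  qed
  have C[measurable]: "upper_cone_int V \<in> sets borel" for V :: "(real^'n) set" by (simp add: open_upper_cone_int)
  let ?V = "\<lambda>G. set (map G is @ [v])"
  have "ennreal (sep_prob v (i # is)) = (\<integral>\<^sup>+G. \<integral>\<^sup>+g. indicator (upper_cone_int (insert g (?V G))) 0 \<partial>std_gaussian \<partial>gauss_fam (set is))"
  proof -
    have "(\<integral>\<^sup>+G. indicator (upper_cone_int (set (map G (i # is) @ [v]))) 0 \<partial>gauss_fam (insert i (set is))) =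
      (\<integral>\<^sup>+G. \<integral>\<^sup>+g. indicator (upper_cone_int (set (map (G(i := g)) (i # is) @ [v]))) 0 \<partial>std_gaussian \<partial>gauss_fam (set is))"
      using assms(1) by (intro nn_integral_gauss_fam_insert mi) auto
    moreover have "set (map (G(i := g)) (i # is) @ [v]) = insert g (?V G)" for G :: "'a \<Rightarrow> real ^ 'n" and g
      using assms(1) by (simp add: map_upd_notin del: set_map)
    ultimately show ?thesis unfolding s by (simp only: list.set(2))
  qed
  moreover have "ennreal (sep_prob v is) = (\<integral>\<^sup>+G. \<integral>\<^sup>+g. indicator (upper_cone_int (?V G)) 0 \<partial>(std_gaussian :: (real^'n) measure) \<partial>gauss_fam (set is))"
    unfolding s using g.emeasure_space_1 by simp
  moreover have mB: "(\<lambda>G. \<integral>\<^sup>+g. indicator (upper_cone_int (?V G)) 0 \<partial>(std_gaussian :: (real^'n) measure)) \<in> borel_measurable (gauss_fam (set is))"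
    using g.emeasure_space_1 mi[OF order_refl] by simp
  have mA: "(\<lambda>p. indicator (upper_cone_int (insert (snd p) (?V (fst p)))) 0 :: ennreal) \<in> borel_measurable (gauss_fam (set is) \<Otimes>\<^sub>M std_gaussian)"
  proof -
    let ?M = "gauss_fam (set is) \<Otimes>\<^sub>M (std_gaussian :: (real^'n) measure)"
    let ?fs = "snd # map (\<lambda>i p. fst p i) is @ [\<lambda>_. v]"
    have "{p \<in> space ?M. 0 \<in> upper_cone_int ((\<lambda>f. f p) ` set ?fs)} \<in> sets ?M"
    proof (rule upper_cone_int_measurable)
      fix f assume "f \<in> set ?fs"
      then consider "f = snd" | i where "i \<in> set is" "f = (\<lambda>p. fst p i)" | "f = (\<lambda>_. v)" by auto
      then show "f \<in> borel_measurable ?M"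
      proof cases
        case (2 i)
        then show ?thesis using measurable_compose[OF measurable_fst gauss_fam_measurable_comp[of i "set is"]] by simp
      qed (auto cong: measurable_cong_sets)
    qed simp
    moreover have "(\<lambda>f. f p) ` set ?fs = insert (snd p) (?V (fst p))" for p :: "('a \<Rightarrow> real^'n) \<times> (real^'n)" by (auto simp: image_iff)
    ultimately have "{p \<in> space ?M. 0 \<in> upper_cone_int (insert (snd p) (?V (fst p)))} \<in> sets ?M" by simp
    then have "(\<lambda>p. indicator {p \<in> space ?M. 0 \<in> upper_cone_int (insert (snd p) (?V (fst p)))} p :: ennreal) \<in> borel_measurable ?M"
      by simp
    then show ?thesis by (rule measurable_cong[THEN iffD1, rotated]) (simp add: indicator_def)
  qed
  note mA' = g.borel_measurable_nn_integral_fst[OF mA, simplified fst_conv snd_conv]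
  ultimately have "ennreal (sep_prob v (i # is)) + ennreal (sep_prob v is) =
     (\<integral>\<^sup>+G. (\<integral>\<^sup>+g. indicator (upper_cone_int (insert g (?V G))) 0 \<partial>std_gaussian) +
        (\<integral>\<^sup>+g. indicator (upper_cone_int (?V G)) 0 \<partial>(std_gaussian :: (real^'n) measure)) \<partial>gauss_fam (set is))"
    by (simp only: nn_integral_add[OF mA' mB])
  also have "\<dots> = (\<integral>\<^sup>+G. (\<integral>\<^sup>+g. indicator (upper_cone_int (insert g (?V G))) 0 + indicator (upper_cone_int (?V G)) 0 \<partial>std_gaussian) \<partial>gauss_fam (set is))"
  proof (intro nn_integral_cong nn_integral_add[symmetric])
    fix G :: "'a \<Rightarrow> real^'n" assume G: "G \<in> space (gauss_fam (set is))"
    show "(\<lambda>g. indicator (upper_cone_int (insert g (?V G))) 0 :: ennreal) \<in> borel_measurable std_gaussian"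
      using measurable_compose[OF measurable_Pair1'[OF G] mA] by simp
  qed simp
  also have "\<dots> = (\<integral>\<^sup>+G. (\<integral>\<^sup>+g. indicator (upper_cone_int (?V G)) g + indicator (upper_cone_int (?V G)) (- g) \<partial>std_gaussian) \<partial>gauss_fam (set is))"
    by (simp only: separation_recursion)
  also have "\<dots> = (\<integral>\<^sup>+G. 2 * emeasure std_gaussian (upper_cone_int (?V G)) \<partial>gauss_fam (set is))"
  proof (intro nn_integral_cong)
    fix G :: "'a \<Rightarrow> real ^ 'n"
    have "(\<integral>\<^sup>+g. indicator (upper_cone_int (?V G)) g + indicator (upper_cone_int (?V G)) (- g) \<partial>std_gaussian) =
      (\<integral>\<^sup>+g. indicator (upper_cone_int (?V G)) g \<partial>std_gaussian) + (\<integral>\<^sup>+g. indicator (upper_cone_int (?V G)) (- g) \<partial>std_gaussian)"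
      by (rule nn_integral_add) auto
    also have "(\<integral>\<^sup>+g. indicator (upper_cone_int (?V G)) (- g) \<partial>std_gaussian) = (\<integral>\<^sup>+g. indicator (upper_cone_int (?V G)) g \<partial>(std_gaussian :: (real^'n) measure))"
      by (rule nn_integral_std_gaussian_uminus) simp
    finally show "(\<integral>\<^sup>+g. indicator (upper_cone_int (?V G)) g + indicator (upper_cone_int (?V G)) (- g) \<partial>std_gaussian) = 2 * emeasure std_gaussian (upper_cone_int (?V G))"
      by (simp add: mult_2)
  qed
  also have "\<dots> = 2 * (\<integral>\<^sup>+G. emeasure std_gaussian (upper_cone_int (?V G)) \<partial>gauss_fam (set is))"
    by (rule nn_integral_cmult[OF emeasure_cone_measurable])
  finally show ?thesis .
qed

lemma tile_nonneg: "0 \<le> tile v S" by (simp add: tile_def)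

lemma upper_cone_int_single_0:
  assumes "v $ i > 0" "v $ j < (0::real)"
  shows "0 \<notin> upper_cone_int {v :: real ^ 'n::finite}"
proof
  assume "0 \<in> upper_cone_int {v}"
  then obtain t where "\<And>i. t * v $ i < 0" by (auto simp: upper_cone_int_def span_singleton)
  from this[of i] this[of j] assms show False by (auto simp: mult_less_0_iff)
qed

text \<open>The partitions for \<open>is\<close> and for the empty list are compared. Tiles with at
  least \<open>length is + 2\<close> coordinates have the same weight in both, so the larger cone
  has absorbed exactly the smaller tiles.\<close>

lemma cone_prob_real:
  fixes v :: "real ^ 'n::finite"
  assumes "distinct is" "\<And>i. v $ i \<noteq> 0"
  shows "(\<integral>\<^sup>+G. emeasure std_gaussian (upper_cone_int (set (map G is @ [v]))) \<partial>gauss_fam (set is)) =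
    ennreal (\<Sum>k\<le>length is. tile_sum_k v k)"
proof -
  interpret g: prob_space "std_gaussian :: (real^'n) measure" by (rule prob_space_std_gaussian)
  interpret e: prob_space "gauss_fam {} :: ('a \<Rightarrow> real ^ 'n) measure" by (rule prob_space_gauss_fam)
  have total: "tile_sum_k v 0 + (\<Sum>S | 2 \<le> card S. tile v S) = 1"
  proof -
    have "emeasure std_gaussian (upper_cone_int {v}) + (\<Sum>S | 2 \<le> card S. ennreal (tile v S)) = 1"
      using cone_prob[of "[]::'a list" v] assms(2) e.emeasure_space_1 by (simp add: numeral_2_eq_2)
    then have "ennreal (tile_sum_k v 0 + (\<Sum>S | 2 \<le> card S. tile v S)) = ennreal 1"
      by (simp add: tile_sum_k_def g.emeasure_eq_measure sum_ennreal tile_nonneg sum_nonneg ennreal_plus)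
    then show ?thesis by (subst (asm) ennreal_inj) (auto simp: tile_sum_k_def tile_nonneg sum_nonneg)
  qed
  let ?d = "length is"
  have "{S :: 'n set. 2 \<le> card S} = (\<Union>k\<in>{1..?d}. {S. card S = Suc k}) \<union> {S. ?d + 2 \<le> card S}"
  proof (intro set_eqI iffI)
    fix S :: "'n set" assume "S \<in> {S. 2 \<le> card S}"
    then have "card S = Suc (card S - 1)" "1 \<le> card S - 1" by auto
    then show "S \<in> (\<Union>k\<in>{1..?d}. {S. card S = Suc k}) \<union> {S. ?d + 2 \<le> card S}"
      by (cases "card S - 1 \<le> ?d") (auto intro!: bexI[of _ "card S - 1"])
  qed auto
  then have "(\<Sum>S | 2 \<le> card S. tile v S) = (\<Sum>S\<in>(\<Union>k\<in>{1..?d}. {S. card S = Suc k}). tile v S) + (\<Sum>S | ?d + 2 \<le> card S. tile v S)"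
    by (simp only:) (rule sum.union_disjoint; auto)
  also have "(\<Sum>S\<in>(\<Union>k\<in>{1..?d}. {S. card S = Suc k}). tile v S) = (\<Sum>k\<in>{1..?d}. tile_sum_k v k)"
    by (subst sum.UNION_disjoint) (auto simp: tile_sum_k_def)
  finally have "(\<Sum>S | 2 \<le> card S. tile v S) = (\<Sum>k\<in>{1..?d}. tile_sum_k v k) + (\<Sum>S | ?d + 2 \<le> card S. tile v S)" .
  moreover have "(\<Sum>k\<le>?d. tile_sum_k v k) = tile_sum_k v 0 + (\<Sum>k\<in>{1..?d}. tile_sum_k v k)"
    by (simp add: sum.atMost_shift sum.atLeast1_atMost_eq atLeast0AtMost[symmetric] sum.atLeast_Suc_atMost)
  ultimately have one: "(\<Sum>k\<le>?d. tile_sum_k v k) + (\<Sum>S | ?d + 2 \<le> card S. tile v S) = 1"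
    using total by simp
  have "(\<integral>\<^sup>+G. emeasure std_gaussian (upper_cone_int (set (map G is @ [v]))) \<partial>gauss_fam (set is))
     + ennreal (\<Sum>S | ?d + 2 \<le> card S. tile v S) = 1"
    using cone_prob[OF assms] by (simp add: sum_ennreal tile_nonneg)
  also have "1 = ennreal (\<Sum>k\<le>?d. tile_sum_k v k) + ennreal (\<Sum>S | ?d + 2 \<le> card S. tile v S)"
    unfolding ennreal_1[symmetric] one[symmetric]
    by (rule ennreal_plus) (auto simp: tile_sum_k_def tile_nonneg intro!: sum_nonneg)
  finally show ?thesis by simp
qed

text \<open>This is Crofton's formula for the cone \<open>upper_cone {v}\<close>.\<close>

lemma sep_prob_formula:
  fixes v :: "real ^ 'n::finite"
  assumes "distinct is" and nz: "\<And>i. v $ i \<noteq> 0" and pos: "v $ i > 0" and neg: "v $ j < 0"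
  shows "sep_prob v is = 2 * (\<Sum>k | k < length is \<and> odd (length is - k). tile_sum_k v k)"
  using assms(1)
proof (induction "is")
  case Nil
  show ?case using upper_cone_int_single_0[OF pos neg] by (simp add: sep_prob_def)
next
  case (Cons i "is")
  let ?d = "length is"
  have "ennreal (sep_prob v (i # is)) + ennreal (sep_prob v is) = 2 * ennreal (\<Sum>k\<le>?d. tile_sum_k v k)"
    unfolding sep_prob_Cons[OF Cons.prems nz] by (subst cone_prob_real) (use Cons.prems nz in auto)
  then have "ennreal (sep_prob v (i # is) + sep_prob v is) = ennreal (2 * (\<Sum>k\<le>?d. tile_sum_k v k))"
    by (simp add: sep_prob_def ennreal_mult')
  then have e: "sep_prob v (i # is) + sep_prob v is = 2 * (\<Sum>k\<le>?d. tile_sum_k v k)"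
    by (subst (asm) ennreal_inj) (auto simp: sep_prob_def tile_sum_k_def tile_nonneg intro!: sum_nonneg)
  \<comment> \<open>A split by parity: the even differences \<open>d - k\<close> become odd when
    \<open>d\<close> is replaced by \<open>Suc d\<close>, and the odd ones are the contribution of
    the shorter list.\<close>
  have "{..?d} = {k. k < ?d \<and> odd (?d - k)} \<union> {k. k < Suc ?d \<and> odd (Suc ?d - k)}"
    by (auto simp: Suc_diff_le less_Suc_eq_le)
  then have "(\<Sum>k\<le>?d. tile_sum_k v k) = (\<Sum>k | k < ?d \<and> odd (?d - k). tile_sum_k v k) +
      (\<Sum>k | k < Suc ?d \<and> odd (Suc ?d - k). tile_sum_k v k)"
    by (simp only:) (rule sum.union_disjoint; auto simp: Suc_diff_le less_Suc_eq_le)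
  then show ?case using e Cons by simp
qed

lemma tile_total:
  fixes v :: "real ^ 'n::finite"
  assumes "\<And>i. v $ i \<noteq> 0"
  shows "(\<Sum>k<CARD('n). tile_sum_k v k) = 1"
proof -
  \<comment> \<open>With \<open>CARD('n) - 1\<close> generators in addition to \<open>v\<close>, a
    tile would need \<open>CARD('n) + 1\<close> coordinates; the cone takes the whole
    probability.\<close>
  have "distinct [0..<CARD('n) - 1]" "length [0..<CARD('n) - 1] = CARD('n) - 1" by simp_all
  then obtain "is" :: "nat list" where d: "distinct is" and l: "length is = CARD('n) - 1" by blast
  have "\<not> m - 1 + 2 \<le> c" if "c \<le> m" "0 < m" for c m :: nat using that by arith
  moreover have "card S \<le> CARD('n)" for S :: "'n set" by (rule card_mono) auto
  ultimately have "\<not> length is + 2 \<le> card S" for S :: "'n set" unfolding l by (meson zero_less_card_finite)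
  then have "{S :: 'n set. length is + 2 \<le> card S} = {}" by blast
  with cone_prob[OF d assms]
  have "(\<integral>\<^sup>+G. emeasure std_gaussian (upper_cone_int (set (map G is @ [v]))) \<partial>gauss_fam (set is)) = 1"
    by (simp only: sum.empty add_0_right)
  with cone_prob_real[OF d assms] have "ennreal (\<Sum>k\<le>CARD('n) - 1. tile_sum_k v k) = ennreal 1" by (simp only: l ennreal_1)
  then have "(\<Sum>k\<le>CARD('n) - 1. tile_sum_k v k) = 1"
    by (subst (asm) ennreal_inj) (auto simp: tile_sum_k_def tile_nonneg intro!: sum_nonneg)
  moreover have "{..m - 1} = {..<m}" if "0 < m" for m :: nat using that by auto
  from this[of "CARD('n)"] have "{..CARD('n) - 1} = {..<CARD('n)}" by (simp only: zero_less_card_finite)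
  ultimately show ?thesis by (simp only:)
qed

section \<open>Faces of the cone and their dimensions\<close>

definition cone_face :: "real ^ 'n::finite \<Rightarrow> 'n set \<Rightarrow> (real ^ 'n) set" where
  "cone_face v S = {x. \<exists>t. (\<forall>i\<in>S. x $ i = t * v $ i) \<and> (\<forall>i. i \<notin> S \<longrightarrow> t * v $ i \<le> x $ i)}"

definition cone_face_space :: "real ^ 'n::finite \<Rightarrow> 'n set \<Rightarrow> (real ^ 'n) set" where
  "cone_face_space v S = {x. \<exists>t. \<forall>i\<in>S. x $ i = t * v $ i}"

text \<open>\<open>- restr S w\<close> is the normal of a supporting hyperplane: being orthogonal to
  \<open>v\<close>, it only sees the slacks of a cone point in \<open>S\<close>, with positive
  weights, and vanishes iff all of them do.\<close>

lemma cone_face_face_of: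
  assumes w: "w \<in> negpos S" and orth: "sip S w v = 0"
  shows "cone_face v S face_of upper_cone {v}"
proof -
  let ?a = "- restr S w"
  have a: "?a \<bullet> x = (\<Sum>i\<in>S. - w $ i * x $ i)" for x
    by (simp add: sip_restr[symmetric] sip_def sum_negf)
  have ge: "?a \<bullet> x \<ge> 0 \<and> (?a \<bullet> x = 0 \<longleftrightarrow> (\<forall>i\<in>S. x $ i = t * v $ i))" if t: "\<forall>i. t * v $ i \<le> x $ i" for x t
  proof -
    have "?a \<bullet> x = ?a \<bullet> (x - t *\<^sub>R v)" using orth by (simp add: inner_diff_right sip_restr[symmetric])
    also have "\<dots> = (\<Sum>i\<in>S. - w $ i * (x $ i - t * v $ i))" by (subst a) simp
    finally have e: "?a \<bullet> x = (\<Sum>i\<in>S. - w $ i * (x $ i - t * v $ i))" .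
    have n: "0 \<le> - w $ i * (x $ i - t * v $ i)" if "i \<in> S" for i
      using w that t by (intro mult_nonneg_nonneg) (auto simp: negpos_def intro: less_imp_le)
    have "?a \<bullet> x = 0 \<longleftrightarrow> (\<forall>i\<in>S. - w $ i * (x $ i - t * v $ i) = 0)"
      unfolding e by (rule sum_nonneg_eq_0_iff) (use n in auto)
    also have "\<dots> \<longleftrightarrow> (\<forall>i\<in>S. x $ i = t * v $ i)" using w by (force simp: negpos_def)
    finally have z: "?a \<bullet> x = 0 \<longleftrightarrow> (\<forall>i\<in>S. x $ i = t * v $ i)" .
    have "0 \<le> ?a \<bullet> x" unfolding e by (rule sum_nonneg) (rule n)
    with z show ?thesis by blast
  qed
  have u: "upper_cone {v} = {x. \<exists>t. \<forall>i. t * v $ i \<le> x $ i}"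
    by (auto simp: upper_cone_def span_singleton)
  have "upper_cone {v} \<inter> {x. ?a \<bullet> x = 0} face_of upper_cone {v}"
    by (rule face_of_Int_supporting_hyperplane_ge[OF convex_upper_cone]) (use ge u in auto)
  also have "upper_cone {v} \<inter> {x. ?a \<bullet> x = 0} = cone_face v S"
  proof (intro set_eqI iffI)
    fix x assume "x \<in> upper_cone {v} \<inter> {x. ?a \<bullet> x = 0}"
    then obtain t where t: "\<forall>i. t * v $ i \<le> x $ i" "?a \<bullet> x = 0" by (auto simp: u)
    with ge[OF t(1)] show "x \<in> cone_face v S" by (auto simp: cone_face_def intro!: exI[of _ t])
  next
    fix x assume "x \<in> cone_face v S"
    then obtain t where t: "\<forall>i\<in>S. x $ i = t * v $ i" "\<forall>i. i \<notin> S \<longrightarrow> t * v $ i \<le> x $ i" by (auto simp: cone_face_def)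
    have t': "\<forall>i. t * v $ i \<le> x $ i"
    proof
      fix i show "t * v $ i \<le> x $ i" using t by (cases "i \<in> S") auto
    qed
    with ge[OF t'] t(1) show "x \<in> upper_cone {v} \<inter> {x. ?a \<bullet> x = 0}" by (auto simp: u)
  qed
  finally show ?thesis .
qed

lemma subspace_cone_face_space: "subspace (cone_face_space v S)"
  unfolding subspace_def cone_face_space_def
proof (intro conjI ballI allI; (elim CollectE exE)?; intro CollectI)
  show "\<exists>t. \<forall>i\<in>S. 0 $ i = t * v $ i" by (intro exI[of _ 0]) simp
  fix x y t s assume "\<forall>i\<in>S. x $ i = t * v $ i" "\<forall>i\<in>S. y $ i = s * v $ i"
  then show "\<exists>t. \<forall>i\<in>S. (x + y) $ i = t * v $ i" by (intro exI[of _ "t + s"]) (simp add: algebra_simps)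
next
  fix c x t assume "\<forall>i\<in>S. x $ i = t * v $ i"
  then show "\<exists>t. \<forall>i\<in>S. (c *\<^sub>R x) $ i = t * v $ i" by (intro exI[of _ "c * t"]) simp
qed

text \<open>The space is the sum of the coordinate subspace off \<open>S\<close> and the line of
  \<open>v\<close>. The sum is direct because \<open>v\<close> has a nonzero entry in
  \<open>S\<close>; the line accounts for the additional 1.\<close>

lemma dim_cone_face_space:
  fixes v :: "real ^ 'n::finite"
  assumes nz: "\<And>i. v $ i \<noteq> 0" and "S \<noteq> {}"
  shows "dim (cone_face_space v S) + card S = CARD('n) + 1"
proof -
  let ?A = "{x::real^'n. \<forall>i. i \<notin> - S \<longrightarrow> x $ i = 0}"
  have sA: "subspace ?A" by (auto simp: subspace_def)
  have dA: "dim ?A = card (- S)" by (rule dim_coordinate_subspace)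
  have "{x + y |x y. x \<in> ?A \<and> y \<in> span {v}} = cone_face_space v S"
  proof (intro set_eqI iffI)
    fix z assume "z \<in> {x + y |x y. x \<in> ?A \<and> y \<in> span {v}}"
    then show "z \<in> cone_face_space v S" by (auto simp: cone_face_space_def span_singleton)
  next
    fix z assume "z \<in> cone_face_space v S"
    then obtain t where t: "\<forall>i\<in>S. z $ i = t * v $ i" by (auto simp: cone_face_space_def)
    have "z = (z - t *\<^sub>R v) + t *\<^sub>R v" by simp
    moreover have "z - t *\<^sub>R v \<in> ?A" using t by simp
    moreover have "t *\<^sub>R v \<in> span {v}" by (simp add: span_base span_scale)
    ultimately show "z \<in> {x + y |x y. x \<in> ?A \<and> y \<in> span {v}}" by blast
  qed
  moreover have "?A \<inter> span {v} = {0}"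
  proof (intro equalityI subsetI)
    obtain j where j: "j \<in> S" using assms(2) by blast
    fix x assume x: "x \<in> ?A \<inter> span {v}"
    then obtain t where t: "x = t *\<^sub>R v" by (auto simp: span_singleton)
    have "x $ j = 0" using x j by simp
    then have "t = 0" using nz[of j] t by simp
    then show "x \<in> {0}" using t by simp
  next
    fix x :: "real ^ 'n" assume "x \<in> {0}"
    then show "x \<in> ?A \<inter> span {v}" by (simp add: span_0)
  qed
  moreover have "dim (span {v}) = 1"
  proof -
    have "v \<noteq> 0" using nz[of undefined] by auto
    then show ?thesis unfolding dim_span by (simp add: dim_singleton)
  qed
  moreover have "card (- S) + card S = CARD('n)"
  proof -
    have "card (- S) = CARD('n) - card S" by (simp add: Compl_eq_Diff_UNIV card_Diff_subset)
    moreover have "card S \<le> CARD('n)" by (rule card_mono) auto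
    ultimately show ?thesis by simp
  qed
  ultimately show ?thesis using dim_sums_Int[OF sA subspace_span[of "{v}"]] unfolding dA by simp
qed

lemma cone_face_interior:
  fixes v :: "real ^ 'n::finite"
  assumes nz: "\<And>i. v $ i \<noteq> 0" and "S \<noteq> {}"
    and x: "\<And>i. i \<in> S \<Longrightarrow> x $ i = t * v $ i" "\<And>i. i \<notin> S \<Longrightarrow> t * v $ i < x $ i"
  shows "x \<in> rel_interior (cone_face v S)" "aff_dim (cone_face v S) = int (CARD('n) + 1 - card S)"
proof -
  let ?L = "cone_face_space v S"
  obtain j where j: "j \<in> S" using assms(2) by blast
  \<comment> \<open>The multiple \<open>t\<close> is recovered from the single coordinate
    \<open>j\<close>, which turns the inequalities off \<open>S\<close> into an open condition on
    \<open>y\<close> itself.\<close>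
  define T where "T = (\<Inter>i\<in>- S. {y. (y $ j / v $ j) * v $ i < y $ i})"
  have oT: "open T" unfolding T_def
    by (intro open_INT ballI finite open_Collect_less continuous_intros) (auto simp: nz)
  have TL: "T \<inter> ?L \<subseteq> cone_face v S"
  proof
    fix y assume y: "y \<in> T \<inter> ?L"
    then obtain s where s: "\<forall>i\<in>S. y $ i = s * v $ i" by (auto simp: cone_face_space_def)
    then have "y $ j / v $ j = s" using j nz[of j] by simp
    then have "\<forall>i. i \<notin> S \<longrightarrow> s * v $ i \<le> y $ i" using y by (auto simp: T_def intro: less_imp_le)
    then show "y \<in> cone_face v S" using s by (auto simp: cone_face_def)
  qed
  have FL: "cone_face v S \<subseteq> ?L" by (auto simp: cone_face_def cone_face_space_def)
  have aff: "affine ?L" using subspace_cone_face_space by (rule subspace_imp_affine)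
  have "affine hull (cone_face v S) \<subseteq> ?L" using FL aff by (rule hull_minimal)
  have "x $ j / v $ j = t" using x(1)[OF j] nz[of j] by simp
  then have xT: "x \<in> T" using x(2) by (auto simp: T_def)
  have xL: "x \<in> ?L" using x(1) by (auto simp: cone_face_space_def)
  have xF: "x \<in> cone_face v S" using TL xT xL by blast
  show "x \<in> rel_interior (cone_face v S)" unfolding mem_rel_interior
    using oT xT xF TL \<open>affine hull (cone_face v S) \<subseteq> ?L\<close> by (intro exI[of _ T]) auto
  have "openin (top_of_set ?L) (?L \<inter> T)" using oT by (rule openin_open_Int)
  then have "aff_dim (?L \<inter> T) = aff_dim ?L" by (rule aff_dim_openin[OF _ aff]) (use xT xL in auto)
  moreover have "aff_dim (?L \<inter> T) \<le> aff_dim (cone_face v S)" using TL by (intro aff_dim_subset) auto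
  moreover have "aff_dim (cone_face v S) \<le> aff_dim ?L" using FL by (rule aff_dim_subset)
  ultimately have "aff_dim (cone_face v S) = aff_dim ?L" by simp
  also have "\<dots> = int (dim ?L)" by (rule aff_dim_subspace[OF subspace_cone_face_space])
  also have "dim ?L = CARD('n) + 1 - card S" using dim_cone_face_space[OF assms(1,2)] by simp
  finally show "aff_dim (cone_face v S) = int (CARD('n) + 1 - card S)" .
qed

lemma cone_whole_face:
  assumes "z \<in> upper_cone_int {v :: real ^ 'n::finite}"
  shows "upper_cone {v} face_of upper_cone {v}" "aff_dim (upper_cone {v}) = int CARD('n)" "z \<in> rel_interior (upper_cone {v})"
    "closest_point (upper_cone {v}) z = z"
proof -
  show "upper_cone {v} face_of upper_cone {v}" by (rule face_of_refl[OF convex_upper_cone])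
  have i: "upper_cone_int {v} \<subseteq> interior (upper_cone {v})"
    by (rule interior_maximal[OF upper_cone_int_subset open_upper_cone_int])
  then show "z \<in> rel_interior (upper_cone {v})" using assms interior_subset_rel_interior by blast
  have "aff_dim (upper_cone_int {v}) = int DIM(real ^ 'n)"
    using assms by (intro aff_dim_open open_upper_cone_int) auto
  moreover have "aff_dim (upper_cone_int {v}) \<le> aff_dim (upper_cone {v})"
    by (rule aff_dim_subset[OF upper_cone_int_subset])
  ultimately show "aff_dim (upper_cone {v}) = int CARD('n)"
    using aff_dim_le_DIM[of "upper_cone {v}"] by simp
  show "closest_point (upper_cone {v}) z = z"
    using assms upper_cone_int_subset by (intro closest_point_self) blast
qed

lemma cone_tile_face:
  fixes v :: "real ^ 'n::finite"
  assumes nz: "\<And>i. v $ i \<noteq> 0" and "S \<noteq> {}" and z: "res S [v] z \<in> negpos S"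
  shows "cone_face v S face_of upper_cone {v}" "aff_dim (cone_face v S) = int (CARD('n) + 1 - card S)"
    "closest_point (upper_cone {v}) z \<in> rel_interior (cone_face v S)"
proof -
  let ?w = "res S [v] z"
  have orth: "sip S ?w v = 0" by (rule res_orth) (simp add: span_base)
  show "cone_face v S face_of upper_cone {v}" by (rule cone_face_face_of[OF z orth])
  have c: "closest_point (upper_cone {v}) z = z - restr S ?w" using res_negpos_closest[OF z] by simp
  have "z - ?w \<in> span {v}" using res_diff_span[of z S "[v]"] by simp
  then obtain t where t: "z - ?w = t *\<^sub>R v" by (auto simp: span_singleton)
  then have zi: "z $ i = ?w $ i + t * v $ i" for i
  proof -
    have "(z - ?w) $ i = (t *\<^sub>R v) $ i" by (simp only: t)
    then show ?thesis by (simp del: res.simps)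
  qed
  have 1: "(z - restr S ?w) $ i = t * v $ i" if "i \<in> S" for i using that zi[of i] by simp
  have 2: "t * v $ i < (z - restr S ?w) $ i" if "i \<notin> S" for i using that zi[of i] z by (simp add: negpos_def)
  show "aff_dim (cone_face v S) = int (CARD('n) + 1 - card S)"
    "closest_point (upper_cone {v}) z \<in> rel_interior (cone_face v S)"
    unfolding c using cone_face_interior[OF nz assms(2) 1 2] by auto
qed

section \<open>Intrinsic volumes\<close>

text \<open>A polyhedron has finitely many faces, the projection is continuous, and a relative
  interior is an open set intersected with a closed affine hull.\<close>

lemma face_projection_measurable:
  fixes P :: "'a::euclidean_space set"
  assumes P: "polyhedron P" "P \<noteq> {}"
  shows "{z. \<exists>F. F face_of P \<and> aff_dim F = m \<and> closest_point P z \<in> rel_interior F} \<in> sets borel"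
proof -
  have [measurable]: "closest_point P \<in> borel_measurable borel"
    by (intro borel_measurable_continuous_onI continuous_on_closest_point polyhedron_imp_convex polyhedron_imp_closed P)
  have ri: "rel_interior F \<in> sets borel" for F :: "'a set"
  proof -
    obtain T where T: "open T" "rel_interior F = affine hull F \<inter> T"
      using openin_rel_interior[of F] unfolding openin_open by blast
    show ?thesis unfolding T(2) using T(1) by (intro sets.Int borel_closed borel_open closed_affine_hull)
  qed
  have "{z. \<exists>F. F face_of P \<and> aff_dim F = m \<and> closest_point P z \<in> rel_interior F} =
    (\<Union>F\<in>{F. F face_of P} \<inter> {F. aff_dim F = m}. closest_point P -` rel_interior F)" by blast
  also have "\<dots> \<in> sets borel"
    using finite_polyhedron_faces[OF P(1)] by (intro sets.finite_UN finite_Int measurable_sets_borel[OF _ ri]) auto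
  finally show ?thesis .
qed

lemma intrinsic_volume_upper_cone:
  fixes v :: "real ^ 'n::finite"
  assumes nz: "\<And>i. v $ i \<noteq> 0" and k: "k < CARD('n)"
  shows "intrinsic_volume (CARD('n) - k) (upper_cone {v}) = tile_sum_k v k"
proof -
  interpret g: prob_space "std_gaussian :: (real^'n) measure" by (rule prob_space_std_gaussian)
  let ?P = "upper_cone {v}" and ?n = "CARD('n)"
  let ?Q = "\<lambda>z. \<exists>F. F face_of ?P \<and> aff_dim F = int (?n - k) \<and> closest_point ?P z \<in> rel_interior F"
  let ?R = "\<lambda>z. if k = 0 then indicator (upper_cone_int {v}) z else (\<Sum>S | card S = Suc k. indicator (negpos S) (res S [v] z)) :: ennreal"
  have fin: "finite {v}" by simp
  have gen: "generic [v]" using nz by (simp add: generic_single[simplified])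
  \<comment> \<open>Relative interiors of distinct faces are disjoint, so the face that receives the
    projection is unique and any one such face decides the dimension.\<close>
  have Q: "?Q z \<longleftrightarrow> aff_dim F = int (?n - k)" if "F face_of ?P" "closest_point ?P z \<in> rel_interior F" for F z
  proof
    assume "?Q z"
    then obtain F' where F': "F' face_of ?P" "aff_dim F' = int (?n - k)" "closest_point ?P z \<in> rel_interior F'" by blast
    have "F = F'" using that F' by (intro face_of_eq[OF that(1) F'(1)]) blast
    then show "aff_dim F = int (?n - k)" using F' by simp
  qed (use that in blast)
  have ae: "AE z in std_gaussian. indicator {z. ?Q z} z = ?R z"
    using AE_res_nonzero[of "[v]"] AE_upper_cone_int[OF fin]
  proof eventually_elim
    case (elim z)
    show ?case
    proof (cases "z \<in> ?P")
      case True
      with elim(2) have z: "z \<in> upper_cone_int {v}" by simp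
      note w = cone_whole_face[OF z]
      have "?Q z \<longleftrightarrow> k = 0" using Q[of ?P z] w k by auto
      moreover have "indicator (negpos S) (res S [v] z) = (0::ennreal)" if "card S = Suc k" for S
      proof -
        have "S \<noteq> {}" using that by auto
        then have "res S [v] z \<notin> negpos S" using tile_disjoint_int[of S "[v]" z] True by auto
        then show ?thesis by simp
      qed
      ultimately show ?thesis using z by (simp add: indicator_def del: res.simps)
    next
      case False
      then have z: "z \<notin> upper_cone_int {v}" using upper_cone_int_subset[of "{v}"] by blast
      have "\<exists>S. length [v] < card S \<and> res S [v] z \<in> negpos S"
      proof (rule tile_cover[OF gen])
        show "res S [v] z $ i \<noteq> 0" if "i \<notin> S" for S i using elim(1) that by (simp del: res.simps)
        show "z \<notin> upper_cone (set [v])" using False by simp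
        fix S assume "length [v] < card S" "res S [v] z \<in> negpos S"
        then show ?thesis by blast
      qed
      then obtain S where S: "1 < card S" "res S [v] z \<in> negpos S" by auto
      have Sne: "S \<noteq> {}" using S(1) by auto
      have cS: "card S \<le> ?n" by (rule card_mono) auto
      note f = cone_tile_face[OF nz Sne S(2)]
      have "?Q z \<longleftrightarrow> ?n + 1 - card S = ?n - k" using Q[OF f(1,3)] f(2) by simp
      \<comment> \<open>The bounds \<open>card S \<le> CARD('n)\<close> and
        \<open>k < CARD('n)\<close> make the truncated subtractions exact.\<close>
      also have "\<dots> \<longleftrightarrow> card S = Suc k" using S(1) cS k by auto
      finally have Q': "?Q z \<longleftrightarrow> card S = Suc k" .
      have "(\<Sum>S\<in>{S. card S = Suc k}. indicator (negpos S) (res S [v] z)) =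
        (\<Sum>S'\<in>{S. card S = Suc k}. if S' = S then 1 else (0::ennreal))"
      proof (intro sum.cong refl)
        fix S' :: "'n set"
        have "res S' [v] z \<in> negpos S' \<longleftrightarrow> S' = S" using S(2) tile_disjoint[OF _ S(2), of S'] by blast
        then show "indicator (negpos S') (res S' [v] z) = (if S' = S then 1 else (0::ennreal))" by (simp add: indicator_def)
      qed
      also have "\<dots> = (if card S = Suc k then 1 else 0)" by (simp add: sum.delta)
      finally show ?thesis using z Q' S(1) by (simp add: indicator_def del: res.simps)
    qed
  qed
  have Qm: "{z. ?Q z} \<in> sets borel"
    by (rule face_projection_measurable[OF polyhedron_upper_cone upper_cone_nonempty]) simp
  have "ennreal (intrinsic_volume (?n - k) ?P) = emeasure std_gaussian {z. ?Q z}"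
    by (simp add: intrinsic_volume_def g.emeasure_eq_measure)
  also have "\<dots> = (\<integral>\<^sup>+z. indicator {z. ?Q z} z \<partial>std_gaussian)" using Qm by simp
  also have "\<dots> = (\<integral>\<^sup>+z. ?R z \<partial>std_gaussian)" by (rule nn_integral_cong_AE[OF ae])
  also have "\<dots> = ennreal (tile_sum_k v k)"
  proof (cases "k = 0")
    case True
    then show ?thesis by (simp add: tile_sum_k_def g.emeasure_eq_measure open_upper_cone_int)
  next
    case False
    have "(\<integral>\<^sup>+z. (\<Sum>S | card S = Suc k. indicator (negpos S) (res S [v] z)) \<partial>std_gaussian) =
      (\<Sum>S | card S = Suc k. \<integral>\<^sup>+z. indicator (negpos S) (res S [v] z) \<partial>std_gaussian)"
      by (rule nn_integral_sum) (simp del: res.simps)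
    also have "\<dots> = (\<Sum>S | card S = Suc k. ennreal (tile v S))" by (simp only: tile_eq)
    also have "\<dots> = ennreal (tile_sum_k v k)" using False by (simp add: tile_sum_k_def sum_ennreal tile_nonneg)
    finally show ?thesis using False by simp
  qed
  finally show ?thesis
    by (subst (asm) ennreal_inj) (auto simp: intrinsic_volume_def tile_sum_k_def tile_nonneg intro!: sum_nonneg)
qed

lemma intrinsic_volume_above:
  assumes "DIM('a) < k"
  shows "intrinsic_volume k (C :: 'a::euclidean_space set) = 0"
proof -
  have "\<not> aff_dim F = int k" for F :: "'a set" using aff_dim_le_DIM[of F] assms by linarith
  then show ?thesis by (simp add: intrinsic_volume_def)
qed

text \<open>Translating a point of the cone along \<open>v\<close> in either direction stays in the
  cone, so each point is a proper midpoint and there is no vertex.\<close>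

lemma intrinsic_volume_0_upper_cone:
  assumes "v \<noteq> (0 :: real ^ 'n::finite)"
  shows "intrinsic_volume 0 (upper_cone {v}) = 0"
proof -
  have "\<not> (F face_of upper_cone {v} \<and> aff_dim F = 0)" for F
  proof
    assume F: "F face_of upper_cone {v} \<and> aff_dim F = 0"
    then obtain a where a: "F = {a}" using aff_dim_eq_0 by blast
    then have e: "a extreme_point_of upper_cone {v}" using F by (simp add: face_of_singleton)
    then obtain t where t: "\<And>i. t * v $ i \<le> a $ i" by (auto simp: extreme_point_of_def upper_cone_def span_singleton)
    have "a + v \<in> upper_cone {v}" "a - v \<in> upper_cone {v}"
      using t by (auto simp: upper_cone_def span_singleton algebra_simps intro: exI[of _ "t + 1"] exI[of _ "t - 1"])
    moreover have "a = midpoint (a + v) (a - v)" by (simp add: midpoint_def scaleR_2[symmetric])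
    then have "a \<in> open_segment (a + v) (a - v)" using assms
      by (metis add_diff_cancel add_left_cancel add_uminus_conv_diff eq_neg_iff_add_eq_0 midpoint_in_open_segment scaleR_2 scaleR_eq_0_iff zero_neq_numeral)
    ultimately show False using e by (auto simp: extreme_point_of_def)
  qed
  then have "{z \<in> space std_gaussian. \<exists>F. F face_of upper_cone {v} \<and> aff_dim F = int 0 \<and> closest_point (upper_cone {v}) z \<in> rel_interior F} = {}" by auto
  then show ?thesis unfolding intrinsic_volume_def by (simp only: measure_empty)
qed

lemma P_eq_upper_cone: "span {v} + {z. \<forall>i. 0 \<le> z $ i} = upper_cone {v :: real ^ 'n::finite}"
proof (intro set_eqI iffI)
  fix x assume "x \<in> span {v} + {z. \<forall>i. 0 \<le> z $ i}"
  then obtain u b where "x = u + b" "u \<in> span {v}" "\<forall>i. 0 \<le> b $ i" by (auto simp: set_plus_def)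
  then show "x \<in> upper_cone {v}" by (auto simp: upper_cone_def intro!: bexI[of _ u])
next
  fix x assume "x \<in> upper_cone {v}"
  then obtain u where u: "u \<in> span {v}" "\<forall>i. u $ i \<le> x $ i" by (auto simp: upper_cone_def)
  then have "u + (x - u) \<in> span {v} + {z. \<forall>i. 0 \<le> z $ i}" by (intro set_plus_intro) auto
  then show "x \<in> span {v} + {z. \<forall>i. 0 \<le> z $ i}" by simp
qed

section \<open>The Gaussian distribution function on the imaginary axis\<close>

lemma complex_Phi_primitive:
  obtains F :: "complex \<Rightarrow> complex" where "\<And>z. (F has_field_derivative exp (- (z\<^sup>2 / 2))) (at z)"
    "\<And>z. complex_Phi z = 1 / 2 + 1 / of_real (sqrt (2 * pi)) * (F z - F 0)"
proof -
  have "(\<lambda>z::complex. exp (- (z\<^sup>2 / 2))) holomorphic_on UNIV" by (intro holomorphic_intros) auto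
  from holomorphic_convex_primitive'[OF convex_UNIV open_UNIV this]
  obtain F :: "complex \<Rightarrow> complex" where F: "\<And>z. (F has_field_derivative exp (- (z\<^sup>2 / 2))) (at z)" by auto
  have "complex_Phi z = 1 / 2 + 1 / of_real (sqrt (2 * pi)) * (F z - F 0)" for z
  proof -
    have "((\<lambda>z. exp (- (z\<^sup>2 / 2))) has_contour_integral (F (pathfinish (linepath 0 z)) - F (pathstart (linepath 0 z)))) (linepath 0 z)"
      by (rule contour_integral_primitive[where S=UNIV]) (rule has_field_derivative_at_within[OF F], rule valid_path_linepath, simp)
    then show ?thesis by (simp add: complex_Phi_def contour_integral_unique)
  qed
  with F show thesis by (rule that)
qed

lemma norm_gauss_exp: "norm (exp (- ((of_real t + z)\<^sup>2 / 2))) = exp ((Im z)\<^sup>2 / 2) * sqrt (2 * pi) * normal_density (- Re z) 1 t"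
proof -
  have "Re (- ((of_real t + z)\<^sup>2 / 2)) = (Im z)\<^sup>2 / 2 + - ((t + Re z)\<^sup>2 / 2)"
    by (simp add: power2_eq_square field_simps)
  then have "norm (exp (- ((of_real t + z)\<^sup>2 / 2))) = exp ((Im z)\<^sup>2 / 2 + - ((t + Re z)\<^sup>2 / 2))"
    by (simp only: norm_exp_eq_Re)
  then show ?thesis by (simp only: exp_add) (simp add: normal_density_def)
qed

lemma gauss_exp_integrable:
  "integrable lborel (\<lambda>t. exp (- ((of_real t + z)\<^sup>2 / 2)) :: complex)"
proof -
  have "integrable lborel (\<lambda>t. exp ((Im z)\<^sup>2 / 2) * sqrt (2 * pi) * normal_density (- Re z) 1 t)"
    by (intro integrable_mult_right integrable_normal_density) simp
  then show ?thesis
  proof (rule Bochner_Integration.integrable_bound)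
    show "AE t in lborel. norm (exp (- ((of_real t + z)\<^sup>2 / 2)) :: complex) \<le> norm (exp ((Im z)\<^sup>2 / 2) * sqrt (2 * pi) * normal_density (- Re z) 1 t)"
      unfolding norm_gauss_exp by simp
    have "(\<lambda>t. exp (- ((of_real t + z)\<^sup>2 / 2)) :: complex) \<in> borel_measurable borel"
      by (intro borel_measurable_continuous_onI continuous_intros) auto
    then show "(\<lambda>t. exp (- ((of_real t + z)\<^sup>2 / 2)) :: complex) \<in> borel_measurable lborel" by simp
  qed
qed

lemma integral_Icc_tendsto:
  fixes f :: "real \<Rightarrow> complex"
  assumes f: "integrable lborel f"
  shows "(\<lambda>n. \<integral>t. indicator {- real n..0} t *\<^sub>R f t \<partial>lborel) \<longlonglongrightarrow> (\<integral>t. indicator {..0} t *\<^sub>R f t \<partial>lborel)"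
proof (rule integral_dominated_convergence[where w="\<lambda>t. norm (f t)"])
  show "AE t in lborel. (\<lambda>n. indicator {- real n..0} t *\<^sub>R f t) \<longlonglongrightarrow> indicator {..0} t *\<^sub>R f t"
  proof (rule AE_I2)
    fix t :: real
    obtain N where N: "- t \<le> real N" using real_arch_simple by blast
    have "eventually (\<lambda>n. indicator {- real n..0} t *\<^sub>R f t = indicator {..0} t *\<^sub>R f t) sequentially"
    proof (rule eventually_sequentiallyI)
      fix n assume "N \<le> n"
      then have "- real n \<le> t" using N by linarith
      then show "indicator {- real n..0} t *\<^sub>R f t = indicator {..0} t *\<^sub>R f t" by (auto split: split_indicator)
    qed
    then show "(\<lambda>n. indicator {- real n..0} t *\<^sub>R f t) \<longlonglongrightarrow> indicator {..0} t *\<^sub>R f t"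
      by (rule tendsto_eventually)
  qed
  show "AE t in lborel. norm (indicator {- real n..0} t *\<^sub>R f t) \<le> norm (f t)" for n
    by (rule AE_I2) (auto split: split_indicator)
qed (use f in auto)

lemma std_gaussian_half: "measure std_gaussian {..0::real} = 1 / 2"
proof -
  interpret g: prob_space "std_gaussian :: real measure" by (rule prob_space_std_gaussian)
  have "AE t in std_gaussian. t \<bullet> (1::real) \<noteq> 0" by (rule AE_std_gaussian_hyperplane) simp
  then have ae: "AE t in std_gaussian. t \<noteq> (0::real)" by simp
  have "(\<integral>\<^sup>+t. indicator {..0::real} (- t) \<partial>std_gaussian) = (\<integral>\<^sup>+t. indicator {..0::real} t \<partial>std_gaussian)"
    by (rule nn_integral_std_gaussian_uminus) simp
  moreover have "(\<integral>\<^sup>+t. indicator {..0::real} (- t) \<partial>std_gaussian) = (\<integral>\<^sup>+t. indicator {0::real..} t \<partial>std_gaussian)"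
    by (intro nn_integral_cong) (auto split: split_indicator)
  ultimately have "emeasure std_gaussian {0::real..} = emeasure std_gaussian {..0::real}" by simp
  then have e: "measure std_gaussian {0::real..} = measure std_gaussian {..0::real}" by (simp add: measure_def)
  have "measure std_gaussian ({0::real..} \<union> {..0}) = measure std_gaussian {0::real..} + measure std_gaussian {..0::real}"
    by (rule measure_Un_AE) (use ae in \<open>auto elim!: eventually_mono simp: g.fmeasurable_eq_sets\<close>)
  moreover have "{0::real..} \<union> {..0} = UNIV" by auto
  ultimately show ?thesis using e g.prob_space by simp
qed

lemma gauss_density_integral:
  "(\<integral>t. indicator {..x} t * std_normal_density t \<partial>lborel) = measure std_gaussian {..x}"
proof -
  interpret g: prob_space "std_gaussian :: real measure" by (rule prob_space_std_gaussian)
  have "(\<integral>t. indicator {..x} t * std_normal_density t \<partial>lborel) = (\<integral>t. indicator {..x} t \<partial>std_gaussian)"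
    unfolding std_gaussian_real by (subst integral_density) (auto simp: mult.commute)
  then show ?thesis by simp
qed

text \<open>With a primitive \<open>F\<close> of the integrand, the segment from 0 to
  \<open>z\<close> and the horizontal ray ending at \<open>z\<close> are compared. It remains to see
  that \<open>F\<close> takes asymptotically equal values at \<open>z - n\<close> and
  \<open>- n\<close>, and that the half line through 0 contributes \<open>1 / 2\<close>.\<close>

lemma complex_Phi_eq:
  "complex_Phi z = 1 / of_real (sqrt (2 * pi)) * (\<integral>t. indicator {..0} t *\<^sub>R exp (- ((of_real t + z)\<^sup>2 / 2)) \<partial>lborel)"
proof (rule complex_Phi_primitive)
  fix F :: "complex \<Rightarrow> complex" assume F: "\<And>z. (F has_field_derivative exp (- (z\<^sup>2 / 2))) (at z)"
    and Phi: "\<And>z. complex_Phi z = 1 / 2 + 1 / of_real (sqrt (2 * pi)) * (F z - F 0)"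
  define I where "I = (\<lambda>z::complex. \<integral>t. indicator {..0::real} t *\<^sub>R exp (- ((of_real t + z)\<^sup>2 / 2)) \<partial>lborel)"
  have lim: "(\<lambda>n. F z - F (z - of_nat n)) \<longlonglongrightarrow> I z" for z
  proof -
    have FTC: "(\<integral>t. indicator {- real n..0} t *\<^sub>R exp (- ((of_real t + z)\<^sup>2 / 2)) \<partial>lborel) = F z - F (z - of_nat n)" for n
    proof -
      have "((\<lambda>t. F (of_real t + z)) has_vector_derivative exp (- ((of_real t + z)\<^sup>2 / 2))) (at t within {- real n..0})" for t
      proof -
        have "((\<lambda>w. F (w + z)) has_field_derivative exp (- ((of_real t + z)\<^sup>2 / 2))) (at (of_real t))"
          using F[of "of_real t + z"] by (simp only: DERIV_shift)
        then show ?thesis by (rule has_vector_derivative_real_field)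
      qed
      then have "(\<integral>t. indicator {- real n..0} t *\<^sub>R exp (- ((of_real t + z)\<^sup>2 / 2)) \<partial>lborel) = F (of_real 0 + z) - F (of_real (- real n) + z)"
        by (intro integral_FTC_atLeastAtMost) (auto intro!: continuous_intros)
      then show ?thesis by (simp add: algebra_simps)
    qed
    have "(\<lambda>n. \<integral>t. indicator {- real n..0} t *\<^sub>R exp (- ((of_real t + z)\<^sup>2 / 2)) \<partial>lborel) \<longlonglongrightarrow> I z"
      unfolding I_def by (rule integral_Icc_tendsto[OF gauss_exp_integrable])
    then show ?thesis by (simp add: FTC)
  qed
  have "(\<lambda>n. F (z - of_nat n) - F (0 - of_nat n)) \<longlonglongrightarrow> 0"
  proof (rule Lim_null_comparison)
    define c where "c = norm z"
    show "eventually (\<lambda>n. norm (F (z - of_nat n) - F (0 - of_nat n)) \<le> exp (- ((real n - c)\<^sup>2) / 2 + c\<^sup>2 / 2) * c) sequentially"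
    proof (rule eventually_sequentiallyI)
      fix n assume n: "nat \<lceil>c\<rceil> \<le> n"
      then have nc: "c \<le> real n" by linarith
      \<comment> \<open>A convex half strip that contains both points. Far to the left and with
        bounded imaginary part, the derivative of \<open>F\<close> is as small as the stated
        exponential.\<close>
      let ?S = "{w. Re w \<le> c - real n} \<inter> {w. \<bar>Im w\<bar> \<le> c}"
      have "convex ?S"
      proof (intro convex_Int)
        show "convex {w. Re w \<le> c - real n}" by (rule convex_halfspace_Re_le)
        have "{w. \<bar>Im w\<bar> \<le> c} = {w. Im w \<le> c} \<inter> {w. Im w \<ge> - c}" by auto
        then show "convex {w. \<bar>Im w\<bar> \<le> c}" by (simp add: convex_Int convex_halfspace_Im_le convex_halfspace_Im_ge)
      qed
      then have "norm (F (z - of_nat n) - F (0 - of_nat n)) \<le> exp (- ((real n - c)\<^sup>2) / 2 + c\<^sup>2 / 2) * norm ((z - of_nat n) - (0 - of_nat n))"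
      proof (rule field_differentiable_bound)
        show "(F has_field_derivative exp (- (w\<^sup>2 / 2))) (at w within ?S)" for w by (rule has_field_derivative_at_within[OF F])
        fix w assume w: "w \<in> ?S"
        have "(real n - c)\<^sup>2 \<le> (- Re w)\<^sup>2" using w nc by (intro power_mono) auto
        moreover have "(Im w)\<^sup>2 \<le> c\<^sup>2" using w by (intro abs_le_square_iff[THEN iffD1]) (auto simp: c_def)
        ultimately have "Re (- (w\<^sup>2 / 2)) \<le> - ((real n - c)\<^sup>2) / 2 + c\<^sup>2 / 2" by (simp add: power2_eq_square field_simps)
        then show "norm (exp (- (w\<^sup>2 / 2))) \<le> exp (- ((real n - c)\<^sup>2) / 2 + c\<^sup>2 / 2)" by (simp only: norm_exp_eq_Re exp_le_cancel_iff)
      next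
        show "z - of_nat n \<in> ?S" using complex_Re_le_cmod[of z] abs_Im_le_cmod[of z] by (simp add: c_def)
        show "0 - of_nat n \<in> ?S" by (simp add: c_def)
      qed
      then show "norm (F (z - of_nat n) - F (0 - of_nat n)) \<le> exp (- ((real n - c)\<^sup>2) / 2 + c\<^sup>2 / 2) * c" by (simp add: c_def)
    qed
    show "(\<lambda>n. exp (- ((real n - c)\<^sup>2) / 2 + c\<^sup>2 / 2) * c) \<longlonglongrightarrow> 0" by real_asymp
  qed
  moreover have "(\<lambda>n. F (z - of_nat n) - F (0 - of_nat n)) \<longlonglongrightarrow> (F z - I z) - (F 0 - I 0)"
  proof -
    have "(\<lambda>n. (F z - (F z - F (z - of_nat n))) - (F 0 - (F 0 - F (0 - of_nat n)))) \<longlonglongrightarrow> (F z - I z) - (F 0 - I 0)"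
      by (intro tendsto_diff tendsto_const lim)
    then show ?thesis by simp
  qed
  ultimately have "(F z - I z) - (F 0 - I 0) = 0" by (rule LIMSEQ_unique[rotated])
  then have d: "F z - F 0 = I z - I 0" by (simp add: algebra_simps)
  have "I 0 = (\<integral>t. complex_of_real (sqrt (2 * pi) * (indicator {..0} t * std_normal_density t)) \<partial>lborel)"
    unfolding I_def
  proof (intro Bochner_Integration.integral_cong refl)
    fix t :: real
    have "exp (- ((complex_of_real t + 0)\<^sup>2 / 2)) = complex_of_real (exp (- (t\<^sup>2 / 2)))"
      by (simp add: exp_of_real[symmetric])
    also have "exp (- (t\<^sup>2 / 2)) = sqrt (2 * pi) * std_normal_density t" by (simp add: std_normal_density_alt)
    finally show "indicator {..0} t *\<^sub>R exp (- ((complex_of_real t + 0)\<^sup>2 / 2)) = complex_of_real (sqrt (2 * pi) * (indicator {..0} t * std_normal_density t))"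
      by (simp add: scaleR_conv_of_real)
  qed
  also have "\<dots> = complex_of_real (sqrt (2 * pi) * (1 / 2))"
    unfolding integral_complex_of_real integral_mult_right_zero gauss_density_integral std_gaussian_half ..
  finally have I0: "I 0 = complex_of_real (sqrt (2 * pi) * (1 / 2))" .
  have nz: "complex_of_real (sqrt (2 * pi)) \<noteq> 0" by simp
  have "complex_Phi z = 1 / of_real (sqrt (2 * pi)) * I z"
    unfolding Phi d I0 using nz by (simp add: field_simps)
  then show ?thesis by (simp add: I_def)
qed

lemma complex_Phi_of_real: "complex_Phi (of_real x) = of_real (measure std_gaussian {..x})"
proof -
  let ?c = "sqrt (2 * pi)"
  have "(\<integral>t. indicator {..0} t *\<^sub>R exp (- ((of_real t + complex_of_real x)\<^sup>2 / 2)) \<partial>lborel) =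
    (\<integral>t. complex_of_real (?c * (indicator {..x} (x + 1 * t) * std_normal_density (x + 1 * t))) \<partial>lborel)"
  proof (intro Bochner_Integration.integral_cong refl)
    fix t :: real
    have "exp (- ((of_real t + complex_of_real x)\<^sup>2 / 2)) = complex_of_real (exp (- ((x + 1 * t)\<^sup>2 / 2)))"
      by (simp add: exp_of_real[symmetric] add.commute)
    also have "exp (- ((x + 1 * t)\<^sup>2 / 2)) = ?c * std_normal_density (x + 1 * t)" by (simp add: std_normal_density_alt)
    finally show "indicator {..0} t *\<^sub>R exp (- ((of_real t + complex_of_real x)\<^sup>2 / 2)) =
       complex_of_real (?c * (indicator {..x} (x + 1 * t) * std_normal_density (x + 1 * t)))"
      by (auto split: split_indicator simp: scaleR_conv_of_real)
  qed
  also have "\<dots> = complex_of_real (?c * (\<integral>t. indicator {..x} (x + 1 * t) * std_normal_density (x + 1 * t) \<partial>lborel))"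
    unfolding integral_complex_of_real integral_mult_right_zero ..
  also have "(\<integral>t. indicator {..x} (x + 1 * t) * std_normal_density (x + 1 * t) \<partial>lborel) = (\<integral>t. indicator {..x} t * std_normal_density t \<partial>lborel)"
    using lborel_integral_real_affine[of 1 "\<lambda>t. indicator {..x} t * std_normal_density t" x] by simp
  finally show ?thesis unfolding complex_Phi_eq gauss_density_integral by simp
qed

section \<open>The half characteristic function and its decay\<close>

definition half_char :: "real \<Rightarrow> complex" where
  "half_char x = (\<integral>t. indicator {..0} t *\<^sub>R exp (- (\<i> * of_real (x * t))) \<partial>std_gaussian)"

text \<open>Completing the square in \<open>complex_Phi_eq\<close>: the exponent
  \<open>- (t + \<i> x)\<^sup>2 / 2\<close> splits into the Gaussian one, the constant
  \<open>x\<^sup>2 / 2\<close> and an oscillating term.\<close>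

lemma complex_Phi_imaginary: "complex_Phi (\<i> * of_real x) = of_real (exp (x\<^sup>2 / 2)) * half_char x"
proof -
  let ?c = "sqrt (2 * pi)"
  have "half_char x = (\<integral>t. std_normal_density t *\<^sub>R (indicator {..0} t *\<^sub>R exp (- (\<i> * of_real (x * t)))) \<partial>lborel)"
    unfolding half_char_def std_gaussian_real by (subst integral_density) auto
  also have "\<dots> = (\<integral>t. of_real (exp (- (x\<^sup>2 / 2)) / ?c) * (indicator {..0} t *\<^sub>R exp (- ((of_real t + \<i> * of_real x)\<^sup>2 / 2))) \<partial>lborel)"
  proof (intro Bochner_Integration.integral_cong refl)
    fix t :: real
    have "exp (- ((of_real t + \<i> * of_real x)\<^sup>2 / 2)) = exp (of_real (- (t\<^sup>2 / 2)) + of_real (x\<^sup>2 / 2) + - (\<i> * of_real (x * t)))"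
      by (rule arg_cong[where f=exp]) (simp add: power2_eq_square field_simps)
    also have "\<dots> = of_real (exp (- (t\<^sup>2 / 2))) * of_real (exp (x\<^sup>2 / 2)) * exp (- (\<i> * of_real (x * t)))"
      by (simp only: exp_add exp_of_real)
    finally have *: "exp (- ((of_real t + \<i> * of_real x)\<^sup>2 / 2)) = of_real (exp (- (t\<^sup>2 / 2))) * of_real (exp (x\<^sup>2 / 2)) * exp (- (\<i> * of_real (x * t)))" .
    have "exp (- (x\<^sup>2 / 2)) * exp (x\<^sup>2 / 2) = 1" by (simp add: exp_minus)
    then have "complex_of_real (exp (- (x\<^sup>2 / 2))) * of_real (exp (x\<^sup>2 / 2)) = 1" by (metis of_real_1 of_real_mult)
    then show "std_normal_density t *\<^sub>R (indicator {..0} t *\<^sub>R exp (- (\<i> * of_real (x * t)))) =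
      of_real (exp (- (x\<^sup>2 / 2)) / ?c) * (indicator {..0} t *\<^sub>R exp (- ((of_real t + \<i> * of_real x)\<^sup>2 / 2)))"
      unfolding * by (simp add: scaleR_conv_of_real std_normal_density_alt mult_ac)
  qed
  also have "\<dots> = of_real (exp (- (x\<^sup>2 / 2)) / ?c) * (\<integral>t. indicator {..0} t *\<^sub>R exp (- ((of_real t + \<i> * of_real x)\<^sup>2 / 2)) \<partial>lborel)"
    by (rule integral_mult_right_zero)
  also have "\<dots> = of_real (exp (- (x\<^sup>2 / 2))) * complex_Phi (\<i> * of_real x)"
    unfolding complex_Phi_eq by simp
  finally have "of_real (exp (x\<^sup>2 / 2)) * half_char x = (of_real (exp (x\<^sup>2 / 2)) * of_real (exp (- (x\<^sup>2 / 2)))) * complex_Phi (\<i> * of_real x)"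
    by simp
  also have "complex_of_real (exp (x\<^sup>2 / 2)) * of_real (exp (- (x\<^sup>2 / 2))) = 1"
    by (simp add: of_real_mult[symmetric] exp_minus del: of_real_mult)
  finally show ?thesis by simp
qed

lemma half_char_norm_le_1: "norm (half_char x) \<le> 1"
proof -
  interpret g: prob_space "std_gaussian :: real measure" by (rule prob_space_std_gaussian)
  have "norm (half_char x) \<le> (\<integral>t. norm (indicator {..0} t *\<^sub>R exp (- (\<i> * of_real (x * t)))) \<partial>std_gaussian)"
    unfolding half_char_def by (rule integral_norm_bound)
  also have "\<dots> \<le> (\<integral>t. 1 \<partial>(std_gaussian :: real measure))"
    by (rule integral_mono_AE) (auto split: split_indicator intro!: g.integrable_const_bound[where B=1])
  finally show ?thesis using g.prob_space by simp
qed

text \<open>Integration by parts. The integrand \<open>H\<close> has derivative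
  \<open>(- t - \<i> x) H\<close>, whose integral over the negative half line is the boundary value
  at 0; so \<open>x\<close> times the function is bounded by the first absolute moment plus the
  density at 0.\<close>

lemma half_char_decay: "\<exists>C. \<forall>x. \<bar>x\<bar> * norm (half_char x) \<le> C"
proof -
  let ?d = std_normal_density
  have i1: "integrable lborel (\<lambda>t. \<bar>t\<bar> * ?d t)"
    using integrable_std_normal_moment_abs[of 1] by (simp add: mult.commute)
  define C where "C = (\<integral>t. \<bar>t\<bar> * ?d t \<partial>lborel) + ?d 0"
  have "\<bar>x\<bar> * norm (half_char x) \<le> C" for x
  proof -
    define c where "c = complex_of_real (1 / sqrt (2 * pi))"
    define H where "H = (\<lambda>w. c * (exp (- (w\<^sup>2 / 2)) * exp (- (\<i> * (of_real x * w)))))"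
    have Ht: "H (of_real t) = of_real (?d t) * exp (- (\<i> * of_real (x * t)))" for t
      by (simp add: H_def c_def std_normal_density_alt exp_of_real[symmetric])
    have nH: "norm (H (of_real t)) = ?d t" for t by (simp add: Ht norm_mult)
    have mH[measurable]: "(\<lambda>t. H (of_real t)) \<in> borel_measurable borel"
      unfolding H_def by (intro borel_measurable_continuous_onI continuous_intros) auto
    have iH: "integrable lborel (\<lambda>t. H (of_real t))"
      by (rule Bochner_Integration.integrable_bound[OF integrable_normal_density[of 1 0]]) (auto simp: nH)
    have itH: "integrable lborel (\<lambda>t. of_real t * H (of_real t))"
      by (rule Bochner_Integration.integrable_bound[OF i1]) (auto simp: nH norm_mult)
    let ?f = "\<lambda>t. (- of_real t - \<i> * of_real x) * H (of_real t)"
    have f_alt: "?f = (\<lambda>t. - (of_real t * H (of_real t)) - \<i> * of_real x * H (of_real t))" by (auto simp: algebra_simps)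
    have if_: "integrable lborel ?f" unfolding f_alt using iH itH by (intro Bochner_Integration.integrable_diff) auto
    have dH: "(H has_field_derivative (- w - \<i> * of_real x) * H w) (at w)" for w
      unfolding H_def by (auto intro!: derivative_eq_intros simp: algebra_simps)
    have FTC: "(\<integral>t. indicator {- real n..0} t *\<^sub>R ?f t \<partial>lborel) = H (of_real 0) - H (of_real (- real n))" for n
    proof (rule integral_FTC_atLeastAtMost)
      show "((\<lambda>t. H (of_real t)) has_vector_derivative ?f t) (at t within {- real n..0})" for t
        by (rule has_vector_derivative_real_field[OF dH])
      show "continuous_on {- real n..0} ?f" unfolding H_def by (intro continuous_intros) auto
    qed simp
    have "(\<lambda>n. H (of_real 0) - H (of_real (- real n))) \<longlonglongrightarrow> (\<integral>t. indicator {..0} t *\<^sub>R ?f t \<partial>lborel)"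
      using integral_Icc_tendsto[OF if_] unfolding FTC .
    moreover have "(\<lambda>n. H (of_real 0) - H (of_real (- real n))) \<longlonglongrightarrow> H (of_real 0) - 0"
    proof -
      have "(\<lambda>n. ?d (- real n)) \<longlonglongrightarrow> 0" unfolding std_normal_density_def by real_asymp
      then have "(\<lambda>n. norm (H (of_real (- real n)))) \<longlonglongrightarrow> 0" by (simp only: nH)
      then have "(\<lambda>n. H (of_real (- real n))) \<longlonglongrightarrow> 0" by (rule tendsto_norm_zero_cancel)
      then show ?thesis by (intro tendsto_diff tendsto_const)
    qed
    ultimately have "(\<integral>t. indicator {..0} t *\<^sub>R ?f t \<partial>lborel) = H (of_real 0) - 0" by (rule LIMSEQ_unique)
    then have "(\<integral>t. indicator {..0} t *\<^sub>R ?f t \<partial>lborel) = H (of_real 0)" by simp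
    moreover have "(\<integral>t. indicator {..0} t *\<^sub>R ?f t \<partial>lborel) =
      - (\<integral>t. indicator {..0} t *\<^sub>R (of_real t * H (of_real t)) \<partial>lborel) - \<i> * of_real x * (\<integral>t. indicator {..0} t *\<^sub>R H (of_real t) \<partial>lborel)"
    proof -
      have a: "integrable lborel (\<lambda>t. indicator {..0} t *\<^sub>R (of_real t * H (of_real t)))"
        by (rule Bochner_Integration.integrable_bound[OF itH]) (auto split: split_indicator)
      have b: "integrable lborel (\<lambda>t. indicator {..0} t *\<^sub>R H (of_real t))"
        by (rule Bochner_Integration.integrable_bound[OF iH]) (auto split: split_indicator)
      have "(\<integral>t. indicator {..0} t *\<^sub>R ?f t \<partial>lborel) =
        (\<integral>t. - (indicator {..0} t *\<^sub>R (of_real t * H (of_real t))) - \<i> * of_real x * (indicator {..0} t *\<^sub>R H (of_real t)) \<partial>lborel)"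
        unfolding f_alt by (intro Bochner_Integration.integral_cong refl) (auto split: split_indicator simp: algebra_simps)
      also have "\<dots> = (\<integral>t. - (indicator {..0} t *\<^sub>R (of_real t * H (of_real t))) \<partial>lborel) -
          (\<integral>t. \<i> * of_real x * (indicator {..0} t *\<^sub>R H (of_real t)) \<partial>lborel)"
        using a b by (intro Bochner_Integration.integral_diff Bochner_Integration.integrable_minus integrable_mult_right)
      also have "(\<integral>t. - (indicator {..0} t *\<^sub>R (of_real t * H (of_real t))) \<partial>lborel) = - (\<integral>t. indicator {..0} t *\<^sub>R (of_real t * H (of_real t)) \<partial>lborel)"
        by (rule Bochner_Integration.integral_minus)
      also have "(\<integral>t. \<i> * of_real x * (indicator {..0} t *\<^sub>R H (of_real t)) \<partial>lborel) = \<i> * of_real x * (\<integral>t. indicator {..0} t *\<^sub>R H (of_real t) \<partial>lborel)"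
        by (rule integral_mult_right_zero)
      finally show ?thesis .
    qed
    moreover have "half_char x = (\<integral>t. indicator {..0} t *\<^sub>R H (of_real t) \<partial>lborel)"
      unfolding half_char_def std_gaussian_real
      by (subst integral_density) (auto simp: Ht scaleR_conv_of_real mult_ac intro!: Bochner_Integration.integral_cong)
    ultimately have "\<i> * of_real x * half_char x = - (\<integral>t. indicator {..0} t *\<^sub>R (of_real t * H (of_real t)) \<partial>lborel) - H (of_real 0)"
      by (simp add: algebra_simps)
    then have "norm (\<i> * of_real x * half_char x) \<le> norm (\<integral>t. indicator {..0} t *\<^sub>R (of_real t * H (of_real t)) \<partial>lborel) + norm (H (of_real 0))"
      using norm_triangle_ineq4[of "- (\<integral>t. indicator {..0} t *\<^sub>R (of_real t * H (of_real t)) \<partial>lborel)" "H (of_real 0)"]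
      unfolding norm_minus_cancel by simp
    also have "norm (\<integral>t. indicator {..0} t *\<^sub>R (of_real t * H (of_real t)) \<partial>lborel) \<le> (\<integral>t. norm (indicator {..0} t *\<^sub>R (of_real t * H (of_real t))) \<partial>lborel)"
      by (rule integral_norm_bound)
    also have "\<dots> \<le> (\<integral>t. \<bar>t\<bar> * ?d t \<partial>lborel)"
    proof (rule integral_mono_AE[OF _ i1])
      show "integrable lborel (\<lambda>t. norm (indicator {..0} t *\<^sub>R (of_real t * H (of_real t))))"
        by (rule Bochner_Integration.integrable_bound[OF itH]) (auto split: split_indicator)
    qed (auto split: split_indicator simp: norm_mult nH)
    finally show ?thesis unfolding nH by (simp add: C_def norm_mult)
  qed
  then show ?thesis by blast
qed

text \<open>The square is bounded because two factors will be estimated by their squares; the bound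
  combines the decay with the trivial estimate near 0 and is integrable.\<close>

lemma half_char_bound: "\<exists>C>0. \<forall>x. (norm (half_char x))\<^sup>2 \<le> C / (1 + x\<^sup>2)"
proof -
  obtain C where C: "\<And>x. \<bar>x\<bar> * norm (half_char x) \<le> C" using half_char_decay by blast
  have "(norm (half_char x))\<^sup>2 \<le> (1 + C\<^sup>2) / (1 + x\<^sup>2)" for x
  proof -
    have "(\<bar>x\<bar> * norm (half_char x))\<^sup>2 \<le> C\<^sup>2" by (rule power_mono[OF C]) simp
    moreover have "(norm (half_char x))\<^sup>2 \<le> 1" using half_char_norm_le_1[of x] by (simp add: power_le_one)
    ultimately have "(norm (half_char x))\<^sup>2 * (1 + x\<^sup>2) \<le> 1 + C\<^sup>2" by (simp add: power_mult_distrib algebra_simps)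
    moreover have "0 < 1 + x\<^sup>2" by (simp add: add_pos_nonneg)
    ultimately show ?thesis by (simp add: pos_le_divide_eq)
  qed
  moreover have "0 < 1 + C\<^sup>2" by (simp add: add_pos_nonneg)
  ultimately show ?thesis by blast
qed

section \<open>Inner and outer angles\<close>

lemma nn_integral_std_gaussian_coords:
  fixes f :: "'n::finite \<Rightarrow> real \<Rightarrow> ennreal"
  assumes [measurable]: "\<And>i. f i \<in> borel_measurable borel"
  shows "(\<integral>\<^sup>+z. (\<Prod>i\<in>UNIV. f i (z $ i)) \<partial>std_gaussian) = (\<Prod>i\<in>UNIV. \<integral>\<^sup>+t. f i t \<partial>std_gaussian)"
proof -
  interpret g: prob_space "std_gaussian :: real measure" by (rule prob_space_std_gaussian)
  interpret product_sigma_finite "\<lambda>_::'n. std_gaussian :: real measure" ..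
  have [measurable]: "vec_lambda \<in> borel_measurable (\<Pi>\<^sub>M i\<in>UNIV. std_gaussian :: real measure)"
    by (subst borel_measurable_euclidean_space) (auto simp: Basis_vec_def inner_axis cong: measurable_cong_sets)
  have [measurable]: "(\<lambda>z::real^'n. f i (z $ i)) \<in> borel_measurable borel" for i
    by (simp add: cart_eq_inner_axis)
  have "(\<integral>\<^sup>+z. (\<Prod>i\<in>UNIV. f i (z $ i)) \<partial>std_gaussian) =
    (\<integral>\<^sup>+z. (\<Prod>i\<in>UNIV. f i (z $ i)) \<partial>distr (\<Pi>\<^sub>M i\<in>UNIV. std_gaussian) borel vec_lambda)"
    by (simp only: std_gaussian_vec)
  also have "\<dots> = (\<integral>\<^sup>+x. (\<Prod>i\<in>UNIV. f i (x i)) \<partial>(\<Pi>\<^sub>M i\<in>UNIV. std_gaussian))"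
    by (subst nn_integral_distr) auto
  also have "\<dots> = (\<Prod>i\<in>UNIV. \<integral>\<^sup>+t. f i t \<partial>std_gaussian)"
    by (rule product_nn_integral_prod) (auto cong: measurable_cong_sets)
  finally show ?thesis .
qed

lemma integral_std_gaussian_coords:
  fixes f :: "'n::finite \<Rightarrow> real \<Rightarrow> complex"
  assumes [measurable]: "\<And>i. f i \<in> borel_measurable borel" and int: "\<And>i. integrable std_gaussian (f i)"
  shows "(\<integral>z. (\<Prod>i\<in>UNIV. f i (z $ i)) \<partial>std_gaussian) = (\<Prod>i\<in>UNIV. \<integral>t. f i t \<partial>std_gaussian)"
proof -
  interpret g: prob_space "std_gaussian :: real measure" by (rule prob_space_std_gaussian)
  interpret product_sigma_finite "\<lambda>_::'n. std_gaussian :: real measure" ..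
  have [measurable]: "vec_lambda \<in> borel_measurable (\<Pi>\<^sub>M i\<in>UNIV. std_gaussian :: real measure)"
    by (subst borel_measurable_euclidean_space) (auto simp: Basis_vec_def inner_axis cong: measurable_cong_sets)
  have [measurable]: "(\<lambda>z::real^'n. f i (z $ i)) \<in> borel_measurable borel" for i
    by (simp add: cart_eq_inner_axis)
  have "(\<integral>z. (\<Prod>i\<in>UNIV. f i (z $ i)) \<partial>std_gaussian) =
    (\<integral>z. (\<Prod>i\<in>UNIV. f i (z $ i)) \<partial>distr (\<Pi>\<^sub>M i\<in>UNIV. std_gaussian) borel vec_lambda)"
    by (simp only: std_gaussian_vec)
  also have "\<dots> = (\<integral>x. (\<Prod>i\<in>UNIV. f i (x i)) \<partial>(\<Pi>\<^sub>M i\<in>UNIV. std_gaussian))"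
    by (subst integral_distr) auto
  also have "\<dots> = (\<Prod>i\<in>UNIV. \<integral>t. f i t \<partial>std_gaussian)"
    by (rule product_integral_prod) (auto intro: int)
  finally show ?thesis .
qed

definition snorm :: "real ^ 'n::finite \<Rightarrow> 'n set \<Rightarrow> real" where
  "snorm v S = sqrt (\<Sum>i\<in>S. (v $ i)\<^sup>2)"

lemma snorm_eq: "snorm v S = norm (restr S v)"
proof -
  have "(norm (restr S v))\<^sup>2 = (\<Sum>i\<in>S. (v $ i)\<^sup>2)"
    unfolding power2_norm_eq_inner sip_restr2[symmetric] by (simp add: sip_def power2_eq_square)
  then show ?thesis unfolding snorm_def by (metis norm_ge_zero real_sqrt_unique)
qed

lemma snorm_pos:
  assumes "\<And>i. v $ i \<noteq> (0::real)" "S \<noteq> {}"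
  shows "0 < snorm v S"
proof -
  obtain j where "j \<in> S" using assms(2) by blast
  then have "restr S v \<noteq> 0" using assms(1)[of j] by (metis restr_nth zero_index)
  then show ?thesis by (simp add: snorm_eq)
qed

text \<open>For \<open>v\<close> without zero entries, the solid angle of the normal cone to
  \<open>cone_face v S\<close>, measured in the span of that normal cone.\<close>

definition inner_angle :: "real ^ 'n::finite \<Rightarrow> 'n set \<Rightarrow> real" where
  "inner_angle v S = measure std_gaussian {z. \<forall>i\<in>S. pr S [v] z $ i < 0}"

text \<open>For \<open>v\<close> without zero entries and nonempty \<open>S\<close>, the solid angle
  of the face \<open>cone_face v S\<close> itself, measured in
  \<open>cone_face_space v S\<close>.\<close>

definition outer_angle :: "real ^ 'n::finite \<Rightarrow> 'n set \<Rightarrow> real" where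
  "outer_angle v S = measure std_gaussian {z. \<forall>i. i \<notin> S \<longrightarrow> 0 < res S [v] z $ i}"

lemma nth_measurable[measurable]: "(\<lambda>z::real^'n::finite. z $ i) \<in> borel_measurable borel"
  by (simp add: cart_eq_inner_axis)

text \<open>The components of \<open>z\<close> in the range of \<open>pr S [v]\<close> and
  orthogonal to it are independent; the former decides the signs of the residual on
  \<open>S\<close>, the latter those off \<open>S\<close>.\<close>

lemma tile_split: "tile v S = inner_angle v S * outer_angle v (S :: 'n::finite set)"
proof -
  interpret g: prob_space "std_gaussian :: (real^'n) measure" by (rule prob_space_std_gaussian)
  let ?A = "{z. \<forall>i\<in>S. pr S [v] z $ i < 0}" and ?B = "{z. \<forall>i. i \<notin> S \<longrightarrow> 0 < res S [v] z $ i}"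
  have [measurable]: "pr S [v] \<in> borel_measurable borel" by (rule pr.meas)
  have A: "?A \<in> sets borel"
  proof -
    have "?A = (\<Inter>i. {z. i \<in> S \<longrightarrow> pr S [v] z $ i < 0})" by auto
    also have "\<dots> \<in> sets borel" by (intro sets.finite_INT) auto
    finally show ?thesis .
  qed
  have B: "?B \<in> sets borel"
  proof -
    have "?B = (\<Inter>i. {z. i \<notin> S \<longrightarrow> 0 < res S [v] z $ i})" by auto
    also have "\<dots> \<in> sets borel" by (intro sets.finite_INT) (auto simp del: res.simps)
    finally show ?thesis .
  qed
  interpret l: Real_Vector_Spaces.linear "res S [v]" by (rule res_linear)
  interpret p: Real_Vector_Spaces.linear "pr S [v]" by (rule pr.linear)
  have "ennreal (tile v S) = (\<integral>\<^sup>+z1. \<integral>\<^sup>+z2. indicator (negpos S) (res S [v] (pr S [v] z1 + (z2 - pr S [v] z2))) \<partial>std_gaussian \<partial>std_gaussian)"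
    unfolding tile_eq[symmetric]
    by (rule pr.std_gaussian_split[of "\<lambda>z. indicator (negpos S) (res S [v] z)" S "[v]"]) (simp del: res.simps)
  also have "\<dots> = (\<integral>\<^sup>+z1. \<integral>\<^sup>+z2. indicator ?A z1 * indicator ?B z2 \<partial>std_gaussian \<partial>std_gaussian)"
  proof (intro nn_integral_cong)
    fix z1 z2
    have e: "res S [v] (pr S [v] z1 + (z2 - pr S [v] z2)) = pr S [v] z1 + (res S [v] z2 - pr S [v] z2)"
      by (simp only: l.add l.diff res_pr)
    have "res S [v] (pr S [v] z1 + (z2 - pr S [v] z2)) $ i = (if i \<in> S then pr S [v] z1 $ i else res S [v] z2 $ i)" for i
      unfolding e by (simp add: pr_def del: res.simps)
    then have "res S [v] (pr S [v] z1 + (z2 - pr S [v] z2)) \<in> negpos S \<longleftrightarrow> z1 \<in> ?A \<and> z2 \<in> ?B"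
      by (auto simp: negpos_def simp del: res.simps)
    then show "indicator (negpos S) (res S [v] (pr S [v] z1 + (z2 - pr S [v] z2))) = (indicator ?A z1 * indicator ?B z2 :: ennreal)"
      by (simp add: indicator_def del: res.simps)
  qed
  also have "\<dots> = ennreal (inner_angle v S * outer_angle v S)"
    using A B by (simp add: nn_integral_cmult nn_integral_multc g.emeasure_eq_measure inner_angle_def outer_angle_def ennreal_mult del: res.simps)
  finally show ?thesis by (subst (asm) ennreal_inj) (auto simp: tile_def inner_angle_def outer_angle_def)
qed

definition gauss_cdf :: "real \<Rightarrow> real" where
  "gauss_cdf x = measure std_gaussian {..x}"

lemma gauss_cdf_upper: "measure std_gaussian {x<..} = gauss_cdf (- x)"
proof -
  have "(\<integral>\<^sup>+t. indicator {..< - x} (- t) \<partial>std_gaussian) = (\<integral>\<^sup>+t. indicator {..< - x} t \<partial>(std_gaussian :: real measure))"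
    by (rule nn_integral_std_gaussian_uminus) simp
  moreover have "(\<integral>\<^sup>+t. indicator {..< - x} (- t) \<partial>(std_gaussian :: real measure)) = (\<integral>\<^sup>+t. indicator {x<..} t \<partial>std_gaussian)"
    by (intro nn_integral_cong) (auto split: split_indicator)
  ultimately have e: "emeasure std_gaussian {x<..} = emeasure std_gaussian {..< - x}" by simp
  also have "\<dots> = emeasure std_gaussian {..- x}"
  proof (rule emeasure_eq_AE)
    have "negligible {- x}" by simp
    from AE_std_gaussian_negligible[OF this]
    show "AE t in std_gaussian. (t \<in> {..< - x}) = (t \<in> {..- x})" by eventually_elim auto
  qed auto
  finally show ?thesis by (simp add: gauss_cdf_def measure_def)
qed

lemma gauss_cdf_measurable[measurable]: "gauss_cdf \<in> borel_measurable borel"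
proof -
  interpret g: prob_space "std_gaussian :: real measure" by (rule prob_space_std_gaussian)
  show ?thesis
    by (rule borel_measurable_mono) (auto simp: mono_def gauss_cdf_def intro!: g.finite_measure_mono)
qed

lemma gauss_cdf_01: "0 \<le> gauss_cdf x" "gauss_cdf x \<le> 1"
proof -
  interpret g: prob_space "std_gaussian :: real measure" by (rule prob_space_std_gaussian)
  show "0 \<le> gauss_cdf x" "gauss_cdf x \<le> 1" by (auto simp: gauss_cdf_def g.prob_le_1)
qed

interpretation restr: orth_proj "restr S" for S :: "'n::finite set"
proof (rule orth_proj.intro)
  show "restr S x \<bullet> y = x \<bullet> restr S y" for x y :: "real ^ 'n"
    by (metis inner_commute sip_commute sip_restr)
qed (simp_all add: restr_linear)

text \<open>The fitted multiple of \<open>v\<close> is \<open>(z \<bullet> u) / snorm v S\<close>, a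
  Gaussian variable independent of the coordinates off \<open>S\<close>. Given it, these coordinates
  are independent and have to exceed fixed thresholds.\<close>

lemma outer_angle_eq:
  fixes v :: "real ^ 'n::finite"
  assumes nz: "\<And>i. v $ i \<noteq> 0" and S: "S \<noteq> {}"
  shows "outer_angle v S = (\<integral>g. (\<Prod>i\<in>- S. gauss_cdf (g * v $ i / snorm v S)) \<partial>std_gaussian)"
proof -
  interpret g: prob_space "std_gaussian :: real measure" by (rule prob_space_std_gaussian)
  interpret gn: prob_space "std_gaussian :: (real^'n) measure" by (rule prob_space_std_gaussian)
  let ?s = "snorm v S"
  define u where "u = (1 / ?s) *\<^sub>R restr S v"
  have s: "0 < ?s" by (rule snorm_pos[OF nz S])
  have u: "norm u = 1" using s by (simp add: u_def snorm_eq)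
  let ?B = "{z. \<forall>i. i \<notin> S \<longrightarrow> 0 < res S [v] z $ i}"
  have Bm: "?B \<in> sets borel"
  proof -
    have "?B = (\<Inter>i. {z. i \<notin> S \<longrightarrow> 0 < res S [v] z $ i})" by auto
    also have "\<dots> \<in> sets borel" by (intro sets.finite_INT) (auto simp del: res.simps)
    finally show ?thesis .
  qed
  have "sip S v v = ?s * ?s"
    unfolding sip_restr2 snorm_eq by (simp add: power2_norm_eq_inner[symmetric] power2_eq_square)
  then have t: "sip S z v / sip S v v = (z \<bullet> u) / ?s" for z
  proof -
    have "sip S z v = z \<bullet> restr S v" unfolding sip_restr by (rule restr.self_adj)
    then show ?thesis unfolding \<open>sip S v v = ?s * ?s\<close> by (simp add: u_def)
  qed
  let ?F = "\<lambda>c. \<Prod>i\<in>- S. gauss_cdf (- (c * v $ i / ?s))"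
  have "ennreal (outer_angle v S) = (\<integral>\<^sup>+z. indicator ?B z \<partial>std_gaussian)"
    using Bm by (simp add: outer_angle_def gn.emeasure_eq_measure)
  also have "\<dots> = (\<integral>\<^sup>+z1. \<integral>\<^sup>+z2. indicator ?B (restr S z1 + (z2 - restr S z2)) \<partial>std_gaussian \<partial>std_gaussian)"
    using Bm by (intro restr.std_gaussian_split) simp
  also have "\<dots> = (\<integral>\<^sup>+z1. ennreal (?F (z1 \<bullet> u)) \<partial>std_gaussian)"
  proof (intro nn_integral_cong)
    fix z1 :: "real ^ 'n"
    have "(\<integral>\<^sup>+z2. indicator ?B (restr S z1 + (z2 - restr S z2)) \<partial>std_gaussian) =
      (\<integral>\<^sup>+z2. (\<Prod>i\<in>UNIV. (if i \<in> S then 1 else indicator {(z1 \<bullet> u) * v $ i / ?s<..} (z2 $ i))) \<partial>std_gaussian)"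
    proof (intro nn_integral_cong)
      fix z2
      let ?z = "restr S z1 + (z2 - restr S z2)"
      have sz: "sip S ?z v = sip S z1 v" by (simp add: sip_linear)
      have "res S [v] ?z = ?z - ((z1 \<bullet> u) / ?s) *\<^sub>R v" by (simp add: sz t)
      then have "res S [v] ?z $ i = z2 $ i - (z1 \<bullet> u) * v $ i / ?s" if "i \<notin> S" for i
        using that by (simp only: vector_minus_component vector_add_component vector_scaleR_component restr_nth) simp
      then have "?z \<in> ?B \<longleftrightarrow> (\<forall>i. i \<notin> S \<longrightarrow> (z1 \<bullet> u) * v $ i / ?s < z2 $ i)" by (simp del: res.simps)
      note iff = this
      show "indicator ?B ?z = (\<Prod>i\<in>UNIV. (if i \<in> S then 1 else indicator {(z1 \<bullet> u) * v $ i / ?s<..} (z2 $ i)) :: ennreal)"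
      proof (cases "?z \<in> ?B")
        case True
        then have "(\<Prod>i\<in>UNIV. (if i \<in> S then 1 else indicator {(z1 \<bullet> u) * v $ i / ?s<..} (z2 $ i)) :: ennreal) = 1"
          unfolding iff by (intro prod.neutral) auto
        then show ?thesis using True by simp
      next
        case False
        then obtain i where "i \<notin> S" "\<not> (z1 \<bullet> u) * v $ i / ?s < z2 $ i" unfolding iff by blast
        then have "(\<Prod>i\<in>UNIV. (if i \<in> S then 1 else indicator {(z1 \<bullet> u) * v $ i / ?s<..} (z2 $ i)) :: ennreal) = 0"
          by (intro prod_zero) (auto intro!: bexI[of _ i])
        then show ?thesis using False by simp
      qed
    qed
    also have "\<dots> = (\<Prod>i\<in>UNIV. \<integral>\<^sup>+t. (if i \<in> S then 1 else indicator {(z1 \<bullet> u) * v $ i / ?s<..} t) \<partial>std_gaussian)"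
      by (rule nn_integral_std_gaussian_coords[where f="\<lambda>i t. if i \<in> S then 1 else indicator {(z1 \<bullet> u) * v $ i / ?s<..} t"]) auto
    also have "\<dots> = (\<Prod>i\<in>UNIV. if i \<in> - S then ennreal (gauss_cdf (- ((z1 \<bullet> u) * v $ i / ?s))) else 1)"
      using g.emeasure_space_1 by (intro prod.cong) (auto simp: gauss_cdf_upper[symmetric] g.emeasure_eq_measure)
    also have "\<dots> = (\<Prod>i\<in>- S. ennreal (gauss_cdf (- ((z1 \<bullet> u) * v $ i / ?s))))"
      by (subst prod.If_cases) (auto simp: Compl_eq)
    also have "\<dots> = ennreal (?F (z1 \<bullet> u))" by (rule prod_ennreal) (rule gauss_cdf_01)
    finally show "(\<integral>\<^sup>+z2. indicator ?B (restr S z1 + (z2 - restr S z2)) \<partial>std_gaussian) = ennreal (?F (z1 \<bullet> u))" .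
  qed
  also have "\<dots> = (\<integral>\<^sup>+c. ennreal (?F c) \<partial>std_gaussian)"
    by (rule nn_integral_std_gaussian_inner[OF _ u, of "\<lambda>c. ennreal (?F c)"]) simp
  \<comment> \<open>Reflecting the Gaussian variable removes the minus sign that comes from the
    upper tails.\<close>
  also have "\<dots> = (\<integral>\<^sup>+c. ennreal (?F (- c)) \<partial>std_gaussian)"
    by (rule nn_integral_std_gaussian_uminus[symmetric]) simp
  also have "\<dots> = ennreal (\<integral>c. ?F (- c) \<partial>std_gaussian)"
    by (rule nn_integral_eq_integral)
       (auto intro!: g.integrable_const_bound[where B=1] AE_I2 prod_nonneg prod_le_1 simp: gauss_cdf_01 abs_prod)
  also have "(\<integral>c. ?F (- c) \<partial>std_gaussian) = (\<integral>g. (\<Prod>i\<in>- S. gauss_cdf (g * v $ i / ?s)) \<partial>std_gaussian)"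
    by simp
  finally show ?thesis
    by (subst (asm) ennreal_inj) (auto simp: outer_angle_def intro!: integral_nonneg_AE AE_I2 prod_nonneg gauss_cdf_01)
qed

section \<open>Fourier inversion for the inner angle\<close>

definition Phi_prod :: "real ^ 'n::finite \<Rightarrow> 'n set \<Rightarrow> real \<Rightarrow> complex" where
  "Phi_prod v S g = (\<Prod>i\<in>S. complex_Phi (\<i> * of_real (g * v $ i / snorm v S)))"

lemma half_char_measurable[measurable]: "half_char \<in> borel_measurable borel"
proof -
  interpret g: prob_space "std_gaussian :: real measure" by (rule prob_space_std_gaussian)
  show ?thesis unfolding half_char_def
    by (rule g.borel_measurable_lebesgue_integral) (simp add: split_beta' cong: measurable_cong_sets)
qed

text \<open>The squares of \<open>v $ i / snorm v S\<close> over \<open>S\<close> add up to 1, so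
  the exponential factors multiply to \<open>exp (g\<^sup>2 / 2)\<close>, the growth that the
  Gaussian density of \<open>g\<close> cancels.\<close>

lemma Phi_prod_half_char:
  assumes nz: "\<And>i. v $ i \<noteq> 0" and S: "S \<noteq> {}"
  shows "Phi_prod v S g = of_real (exp (g\<^sup>2 / 2)) * (\<Prod>i\<in>S. half_char (g * v $ i / snorm v S))"
proof -
  have s: "0 < snorm v S" by (rule snorm_pos[OF nz S])
  then have s2: "(\<Sum>i\<in>S. (v $ i)\<^sup>2) = (snorm v S)\<^sup>2" by (simp add: snorm_def sum_nonneg)
  have "Phi_prod v S g = of_real (\<Prod>i\<in>S. exp ((g * v $ i / snorm v S)\<^sup>2 / 2)) * (\<Prod>i\<in>S. half_char (g * v $ i / snorm v S))"
    unfolding Phi_prod_def complex_Phi_imaginary by (simp add: prod.distrib)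
  also have "(\<Prod>i\<in>S. exp ((g * v $ i / snorm v S)\<^sup>2 / 2)) = exp (\<Sum>i\<in>S. (g * v $ i / snorm v S)\<^sup>2 / 2)"
    by (rule exp_sum[symmetric]) simp
  also have "(\<Sum>i\<in>S. (g * v $ i / snorm v S)\<^sup>2 / 2) = g\<^sup>2 / (2 * (snorm v S)\<^sup>2) * (\<Sum>i\<in>S. (v $ i)\<^sup>2)"
    unfolding sum_distrib_left by (intro sum.cong refl) (simp add: power_divide power_mult_distrib)
  also have "\<dots> = g\<^sup>2 / 2" using s unfolding s2 by simp
  finally show ?thesis .
qed

lemma gauss_scale:
  fixes f :: "real \<Rightarrow> complex"
  assumes [measurable]: "f \<in> borel_measurable borel" and e: "0 < e"
  shows "(1 / e) *\<^sub>R (\<integral>h. f (h / e) \<partial>std_gaussian) = (\<integral>g. std_normal_density (e * g) *\<^sub>R f g \<partial>lborel)"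
proof -
  have "(\<integral>h. f (h / e) \<partial>std_gaussian) = (\<integral>h. std_normal_density h *\<^sub>R f (h / e) \<partial>lborel)"
    unfolding std_gaussian_real by (subst integral_density) auto
  also have "\<dots> = \<bar>e\<bar> *\<^sub>R (\<integral>g. std_normal_density (0 + e * g) *\<^sub>R f ((0 + e * g) / e) \<partial>lborel)"
    using e by (intro lborel_integral_real_affine) auto
  finally show ?thesis using e by simp
qed

lemma gauss_scale_nn:
  fixes f :: "real \<Rightarrow> ennreal"
  assumes [measurable]: "f \<in> borel_measurable borel" and e: "0 < e"
  shows "(\<integral>\<^sup>+c. f c \<partial>std_gaussian) = ennreal e * (\<integral>\<^sup>+r. ennreal (std_normal_density (e * r)) * f (e * r) \<partial>lborel)"
proof -
  have "(\<integral>\<^sup>+c. f c \<partial>std_gaussian) = (\<integral>\<^sup>+c. ennreal (std_normal_density c) * f c \<partial>lborel)"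
    unfolding std_gaussian_real by (subst nn_integral_density) auto
  also have "\<dots> = ennreal \<bar>e\<bar> * (\<integral>\<^sup>+r. ennreal (std_normal_density (0 + e * r)) * f (0 + e * r) \<partial>lborel)"
    using e by (intro nn_integral_real_affine) auto
  finally show ?thesis using e by simp
qed

lemma gauss_char: "(\<integral>h. exp (- (\<i> * of_real (c * h))) \<partial>std_gaussian) = of_real (exp (- (c\<^sup>2 / 2)))"
proof -
  have "char std_normal_distribution (- c) = of_real (exp (- ((- c)\<^sup>2) / 2))" by (simp add: char_std_normal_distribution)
  then show ?thesis by (simp add: char_def std_gaussian_real)
qed

lemma outer_projection: "norm u = 1 \<Longrightarrow> orth_proj (\<lambda>z::'a::euclidean_space. (z \<bullet> u) *\<^sub>R u)"
proof (rule orth_proj.intro)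
  assume u: "norm u = 1"
  show "linear (\<lambda>z. (z \<bullet> u) *\<^sub>R u)" by (rule linearI) (auto simp: inner_add_left algebra_simps)
  have "u \<bullet> u = 1" using u by (simp add: power2_norm_eq_inner[symmetric])
  then show "(((x \<bullet> u) *\<^sub>R u) \<bullet> u) *\<^sub>R u = (x \<bullet> u) *\<^sub>R u" for x by simp
  show "(x \<bullet> u) *\<^sub>R u \<bullet> y = x \<bullet> (y \<bullet> u) *\<^sub>R u" for x y by (simp add: inner_commute mult.commute)
qed

text \<open>The product of half characteristic functions is the Fourier transform, along the unit
  vector \<open>u\<close>, of the Gaussian law restricted to \<open>N\<close>. Exchanging the
  integrals replaces the oscillation by the weight \<open>w\<close>, which together with the factor
  \<open>1 / e\<close> concentrates at \<open>z \<bullet> u = 0\<close> on the scale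
  \<open>e\<close>; the component along \<open>u\<close> is then rescaled by
  \<open>e\<close>.\<close>

lemma inner_angle_regularised:
  fixes v :: "real ^ 'n::finite"
  assumes nz: "\<And>i. v $ i \<noteq> 0" and S: "S \<noteq> {}" and e: "0 < e"
  shows "(\<integral>g. exp (- ((e * g)\<^sup>2 / 2)) *\<^sub>R Phi_prod v S g \<partial>std_gaussian) =
    of_real (enn2real (\<integral>\<^sup>+r. \<integral>\<^sup>+z. ennreal (exp (- ((e * r)\<^sup>2 / 2))) *
       indicator {z. \<forall>i\<in>S. pr S [v] z $ i + e * r * (v $ i / snorm v S) \<le> 0} z \<partial>std_gaussian \<partial>std_gaussian))"
proof -
  interpret g: prob_space "std_gaussian :: real measure" by (rule prob_space_std_gaussian)
  interpret gn: prob_space "std_gaussian :: (real^'n) measure" by (rule prob_space_std_gaussian)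
  interpret gg: pair_prob_space "std_gaussian :: real measure" "std_gaussian :: (real^'n) measure" ..
  let ?s = "snorm v S"
  have s: "0 < ?s" by (rule snorm_pos[OF nz S])
  define u where "u = (1 / ?s) *\<^sub>R restr S v"
  have u: "norm u = 1" using s by (simp add: u_def snorm_eq)
  have ui: "u $ i = v $ i / ?s" if "i \<in> S" for i using that by (simp add: u_def)
  have ui0: "u $ i = 0" if "i \<notin> S" for i using that by (simp add: u_def)
  interpret U: orth_proj "\<lambda>z::real^'n. (z \<bullet> u) *\<^sub>R u" by (rule outer_projection[OF u])
  have uu: "u \<bullet> u = 1" using u by (simp add: power2_norm_eq_inner[symmetric])
  define N where "N = {z::real^'n. \<forall>i\<in>S. z $ i \<le> 0}"
  have N[measurable]: "N \<in> sets borel"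
  proof -
    have "N = (\<Inter>i. {z. i \<in> S \<longrightarrow> z $ i \<le> 0})" by (auto simp: N_def)
    also have "\<dots> \<in> sets borel" by (intro sets.finite_INT) auto
    finally show ?thesis .
  qed
  have prod: "(\<Prod>i\<in>S. half_char (x * v $ i / ?s)) = (\<integral>z. indicator N z *\<^sub>R exp (- (\<i> * of_real (x * (z \<bullet> u)))) \<partial>std_gaussian)" for x
  proof -
    let ?f = "\<lambda>i t. if i \<in> S then indicator {..0::real} t *\<^sub>R exp (- (\<i> * of_real ((x * v $ i / ?s) * t))) else 1"
    have "(\<Prod>i\<in>S. half_char (x * v $ i / ?s)) = (\<Prod>i\<in>UNIV. \<integral>t. ?f i t \<partial>std_gaussian)"
    proof -
      have "(\<integral>t. ?f i t \<partial>std_gaussian) = (if i \<in> S then half_char (x * v $ i / ?s) else 1)" for i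
        using g.prob_space by (simp add: half_char_def)
      then have "(\<Prod>i\<in>UNIV. \<integral>t. ?f i t \<partial>std_gaussian) = (\<Prod>i\<in>UNIV. if i \<in> S then half_char (x * v $ i / ?s) else 1)"
        by (simp only:)
      then show ?thesis by (simp add: prod.If_cases)
    qed
    also have "\<dots> = (\<integral>z. (\<Prod>i\<in>UNIV. ?f i (z $ i)) \<partial>std_gaussian)"
    proof (rule integral_std_gaussian_coords[where f="?f", symmetric])
      show "integrable std_gaussian (?f i)" for i
        by (rule g.integrable_const_bound[where B=1]) (auto split: split_indicator cong: measurable_cong_sets)
    qed simp
    also have "\<dots> = (\<integral>z. indicator N z *\<^sub>R exp (- (\<i> * of_real (x * (z \<bullet> u)))) \<partial>std_gaussian)"
    proof (intro Bochner_Integration.integral_cong refl)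
      fix z :: "real ^ 'n"
      have "(\<Prod>i\<in>UNIV. ?f i (z $ i)) = (\<Prod>i\<in>S. indicator {..0} (z $ i) *\<^sub>R exp (- (\<i> * of_real ((x * v $ i / ?s) * z $ i))))"
        by (simp add: prod.If_cases)
      also have "\<dots> = (\<Prod>i\<in>S. indicator {..0} (z $ i)) *\<^sub>R (\<Prod>i\<in>S. exp (- (\<i> * of_real ((x * v $ i / ?s) * z $ i))))"
        by (simp add: scaleR_conv_of_real prod.distrib)
      also have "(\<Prod>i\<in>S. indicator {..0} (z $ i)) = (indicator N z :: real)"
        by (auto simp: indicator_def N_def)
      also have "(\<Prod>i\<in>S. exp (- (\<i> * of_real ((x * v $ i / ?s) * z $ i)))) = exp (\<Sum>i\<in>S. - (\<i> * of_real ((x * v $ i / ?s) * z $ i)))"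
        by (rule exp_sum[symmetric]) simp
      also have "(\<Sum>i\<in>S. - (\<i> * of_real ((x * v $ i / ?s) * z $ i))) = - (\<i> * of_real (x * (z \<bullet> u)))"
      proof -
        have "z \<bullet> u = (1 / ?s) * (\<Sum>i\<in>S. v $ i * z $ i)"
          unfolding u_def inner_scaleR_right inner_commute[of z] sip_restr[symmetric] sip_def ..
        then have "(\<Sum>i\<in>S. (x * v $ i / ?s) * z $ i) = x * (z \<bullet> u)" by (simp add: sum_distrib_left mult_ac)
        then show ?thesis unfolding sum_negf sum_distrib_left[symmetric] of_real_sum[symmetric] by simp
      qed
      finally show "(\<Prod>i\<in>UNIV. ?f i (z $ i)) = indicator N z *\<^sub>R exp (- (\<i> * of_real (x * (z \<bullet> u))))" .
    qed
    finally show ?thesis .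
  qed
  define w where "w = (\<lambda>c. exp (- ((c / e)\<^sup>2 / 2)))"
  have [measurable]: "w \<in> borel_measurable borel" unfolding w_def by simp
  \<comment> \<open>The density of \<open>g\<close> times \<open>exp (g\<^sup>2 / 2)\<close> is
    constant, so together with the regularising factor the density at \<open>e * g\<close> is
    left.\<close>
  have "(\<integral>g. exp (- ((e * g)\<^sup>2 / 2)) *\<^sub>R Phi_prod v S g \<partial>std_gaussian) =
    (\<integral>g. std_normal_density (e * g) *\<^sub>R (\<Prod>i\<in>S. half_char (g * v $ i / ?s)) \<partial>lborel)"
  proof -
    have [measurable]: "Phi_prod v S \<in> borel_measurable borel"
      unfolding Phi_prod_half_char[OF nz S, abs_def] by measurable
    have "(\<integral>g. exp (- ((e * g)\<^sup>2 / 2)) *\<^sub>R Phi_prod v S g \<partial>std_gaussian) =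
       (\<integral>g. std_normal_density g *\<^sub>R (exp (- ((e * g)\<^sup>2 / 2)) *\<^sub>R Phi_prod v S g) \<partial>lborel)"
      unfolding std_gaussian_real by (subst integral_density) auto
    also have "\<dots> = (\<integral>g. std_normal_density (e * g) *\<^sub>R (\<Prod>i\<in>S. half_char (g * v $ i / ?s)) \<partial>lborel)"
    proof (intro Bochner_Integration.integral_cong refl)
      fix g :: real
      have "exp (- (g\<^sup>2 / 2)) * exp (g\<^sup>2 / 2) = 1" by (simp add: exp_minus)
      then have "std_normal_density g * exp (- ((e * g)\<^sup>2 / 2)) * exp (g\<^sup>2 / 2) = std_normal_density (e * g)"
        by (simp add: std_normal_density_alt)
      then have "complex_of_real (std_normal_density (e * g)) = of_real (std_normal_density g) * (of_real (exp (- ((e * g)\<^sup>2 / 2))) * of_real (exp (g\<^sup>2 / 2)))"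
        by (simp only: of_real_mult[symmetric] mult.assoc)
      then show "std_normal_density g *\<^sub>R (exp (- ((e * g)\<^sup>2 / 2)) *\<^sub>R Phi_prod v S g) =
        std_normal_density (e * g) *\<^sub>R (\<Prod>i\<in>S. half_char (g * v $ i / ?s))"
        unfolding Phi_prod_half_char[OF nz S] scaleR_conv_of_real by (simp only: mult.assoc)
    qed
    finally show ?thesis .
  qed
  also have "\<dots> = (1 / e) *\<^sub>R (\<integral>h. (\<Prod>i\<in>S. half_char (h / e * v $ i / ?s)) \<partial>std_gaussian)"
    by (rule gauss_scale[OF _ e, symmetric]) simp
  also have "\<dots> = (1 / e) *\<^sub>R (\<integral>h. \<integral>z. indicator N z *\<^sub>R exp (- (\<i> * of_real (h / e * (z \<bullet> u)))) \<partial>std_gaussian \<partial>std_gaussian)"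
    unfolding prod ..
  \<comment> \<open>After the change of variable the integrand is bounded on a product of two
    probability spaces, so Fubini applies; this is what the regularising factor is for.\<close>
  also have "(\<integral>h. \<integral>z. indicator N z *\<^sub>R exp (- (\<i> * of_real (h / e * (z \<bullet> u)))) \<partial>std_gaussian \<partial>std_gaussian) =
    (\<integral>z. \<integral>h. indicator N z *\<^sub>R exp (- (\<i> * of_real (h / e * (z \<bullet> u)))) \<partial>std_gaussian \<partial>std_gaussian)"
    by (rule gg.Fubini_integral[symmetric])
       (auto intro!: gg.integrable_const_bound[where B=1] AE_I2 split: split_indicator cong: measurable_cong_sets)
  also have "\<dots> = (\<integral>z. of_real (indicator N z * w (z \<bullet> u)) \<partial>std_gaussian)"
  proof (intro Bochner_Integration.integral_cong refl)
    fix z :: "real ^ 'n"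
    have "(\<integral>h. exp (- (\<i> * of_real (h / e * (z \<bullet> u)))) \<partial>std_gaussian) = of_real (w (z \<bullet> u))"
      using gauss_char[of "(z \<bullet> u) / e"] by (simp add: w_def mult.commute)
    then show "(\<integral>h. indicator N z *\<^sub>R exp (- (\<i> * of_real (h / e * (z \<bullet> u)))) \<partial>std_gaussian) = of_real (indicator N z * w (z \<bullet> u))"
      by (simp add: scaleR_conv_of_real)
  qed
  also have "\<dots> = of_real (\<integral>z. indicator N z * w (z \<bullet> u) \<partial>std_gaussian)" by (rule integral_complex_of_real)
  also have "(\<integral>z. indicator N z * w (z \<bullet> u) \<partial>std_gaussian) = enn2real (\<integral>\<^sup>+z. ennreal (indicator N z * w (z \<bullet> u)) \<partial>std_gaussian)"
    by (rule integral_eq_nn_integral) (auto simp: w_def cong: measurable_cong_sets)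
  also have "(\<integral>\<^sup>+z. ennreal (indicator N z * w (z \<bullet> u)) \<partial>std_gaussian) =
     ennreal e * (\<integral>\<^sup>+r. \<integral>\<^sup>+z. ennreal (exp (- ((e * r)\<^sup>2 / 2))) *
       indicator {z. \<forall>i\<in>S. pr S [v] z $ i + e * r * (v $ i / ?s) \<le> 0} z \<partial>std_gaussian \<partial>std_gaussian)"
  proof -
    let ?Q = "\<lambda>c. {z. \<forall>i\<in>S. pr S [v] z $ i + c * (v $ i / ?s) \<le> 0}"
    have pr_u: "pr S [v] z $ i = (z - (z \<bullet> u) *\<^sub>R u) $ i" if i: "i \<in> S" for z i
    proof -
      have "sip S v v = ?s * ?s"
        unfolding sip_restr2 snorm_eq by (simp add: power2_norm_eq_inner[symmetric] power2_eq_square)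
      moreover have "sip S z v = z \<bullet> restr S v" unfolding sip_restr by (rule restr.self_adj)
      ultimately have "sip S z v / sip S v v = (z \<bullet> u) / ?s" by (simp add: u_def)
      then show ?thesis using i by (simp add: pr_def ui)
    qed
    have N_iff: "(c *\<^sub>R u + (z - (z \<bullet> u) *\<^sub>R u)) \<in> N \<longleftrightarrow> z \<in> ?Q c" for c z
    proof -
      have "(c *\<^sub>R u + (z - (z \<bullet> u) *\<^sub>R u)) $ i = pr S [v] z $ i + c * (v $ i / ?s)" if "i \<in> S" for i
        using pr_u[OF that, of z] by (simp add: ui[OF that])
      then show ?thesis by (simp add: N_def)
    qed
    have Qm: "(\<lambda>(c, z). indicator (?Q c) z :: ennreal) \<in> borel_measurable (borel \<Otimes>\<^sub>M borel)"
    proof -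
      have "(\<lambda>(c, z). indicator N (c *\<^sub>R u + (z - (z \<bullet> u) *\<^sub>R u)) :: ennreal) \<in> borel_measurable (borel \<Otimes>\<^sub>M borel)"
        by measurable
      then show ?thesis unfolding indicator_def N_iff .
    qed
    have Qm1: "(\<lambda>c. \<integral>\<^sup>+z. indicator (?Q c) z \<partial>std_gaussian) \<in> borel_measurable borel"
      using gn.borel_measurable_nn_integral_fst[of "\<lambda>(c, z). indicator (?Q c) z" borel] Qm by simp
    have Qm2: "(\<lambda>z. indicator (?Q c) z :: ennreal) \<in> borel_measurable borel" for c
      using measurable_compose[OF measurable_Pair1'[of c borel borel] Qm] by simp
    have "(\<integral>\<^sup>+z. ennreal (indicator N z * w (z \<bullet> u)) \<partial>std_gaussian) =
      (\<integral>\<^sup>+z1. \<integral>\<^sup>+z2. ennreal (indicator N ((z1 \<bullet> u) *\<^sub>R u + (z2 - (z2 \<bullet> u) *\<^sub>R u)) * w (((z1 \<bullet> u) *\<^sub>R u + (z2 - (z2 \<bullet> u) *\<^sub>R u)) \<bullet> u)) \<partial>std_gaussian \<partial>std_gaussian)"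
      by (rule U.std_gaussian_split) simp
    also have "\<dots> = (\<integral>\<^sup>+z1. \<integral>\<^sup>+z2. ennreal (w (z1 \<bullet> u)) * indicator (?Q (z1 \<bullet> u)) z2 \<partial>std_gaussian \<partial>std_gaussian)"
    proof (intro nn_integral_cong)
      fix z1 z2
      have "((z1 \<bullet> u) *\<^sub>R u + (z2 - (z2 \<bullet> u) *\<^sub>R u)) \<bullet> u = z1 \<bullet> u"
        by (simp add: inner_add_left inner_diff_left uu)
      then show "ennreal (indicator N ((z1 \<bullet> u) *\<^sub>R u + (z2 - (z2 \<bullet> u) *\<^sub>R u)) * w (((z1 \<bullet> u) *\<^sub>R u + (z2 - (z2 \<bullet> u) *\<^sub>R u)) \<bullet> u)) =
        ennreal (w (z1 \<bullet> u)) * indicator (?Q (z1 \<bullet> u)) z2"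
        using N_iff[of "z1 \<bullet> u" z2] by (simp add: indicator_def)
    qed
    also have "\<dots> = (\<integral>\<^sup>+z1. ennreal (w (z1 \<bullet> u)) * (\<integral>\<^sup>+z2. indicator (?Q (z1 \<bullet> u)) z2 \<partial>std_gaussian) \<partial>std_gaussian)"
      using Qm2 by (simp add: nn_integral_cmult)
    also have "\<dots> = (\<integral>\<^sup>+c. ennreal (w c) * (\<integral>\<^sup>+z2. indicator (?Q c) z2 \<partial>std_gaussian) \<partial>std_gaussian)"
      using Qm1 by (intro nn_integral_std_gaussian_inner[OF _ u, of "\<lambda>c. ennreal (w c) * (\<integral>\<^sup>+z2. indicator (?Q c) z2 \<partial>std_gaussian)"]) simp
    \<comment> \<open>With \<open>c = e * r\<close> the weight becomes
      \<open>exp (- (r\<^sup>2 / 2))\<close>: a standard Gaussian variable \<open>r\<close>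
      reappears, and the former density at \<open>e * r\<close> supplies the remaining
      factor.\<close>
    also have "\<dots> = ennreal e * (\<integral>\<^sup>+r. ennreal (std_normal_density (e * r)) * (ennreal (w (e * r)) * (\<integral>\<^sup>+z2. indicator (?Q (e * r)) z2 \<partial>std_gaussian)) \<partial>lborel)"
      using Qm1 by (intro gauss_scale_nn e) simp
    also have "(\<integral>\<^sup>+r. ennreal (std_normal_density (e * r)) * (ennreal (w (e * r)) * (\<integral>\<^sup>+z2. indicator (?Q (e * r)) z2 \<partial>std_gaussian)) \<partial>lborel)
       = (\<integral>\<^sup>+r. ennreal (std_normal_density r) * (ennreal (exp (- ((e * r)\<^sup>2 / 2))) * (\<integral>\<^sup>+z2. indicator (?Q (e * r)) z2 \<partial>std_gaussian)) \<partial>lborel)"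
    proof (intro nn_integral_cong)
      fix r
      have "std_normal_density (e * r) * w (e * r) = std_normal_density r * exp (- ((e * r)\<^sup>2 / 2))"
        using e by (simp add: std_normal_density_alt w_def)
      then have "ennreal (std_normal_density (e * r)) * ennreal (w (e * r)) = ennreal (std_normal_density r) * ennreal (exp (- ((e * r)\<^sup>2 / 2)))"
        by (simp add: ennreal_mult[symmetric] w_def)
      then show "ennreal (std_normal_density (e * r)) * (ennreal (w (e * r)) * (\<integral>\<^sup>+z2. indicator (?Q (e * r)) z2 \<partial>std_gaussian)) =
        ennreal (std_normal_density r) * (ennreal (exp (- ((e * r)\<^sup>2 / 2))) * (\<integral>\<^sup>+z2. indicator (?Q (e * r)) z2 \<partial>std_gaussian))"
        by (simp add: mult.assoc[symmetric])
    qed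
    also have "\<dots> = (\<integral>\<^sup>+r. ennreal (exp (- ((e * r)\<^sup>2 / 2))) * (\<integral>\<^sup>+z2. indicator (?Q (e * r)) z2 \<partial>std_gaussian) \<partial>std_gaussian)"
      unfolding std_gaussian_real using Qm1 by (subst nn_integral_density) (auto simp: std_gaussian_real)
    also have "\<dots> = (\<integral>\<^sup>+r. \<integral>\<^sup>+z. ennreal (exp (- ((e * r)\<^sup>2 / 2))) * indicator (?Q (e * r)) z \<partial>std_gaussian \<partial>std_gaussian)"
      using Qm2 by (simp add: nn_integral_cmult)
    finally show ?thesis .
  qed
  finally show ?thesis using e by (simp add: enn2real_mult scaleR_conv_of_real)
qed

text \<open>A second index \<open>j\<close> in \<open>S\<close> gives a vector supported on
  \<open>i\<close> and \<open>j\<close>, orthogonal to \<open>v\<close>, with a nonzero entry at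
  \<open>i\<close>. For a single coordinate the projection would be 0.\<close>

lemma pr_coord_nonzero:
  fixes v :: "real ^ 'n::finite"
  assumes nz: "\<And>i. v $ i \<noteq> 0" and i: "i \<in> S" and S: "2 \<le> card S"
  shows "AE z in std_gaussian. pr S [v] z $ i \<noteq> 0"
proof -
  have "card (S - {i}) \<noteq> 0" using S i by (simp add: card_Diff_singleton)
  then obtain j where j: "j \<in> S" "j \<noteq> i" by (metis Diff_iff all_not_in_conv card.empty singletonI)
  define x where "x = v $ j *\<^sub>R axis i 1 - v $ i *\<^sub>R axis j (1::real)"
  have "pr S [v] x = x"
  proof (rule pr_eq_self)
    show "restr S x = x" using i j by (auto simp: vec_eq_iff x_def axis_def)
    show "x \<bullet> u = 0" if "u \<in> set [v]" for u
      using that by (simp add: x_def inner_diff_left inner_axis' mult.commute)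
  qed
  then have "pr S [v] x $ i \<noteq> 0" using j nz[of j] by (simp add: x_def axis_def)
  moreover have "linear (\<lambda>z. pr S [v] z $ i)"
    by (rule linearI) (simp_all add: linear_add[OF pr.linear] linear_scale[OF pr.linear])
  ultimately show ?thesis by (intro AE_linear_functional[of _ x]) auto
qed

lemma Phi_prod_measurable:
  assumes "\<And>i. v $ i \<noteq> 0" "S \<noteq> {}"
  shows "Phi_prod v S \<in> borel_measurable borel"
  unfolding Phi_prod_half_char[OF assms, abs_def] by measurable

text \<open>The limit of vanishing regularisation: the left side is dominated by the integrable
  product, the right side by 1. No coordinate of the projection in \<open>S\<close> is 0 almost
  surely, so the shifted closed orthant turns into the open one.\<close>

lemma inner_angle_eq:
  fixes v :: "real ^ 'n::finite"
  assumes nz: "\<And>i. v $ i \<noteq> 0" and S: "2 \<le> card S"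
    and int: "integrable std_gaussian (Phi_prod v S)"
  shows "of_real (inner_angle v S) = (\<integral>g. Phi_prod v S g \<partial>std_gaussian)"
proof -
  interpret g: prob_space "std_gaussian :: real measure" by (rule prob_space_std_gaussian)
  interpret gn: prob_space "std_gaussian :: (real^'n) measure" by (rule prob_space_std_gaussian)
  interpret gg: pair_prob_space "std_gaussian :: real measure" "std_gaussian :: (real^'n) measure" ..
  have Sne: "S \<noteq> {}" using S by auto
  let ?e = "\<lambda>m. 1 / real (Suc m)"
  let ?I = "\<lambda>e r z. ennreal (exp (- ((e * r)\<^sup>2 / 2))) * indicator {z. \<forall>i\<in>S. pr S [v] z $ i + e * r * (v $ i / snorm v S) \<le> 0} z"
  let ?A = "{z. \<forall>i\<in>S. pr S [v] z $ i < 0}"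
  have A: "?A \<in> sets borel"
  proof -
    have [measurable]: "pr S [v] \<in> borel_measurable borel" by (rule pr.meas)
    have "?A = (\<Inter>i. {z. i \<in> S \<longrightarrow> pr S [v] z $ i < 0})" by auto
    also have "\<dots> \<in> sets borel" by (intro sets.finite_INT) auto
    finally show ?thesis .
  qed
  have elim: "?e \<longlonglongrightarrow> 0" by (rule LIMSEQ_Suc[OF lim_1_over_n])
  have [measurable]: "pr S [v] \<in> borel_measurable borel" by (rule pr.meas)
  have left: "(\<lambda>m. \<integral>g. exp (- ((?e m * g)\<^sup>2 / 2)) *\<^sub>R Phi_prod v S g \<partial>std_gaussian) \<longlonglongrightarrow> (\<integral>g. Phi_prod v S g \<partial>std_gaussian)"
  proof (rule integral_dominated_convergence[where w="\<lambda>g. norm (Phi_prod v S g)"])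
    show "AE g in std_gaussian. (\<lambda>m. exp (- ((?e m * g)\<^sup>2 / 2)) *\<^sub>R Phi_prod v S g) \<longlonglongrightarrow> Phi_prod v S g"
    proof (rule AE_I2)
      fix g
      have "(\<lambda>m. exp (- ((?e m * g)\<^sup>2 / 2)) *\<^sub>R Phi_prod v S g) \<longlonglongrightarrow> exp (- ((0 * g)\<^sup>2 / 2)) *\<^sub>R Phi_prod v S g"
        by (intro tendsto_intros elim) simp
      then show "(\<lambda>m. exp (- ((?e m * g)\<^sup>2 / 2)) *\<^sub>R Phi_prod v S g) \<longlonglongrightarrow> Phi_prod v S g" by simp
    qed
    show "AE g in std_gaussian. norm (exp (- ((?e m * g)\<^sup>2 / 2)) *\<^sub>R Phi_prod v S g) \<le> norm (Phi_prod v S g)" for m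
      by (rule AE_I2) (auto intro!: mult_left_le_one_le)
  qed (use int Phi_prod_measurable[OF nz Sne] in \<open>auto cong: measurable_cong_sets\<close>)
  have Im: "(\<lambda>p. ?I e (fst p) (snd p)) \<in> borel_measurable (std_gaussian \<Otimes>\<^sub>M std_gaussian)" for e
  proof -
    have "{p :: real \<times> (real^'n). \<forall>i\<in>S. pr S [v] (snd p) $ i + e * fst p * (v $ i / snorm v S) \<le> 0} \<in> sets (borel \<Otimes>\<^sub>M borel)"
    proof -
      have "{p :: real \<times> (real^'n). \<forall>i\<in>S. pr S [v] (snd p) $ i + e * fst p * (v $ i / snorm v S) \<le> 0} =
        (\<Inter>i. {p \<in> space (borel \<Otimes>\<^sub>M borel). i \<in> S \<longrightarrow> pr S [v] (snd p) $ i + e * fst p * (v $ i / snorm v S) \<le> 0})"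
        by (auto simp: space_pair_measure)
      also have "\<dots> \<in> sets (borel \<Otimes>\<^sub>M borel)" by (intro sets.finite_INT) auto
      finally show ?thesis .
    qed
    then have [measurable]: "(\<lambda>p. indicator {p :: real \<times> (real^'n). \<forall>i\<in>S. pr S [v] (snd p) $ i + e * fst p * (v $ i / snorm v S) \<le> 0} p :: ennreal) \<in> borel_measurable (borel \<Otimes>\<^sub>M borel)"
      by simp
    have "(\<lambda>p. ennreal (exp (- ((e * fst p)\<^sup>2 / 2))) * indicator {p :: real \<times> (real^'n). \<forall>i\<in>S. pr S [v] (snd p) $ i + e * fst p * (v $ i / snorm v S) \<le> 0} p) \<in> borel_measurable (borel \<Otimes>\<^sub>M borel)"
      by measurable
    then show ?thesis by (simp add: indicator_def cong: measurable_cong_sets)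
  qed
  have right: "(\<lambda>m. \<integral>\<^sup>+p. ?I (?e m) (fst p) (snd p) \<partial>(std_gaussian \<Otimes>\<^sub>M std_gaussian)) \<longlonglongrightarrow>
    (\<integral>\<^sup>+p. indicator {z. \<forall>i\<in>S. pr S [v] z $ i < 0} (snd p) \<partial>((std_gaussian :: real measure) \<Otimes>\<^sub>M std_gaussian))"
  proof (rule nn_integral_dominated_convergence[where w="\<lambda>_. 1"])
    have "AE p in (std_gaussian :: real measure) \<Otimes>\<^sub>M std_gaussian. \<forall>i\<in>S. pr S [v] (snd p) $ i \<noteq> 0"
      unfolding AE_finite_all[OF finite]
    proof (intro ballI gg.AE_pair_measure)
      fix i assume "i \<in> S"
      have "{p \<in> space (borel \<Otimes>\<^sub>M borel) :: (real \<times> (real^'n)) set. pr S [v] (snd p) $ i \<noteq> 0} \<in> sets (borel \<Otimes>\<^sub>M borel)"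
        by measurable
      then show "{p \<in> space (std_gaussian \<Otimes>\<^sub>M std_gaussian) :: (real \<times> (real^'n)) set. pr S [v] (snd p) $ i \<noteq> 0} \<in> sets (std_gaussian \<Otimes>\<^sub>M std_gaussian)"
        by (simp add: space_pair_measure cong: sets_pair_measure_cong)
      show "AE x in (std_gaussian :: real measure). AE y in std_gaussian. pr S [v] (snd (x, y)) $ i \<noteq> 0"
        using pr_coord_nonzero[OF nz \<open>i \<in> S\<close> S] by simp
    qed
    then show "AE p in (std_gaussian :: real measure) \<Otimes>\<^sub>M std_gaussian. (\<lambda>m. ?I (?e m) (fst p) (snd p)) \<longlonglongrightarrow> indicator {z. \<forall>i\<in>S. pr S [v] z $ i < 0} (snd p)"
    proof eventually_elim
      case (elim p)
      let ?h = "\<lambda>m i. pr S [v] (snd p) $ i + ?e m * fst p * (v $ i / snorm v S)"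
      have h: "(\<lambda>m. ?h m i) \<longlonglongrightarrow> pr S [v] (snd p) $ i" for i
      proof -
        have "(\<lambda>m. ?h m i) \<longlonglongrightarrow> pr S [v] (snd p) $ i + 0 * fst p * (v $ i / snorm v S)"
          by (intro tendsto_intros LIMSEQ_Suc[OF lim_1_over_n])
        then show ?thesis by simp
      qed
      have ev: "eventually (\<lambda>m. (\<forall>i\<in>S. ?h m i \<le> 0) \<longleftrightarrow> (\<forall>i\<in>S. pr S [v] (snd p) $ i < 0)) sequentially"
      proof (cases "\<forall>i\<in>S. pr S [v] (snd p) $ i < 0")
        case True
        then have "\<forall>i\<in>S. eventually (\<lambda>m. ?h m i < 0) sequentially" using order_tendstoD(2)[OF h] by blast
        then have "eventually (\<lambda>m. \<forall>i\<in>S. ?h m i < 0) sequentially" by (simp add: eventually_ball_finite_distrib)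
        then show ?thesis by eventually_elim (use True in \<open>auto intro: less_imp_le\<close>)
      next
        case False
        then obtain i where i: "i \<in> S" "pr S [v] (snd p) $ i > 0" using elim by (force simp: not_less)
        have "eventually (\<lambda>m. ?h m i > 0) sequentially" using order_tendstoD(1)[OF h i(2)] .
        then show ?thesis by eventually_elim (use False i in \<open>auto simp: not_le\<close>)
      qed
      have "(\<lambda>m. ennreal (exp (- ((?e m * fst p)\<^sup>2 / 2)))) \<longlonglongrightarrow> ennreal (exp (- ((0 * fst p)\<^sup>2 / 2)))"
        by (intro tendsto_ennrealI tendsto_intros LIMSEQ_Suc[OF lim_1_over_n]) simp
      then have "(\<lambda>m. ennreal (exp (- ((?e m * fst p)\<^sup>2 / 2))) * indicator {z. \<forall>i\<in>S. pr S [v] z $ i < 0} (snd p)) \<longlonglongrightarrow> 1 * indicator {z. \<forall>i\<in>S. pr S [v] z $ i < 0} (snd p)"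
        by (cases "\<forall>i\<in>S. pr S [v] (snd p) $ i < 0") simp_all
      then have l: "(\<lambda>m. ennreal (exp (- ((?e m * fst p)\<^sup>2 / 2))) * indicator {z. \<forall>i\<in>S. pr S [v] z $ i < 0} (snd p)) \<longlonglongrightarrow> indicator {z. \<forall>i\<in>S. pr S [v] z $ i < 0} (snd p)"
        by simp
      have "eventually (\<lambda>m. ennreal (exp (- ((?e m * fst p)\<^sup>2 / 2))) * indicator {z. \<forall>i\<in>S. pr S [v] z $ i < 0} (snd p) = ?I (?e m) (fst p) (snd p)) sequentially"
        using ev by eventually_elim (simp add: indicator_def)
      with l show ?case by (rule Lim_transform_eventually)
    qed
    show "(\<integral>\<^sup>+p. 1 \<partial>((std_gaussian :: real measure) \<Otimes>\<^sub>M (std_gaussian :: (real^'n) measure))) < \<infinity>"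
      using gg.emeasure_space_1 by simp
    show "AE p in (std_gaussian :: real measure) \<Otimes>\<^sub>M std_gaussian. ?I (?e m) (fst p) (snd p) \<le> 1" for m
      by (rule AE_I2) (auto simp: indicator_def ennreal_le_1)
    show "(\<lambda>p. indicator {z. \<forall>i\<in>S. pr S [v] z $ i < 0} (snd p)) \<in> borel_measurable ((std_gaussian :: real measure) \<Otimes>\<^sub>M std_gaussian)"
      by (rule measurable_compose[OF measurable_snd]) (use A in \<open>simp cong: measurable_cong_sets\<close>)
  qed (simp_all only: Im borel_measurable_const)
  have "(\<integral>\<^sup>+p. indicator ?A (snd p) \<partial>((std_gaussian :: real measure) \<Otimes>\<^sub>M std_gaussian)) = ennreal (inner_angle v S)"
  proof -
    have "(\<lambda>p. indicator ?A (snd p) :: ennreal) \<in> borel_measurable ((std_gaussian :: real measure) \<Otimes>\<^sub>M std_gaussian)"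
      by (rule measurable_compose[OF measurable_snd]) (use A in \<open>simp cong: measurable_cong_sets\<close>)
    from gn.nn_integral_fst[OF this, symmetric] show ?thesis
      using A g.emeasure_space_1 by (simp add: inner_angle_def gn.emeasure_eq_measure)
  qed
  with right have "(\<lambda>m. enn2real (\<integral>\<^sup>+p. ?I (?e m) (fst p) (snd p) \<partial>(std_gaussian \<Otimes>\<^sub>M std_gaussian))) \<longlonglongrightarrow> inner_angle v S"
    by (intro tendsto_enn2real) (auto simp: inner_angle_def)
  then have "(\<lambda>m. complex_of_real (enn2real (\<integral>\<^sup>+p. ?I (?e m) (fst p) (snd p) \<partial>(std_gaussian \<Otimes>\<^sub>M std_gaussian)))) \<longlonglongrightarrow> of_real (inner_angle v S)"
    by (rule tendsto_of_real)
  moreover have "(\<integral>g. exp (- ((?e m * g)\<^sup>2 / 2)) *\<^sub>R Phi_prod v S g \<partial>std_gaussian) =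
    of_real (enn2real (\<integral>\<^sup>+p. ?I (?e m) (fst p) (snd p) \<partial>(std_gaussian \<Otimes>\<^sub>M std_gaussian)))" for m
    by (subst inner_angle_regularised[OF nz Sne]) (simp, simp only: gn.nn_integral_fst[OF Im, symmetric] fst_conv snd_conv)
  ultimately have "(\<lambda>m. \<integral>g. exp (- ((?e m * g)\<^sup>2 / 2)) *\<^sub>R Phi_prod v S g \<partial>std_gaussian) \<longlonglongrightarrow> of_real (inner_angle v S)"
    by (simp only:)
  then show ?thesis using left by (rule LIMSEQ_unique)
qed

lemma arctan_integral: "(\<integral>\<^sup>+x. ennreal (1 / (1 + x\<^sup>2)) \<partial>lborel) < \<infinity>"
proof -
  have "(\<integral>\<^sup>+x. ennreal (1 / (1 + x\<^sup>2)) * indicator {0..} x \<partial>lborel) = ennreal (pi / 2 - arctan 0)"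
    by (rule nn_integral_FTC_atLeast[where F=arctan])
       (auto intro!: derivative_eq_intros tendsto_arctan_at_top simp: add_nonneg_eq_0_iff inverse_eq_divide)
  moreover have "(\<integral>\<^sup>+x. ennreal (1 / (1 + x\<^sup>2)) * indicator {..0} x \<partial>lborel) = (\<integral>\<^sup>+x. ennreal (1 / (1 + x\<^sup>2)) * indicator {0..} x \<partial>lborel)"
  proof -
    have "(\<integral>\<^sup>+x. ennreal (1 / (1 + x\<^sup>2)) * indicator {..0} x \<partial>lborel) =
      ennreal \<bar>- 1\<bar> * (\<integral>\<^sup>+x. ennreal (1 / (1 + (0 + (- 1) * x)\<^sup>2)) * indicator {..0} (0 + (- 1) * x) \<partial>lborel)"
      by (rule nn_integral_real_affine) auto
    then show ?thesis by (auto simp: indicator_def intro!: nn_integral_cong)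
  qed
  moreover have "(\<integral>\<^sup>+x. ennreal (1 / (1 + x\<^sup>2)) \<partial>lborel) \<le>
     (\<integral>\<^sup>+x. ennreal (1 / (1 + x\<^sup>2)) * indicator {0..} x + ennreal (1 / (1 + x\<^sup>2)) * indicator {..0} x \<partial>lborel)"
    by (rule nn_integral_mono) (auto split: split_indicator)
  ultimately show ?thesis by (subst (asm) nn_integral_add) (auto simp: less_top[symmetric] top_unique)
qed

text \<open>After the exponentials have cancelled, all factors except those of \<open>a\<close> and
  \<open>b\<close> are bounded by 1, and these two decay like \<open>1 / \<bar>g\<bar>\<close>. The
  constant is uniform in \<open>v\<close>, so that the bound can be averaged over the data.\<close>

lemma Phi_prod_bound:
  "\<exists>C\<ge>0. \<forall>(v :: real ^ 'n::finite) S a b. (\<forall>i. v $ i \<noteq> 0) \<longrightarrow> a \<in> S \<longrightarrow> b \<in> S \<longrightarrow> a \<noteq> b \<longrightarrow>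
    (\<integral>\<^sup>+g. ennreal (norm (Phi_prod v S g)) \<partial>std_gaussian) \<le> ennreal (C * (snorm v S / (sqrt \<bar>v $ a\<bar> * sqrt \<bar>v $ b\<bar>)))"
proof -
  obtain C0 where C0: "C0 > 0" "\<And>x. (norm (half_char x))\<^sup>2 \<le> C0 / (1 + x\<^sup>2)" using half_char_bound by blast
  define K where "K = enn2real (\<integral>\<^sup>+x. ennreal (1 / (1 + x\<^sup>2)) \<partial>lborel)"
  have K0: "0 \<le> K" by (simp add: K_def)
  have K: "(\<integral>\<^sup>+x. ennreal (1 / (1 + x\<^sup>2)) \<partial>lborel) = ennreal K" using arctan_integral by (simp add: K_def)
  have Ku: "(\<integral>\<^sup>+g. ennreal (1 / (1 + (g * u)\<^sup>2)) \<partial>lborel) = ennreal (K / \<bar>u\<bar>)" if u: "u \<noteq> 0" for u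
  proof -
    have "ennreal K = ennreal \<bar>u\<bar> * (\<integral>\<^sup>+g. ennreal (1 / (1 + (0 + u * g)\<^sup>2)) \<partial>lborel)"
      unfolding K[symmetric] by (rule nn_integral_real_affine) (use u in auto)
    then have e: "ennreal K = ennreal \<bar>u\<bar> * (\<integral>\<^sup>+g. ennreal (1 / (1 + (g * u)\<^sup>2)) \<partial>lborel)" by (simp add: mult.commute)
    have "(\<integral>\<^sup>+g. ennreal (1 / (1 + (g * u)\<^sup>2)) \<partial>lborel) = ennreal (1 / \<bar>u\<bar>) * ennreal K"
      unfolding e mult.assoc[symmetric] using u by (subst ennreal_mult[symmetric]) auto
    then show ?thesis using K0 by (simp add: ennreal_mult[symmetric])
  qed
  define C where "C = C0 * K / sqrt (2 * pi)"
  have "(\<integral>\<^sup>+g. ennreal (norm (Phi_prod v S g)) \<partial>std_gaussian) \<le> ennreal (C * (snorm v S / (sqrt \<bar>v $ a\<bar> * sqrt \<bar>v $ b\<bar>)))"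
    if nz: "\<forall>i. v $ i \<noteq> 0" and ab: "a \<in> S" "b \<in> S" "a \<noteq> b" for v :: "real ^ 'n" and S a b
  proof -
    have Sne: "S \<noteq> {}" using ab by auto
    let ?s = "snorm v S"
    have s: "0 < ?s" using nz Sne by (intro snorm_pos) auto
    define ua where "ua = v $ a / ?s"
    define ub where "ub = v $ b / ?s"
    have u0: "ua \<noteq> 0" "ub \<noteq> 0" using nz s by (auto simp: ua_def ub_def)
    \<comment> \<open>The weight in \<open>2 x y \<le> w x\<^sup>2 + y\<^sup>2 / w\<close> is chosen
      such that both integrals, \<open>w * (K / \<bar>ua\<bar>)\<close> and
      \<open>(1 / w) * (K / \<bar>ub\<bar>)\<close>, become equal and only square roots of the
      entries occur in the denominator.\<close>
    define w where "w = sqrt \<bar>ua\<bar> / sqrt \<bar>ub\<bar>"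
    have w: "0 < w" using u0 by (simp add: w_def)
    have pw: "std_normal_density g * norm (Phi_prod v S g) \<le>
       C0 / (2 * sqrt (2 * pi)) * (w * (1 / (1 + (g * ua)\<^sup>2)) + (1 / w) * (1 / (1 + (g * ub)\<^sup>2)))" for g
    proof -
      let ?x = "norm (half_char (g * ua))" and ?y = "norm (half_char (g * ub))"
      have "norm (\<Prod>i\<in>S. half_char (g * v $ i / ?s)) = (\<Prod>i\<in>S. norm (half_char (g * v $ i / ?s)))" by (rule prod_norm[symmetric])
      also have "\<dots> = (\<Prod>i\<in>{a, b}. norm (half_char (g * v $ i / ?s))) * (\<Prod>i\<in>S - {a, b}. norm (half_char (g * v $ i / ?s)))"
        using ab by (subst prod.subset_diff[of "{a, b}" S]) (auto simp: mult.commute)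
      also have "\<dots> \<le> (\<Prod>i\<in>{a, b}. norm (half_char (g * v $ i / ?s))) * 1"
        by (intro mult_left_mono prod_le_1) (auto intro: half_char_norm_le_1 prod_nonneg)
      also have "\<dots> = ?x * ?y" using ab by (simp add: ua_def ub_def)
      also have "\<dots> \<le> (w * ?x\<^sup>2 + (1 / w) * ?y\<^sup>2) / 2"
      proof -
        have "0 \<le> (sqrt w * ?x - ?y / sqrt w)\<^sup>2" by simp
        also have "\<dots> = w * ?x\<^sup>2 + (1 / w) * ?y\<^sup>2 - 2 * (?x * ?y)"
          using w by (simp add: power2_diff power_mult_distrib power_divide)
        finally show ?thesis by simp
      qed
      also have "\<dots> \<le> (w * (C0 / (1 + (g * ua)\<^sup>2)) + (1 / w) * (C0 / (1 + (g * ub)\<^sup>2))) / 2"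
        using w C0(2)[of "g * ua"] C0(2)[of "g * ub"] by (intro divide_right_mono add_mono mult_left_mono) auto
      finally have h: "norm (\<Prod>i\<in>S. half_char (g * v $ i / ?s)) \<le> (w * (C0 / (1 + (g * ua)\<^sup>2)) + (1 / w) * (C0 / (1 + (g * ub)\<^sup>2))) / 2" .
      have "exp (- (g\<^sup>2 / 2)) * exp (g\<^sup>2 / 2) = 1" by (simp add: exp_minus)
      then have "std_normal_density g * norm (Phi_prod v S g) = norm (\<Prod>i\<in>S. half_char (g * v $ i / ?s)) / sqrt (2 * pi)"
        unfolding Phi_prod_half_char[OF nz[rule_format] Sne] by (simp add: norm_mult std_normal_density_alt)
      also have "\<dots> \<le> ((w * (C0 / (1 + (g * ua)\<^sup>2)) + (1 / w) * (C0 / (1 + (g * ub)\<^sup>2))) / 2) / sqrt (2 * pi)"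
        by (rule divide_right_mono[OF h]) simp
      also have "\<dots> = C0 / (2 * sqrt (2 * pi)) * (w * (1 / (1 + (g * ua)\<^sup>2)) + (1 / w) * (1 / (1 + (g * ub)\<^sup>2)))"
        by (simp add: add_divide_distrib ring_distribs mult_ac)
      finally show ?thesis .
    qed
    let ?c = "C0 / (2 * sqrt (2 * pi))"
    have c0: "0 \<le> ?c" using C0 by simp
    have "(\<integral>\<^sup>+g. ennreal (norm (Phi_prod v S g)) \<partial>std_gaussian) = (\<integral>\<^sup>+g. ennreal (std_normal_density g * norm (Phi_prod v S g)) \<partial>lborel)"
      unfolding std_gaussian_real using Phi_prod_measurable[OF nz[rule_format] Sne]
      by (subst nn_integral_density) (auto simp: ennreal_mult)
    also have "\<dots> \<le> (\<integral>\<^sup>+g. ennreal ?c * (ennreal w * ennreal (1 / (1 + (g * ua)\<^sup>2)) + ennreal (1 / w) * ennreal (1 / (1 + (g * ub)\<^sup>2))) \<partial>lborel)"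
    proof (rule nn_integral_mono)
      fix g
      have "ennreal ?c * (ennreal w * ennreal (1 / (1 + (g * ua)\<^sup>2)) + ennreal (1 / w) * ennreal (1 / (1 + (g * ub)\<^sup>2))) =
         ennreal (?c * (w * (1 / (1 + (g * ua)\<^sup>2)) + (1 / w) * (1 / (1 + (g * ub)\<^sup>2))))"
        using w c0 by (simp add: ennreal_mult[symmetric] ennreal_plus[symmetric] del: ennreal_plus)
      then show "ennreal (std_normal_density g * norm (Phi_prod v S g)) \<le>
         ennreal ?c * (ennreal w * ennreal (1 / (1 + (g * ua)\<^sup>2)) + ennreal (1 / w) * ennreal (1 / (1 + (g * ub)\<^sup>2)))"
        using pw[of g] by (simp add: ennreal_leI)
    qed
    also have "\<dots> = ennreal ?c * (ennreal w * ennreal (K / \<bar>ua\<bar>) + ennreal (1 / w) * ennreal (K / \<bar>ub\<bar>))"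
      by (simp add: nn_integral_cmult nn_integral_add Ku u0)
    also have "\<dots> = ennreal (?c * (w * (K / \<bar>ua\<bar>) + (1 / w) * (K / \<bar>ub\<bar>)))"
      using w c0 K0 by (simp add: ennreal_mult[symmetric] ennreal_plus[symmetric] del: ennreal_plus)
    also have "?c * (w * (K / \<bar>ua\<bar>) + (1 / w) * (K / \<bar>ub\<bar>)) = C * (?s / (sqrt \<bar>v $ a\<bar> * sqrt \<bar>v $ b\<bar>))"
    proof -
      have q: "x / \<bar>y\<bar> = x / (sqrt \<bar>y\<bar> * sqrt \<bar>y\<bar>)" for x y :: real by simp
      have 1: "w * (K / \<bar>ua\<bar>) = K / (sqrt \<bar>ua\<bar> * sqrt \<bar>ub\<bar>)"
        using u0 unfolding w_def q[of K ua] by (simp add: field_simps)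
      have 2: "(1 / w) * (K / \<bar>ub\<bar>) = K / (sqrt \<bar>ua\<bar> * sqrt \<bar>ub\<bar>)"
        using u0 unfolding w_def q[of K ub] by (simp add: field_simps)
      have 3: "sqrt \<bar>ua\<bar> * sqrt \<bar>ub\<bar> = sqrt \<bar>v $ a\<bar> * sqrt \<bar>v $ b\<bar> / ?s"
        using s by (simp add: ua_def ub_def real_sqrt_divide abs_divide)
      show ?thesis unfolding 1 2 3 by (simp add: C_def field_simps)
    qed
    finally show ?thesis .
  qed
  moreover have "0 \<le> C" using C0 K0 by (simp add: C_def)
  ultimately show ?thesis by blast
qed

section \<open>The law of the signed covariates\<close>

text \<open>For a unit vector \<open>b\<close>, the conditional probability of \<open>B\<close>
  under the standard Gaussian law given that the component along \<open>b\<close> is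
  \<open>s\<close>.\<close>

definition fibre_prob :: "'a::euclidean_space \<Rightarrow> 'a set \<Rightarrow> real \<Rightarrow> real" where
  "fibre_prob b B s = measure std_gaussian {g. s *\<^sub>R b + (g - (g \<bullet> b) *\<^sub>R b) \<in> B}"

lemma fibre_prob_01: "0 \<le> fibre_prob b B s" "fibre_prob b B s \<le> 1"
proof -
  interpret g: prob_space "std_gaussian :: 'a measure" by (rule prob_space_std_gaussian)
  show "0 \<le> fibre_prob b B s" "fibre_prob b B s \<le> 1" by (simp_all add: fibre_prob_def)
qed

lemma fibre_prob_eq:
  assumes [measurable]: "B \<in> sets borel"
  shows "ennreal (fibre_prob b B s) = (\<integral>\<^sup>+g. indicator B (s *\<^sub>R b + (g - (g \<bullet> b) *\<^sub>R b)) \<partial>std_gaussian)"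
proof -
  interpret g: prob_space "std_gaussian :: 'a measure" by (rule prob_space_std_gaussian)
  have "(\<integral>\<^sup>+g. indicator B (s *\<^sub>R b + (g - (g \<bullet> b) *\<^sub>R b)) \<partial>std_gaussian) =
     (\<integral>\<^sup>+g. indicator {g. s *\<^sub>R b + (g - (g \<bullet> b) *\<^sub>R b) \<in> B} g \<partial>std_gaussian)"
    by (intro nn_integral_cong) (simp add: indicator_def)
  also have "\<dots> = ennreal (fibre_prob b B s)"
    by (subst nn_integral_indicator) (simp_all add: fibre_prob_def g.emeasure_eq_measure)
  finally show ?thesis by simp
qed

lemma fibre_prob_measurable:
  assumes [measurable]: "B \<in> sets borel"
  shows "fibre_prob b B \<in> borel_measurable borel"
proof -
  interpret g: prob_space "std_gaussian :: 'a measure" by (rule prob_space_std_gaussian)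
  have [measurable]: "(\<lambda>p. indicator B (fst p *\<^sub>R b + (snd p - (snd p \<bullet> b) *\<^sub>R b)) :: ennreal) \<in> borel_measurable (borel \<Otimes>\<^sub>M std_gaussian)"
    by (simp cong: measurable_cong_sets)
  have "(\<lambda>s. enn2real (\<integral>\<^sup>+g. indicator B (s *\<^sub>R b + (g - (g \<bullet> b) *\<^sub>R b)) \<partial>std_gaussian)) \<in> borel_measurable borel"
    using g.borel_measurable_nn_integral_fst[of "\<lambda>p. indicator B (fst p *\<^sub>R b + (snd p - (snd p \<bullet> b) *\<^sub>R b))" borel] by simp
  then show ?thesis by (simp add: fibre_prob_eq[OF assms, symmetric] fibre_prob_01)
qed

lemma fibre_prob_uminus:
  assumes [measurable]: "B \<in> sets borel"
  shows "fibre_prob b {x. - x \<in> B} s = fibre_prob b B (- s)"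
proof -
  have "ennreal (fibre_prob b {x. - x \<in> B} s) = (\<integral>\<^sup>+g. indicator B ((- s) *\<^sub>R b + (- g - (- g \<bullet> b) *\<^sub>R b)) \<partial>std_gaussian)"
    by (subst fibre_prob_eq) (auto intro!: nn_integral_cong simp: indicator_def algebra_simps)
  also have "\<dots> = ennreal (fibre_prob b B (- s))"
    unfolding fibre_prob_eq[OF assms]
    by (rule nn_integral_std_gaussian_uminus[where f = "\<lambda>g. indicator B ((- s) *\<^sub>R b + (g - (g \<bullet> b) *\<^sub>R b))"]) simp
  finally show ?thesis by (simp add: fibre_prob_01)
qed

lemma std_gaussian_fibre:
  assumes b: "norm b = 1" and [measurable]: "B \<in> sets borel" "C \<in> sets borel"
  shows "(\<integral>\<^sup>+z. indicator C (z \<bullet> b) * indicator B z \<partial>std_gaussian) =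
    (\<integral>\<^sup>+z. indicator C (z \<bullet> b) * ennreal (fibre_prob b B (z \<bullet> b)) \<partial>std_gaussian)"
proof -
  interpret op: orth_proj "\<lambda>z. (z \<bullet> b) *\<^sub>R b" by (rule outer_projection[OF b])
  have bb: "b \<bullet> b = 1" using b by (simp add: power2_norm_eq_inner[symmetric])
  have "(\<integral>\<^sup>+z. indicator C (z \<bullet> b) * indicator B z \<partial>std_gaussian) =
     (\<integral>\<^sup>+z1. \<integral>\<^sup>+z2. indicator C (((z1 \<bullet> b) *\<^sub>R b + (z2 - (z2 \<bullet> b) *\<^sub>R b)) \<bullet> b) * indicator B ((z1 \<bullet> b) *\<^sub>R b + (z2 - (z2 \<bullet> b) *\<^sub>R b)) \<partial>std_gaussian \<partial>std_gaussian)"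
    by (rule op.std_gaussian_split) simp
  also have "\<dots> = (\<integral>\<^sup>+z1. \<integral>\<^sup>+z2. indicator C (z1 \<bullet> b) * indicator B ((z1 \<bullet> b) *\<^sub>R b + (z2 - (z2 \<bullet> b) *\<^sub>R b)) \<partial>std_gaussian \<partial>std_gaussian)"
    by (simp add: inner_add_left inner_diff_left bb)
  also have "\<dots> = (\<integral>\<^sup>+z1. indicator C (z1 \<bullet> b) * ennreal (fibre_prob b B (z1 \<bullet> b)) \<partial>std_gaussian)"
    by (subst nn_integral_cmult) (simp_all add: fibre_prob_eq cong: measurable_cong_sets)
  finally show ?thesis .
qed

text \<open>Conditioning on \<open>X \<bullet> bs\<close>, both sides become the mean of the product of the conditional expectations of the two indicators.\<close>

lemma label_independence:
  fixes X :: "'w \<Rightarrow> 'a::euclidean_space"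
  assumes "prob_space M" and X[measurable]: "X \<in> borel_measurable M" and E[measurable]: "E \<in> sets M"
    and law: "distr M borel X = std_gaussian" and bs: "bs \<noteq> 0"
    and ae: "AE \<omega> in M. cond_prob_rv M X E \<omega> = cond_prob_rv M (\<lambda>\<omega>. X \<omega> \<bullet> bs) E \<omega>"
    and B[measurable]: "B \<in> sets borel"
  defines "b \<equiv> bs /\<^sub>R norm bs"
  shows "(\<integral>\<omega>. indicator E \<omega> * indicator B (X \<omega>) \<partial>M) = (\<integral>\<omega>. indicator E \<omega> * fibre_prob b B (X \<omega> \<bullet> b) \<partial>M)"
    "(\<integral>\<omega>. indicator B (X \<omega>) \<partial>M) = (\<integral>\<omega>. fibre_prob b B (X \<omega> \<bullet> b) \<partial>M)"
proof -
  interpret M: prob_space M by fact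
  have b1: "norm b = 1" using bs by (simp add: b_def)
  define F where "F = vimage_algebra (space M) (\<lambda>\<omega>. X \<omega> \<bullet> bs) borel"
  define FX where "FX = vimage_algebra (space M) X borel"
  have F: "subalgebra M F" unfolding F_def subalgebra_def by (auto simp: sets_vimage_algebra2)
  have FX: "subalgebra M FX" unfolding FX_def subalgebra_def by (auto simp: sets_vimage_algebra2)
  interpret F: finite_measure_subalgebra M F by standard (rule F)
  interpret FX: finite_measure_subalgebra M FX by standard (rule FX)
  note [measurable] = fibre_prob_measurable
  have FM: "(\<lambda>\<omega>. X \<omega> \<bullet> bs) \<in> borel_measurable F" unfolding F_def by (rule measurable_vimage_algebra1) simp
  have XM: "X \<in> borel_measurable FX" unfolding FX_def by (rule measurable_vimage_algebra1) simp
  have sc: "X \<omega> \<bullet> b = (X \<omega> \<bullet> bs) / norm bs" for \<omega> by (simp add: b_def divide_inverse mult.commute)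
  have fF: "(\<lambda>\<omega>. fibre_prob b B (X \<omega> \<bullet> b)) \<in> borel_measurable F"
    unfolding sc using FM by measurable
  have gM: "(\<lambda>\<omega>. fibre_prob b B (X \<omega> \<bullet> b)) \<in> borel_measurable M" by measurable
  have gI: "integrable M (\<lambda>\<omega>. fibre_prob b B (X \<omega> \<bullet> b))"
    by (rule M.integrable_const_bound[of _ 1]) (auto simp: fibre_prob_01)
  have iI: "integrable M (\<lambda>\<omega>. indicator B (X \<omega>) :: real)"
    by (rule M.integrable_const_bound[of _ 1]) (auto simp: indicator_def)
  \<comment> \<open>The defining property of a conditional expectation: \<open>fibre_prob\<close> is
    a version of the probability of \<open>B\<close> given \<open>X \<bullet> bs\<close>, as
    \<open>c1\<close> records.\<close>
  have key: "(\<integral>\<omega>. indicator C (X \<omega> \<bullet> bs) * indicator B (X \<omega>) \<partial>M) = (\<integral>\<omega>. indicator C (X \<omega> \<bullet> bs) * fibre_prob b B (X \<omega> \<bullet> b) \<partial>M)"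
    if C[measurable]: "C \<in> sets borel" for C :: "real set"
  proof -
    let ?C = "{t. t * norm bs \<in> C}"
    have ind: "indicator C (z \<bullet> bs) = indicator ?C (z \<bullet> b)" for z
    proof -
      have "(z \<bullet> b) * norm bs = z \<bullet> bs" using bs by (simp add: b_def field_simps)
      then show ?thesis by (simp add: indicator_def)
    qed
    have C': "?C \<in> sets borel" by measurable
    have "(\<integral>\<^sup>+\<omega>. indicator ?C (X \<omega> \<bullet> b) * indicator B (X \<omega>) \<partial>M) = (\<integral>\<^sup>+z. indicator ?C (z \<bullet> b) * indicator B z \<partial>std_gaussian)"
      unfolding law[symmetric] by (subst nn_integral_distr) auto
    also have "\<dots> = (\<integral>\<^sup>+z. indicator ?C (z \<bullet> b) * ennreal (fibre_prob b B (z \<bullet> b)) \<partial>std_gaussian)"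
      by (rule std_gaussian_fibre[OF b1 B C'])
    also have "\<dots> = (\<integral>\<^sup>+\<omega>. indicator ?C (X \<omega> \<bullet> b) * ennreal (fibre_prob b B (X \<omega> \<bullet> b)) \<partial>M)"
      unfolding law[symmetric] by (subst nn_integral_distr) auto
    finally have "(\<integral>\<^sup>+\<omega>. indicator ?C (X \<omega> \<bullet> b) * indicator B (X \<omega>) \<partial>M) = (\<integral>\<^sup>+\<omega>. indicator ?C (X \<omega> \<bullet> b) * ennreal (fibre_prob b B (X \<omega> \<bullet> b)) \<partial>M)" .
    then have "(\<integral>\<^sup>+\<omega>. ennreal (indicator ?C (X \<omega> \<bullet> b) * indicator B (X \<omega>)) \<partial>M) = (\<integral>\<^sup>+\<omega>. ennreal (indicator ?C (X \<omega> \<bullet> b) * fibre_prob b B (X \<omega> \<bullet> b)) \<partial>M)"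
      by (simp add: ennreal_mult' fibre_prob_01 ennreal_indicator)
    then show ?thesis unfolding ind
      by (simp add: integral_eq_nn_integral fibre_prob_01)
  qed
  from key[of UNIV] show "(\<integral>\<omega>. indicator B (X \<omega>) \<partial>M) = (\<integral>\<omega>. fibre_prob b B (X \<omega> \<bullet> b) \<partial>M)" by simp
  have c1: "AE \<omega> in M. real_cond_exp M F (\<lambda>\<omega>. indicator B (X \<omega>)) \<omega> = fibre_prob b B (X \<omega> \<bullet> b)"
  proof (rule F.real_cond_exp_charact)
    fix A assume "A \<in> sets F"
    then obtain C where C: "C \<in> sets borel" "A = (\<lambda>\<omega>. X \<omega> \<bullet> bs) -` C \<inter> space M"
      by (auto simp: F_def sets_vimage_algebra2)
    have "indicator A \<omega> = (indicator C (X \<omega> \<bullet> bs) :: real)" if "\<omega> \<in> space M" for \<omega>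
      using that C by (simp add: indicator_def)
    then show "(LINT \<omega>:A|M. indicator B (X \<omega>)) = (LINT \<omega>:A|M. fibre_prob b B (X \<omega> \<bullet> b))"
      using key[OF C(1)] unfolding set_lebesgue_integral_def by (simp cong: Bochner_Integration.integral_cong)
  qed (use gI iI fF in auto)
  define h where "h = cond_prob_rv M (\<lambda>\<omega>. X \<omega> \<bullet> bs) E"
  have h: "h = real_cond_exp M F (indicator E)" by (simp add: h_def cond_prob_rv_def F_def)
  have hF: "h \<in> borel_measurable F" unfolding h by simp
  have hM[measurable]: "h \<in> borel_measurable M" unfolding h by simp
  have iE: "integrable M (indicator E :: _ \<Rightarrow> real)" by (simp add: M.emeasure_eq_measure)
  have hint: "integrable M h" unfolding h by (rule F.real_cond_exp_int[OF iE])
  have "(\<integral>\<omega>. indicator B (X \<omega>) * indicator E \<omega> \<partial>M) = (\<integral>\<omega>. indicator B (X \<omega>) * real_cond_exp M FX (indicator E) \<omega> \<partial>M)"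
  proof (rule FX.real_cond_exp_intg(2)[symmetric])
    show "(\<lambda>\<omega>. indicator B (X \<omega>) :: real) \<in> borel_measurable FX" using XM by measurable
    show "integrable M (\<lambda>\<omega>. indicator B (X \<omega>) * indicator E \<omega> :: real)"
      by (rule M.integrable_const_bound[of _ 1]) (auto simp: indicator_def)
  qed simp
  \<comment> \<open>The hypothesis on the labels enters here: the probability of \<open>E\<close>
    given \<open>X\<close> is replaced by \<open>h\<close>, a function of
    \<open>X \<bullet> bs\<close>, so that the other indicator can be conditioned on
    \<open>X \<bullet> bs\<close> alone.\<close>
  also have "\<dots> = (\<integral>\<omega>. h \<omega> * indicator B (X \<omega>) \<partial>M)"
  proof (rule integral_cong_AE)
    show "AE \<omega> in M. indicator B (X \<omega>) * real_cond_exp M FX (indicator E) \<omega> = h \<omega> * indicator B (X \<omega>)"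
      using ae unfolding h_def FX_def cond_prob_rv_def by eventually_elim simp
  qed auto
  also have "\<dots> = (\<integral>\<omega>. h \<omega> * real_cond_exp M F (\<lambda>\<omega>. indicator B (X \<omega>)) \<omega> \<partial>M)"
  proof (rule F.real_cond_exp_intg(2)[symmetric, OF _ hF])
    show "integrable M (\<lambda>\<omega>. h \<omega> * indicator B (X \<omega>))"
      by (rule Bochner_Integration.integrable_bound[OF hint]) (auto simp: indicator_def)
  qed auto
  also have "\<dots> = (\<integral>\<omega>. fibre_prob b B (X \<omega> \<bullet> b) * real_cond_exp M F (indicator E) \<omega> \<partial>M)"
  proof (rule integral_cong_AE)
    show "AE \<omega> in M. h \<omega> * real_cond_exp M F (\<lambda>\<omega>. indicator B (X \<omega>)) \<omega> = fibre_prob b B (X \<omega> \<bullet> b) * real_cond_exp M F (indicator E) \<omega>"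
      using c1 unfolding h by eventually_elim simp
  qed auto
  also have "\<dots> = (\<integral>\<omega>. fibre_prob b B (X \<omega> \<bullet> b) * indicator E \<omega> \<partial>M)"
  proof (rule F.real_cond_exp_intg(2)[OF _ fF])
    show "integrable M (\<lambda>\<omega>. fibre_prob b B (X \<omega> \<bullet> b) * indicator E \<omega>)"
      by (rule Bochner_Integration.integrable_bound[OF gI]) (auto simp: indicator_def)
  qed simp
  finally show "(\<integral>\<omega>. indicator E \<omega> * indicator B (X \<omega>) \<partial>M) = (\<integral>\<omega>. indicator E \<omega> * fibre_prob b B (X \<omega> \<bullet> b) \<partial>M)"
    by (simp add: mult.commute)
qed

text \<open>Where the label is \<open>-1\<close> the set is reflected, and
  \<open>fibre_prob_uminus\<close> turns this into a change of sign of the given component. Whatever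
  the labels do, the part of the signed vector orthogonal to \<open>bs\<close> stays
  Gaussian.\<close>

lemma signed_law:
  fixes X :: "'w \<Rightarrow> 'a::euclidean_space"
  assumes "prob_space M" and X[measurable]: "X \<in> borel_measurable M" and Y[measurable]: "Y \<in> borel_measurable M"
    and Y1: "\<And>\<omega>. \<omega> \<in> space M \<Longrightarrow> Y \<omega> \<in> {-1, 1::real}"
    and law: "distr M borel X = std_gaussian" and bs: "bs \<noteq> 0"
    and ae: "AE \<omega> in M. cond_prob_rv M X {\<omega> \<in> space M. Y \<omega> = 1} \<omega> = cond_prob_rv M (\<lambda>\<omega>. X \<omega> \<bullet> bs) {\<omega> \<in> space M. Y \<omega> = 1} \<omega>"
    and B[measurable]: "B \<in> sets borel"
  shows "(\<integral>\<^sup>+\<omega>. indicator B (Y \<omega> *\<^sub>R X \<omega>) \<partial>M) = (\<integral>\<^sup>+\<omega>. ennreal (fibre_prob (bs /\<^sub>R norm bs) B (Y \<omega> * (X \<omega> \<bullet> bs) / norm bs)) \<partial>M)"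
proof -
  interpret M: prob_space M by fact
  define E where "E = {\<omega> \<in> space M. Y \<omega> = 1}"
  define b where "b = bs /\<^sub>R norm bs"
  have E[measurable]: "E \<in> sets M" unfolding E_def by measurable
  note [measurable] = fibre_prob_measurable
  let ?B = "{x. - x \<in> B}"
  have B'[measurable]: "?B \<in> sets borel" by measurable
  note L = label_independence[OF assms(1) X E law bs ae[folded E_def], folded b_def]
  have iI: "integrable M (\<lambda>\<omega>. f \<omega> * indicator C (X \<omega>) :: real)"
    if "f \<in> borel_measurable M" "\<And>\<omega>. f \<omega> \<in> {0..1}" "C \<in> sets borel" for f C
    using that by (intro M.integrable_const_bound[of _ 1]) (auto simp: indicator_def)
  have gI: "integrable M (\<lambda>\<omega>. f \<omega> * fibre_prob b C (X \<omega> \<bullet> b) :: real)"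
    if "f \<in> borel_measurable M" "\<And>\<omega>. f \<omega> \<in> {0..1}" "C \<in> sets borel" for f C
    using that by (intro M.integrable_const_bound[of _ 1]) (auto simp: fibre_prob_01 intro!: mult_le_one)
  have sc: "Y \<omega> * (X \<omega> \<bullet> bs) / norm bs = Y \<omega> * (X \<omega> \<bullet> b)" for \<omega> by (simp add: b_def divide_inverse mult.commute mult.left_commute)
  \<comment> \<open>The part with label \<open>-1\<close> is written as everything minus the part
    with label 1; these are the two cases of \<open>label_independence\<close>.\<close>
  have "(\<integral>\<omega>. (indicator B (Y \<omega> *\<^sub>R X \<omega>) :: real) \<partial>M) = (\<integral>\<omega>. indicator E \<omega> * indicator B (X \<omega>) + (indicator ?B (X \<omega>) - indicator E \<omega> * indicator ?B (X \<omega>)) \<partial>M)"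
  proof (rule Bochner_Integration.integral_cong[OF refl])
    fix \<omega> assume w: "\<omega> \<in> space M"
    from Y1[OF w] consider "Y \<omega> = 1" | "Y \<omega> = -1" by auto
    then show "indicator B (Y \<omega> *\<^sub>R X \<omega>) = (indicator E \<omega> * indicator B (X \<omega>) + (indicator ?B (X \<omega>) - indicator E \<omega> * indicator ?B (X \<omega>)) :: real)"
      by cases (simp_all add: E_def indicator_def w)
  qed
  also have "\<dots> = (\<integral>\<omega>. indicator E \<omega> * indicator B (X \<omega>) \<partial>M) + ((\<integral>\<omega>. indicator ?B (X \<omega>) \<partial>M) - (\<integral>\<omega>. indicator E \<omega> * indicator ?B (X \<omega>) \<partial>M))"
    using iI[of "indicator E" B] iI[of "indicator E" ?B] iI[of "\<lambda>_. 1" ?B] by simp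
  also have "\<dots> = (\<integral>\<omega>. indicator E \<omega> * fibre_prob b B (X \<omega> \<bullet> b) \<partial>M) + ((\<integral>\<omega>. fibre_prob b ?B (X \<omega> \<bullet> b) \<partial>M) - (\<integral>\<omega>. indicator E \<omega> * fibre_prob b ?B (X \<omega> \<bullet> b) \<partial>M))"
    by (simp only: L(1)[OF B] L(1)[OF B'] L(2)[OF B'])
  also have "\<dots> = (\<integral>\<omega>. indicator E \<omega> * fibre_prob b B (X \<omega> \<bullet> b) + (fibre_prob b ?B (X \<omega> \<bullet> b) - indicator E \<omega> * fibre_prob b ?B (X \<omega> \<bullet> b)) \<partial>M)"
    using gI[of "indicator E" B] gI[of "indicator E" ?B] gI[of "\<lambda>_. 1" ?B] by simp
  also have "\<dots> = (\<integral>\<omega>. fibre_prob b B (Y \<omega> * (X \<omega> \<bullet> b)) \<partial>M)"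
  proof (rule Bochner_Integration.integral_cong[OF refl])
    fix \<omega> assume w: "\<omega> \<in> space M"
    from Y1[OF w] consider "Y \<omega> = 1" | "Y \<omega> = -1" by auto
    then show "indicator E \<omega> * fibre_prob b B (X \<omega> \<bullet> b) + (fibre_prob b ?B (X \<omega> \<bullet> b) - indicator E \<omega> * fibre_prob b ?B (X \<omega> \<bullet> b)) = fibre_prob b B (Y \<omega> * (X \<omega> \<bullet> b))"
      by cases (simp_all add: E_def indicator_def w fibre_prob_uminus)
  qed
  finally have "(\<integral>\<omega>. indicator B (Y \<omega> *\<^sub>R X \<omega>) \<partial>M) = (\<integral>\<omega>. fibre_prob b B (Y \<omega> * (X \<omega> \<bullet> b)) \<partial>M)" .
  moreover have "integrable M (\<lambda>\<omega>. indicator B (Y \<omega> *\<^sub>R X \<omega>) :: real)" "integrable M (\<lambda>\<omega>. fibre_prob b B (Y \<omega> * (X \<omega> \<bullet> b)))"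
    by (auto intro!: M.integrable_const_bound[of _ 1] simp: fibre_prob_01 indicator_def)
  ultimately have "(\<integral>\<^sup>+\<omega>. ennreal (indicator B (Y \<omega> *\<^sub>R X \<omega>)) \<partial>M) = (\<integral>\<^sup>+\<omega>. ennreal (fibre_prob b B (Y \<omega> * (X \<omega> \<bullet> b))) \<partial>M)"
    by (simp add: nn_integral_eq_integral fibre_prob_01)
  then show ?thesis unfolding sc b_def[symmetric] by (simp add: ennreal_indicator)
qed

section \<open>Rows and columns of a rotated Gaussian matrix\<close>

text \<open>\<open>H\<close> takes \<open>b\<close> to the axis \<open>i0\<close>. In the rotated
  coordinates row \<open>i\<close> has the entry \<open>w $ i\<close> at \<open>i0\<close> and the
  entries of \<open>H (G i)\<close> elsewhere, so the range of the matrix is spanned by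
  \<open>w\<close> and the other columns. With the minus sign, a separating \<beta> corresponds to a
  vector with negative entries.\<close>

lemma span_columns:
  fixes b :: "real ^ 'p::finite" and w :: "real ^ 'n::finite" and G :: "'n \<Rightarrow> real ^ 'p"
  assumes b: "norm b = 1" and H: "H = householder (b - axis i0 1)"
  shows "span (insert w ((\<lambda>k. \<chi> i. H (G i) $ k) ` (UNIV - {i0}))) =
    range (\<lambda>\<beta>. \<chi> i. - ((w $ i *\<^sub>R b + (G i - (G i \<bullet> b) *\<^sub>R b)) \<bullet> \<beta>))"
proof -
  define T where "T = (\<lambda>\<beta>. (\<chi> i. - ((w $ i *\<^sub>R b + (G i - (G i \<bullet> b) *\<^sub>R b)) \<bullet> \<beta>)) :: real ^ 'n)"
  let ?V = "insert w ((\<lambda>k. \<chi> i. H (G i) $ k) ` (UNIV - {i0}))"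
  have bb: "b \<bullet> b = 1" using b by (simp add: power2_norm_eq_inner[symmetric])
  have Hb: "H b = axis i0 1" unfolding H by (rule householder_swap) (simp add: b)
  have HH: "H (H x) = x" for x unfolding H by (rule householder_invol)
  have Hs: "x \<bullet> H y = H x \<bullet> y" for x y
    unfolding H householder_def by (simp only: inner_diff_left inner_diff_right inner_commute inner_scaleR_left inner_scaleR_right times_divide_eq_left mult.assoc mult.left_commute) (simp add: mult.commute mult.left_commute inner_commute)
  have linT: "linear T" unfolding T_def
    by (rule linearI) (auto simp: vec_eq_iff inner_add_right algebra_simps)
  have Tb: "T b = - w" by (simp add: T_def vec_eq_iff inner_add_left inner_diff_left bb)
  have Te: "T (H (axis k 1)) = - (\<chi> i. H (G i) $ k)" if "k \<noteq> i0" for k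
  proof -
    have "b \<bullet> H (axis k 1) = 0" using that by (simp add: Hs Hb inner_axis_axis)
    moreover have "G i \<bullet> H (axis k 1) = H (G i) $ k" for i by (simp add: Hs inner_axis)
    ultimately show ?thesis by (simp add: T_def vec_eq_iff inner_add_left inner_diff_left)
  qed
  have "range T \<subseteq> span ?V"
  proof clarify
    fix \<beta>
    let ?c = "H \<beta>"
    have lin: "linear (\<lambda>c. T (H c))" unfolding H using linear_compose[OF householder_linear linT] by (simp add: o_def)
    have "T \<beta> = T (H (\<Sum>k\<in>UNIV. ?c $ k *\<^sub>R axis k 1))"
      using basis_expansion[of ?c] by (simp add: HH scalar_mult_eq_scaleR)
    also have "\<dots> = (\<Sum>k\<in>UNIV. ?c $ k *\<^sub>R T (H (axis k 1)))"
      by (simp add: linear_sum[OF lin] linear_scale[OF lin] o_def)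
    also have "\<dots> \<in> span ?V"
    proof (intro span_sum span_scale)
      fix k :: 'p
      show "T (H (axis k 1)) \<in> span ?V"
      proof (cases "k = i0")
        case True
        then have "T (H (axis k 1)) = - w" using Hb HH[of b] Tb by simp
        then show ?thesis by (simp add: span_base span_neg)
      next
        case False
        then show ?thesis by (simp add: Te span_base span_neg)
      qed
    qed
    finally show "T \<beta> \<in> span ?V" .
  qed
  moreover have "span ?V \<subseteq> range T"
  proof (rule span_minimal)
    show "subspace (range T)" using linear_subspace_image[OF linT subspace_UNIV] .
    have "w = T (- b)" using Tb by (simp add: linear_neg[OF linT])
    moreover have "(\<chi> i. H (G i) $ k) = T (- H (axis k 1))" if "k \<noteq> i0" for k
      using Te[OF that] by (simp add: linear_neg[OF linT])
    ultimately show "?V \<subseteq> range T" by auto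
  qed
  ultimately show ?thesis unfolding T_def by blast
qed

lemma separable_iff_upper_cone:
  fixes b :: "real ^ 'p::finite" and w :: "real ^ 'n::finite" and G :: "'n \<Rightarrow> real ^ 'p"
  assumes b: "norm b = 1" and H: "H = householder (b - axis i0 1)" and "set is = UNIV - {i0}"
  shows "(\<exists>\<beta>. \<forall>i. (w $ i *\<^sub>R b + (G i - (G i \<bullet> b) *\<^sub>R b)) \<bullet> \<beta> > 0) \<longleftrightarrow>
    0 \<in> upper_cone_int (set (map (\<lambda>k. \<chi> i. H (G i) $ k) is @ [w]))"
proof -
  have e: "set (map (\<lambda>k. \<chi> i. H (G i) $ k) is @ [w]) = insert w ((\<lambda>k. \<chi> i. H (G i) $ k) ` (UNIV - {i0}))"
    by (simp add: assms(3))
  show ?thesis unfolding e upper_cone_int_def span_columns[OF b H]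
  proof
    assume "\<exists>\<beta>. \<forall>i. (w $ i *\<^sub>R b + (G i - (G i \<bullet> b) *\<^sub>R b)) \<bullet> \<beta> > 0"
    then obtain \<beta> where "\<forall>i. (w $ i *\<^sub>R b + (G i - (G i \<bullet> b) *\<^sub>R b)) \<bullet> \<beta> > 0" ..
    then show "0 \<in> {z. \<exists>u\<in>range (\<lambda>\<beta>. \<chi> i. - ((w $ i *\<^sub>R b + (G i - (G i \<bullet> b) *\<^sub>R b)) \<bullet> \<beta>)). \<forall>i. u $ i < z $ i}"
      by (intro CollectI bexI[OF _ rangeI[of _ \<beta>]]) simp
  qed auto
qed

text \<open>\<open>K\<close> rotates every row and transposes. It is an isometry between spaces of
  matrices, so the columns are again independent standard Gaussian vectors; the event does not
  involve column \<open>i0\<close>, which is integrated out.\<close>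

lemma separable_prob:
  fixes b :: "real ^ 'p::finite" and w :: "real ^ 'n::finite" and "is" :: "'p list"
  assumes b: "norm b = 1" and "is": "set is = UNIV - {i0}"
  shows "emeasure (gauss_fam UNIV) {G. \<exists>\<beta>. \<forall>i. (w $ i *\<^sub>R b + (G i - (G i \<bullet> b) *\<^sub>R b)) \<bullet> \<beta> > 0} = ennreal (sep_prob w is)"
    and "{G. \<exists>\<beta>. \<forall>i. (w $ i *\<^sub>R b + (G i - (G i \<bullet> b) *\<^sub>R b)) \<bullet> \<beta> > 0} \<in> sets (gauss_fam (UNIV :: 'n set))"
proof -
  interpret P: prob_space "gauss_fam (set is) :: ('p \<Rightarrow> real^'n) measure" by (rule prob_space_gauss_fam)
  interpret g: prob_space "std_gaussian :: (real^'n) measure" by (rule prob_space_std_gaussian)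
  define H where "H = householder (b - axis i0 1)"
  define K where "K = (\<lambda>X :: (real^'p)^'n. (\<chi> k. \<chi> i. H (X $ i) $ k) :: (real^'n)^'p)"
  define Q where "Q = {Y :: (real^'n)^'p. 0 \<in> upper_cone_int (set (map (\<lambda>k. Y $ k) is @ [w]))}"
  have linH: "linear H" unfolding H_def by (rule householder_linear)
  have nrmH: "norm (H x) = norm x" for x unfolding H_def by (rule householder_norm)
  have HH: "H (H x) = x" for x unfolding H_def by (rule householder_invol)
  have linK: "linear K" unfolding K_def
    by (rule linearI) (auto simp: vec_eq_iff linear_add[OF linH] linear_scale[OF linH])
  have nrmK: "norm (K X) = norm X" for X
  proof -
    have "(norm (K X))\<^sup>2 = (\<Sum>k\<in>UNIV. \<Sum>i\<in>UNIV. (H (X $ i) $ k)\<^sup>2)"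
      unfolding power2_norm_eq_inner by (simp add: K_def inner_vec_def power2_eq_square)
    also have "\<dots> = (\<Sum>i\<in>UNIV. \<Sum>k\<in>UNIV. (H (X $ i) $ k)\<^sup>2)" by (rule sum.swap)
    also have "\<dots> = (\<Sum>i\<in>UNIV. (norm (H (X $ i)))\<^sup>2)"
      unfolding power2_norm_eq_inner by (simp add: inner_vec_def power2_eq_square)
    also have "\<dots> = (norm X)\<^sup>2"
      unfolding nrmH unfolding power2_norm_eq_inner by (simp add: inner_vec_def)
    finally show ?thesis by simp
  qed
  have surjK: "surj K"
  proof (rule surjI)
    fix Y show "K (\<chi> i. H (\<chi> k. Y $ k $ i)) = Y" by (simp add: K_def HH vec_eq_iff)
  qed
  have KM[measurable]: "K \<in> borel_measurable borel" by (rule linear_borel_measurable[OF linK])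
  have QM[measurable]: "Q \<in> sets borel"
  proof -
    let ?fs = "map (\<lambda>k Y. Y $ k) is @ [\<lambda>_ :: (real^'n)^'p. w]"
    have "{Y \<in> space borel. (0 :: real^'n) \<in> upper_cone_int ((\<lambda>f. f Y) ` set ?fs)} \<in> sets borel"
      by (rule upper_cone_int_measurable) (auto intro!: borel_measurable_continuous_onI continuous_intros)
    moreover have "set (map (\<lambda>k. Y $ k) is @ [w]) = (\<lambda>f. f Y) ` set ?fs" for Y :: "(real^'n)^'p" by force
    ultimately show ?thesis unfolding Q_def by simp
  qed
  have vl: "vec_lambda \<in> borel_measurable (gauss_fam UNIV :: ('i::finite \<Rightarrow> 'e::euclidean_space) measure)"
    by (subst borel_measurable_euclidean_space)
      (auto simp: Basis_vec_def inner_axis intro!: borel_measurable_inner gauss_fam_measurable_comp)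
  note [measurable] = vl
  have e: "{G. \<exists>\<beta>. \<forall>i. (w $ i *\<^sub>R b + (G i - (G i \<bullet> b) *\<^sub>R b)) \<bullet> \<beta> > 0} = {G \<in> space (gauss_fam UNIV). vec_lambda G \<in> K -` Q}"
    unfolding separable_iff_upper_cone[OF b H_def "is"] by (auto simp: K_def Q_def space_PiM space_std_gaussian)
  have KQ[measurable]: "K -` Q \<in> sets borel" using measurable_sets_borel[OF KM QM] .
  show "{G. \<exists>\<beta>. \<forall>i. (w $ i *\<^sub>R b + (G i - (G i \<bullet> b) *\<^sub>R b)) \<bullet> \<beta> > 0} \<in> sets (gauss_fam (UNIV :: 'n set))"
    unfolding e by measurable
  have i0: "i0 \<notin> set is" "insert i0 (set is) = UNIV" using "is" by auto
  have QV: "(\<lambda>G. indicator Q (vec_lambda G) :: ennreal) \<in> borel_measurable (gauss_fam (insert i0 (set is)))"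
    unfolding i0(2) by measurable
  have "emeasure (gauss_fam UNIV) {G. \<exists>\<beta>. \<forall>i. (w $ i *\<^sub>R b + (G i - (G i \<bullet> b) *\<^sub>R b)) \<bullet> \<beta> > 0} =
     emeasure (distr (gauss_fam UNIV) borel vec_lambda) (K -` Q)"
    unfolding e by (subst emeasure_distr[OF vl KQ]) (auto intro!: arg_cong[where f = "emeasure _"])
  also have "\<dots> = (\<integral>\<^sup>+X. indicator Q (K X) \<partial>std_gaussian)"
  proof -
    have "(\<integral>\<^sup>+X. indicator Q (K X) \<partial>std_gaussian) = (\<integral>\<^sup>+X. indicator (K -` Q) X \<partial>(std_gaussian :: ((real^'p)^'n) measure))"
      by (intro nn_integral_cong) (simp add: indicator_def)
    also have "\<dots> = emeasure std_gaussian (K -` Q)" by (rule nn_integral_indicator) simp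
    finally show ?thesis unfolding std_gaussian_vec by simp
  qed
  also have "\<dots> = (\<integral>\<^sup>+Y. indicator Q Y \<partial>std_gaussian)"
    by (rule nn_integral_isometry_std_gaussian[OF linK nrmK surjK]) simp
  also have "\<dots> = (\<integral>\<^sup>+Y. indicator Q Y \<partial>distr (gauss_fam UNIV) borel vec_lambda)"
    by (simp only: std_gaussian_vec)
  also have "\<dots> = (\<integral>\<^sup>+G. indicator Q (vec_lambda G) \<partial>gauss_fam (insert i0 (set is)))"
    unfolding i0(2) by (subst nn_integral_distr[OF vl]) auto
  also have "\<dots> = (\<integral>\<^sup>+G. \<integral>\<^sup>+g. indicator Q (vec_lambda (G(i0 := g))) \<partial>std_gaussian \<partial>gauss_fam (set is))"
    by (rule nn_integral_gauss_fam_insert[OF _ i0(1) QV]) simp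
  also have "\<dots> = (\<integral>\<^sup>+G. indicator {G \<in> space (gauss_fam (set is)). 0 \<in> upper_cone_int (set (map G is @ [w]))} G \<partial>gauss_fam (set is))"
  proof (rule nn_integral_cong)
    fix G :: "'p \<Rightarrow> real^'n" assume "G \<in> space (gauss_fam (set is))"
    moreover have "map (\<lambda>k. vec_lambda (G(i0 := g)) $ k) is = map G is" for g using map_upd_notin[OF i0(1), of G g] by (simp add: fun_upd_def)
    ultimately show "(\<integral>\<^sup>+g. indicator Q (vec_lambda (G(i0 := g))) \<partial>std_gaussian) =
       indicator {G \<in> space (gauss_fam (set is)). 0 \<in> upper_cone_int (set (map G is @ [w]))} G"
      unfolding Q_def using g.emeasure_space_1 by (simp add: indicator_def)
  qed
  also have "\<dots> = ennreal (sep_prob w is)"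
  proof (subst nn_integral_indicator)
    show "{G \<in> space (gauss_fam (set is)). 0 \<in> upper_cone_int (set (map G is @ [w]))} \<in> sets (gauss_fam (set is))"
      using upper_cone_int_measurable_fam[of "is" "set is" "\<lambda>_. 0" "gauss_fam (set is)" "\<lambda>G. G" w] by simp
  qed (simp add: sep_prob_def P.emeasure_eq_measure)
  finally show "emeasure (gauss_fam UNIV) {G. \<exists>\<beta>. \<forall>i. (w $ i *\<^sub>R b + (G i - (G i \<bullet> b) *\<^sub>R b)) \<bullet> \<beta> > 0} = ennreal (sep_prob w is)" .
qed

section \<open>Independence and the joint law of the signed covariates\<close>

lemma (in prob_space) indep_vars_reindex:
  assumes ind: "indep_vars M' X I" and h: "inj_on h K" "h ` K \<subseteq> I"
  shows "indep_vars (\<lambda>k. M' (h k)) (\<lambda>k. X (h k)) K"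
  unfolding indep_vars_def2 indep_sets_def
proof (intro conjI ballI allI impI)
  fix k assume "k \<in> K"
  then have hk: "h k \<in> I" using h by auto
  then show m: "random_variable (M' (h k)) (X (h k))" using ind by (auto simp: indep_vars_def2)
  then show "{X (h k) -` A \<inter> space M |A. A \<in> sets (M' (h k))} \<subseteq> events" by auto
next
  fix J A assume J: "J \<subseteq> K" "J \<noteq> {}" "finite J" and A: "A \<in> (\<Pi> k\<in>J. {X (h k) -` A \<inter> space M |A. A \<in> sets (M' (h k))})"
  define g where "g = the_inv_into J h"
  have inj: "inj_on h J" using h(1) J(1) by (rule inj_on_subset)
  have g: "g (h k) = k" if "k \<in> J" for k unfolding g_def using inj that by (rule the_inv_into_f_f)
  have "prob (\<Inter>j\<in>h ` J. A (g j)) = (\<Prod>j\<in>h ` J. prob (A (g j)))"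
  proof -
    have "indep_sets (\<lambda>i. {X i -` A \<inter> space M |A. A \<in> sets (M' i)}) I" using ind by (simp add: indep_vars_def2)
    moreover have "h ` J \<subseteq> I" "h ` J \<noteq> {}" "finite (h ` J)" using J h by auto
    moreover have "(\<lambda>j. A (g j)) \<in> (\<Pi> j\<in>h ` J. {X j -` A \<inter> space M |A. A \<in> sets (M' j)})"
      using A g by (auto simp: Pi_iff)
    ultimately show ?thesis unfolding indep_sets_def by blast
  qed
  then show "prob (\<Inter>j\<in>J. A j) = (\<Prod>j\<in>J. prob (A j))"
    by (simp add: prod.reindex[OF inj] g cong: INF_cong_simp)
qed

lemma emeasure_distr_nn_integral:
  assumes f: "f \<in> measurable M N" and A: "A \<in> sets N"
  shows "emeasure (distr M N f) A = (\<integral>\<^sup>+x. indicator A (f x) \<partial>M)"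
proof -
  have "emeasure (distr M N f) A = (\<integral>\<^sup>+x. indicator A x \<partial>distr M N f)" using A by (simp add: nn_integral_indicator)
  also have "\<dots> = (\<integral>\<^sup>+x. indicator A (f x) \<partial>M)" by (rule nn_integral_distr[OF f]) (use A in auto)
  finally show ?thesis .
qed

text \<open>Both laws are measures on the product space and are compared on boxes. There the
  integral over \<open>G\<close> factorises into fibre probabilities, which are functions of the
  independent \<open>V i\<close>, and \<open>law\<close> treats each factor.\<close>

lemma joint_law:
  fixes Z :: "'n::finite \<Rightarrow> 'w \<Rightarrow> 'a::euclidean_space" and V :: "'n \<Rightarrow> 'w \<Rightarrow> real"
  assumes "prob_space M" and Z: "prob_space.indep_vars M (\<lambda>_. borel) Z UNIV" and V: "prob_space.indep_vars M (\<lambda>_. borel) V UNIV"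
    and law: "\<And>i B. B \<in> sets borel \<Longrightarrow> (\<integral>\<^sup>+\<omega>. indicator B (Z i \<omega>) \<partial>M) = (\<integral>\<^sup>+\<omega>. ennreal (fibre_prob b B (V i \<omega>)) \<partial>M)"
    and E: "E \<in> sets (\<Pi>\<^sub>M i\<in>(UNIV :: 'n set). (borel :: 'a measure))"
  shows "(\<integral>\<^sup>+\<omega>. indicator E (\<lambda>i. Z i \<omega>) \<partial>M) =
    (\<integral>\<^sup>+\<omega>. \<integral>\<^sup>+G. indicator E (\<lambda>i. V i \<omega> *\<^sub>R b + (G i - (G i \<bullet> b) *\<^sub>R b)) \<partial>gauss_fam UNIV \<partial>M)"
proof -
  interpret M: prob_space M by fact
  interpret G: prob_space "gauss_fam UNIV :: ('n \<Rightarrow> 'a) measure" by (rule prob_space_gauss_fam)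
  interpret g: prob_space "std_gaussian :: 'a measure" by (rule prob_space_std_gaussian)
  interpret Gs: product_sigma_finite "\<lambda>_::'n. std_gaussian :: 'a measure" ..
  let ?P = "\<Pi>\<^sub>M i\<in>(UNIV :: 'n set). (borel :: 'a measure)"
  have Zm[measurable]: "Z i \<in> borel_measurable M" for i using Z by (auto simp: M.indep_vars_def)
  have Vm[measurable]: "V i \<in> borel_measurable M" for i using V by (auto simp: M.indep_vars_def)
  interpret D: prob_space "distr M borel (Z i)" for i by (rule M.prob_space_distr) simp
  interpret Ds: product_sigma_finite "\<lambda>i. distr M borel (Z i)" ..
  define f where "f = (\<lambda>(\<omega>, G :: 'n \<Rightarrow> 'a). \<lambda>i. V i \<omega> *\<^sub>R b + (G i - (G i \<bullet> b) *\<^sub>R b))"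
  have comp[measurable]: "(\<lambda>p. (snd p :: 'n \<Rightarrow> 'a) i) \<in> borel_measurable (M \<Otimes>\<^sub>M gauss_fam UNIV)" for i
    by (rule measurable_compose[OF measurable_snd gauss_fam_measurable_comp]) simp
  have comp'[measurable]: "(\<lambda>G :: 'n \<Rightarrow> 'a. G i) \<in> borel_measurable (gauss_fam UNIV)" for i
    by (rule gauss_fam_measurable_comp) simp
  have f[measurable]: "f \<in> measurable (M \<Otimes>\<^sub>M gauss_fam UNIV) ?P"
    unfolding f_def split_beta' by (rule measurable_PiM_single') auto
  have Z': "(\<lambda>\<omega> i. Z i \<omega>) \<in> measurable M ?P" by (rule measurable_PiM_single') auto
  have "distr (M \<Otimes>\<^sub>M gauss_fam UNIV) ?P f = (\<Pi>\<^sub>M i\<in>UNIV. distr M borel (Z i))"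
  proof (rule Ds.PiM_eqI)
    show "sets (distr (M \<Otimes>\<^sub>M gauss_fam UNIV) ?P f) = sets (\<Pi>\<^sub>M i\<in>UNIV. distr M borel (Z i))"
      by (simp cong: sets_PiM_cong)
    fix A :: "'n \<Rightarrow> 'a set" assume "\<And>i. i \<in> UNIV \<Longrightarrow> A i \<in> sets (distr M borel (Z i))"
    then have A[measurable]: "A i \<in> sets borel" for i by simp
    have AE: "Pi\<^sub>E UNIV A \<in> sets ?P" by (rule sets_PiM_I_finite) auto
    have iv: "M.indep_vars (\<lambda>_. borel) (\<lambda>i \<omega>. ennreal (fibre_prob b (A i) (V i \<omega>))) UNIV"
    proof -
      have "M.indep_vars (\<lambda>_. borel) (\<lambda>i. (\<lambda>s. ennreal (fibre_prob b (A i) s)) \<circ> V i) UNIV"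
        by (rule M.indep_vars_compose[OF V]) (intro measurable_compose[OF fibre_prob_measurable measurable_ennreal] A)
      then show ?thesis by (simp add: o_def)
    qed
    have "emeasure (distr (M \<Otimes>\<^sub>M gauss_fam UNIV) ?P f) (Pi\<^sub>E UNIV A) = (\<integral>\<^sup>+p. indicator (Pi\<^sub>E UNIV A) (f p) \<partial>(M \<Otimes>\<^sub>M gauss_fam UNIV))"
      by (rule emeasure_distr_nn_integral[OF f AE])
    also have "\<dots> = (\<integral>\<^sup>+\<omega>. \<integral>\<^sup>+G. indicator (Pi\<^sub>E UNIV A) (f (\<omega>, G)) \<partial>gauss_fam UNIV \<partial>M)"
      using AE by (intro G.nn_integral_fst[symmetric]) measurable
    also have "\<dots> = (\<integral>\<^sup>+\<omega>. \<integral>\<^sup>+G. (\<Prod>i\<in>UNIV. indicator (A i) (V i \<omega> *\<^sub>R b + (G i - (G i \<bullet> b) *\<^sub>R b))) \<partial>gauss_fam UNIV \<partial>M)"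
      by (intro nn_integral_cong) (auto simp: f_def indicator_def PiE_def Pi_iff prod_eq_1_iff)
    also have "\<dots> = (\<integral>\<^sup>+\<omega>. (\<Prod>i\<in>UNIV. \<integral>\<^sup>+g. indicator (A i) (V i \<omega> *\<^sub>R b + (g - (g \<bullet> b) *\<^sub>R b)) \<partial>std_gaussian) \<partial>M)"
      by (intro nn_integral_cong Gs.product_nn_integral_prod) (simp_all cong: measurable_cong_sets)
    also have "\<dots> = (\<integral>\<^sup>+\<omega>. (\<Prod>i\<in>UNIV. ennreal (fibre_prob b (A i) (V i \<omega>))) \<partial>M)"
      by (simp add: fibre_prob_eq)
    also have "\<dots> = (\<Prod>i\<in>UNIV. \<integral>\<^sup>+\<omega>. ennreal (fibre_prob b (A i) (V i \<omega>)) \<partial>M)"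
      by (rule M.indep_vars_nn_integral[OF _ iv]) auto
    also have "\<dots> = (\<Prod>i\<in>UNIV. emeasure (distr M borel (Z i)) (A i))"
    proof (rule prod.cong[OF refl])
      fix i
      have "emeasure (distr M borel (Z i)) (A i) = (\<integral>\<^sup>+\<omega>. indicator (A i) (Z i \<omega>) \<partial>M)"
        by (rule emeasure_distr_nn_integral[OF Zm A])
      then show "(\<integral>\<^sup>+\<omega>. ennreal (fibre_prob b (A i) (V i \<omega>)) \<partial>M) = emeasure (distr M borel (Z i)) (A i)"
        using law[OF A] by simp
    qed
    finally show "emeasure (distr (M \<Otimes>\<^sub>M gauss_fam UNIV) ?P f) (Pi\<^sub>E UNIV A) = (\<Prod>i\<in>UNIV. emeasure (distr M borel (Z i)) (A i))" .
  qed simp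
  also have "\<dots> = distr M ?P (\<lambda>\<omega> i. Z i \<omega>)"
    using Z M.indep_vars_iff_distr_eq_PiM'[of UNIV Z "\<lambda>_. borel"] by (simp add: restrict_def)
  finally have "(\<integral>\<^sup>+p. indicator E (f p) \<partial>(M \<Otimes>\<^sub>M gauss_fam UNIV)) = (\<integral>\<^sup>+\<omega>. indicator E (\<lambda>i. Z i \<omega>) \<partial>M)"
    by (simp only: emeasure_distr_nn_integral[OF f E, symmetric] emeasure_distr_nn_integral[OF Z' E, symmetric])
  moreover have "(\<integral>\<^sup>+p. indicator E (f p) \<partial>(M \<Otimes>\<^sub>M gauss_fam UNIV)) = (\<integral>\<^sup>+\<omega>. \<integral>\<^sup>+G. indicator E (f (\<omega>, G)) \<partial>gauss_fam UNIV \<partial>M)"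
    by (intro G.nn_integral_fst[symmetric] measurable_compose[OF f borel_measurable_indicator[OF E]])
  ultimately show ?thesis by (simp add: f_def)
qed

section \<open>The separation model\<close>

lemma open_positive_inner:
  fixes c :: "'n::finite \<Rightarrow> 'a::euclidean_space"
  shows "open {Z :: 'n \<Rightarrow> 'a. \<forall>i\<in>S. Z i \<bullet> c i > 0}"
proof -
  have "open {Z :: 'n \<Rightarrow> 'a. Z i \<bullet> c i > 0}" for i
    by (intro open_Collect_less continuous_on_inner continuous_on_const continuous_on_product_coordinates)
  then have "open (\<Inter>i\<in>S. {Z :: 'n \<Rightarrow> 'a. Z i \<bullet> c i > 0})" by (intro open_INT) auto
  then show ?thesis by (simp add: Collect_ball_eq)
qed

lemma open_separable: "open {Z :: 'n::finite \<Rightarrow> 'a::euclidean_space. \<exists>\<beta>. \<forall>i. Z i \<bullet> \<beta> > 0}"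
  using open_positive_inner[where S = UNIV] by (intro open_Collect_ex) simp

locale separation_model = prob_space M for M :: "'w measure" +
  fixes x :: "nat \<Rightarrow> 'w \<Rightarrow> real ^ 'p::finite" and y :: "nat \<Rightarrow> 'w \<Rightarrow> real" and \<beta>s :: "real ^ 'p" and n :: nat
    and idx :: "'n::finite \<Rightarrow> nat"
  assumes pn: "CARD('p) < n" and idx: "bij_betw idx UNIV {1..n}"
    and y_values: "\<And>j \<omega>. j \<in> {1..n} \<Longrightarrow> \<omega> \<in> space M \<Longrightarrow> y j \<omega> \<in> {-1, 1}"
    and indep: "indep_vars (\<lambda>_. borel) (\<lambda>j \<omega>. (x j \<omega>, y j \<omega>)) {1..n}"
    and ident: "\<And>i j. i \<in> {1..n} \<Longrightarrow> j \<in> {1..n} \<Longrightarrow>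
           distr M borel (\<lambda>\<omega>. (x i \<omega>, y i \<omega>)) = distr M borel (\<lambda>\<omega>. (x j \<omega>, y j \<omega>))"
    and gaussian: "\<And>j. j \<in> {1..n} \<Longrightarrow> distr M borel (x j) = std_gaussian"
    and \<beta>s: "\<beta>s \<noteq> 0"
    and label: "\<And>j. j \<in> {1..n} \<Longrightarrow>
           AE \<omega> in M. cond_prob_rv M (x j) {\<omega> \<in> space M. y j \<omega> = 1} \<omega>
                    = cond_prob_rv M (\<lambda>\<omega>. x j \<omega> \<bullet> \<beta>s) {\<omega> \<in> space M. y j \<omega> = 1} \<omega>"
begin

definition b :: "real ^ 'p" where "b = \<beta>s /\<^sub>R norm \<beta>s"

definition z :: "nat \<Rightarrow> 'w \<Rightarrow> real ^ 'p" where "z j \<omega> = y j \<omega> *\<^sub>R x j \<omega>"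

definition v :: "nat \<Rightarrow> 'w \<Rightarrow> real" where "v j \<omega> = y j \<omega> * (x j \<omega> \<bullet> \<beta>s) / norm \<beta>s"

definition w :: "'w \<Rightarrow> real ^ 'n" where "w \<omega> = (\<chi> i. v (idx i) \<omega>)"

definition \<delta> :: real where "\<delta> = \<P>(\<omega> in M. y 1 \<omega> * (x 1 \<omega> \<bullet> \<beta>s) > 0)"

definition A :: "nat \<Rightarrow> 'w set" where
  "A N = {\<omega> \<in> space M. (\<forall>j\<in>{1..N}. v j \<omega> > 0) \<and> (\<forall>j\<in>{N+1..n}. v j \<omega> < 0)}"

text \<open>\<open>B\<close> is the set of indices with positive \<open>v j\<close>. Up to a null
  set, separability is the disjoint union of these events over all \<open>B\<close>.\<close>

definition separable_pattern :: "nat set \<Rightarrow> 'w set" where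
  "separable_pattern B = {\<omega> \<in> space M. (\<exists>\<beta>. \<forall>j\<in>{1..n}. y j \<omega> * (x j \<omega> \<bullet> \<beta>) > 0) \<and>
     (\<forall>j\<in>B. v j \<omega> > 0) \<and> (\<forall>j\<in>{1..n} - B. v j \<omega> < 0)}"

lemma norm_b: "norm b = 1"
  using \<beta>s by (simp add: b_def)

lemma v_eq: "v j \<omega> = z j \<omega> \<bullet> b"
  by (simp add: v_def z_def b_def divide_inverse mult.commute mult.left_commute)

lemma card_n: "CARD('n) = n"
  using bij_betw_same_card[OF idx] by simp

lemma xy_measurable: "j \<in> {1..n} \<Longrightarrow> (\<lambda>\<omega>. (x j \<omega>, y j \<omega>)) \<in> borel_measurable M"
  using indep by (auto simp: indep_vars_def2)

lemma x_measurable: "j \<in> {1..n} \<Longrightarrow> x j \<in> borel_measurable M"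
  using measurable_compose[OF xy_measurable borel_measurable_continuous_onI[OF continuous_on_fst[OF continuous_on_id]]] by simp

lemma y_measurable: "j \<in> {1..n} \<Longrightarrow> y j \<in> borel_measurable M"
  using measurable_compose[OF xy_measurable borel_measurable_continuous_onI[OF continuous_on_snd[OF continuous_on_id]]] by simp

lemma z_measurable: "j \<in> {1..n} \<Longrightarrow> z j \<in> borel_measurable M"
  unfolding z_def[abs_def] using x_measurable[of j] y_measurable[of j] by measurable

lemma v_measurable: "j \<in> {1..n} \<Longrightarrow> v j \<in> borel_measurable M"
  unfolding v_def[abs_def] using x_measurable[of j] y_measurable[of j] by measurable

lemma idx_in: "idx i \<in> {1..n}"
  using idx by (auto simp: bij_betw_def)

lemma indep_z: "bij_betw h (UNIV :: 'n set) {1..n} \<Longrightarrow> indep_vars (\<lambda>_. borel) (\<lambda>i. z (h i)) (UNIV :: 'n set)"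
proof -
  assume "bij_betw h (UNIV :: 'n set) {1..n}"
  then have h: "inj h" "range h \<subseteq> {1..n}" by (auto simp: bij_betw_def)
  have "indep_vars (\<lambda>_. borel) (\<lambda>i. (\<lambda>p. snd p *\<^sub>R fst p) \<circ> (\<lambda>\<omega>. (x (h i) \<omega>, y (h i) \<omega>))) (UNIV :: 'n set)"
    by (rule indep_vars_compose[OF indep_vars_reindex[OF indep h]])
      (intro borel_measurable_continuous_onI continuous_intros)
  then show ?thesis by (simp add: o_def z_def[abs_def])
qed

lemma indep_v_nat: "indep_vars (\<lambda>_. borel) v {1..n}"
proof -
  have "indep_vars (\<lambda>_. borel) (\<lambda>j. (\<lambda>p. snd p * (fst p \<bullet> \<beta>s) / norm \<beta>s) \<circ> (\<lambda>\<omega>. (x j \<omega>, y j \<omega>))) {1..n}"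
    by (rule indep_vars_compose[OF indep]) (use \<beta>s in \<open>intro borel_measurable_continuous_onI continuous_intros, auto\<close>)
  then show ?thesis by (simp add: o_def v_def[abs_def])
qed

lemma indep_v: "indep_vars (\<lambda>_. borel) (\<lambda>i. v (idx i)) (UNIV :: 'n set)"
  using indep_vars_reindex[OF indep_v_nat, of idx UNIV] idx by (auto simp: bij_betw_def)

lemma law_z:
  assumes "i \<in> {1..n}" "j \<in> {1..n}"
  shows "distr M borel (z i) = distr M borel (z j)"
proof -
  have m: "(\<lambda>p. snd p *\<^sub>R fst p) \<in> borel_measurable (borel :: ((real^'p) \<times> real) measure)"
    by (intro borel_measurable_continuous_onI continuous_intros)
  have "distr M borel (z i) = distr (distr M borel (\<lambda>\<omega>. (x i \<omega>, y i \<omega>))) borel (\<lambda>p. snd p *\<^sub>R fst p)" if "i \<in> {1..n}" for i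
    by (subst distr_distr[OF m xy_measurable[OF that]]) (simp add: o_def z_def[abs_def])
  from this[OF assms(1)] this[OF assms(2)] show ?thesis by (simp only: ident[OF assms])
qed

lemma z_family_measurable:
  assumes "bij_betw h (UNIV :: 'n set) {1..n}"
  shows "(\<lambda>\<omega> i. z (h i) \<omega>) \<in> measurable M (\<Pi>\<^sub>M i\<in>(UNIV :: 'n set). borel)"
  using assms by (intro measurable_PiM_single') (auto simp: bij_betw_def intro!: z_measurable)

lemma z_family_exchangeable:
  assumes "bij_betw h (UNIV :: 'n set) {1..n}" and E: "E \<in> sets (\<Pi>\<^sub>M i\<in>(UNIV :: 'n set). borel)"
  shows "prob {\<omega> \<in> space M. (\<lambda>i. z (h i) \<omega>) \<in> E} = prob {\<omega> \<in> space M. (\<lambda>i. z (idx i) \<omega>) \<in> E}"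
proof -
  have d: "distr M (\<Pi>\<^sub>M i\<in>(UNIV :: 'n set). borel) (\<lambda>\<omega> i. z (h i) \<omega>) = (\<Pi>\<^sub>M i\<in>(UNIV :: 'n set). distr M borel (z (idx undefined)))"
    if h: "bij_betw h (UNIV :: 'n set) {1..n}" for h
  proof -
    have hi: "h i \<in> {1..n}" for i using h by (auto simp: bij_betw_def)
    have "distr M (\<Pi>\<^sub>M i\<in>(UNIV :: 'n set). borel) (\<lambda>\<omega> i. z (h i) \<omega>) = (\<Pi>\<^sub>M i\<in>(UNIV :: 'n set). distr M borel (z (h i)))"
      using indep_z[OF h] z_measurable[OF hi] indep_vars_iff_distr_eq_PiM'[of UNIV "\<lambda>i. z (h i)" "\<lambda>_. borel"] by (simp add: restrict_def)
    then show ?thesis using law_z[OF hi idx_in[of undefined]] by simp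
  qed
  have "prob {\<omega> \<in> space M. (\<lambda>i. z (h i) \<omega>) \<in> E} = measure (distr M (\<Pi>\<^sub>M i\<in>(UNIV :: 'n set). borel) (\<lambda>\<omega> i. z (h i) \<omega>)) E"
    if h: "bij_betw h (UNIV :: 'n set) {1..n}" for h
    by (subst measure_distr[OF z_family_measurable[OF h] E]) (auto intro!: arg_cong[where f = prob])
  from this[OF assms(1)] this[OF idx] show ?thesis by (simp only: d[OF assms(1)] d[OF idx])
qed

definition pattern :: "'n set \<Rightarrow> ('n \<Rightarrow> real ^ 'p) set" where
  "pattern U = {Z. (\<exists>\<beta>. \<forall>i. Z i \<bullet> \<beta> > 0) \<and> (\<forall>i\<in>U. Z i \<bullet> b > 0) \<and> (\<forall>i\<in>-U. Z i \<bullet> b < 0)}"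

lemma pattern_sets: "pattern U \<in> sets (\<Pi>\<^sub>M i\<in>UNIV. borel)"
proof -
  have "open {Z :: 'n \<Rightarrow> real^'p. \<forall>i\<in>U. Z i \<bullet> b > 0}" "open {Z :: 'n \<Rightarrow> real^'p. \<forall>i\<in>-U. Z i \<bullet> b < 0}"
    using open_positive_inner[of U "\<lambda>_. b"] open_positive_inner[of "-U" "\<lambda>_. - b"] by simp_all
  moreover have "pattern U = {Z. \<exists>\<beta>. \<forall>i. Z i \<bullet> \<beta> > 0} \<inter> {Z. \<forall>i\<in>U. Z i \<bullet> b > 0} \<inter> {Z. \<forall>i\<in>-U. Z i \<bullet> b < 0}"
    by (auto simp: pattern_def)
  ultimately have "open (pattern U)" using open_separable by auto
  then show ?thesis unfolding sets_PiM_equal_borel by simp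
qed

lemma separable_pattern_eq:
  assumes h: "bij_betw h (UNIV :: 'n set) {1..n}" and B: "h ` U = B"
  shows "separable_pattern B = {\<omega> \<in> space M. (\<lambda>i. z (h i) \<omega>) \<in> pattern U}"
proof -
  have r: "range h = {1..n}" and "inj h" using h by (auto simp: bij_betw_def)
  then have c: "{1..n} - B = h ` (-U)" using image_set_diff[of h UNIV U] B by (simp add: Compl_eq_Diff_UNIV)
  show ?thesis unfolding separable_pattern_def pattern_def c unfolding B[symmetric] r[symmetric]
    by (simp add: v_eq z_def)
qed

text \<open>A bijection \<open>h\<close> that sends the positions of \<open>{1..card B}\<close> to
  \<open>B\<close> and the others to the complement transports one event to the other, and the
  family of signed covariates is exchangeable.\<close>

lemma separable_pattern_prob:
  assumes "B \<subseteq> {1..n}"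
  shows "prob (separable_pattern B) = prob (separable_pattern {1..card B})" "separable_pattern B \<in> events"
proof -
  have fB: "finite B" using assms finite_subset by blast
  have cB: "card B \<le> n" using card_mono[OF _ assms] by simp
  define U where "U = idx -` {1..card B}"
  have r: "range idx = {1..n}" and inj: "inj idx" using idx by (auto simp: bij_betw_def)
  have iU: "idx ` U = {1..card B}" unfolding U_def using r cB by (auto simp: image_vimage_eq)
  then have cU: "card U = card B" using card_image[of idx U] inj by (metis card_atLeastAtMost diff_Suc_1 inj_on_subset subset_UNIV One_nat_def)
  have "card (- U) = card ({1..n} - B)"
    using cU assms fB by (simp add: card_Diff_subset Compl_eq_Diff_UNIV card_n)
  then obtain g where g: "bij_betw g (- U) ({1..n} - B)" using finite_same_card_bij[of "-U" "{1..n} - B"] by auto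
  obtain f where f: "bij_betw f U B" using finite_same_card_bij[of U B] fB cU by auto
  define h where "h = (\<lambda>i. if i \<in> U then f i else g i)"
  have "bij_betw h (U \<union> - U) (B \<union> ({1..n} - B))"
  proof (rule bij_betw_combine)
    show "bij_betw h U B" using f by (subst bij_betw_cong[of _ _ f]) (auto simp: h_def)
    show "bij_betw h (- U) ({1..n} - B)" using g by (subst bij_betw_cong[of _ _ g]) (auto simp: h_def)
  qed auto
  then have h: "bij_betw h UNIV {1..n}" using assms by (simp add: Un_absorb1)
  have hU: "h ` U = B" using f by (auto simp: h_def bij_betw_def)
  show "prob (separable_pattern B) = prob (separable_pattern {1..card B})"
    unfolding separable_pattern_eq[OF h hU] separable_pattern_eq[OF idx iU]
    by (rule z_family_exchangeable[OF h pattern_sets])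
  show "separable_pattern B \<in> events"
    unfolding separable_pattern_eq[OF h hU] using measurable_sets[OF z_family_measurable[OF h] pattern_sets, of U]
    by (simp add: vimage_def Int_def conj_commute)
qed

lemma AE_v_nonzero: "j \<in> {1..n} \<Longrightarrow> AE \<omega> in M. v j \<omega> \<noteq> 0"
proof -
  assume j: "j \<in> {1..n}"
  have "AE u in distr M borel (x j). u \<bullet> \<beta>s \<noteq> 0"
    unfolding gaussian[OF j] by (rule AE_std_gaussian_hyperplane[OF \<beta>s])
  then have "AE \<omega> in M. x j \<omega> \<bullet> \<beta>s \<noteq> 0"
    using x_measurable[OF j] by (subst (asm) AE_distr_iff) auto
  moreover have "AE \<omega> in M. y j \<omega> \<noteq> 0" using y_values[OF j] by (intro AE_I2) force
  ultimately show ?thesis by eventually_elim (use \<beta>s in \<open>simp add: v_def\<close>)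
qed

text \<open>Almost surely no \<open>v j\<close> is 0. Splitting by the set of positive ones and
  grouping these sets by their size produces the binomial coefficients.\<close>

lemma separation_prob_sum:
  "separation_prob M n x y = (\<Sum>N\<le>n. real (n choose N) * prob (separable_pattern {1..N}))"
proof -
  let ?S = "{\<omega> \<in> space M. \<exists>\<beta>. \<forall>j\<in>{1..n}. y j \<omega> * (x j \<omega> \<bullet> \<beta>) > 0}"
  have S: "?S \<in> events"
  proof -
    have r: "range idx = {1..n}" using idx by (auto simp: bij_betw_def)
    have o: "{Z :: 'n \<Rightarrow> real^'p. \<exists>\<beta>. \<forall>i. Z i \<bullet> \<beta> > 0} \<in> sets (\<Pi>\<^sub>M i\<in>UNIV. borel)"
      unfolding sets_PiM_equal_borel using open_separable by (rule borel_open)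
    from measurable_sets[OF z_family_measurable[OF idx] o]
    have "(\<lambda>\<omega> i. z (idx i) \<omega>) -` {Z. \<exists>\<beta>. \<forall>i. Z i \<bullet> \<beta> > 0} \<inter> space M \<in> events" .
    also have "(\<lambda>\<omega> i. z (idx i) \<omega>) -` {Z. \<exists>\<beta>. \<forall>i. Z i \<bullet> \<beta> > 0} \<inter> space M = ?S"
      unfolding r[symmetric] by (auto simp: z_def)
    finally show ?thesis .
  qed
  let ?P = "Pow {1..n}"
  have "AE \<omega> in M. \<forall>j\<in>{1..n}. v j \<omega> \<noteq> 0" by (intro AE_finite_allI AE_v_nonzero) auto
  then have "AE \<omega> in M. \<omega> \<in> ?S \<longleftrightarrow> \<omega> \<in> (\<Union>B\<in>?P. separable_pattern B)"
    using AE_space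
  proof eventually_elim
    case (elim \<omega>)
    show ?case
    proof
      assume "\<omega> \<in> ?S"
      moreover have "\<forall>j\<in>{1..n} - {j\<in>{1..n}. v j \<omega> > 0}. v j \<omega> < 0" using elim(1) by (metis (mono_tags, lifting) Diff_iff linorder_neqE_linordered_idom mem_Collect_eq)
      ultimately have "\<omega> \<in> separable_pattern {j\<in>{1..n}. v j \<omega> > 0}" by (simp add: separable_pattern_def)
      then show "\<omega> \<in> (\<Union>B\<in>?P. separable_pattern B)" by (intro UN_I) auto
    qed (auto simp: separable_pattern_def)
  qed
  then have "prob ?S = prob (\<Union>B\<in>?P. separable_pattern B)"
    using S separable_pattern_prob(2) by (intro measure_eq_AE) (auto intro!: sets.finite_UN)
  also have "\<dots> = (\<Sum>B\<in>?P. prob (separable_pattern B))"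
  proof (rule finite_measure_finite_Union)
    show "separable_pattern ` ?P \<subseteq> events" using separable_pattern_prob(2) by auto
    show "disjoint_family_on separable_pattern ?P" unfolding disjoint_family_on_def
    proof (intro ballI impI)
      fix B C assume BC: "B \<in> ?P" "C \<in> ?P" "B \<noteq> C"
      show "separable_pattern B \<inter> separable_pattern C = {}"
      proof (rule ccontr)
        assume "separable_pattern B \<inter> separable_pattern C \<noteq> {}"
        then obtain \<omega> where w: "\<omega> \<in> separable_pattern B" "\<omega> \<in> separable_pattern C" by auto
        have "B' = {j\<in>{1..n}. v j \<omega> > 0}" if "B' \<in> ?P" "\<omega> \<in> separable_pattern B'" for B'
        proof -
          have 1: "\<forall>j\<in>B'. v j \<omega> > 0" "\<forall>j\<in>{1..n} - B'. v j \<omega> < 0" using that(2) by (simp_all add: separable_pattern_def)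
          have "v j \<omega> > 0 \<longleftrightarrow> j \<in> B'" if "j \<in> {1..n}" for j using 1 that by (meson Diff_iff order_less_asym)
          then show ?thesis using that(1) by blast
        qed
        from this[OF BC(1) w(1)] this[OF BC(2) w(2)] BC(3) show False by simp
      qed
    qed
  qed simp
  also have "\<dots> = (\<Sum>B\<in>?P. prob (separable_pattern {1..card B}))"
    using separable_pattern_prob(1) by (intro sum.cong) auto
  also have "\<dots> = (\<Sum>N\<le>n. \<Sum>B | B \<in> ?P \<and> card B = N. prob (separable_pattern {1..card B}))"
    using card_mono[of "{1..n}"] by (intro sum.group[symmetric]) auto
  also have "\<dots> = (\<Sum>N\<le>n. real (n choose N) * prob (separable_pattern {1..N}))"
  proof (rule sum.cong[OF refl])
    fix N
    have "(\<Sum>B | B \<in> ?P \<and> card B = N. prob (separable_pattern {1..card B})) = real (card {B. B \<subseteq> {1..n} \<and> card B = N}) * prob (separable_pattern {1..N})"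
      by simp
    also have "\<dots> = real (n choose N) * prob (separable_pattern {1..N})" by (simp add: n_subsets)
    finally show "(\<Sum>B | B \<in> ?P \<and> card B = N. prob (separable_pattern {1..card B})) = real (n choose N) * prob (separable_pattern {1..N})" .
  qed
  finally show ?thesis by (simp add: separation_prob_def)
qed

lemma prob_v:
  assumes j: "j \<in> {1..n}"
  shows "prob {\<omega> \<in> space M. v j \<omega> > 0} = \<delta>" "prob {\<omega> \<in> space M. v j \<omega> < 0} = 1 - \<delta>"
proof -
  have n1: "1 \<in> {1..n}" using pn by auto
  have p: "prob {\<omega> \<in> space M. v i \<omega> > 0} = measure (distr M borel (z i)) {u. u \<bullet> b > 0}" if "i \<in> {1..n}" for i
    unfolding v_eq by (subst measure_distr[OF z_measurable[OF that]]) (auto intro!: arg_cong[where f = prob])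
  have "\<delta> = prob {\<omega> \<in> space M. v 1 \<omega> > 0}"
    unfolding \<delta>_def using \<beta>s by (simp add: v_def zero_less_divide_iff)
  then show 1: "prob {\<omega> \<in> space M. v j \<omega> > 0} = \<delta>"
    using p[OF j] p[OF n1] law_z[OF j n1] by simp
  have [measurable]: "v j \<in> borel_measurable M" by (rule v_measurable[OF j])
  have "prob {\<omega> \<in> space M. v j \<omega> < 0} = prob {\<omega> \<in> space M. \<not> v j \<omega> > 0}"
    using AE_v_nonzero[OF j] by (intro measure_eq_AE) (auto elim!: eventually_mono)
  also have "\<dots> = 1 - \<delta>" using prob_neg[of "\<lambda>\<omega>. v j \<omega> > 0"] 1 by simp
  finally show "prob {\<omega> \<in> space M. v j \<omega> < 0} = 1 - \<delta>" .
qed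

lemma A_measurable: "N \<le> n \<Longrightarrow> A N \<in> events"
  unfolding A_def using v_measurable by measurable

lemma prob_A:
  assumes N: "N \<le> n"
  shows "prob (A N) = \<delta> ^ N * (1 - \<delta>) ^ (n - N)"
proof -
  let ?C = "\<lambda>j. if j \<le> N then {0<..} else {..<0} :: real set"
  have "prob (\<Inter>j\<in>{1..n}. v j -` ?C j \<inter> space M) = (\<Prod>j\<in>{1..n}. prob (v j -` ?C j \<inter> space M))"
    using pn by (intro indep_varsD[OF indep_v_nat]) auto
  moreover have "(\<Inter>j\<in>{1..n}. v j -` ?C j \<inter> space M) = A N"
    using N pn by (force simp: A_def not_le Suc_le_eq split: if_splits)
  moreover have "(\<Prod>j\<in>{1..n}. prob (v j -` ?C j \<inter> space M)) = (\<Prod>j\<in>{1..n}. if j \<le> N then \<delta> else 1 - \<delta>)"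
  proof (rule prod.cong[OF refl])
    fix j assume "j \<in> {1..n}"
    from prob_v[OF this] show "prob (v j -` ?C j \<inter> space M) = (if j \<le> N then \<delta> else 1 - \<delta>)"
      by (auto simp: vimage_def Int_def conj_commute)
  qed
  moreover have "(\<Prod>j\<in>{1..n}. if j \<le> N then \<delta> else 1 - \<delta>) = \<delta> ^ N * (1 - \<delta>) ^ (n - N)"
  proof -
    have "{1..n} \<inter> {j. j \<le> N} = {1..N}" "{1..n} \<inter> - {j. j \<le> N} = {N+1..n}" using N by auto
    then show ?thesis by (simp add: prod.If_cases)
  qed
  ultimately show ?thesis by simp
qed

text \<open>On this event \<open>\<beta>s\<close> itself separates, so separability is no further
  condition; in the negative case below \<open>- \<beta>s\<close> does.\<close>

lemma prob_all_positive: "prob (separable_pattern {1..n}) = \<delta> ^ n"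
proof -
  have "separable_pattern {1..n} = A n"
    using \<beta>s by (auto simp: separable_pattern_def A_def v_def zero_less_divide_iff intro!: exI[of _ \<beta>s])
  then show ?thesis using prob_A[of n] by simp
qed

lemma prob_all_negative: "prob (separable_pattern {}) = (1 - \<delta>) ^ n"
proof -
  have "separable_pattern {} = A 0"
    using \<beta>s by (auto simp: separable_pattern_def A_def v_def divide_less_0_iff intro!: exI[of _ "- \<beta>s"])
  then show ?thesis using prob_A[of 0] by simp
qed

lemma separation_prob_split:
  "separation_prob M n x y = \<delta> ^ n + (1 - \<delta>) ^ n + (\<Sum>N=1..n-1. real (n choose N) * prob (separable_pattern {1..N}))"
proof -
  have n: "0 < n" using pn by auto
  have "(\<Sum>N\<le>n. f N) = f n + f 0 + (\<Sum>N=1..n-1. f N)" for f :: "nat \<Rightarrow> real"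
  proof -
    have "{..n} = insert 0 (insert n {1..n-1})" using n by auto
    moreover have "0 \<notin> insert n {1..n-1}" "n \<notin> {1..n-1}" using n by auto
    ultimately show ?thesis by (simp only: sum.insert finite_insert finite_atLeastAtMost) simp
  qed
  note e = this[of "\<lambda>N. real (n choose N) * prob (separable_pattern {1..N})"]
  have z: "{1..0} = ({} :: nat set)" by simp
  show ?thesis unfolding separation_prob_sum e z prob_all_positive prob_all_negative binomial_n_0 binomial_n_n of_nat_1 mult_1_left ..
qed

lemma law_fibre:
  assumes "j \<in> {1..n}" "B \<in> sets borel"
  shows "(\<integral>\<^sup>+\<omega>. indicator B (z j \<omega>) \<partial>M) = (\<integral>\<^sup>+\<omega>. ennreal (fibre_prob b B (v j \<omega>)) \<partial>M)"
  unfolding z_def v_def b_def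
  by (rule signed_law[OF prob_space_axioms x_measurable[OF assms(1)] y_measurable[OF assms(1)] y_values[OF assms(1)]
      gaussian[OF assms(1)] \<beta>s label[OF assms(1)] assms(2)])

text \<open>The sign conditions in \<open>pattern U\<close> only involve the components along
  \<open>b\<close> and form the indicator of \<open>A N\<close>; what the integral over
  \<open>G\<close> leaves is the probability computed from the columns.\<close>

lemma separable_pattern_sep_prob:
  fixes "is" :: "'p list"
  assumes N: "N \<le> n" and "is": "set is = UNIV - {i0}"
  shows "ennreal (prob (separable_pattern {1..N})) = (\<integral>\<^sup>+\<omega>. indicator (A N) \<omega> * ennreal (sep_prob (w \<omega>) is) \<partial>M)"
proof -
  define U where "U = idx -` {1..N}"
  have r: "range idx = {1..n}" and inj: "inj idx" using idx by (auto simp: bij_betw_def)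
  have iU: "idx ` U = {1..N}" unfolding U_def using r N by (auto simp: image_vimage_eq)
  then have iU': "idx ` (- U) = {N+1..n}" using r inj
    by (subst image_set_diff[OF inj, of UNIV U, folded Compl_eq_Diff_UNIV]) auto
  have sep: "{\<omega> \<in> space M. (\<lambda>i. z (idx i) \<omega>) \<in> pattern U} \<in> events"
    using measurable_sets[OF z_family_measurable[OF idx] pattern_sets, of U]
    by (simp add: vimage_def Int_def conj_commute)
  have "ennreal (prob (separable_pattern {1..N})) = (\<integral>\<^sup>+\<omega>. indicator {\<omega> \<in> space M. (\<lambda>i. z (idx i) \<omega>) \<in> pattern U} \<omega> \<partial>M)"
    unfolding separable_pattern_eq[OF idx iU] using sep by (simp add: emeasure_eq_measure)
  also have "\<dots> = (\<integral>\<^sup>+\<omega>. indicator (pattern U) (\<lambda>i. z (idx i) \<omega>) \<partial>M)"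
    by (intro nn_integral_cong) (simp add: indicator_def)
  also have "\<dots> = (\<integral>\<^sup>+\<omega>. \<integral>\<^sup>+G. indicator (pattern U) (\<lambda>i. v (idx i) \<omega> *\<^sub>R b + (G i - (G i \<bullet> b) *\<^sub>R b)) \<partial>gauss_fam UNIV \<partial>M)"
    by (rule joint_law[OF prob_space_axioms indep_z[OF idx] indep_v law_fibre pattern_sets]) (rule idx_in)
  also have "\<dots> = (\<integral>\<^sup>+\<omega>. indicator (A N) \<omega> * ennreal (sep_prob (w \<omega>) is) \<partial>M)"
  proof (rule nn_integral_cong)
    fix \<omega> assume \<omega>: "\<omega> \<in> space M"
    let ?S = "{G :: 'n \<Rightarrow> real^'p. \<exists>\<beta>. \<forall>i. (w \<omega> $ i *\<^sub>R b + (G i - (G i \<bullet> b) *\<^sub>R b)) \<bullet> \<beta> > 0}"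
    have bb: "b \<bullet> b = 1" using norm_b by (simp add: power2_norm_eq_inner[symmetric])
    have "(v (idx i) \<omega> *\<^sub>R b + (G i - (G i \<bullet> b) *\<^sub>R b)) \<bullet> b = v (idx i) \<omega>" for i and G :: "'n \<Rightarrow> real^'p"
      by (simp add: inner_add_left inner_diff_left bb)
    moreover have "\<omega> \<in> A N \<longleftrightarrow> (\<forall>i\<in>U. v (idx i) \<omega> > 0) \<and> (\<forall>i\<in>-U. v (idx i) \<omega> < 0)"
      unfolding A_def iU[symmetric] iU'[symmetric] using \<omega> by simp
    ultimately have "indicator (pattern U) (\<lambda>i. v (idx i) \<omega> *\<^sub>R b + (G i - (G i \<bullet> b) *\<^sub>R b)) = (indicator (A N) \<omega> * indicator ?S G :: ennreal)" for G
      by (simp add: pattern_def indicator_def w_def)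
    then show "(\<integral>\<^sup>+G. indicator (pattern U) (\<lambda>i. v (idx i) \<omega> *\<^sub>R b + (G i - (G i \<bullet> b) *\<^sub>R b)) \<partial>gauss_fam UNIV) = indicator (A N) \<omega> * ennreal (sep_prob (w \<omega>) is)"
      using separable_prob[OF norm_b "is", of "w \<omega>"] by (simp add: nn_integral_cmult)
  qed
  finally show ?thesis .
qed

end

section \<open>Expected intrinsic volumes on the events \<open>A N\<close>\<close>

lemma measure_std_gaussian_section_measurable:
  fixes Q :: "'a::euclidean_space \<Rightarrow> 'b::euclidean_space \<Rightarrow> bool"
  assumes "{p. Q (fst p) (snd p)} \<in> sets borel"
  shows "(\<lambda>v. measure std_gaussian {z. Q v z}) \<in> borel_measurable borel"
proof -
  interpret g: prob_space "std_gaussian :: 'b measure" by (rule prob_space_std_gaussian)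
  have "{p. Q (fst p) (snd p)} \<in> sets (borel \<Otimes>\<^sub>M (std_gaussian :: 'b measure))"
    using assms by (simp add: borel_prod[symmetric] cong: sets_pair_measure_cong)
  from g.measurable_emeasure_Pair[OF this] show ?thesis
    unfolding measure_def by (simp add: vimage_def)
qed

lemma tile_measurable:
  fixes S :: "'n::finite set"
  shows "(\<lambda>v. tile v S) \<in> borel_measurable borel"
  unfolding tile_def
proof (rule measure_std_gaussian_section_measurable)
  have "(\<lambda>p. res S (map (\<lambda>f. f p) [fst]) (snd p)) \<in> borel_measurable (borel :: ((real^'n) \<times> (real^'n)) measure)"
    by (rule res_measurable) (auto intro!: borel_measurable_continuous_onI continuous_intros)
  from measurable_sets_borel[OF this negpos_borel[of S]] show "{p. res S [fst p] (snd p) \<in> negpos S} \<in> sets borel"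
    by (simp add: vimage_def)
qed

lemma tile_sum_k_measurable: "(\<lambda>v :: real ^ 'n::finite. tile_sum_k v k) \<in> borel_measurable borel"
proof (cases "k = 0")
  case True
  have "{p \<in> space (borel :: ((real^'n) \<times> (real^'n)) measure). snd p \<in> upper_cone_int ((\<lambda>f. f p) ` set [fst])} \<in> sets borel"
    by (rule upper_cone_int_measurable) (auto intro!: borel_measurable_continuous_onI continuous_intros)
  then have "{p :: (real^'n) \<times> (real^'n). snd p \<in> upper_cone_int {fst p}} \<in> sets borel" by simp
  from measure_std_gaussian_section_measurable[OF this] show ?thesis by (simp add: tile_sum_k_def True)
next
  case False
  then show ?thesis unfolding tile_sum_k_def by (auto intro!: borel_measurable_sum tile_measurable)
qed

lemma tile_sum_k_nonneg: "0 \<le> tile_sum_k v k"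
  by (simp add: tile_sum_k_def sum_nonneg tile_nonneg)

lemma tile_sum_k_le_1:
  assumes "\<And>i. v $ i \<noteq> 0" "k < CARD('n)"
  shows "tile_sum_k (v :: real ^ 'n::finite) k \<le> 1"
  using member_le_sum[of k "{..<CARD('n)}" "tile_sum_k v"] tile_total[OF assms(1)] assms(2) by (simp add: tile_sum_k_nonneg)

context separation_model
begin

text \<open>Kept free of the division by \<open>prob (A N)\<close>, so that the identities for
  \<open>T\<close> remain valid when this probability is 0.\<close>

definition T :: "nat \<Rightarrow> nat \<Rightarrow> real" where "T k N = (LINT \<omega>:A N|M. tile_sum_k (w \<omega>) k)"

definition \<nu> :: "nat \<Rightarrow> nat \<Rightarrow> real" where
  "\<nu> k N = cond_exp_event M (A N) (\<lambda>\<omega>. intrinsic_volume k (upper_cone {w \<omega>}))"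

lemma w_measurable: "w \<in> borel_measurable M"
  unfolding w_def[abs_def]
  by (subst borel_measurable_euclidean_space) (auto simp: Basis_vec_def inner_axis intro!: v_measurable idx_in)

lemma A_nonzero: "\<omega> \<in> A N \<Longrightarrow> w \<omega> $ i \<noteq> 0"
proof -
  assume "\<omega> \<in> A N"
  then have "idx i \<in> {1..N} \<Longrightarrow> v (idx i) \<omega> > 0" "idx i \<in> {N+1..n} \<Longrightarrow> v (idx i) \<omega> < 0" by (simp_all add: A_def)
  then show ?thesis using idx_in[of i] by (cases "idx i \<le> N") (auto simp: w_def)
qed

lemma A_signs:
  assumes "\<omega> \<in> A N" "N \<in> {1..n-1}"
  obtains i j where "w \<omega> $ i > 0" "w \<omega> $ j < 0"
proof -
  have "1 \<in> range idx" "n \<in> range idx" using idx assms(2) by (auto simp: bij_betw_def)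
  then obtain i j where "idx i = 1" "idx j = n" by (metis imageE)
  then show ?thesis using assms that[of i j] by (auto simp: A_def w_def)
qed

lemma tile_sum_integrable:
  assumes "k < n" "N \<le> n"
  shows "set_integrable M (A N) (\<lambda>\<omega>. tile_sum_k (w \<omega>) k)"
proof -
  have "(\<lambda>\<omega>. tile_sum_k (w \<omega>) k) \<in> borel_measurable M"
    using measurable_compose[OF w_measurable tile_sum_k_measurable] .
  moreover have "norm (indicator (A N) \<omega> *\<^sub>R tile_sum_k (w \<omega>) k) \<le> 1" for \<omega>
    using tile_sum_k_le_1[of "w \<omega>" k, OF A_nonzero] assms(1) card_n by (cases "\<omega> \<in> A N") (auto simp: tile_sum_k_nonneg)
  ultimately show ?thesis unfolding set_integrable_def using A_measurable[OF assms(2)]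
    by (intro integrable_const_bound[of _ 1]) auto
qed

lemma nu_eq:
  assumes "k < n"
  shows "\<nu> (n - k) N = T k N / prob (A N)"
proof -
  have "(LINT \<omega>:A N|M. intrinsic_volume (n - k) (upper_cone {w \<omega>})) = T k N"
    unfolding T_def set_lebesgue_integral_def
  proof (rule Bochner_Integration.integral_cong[OF refl])
    fix \<omega>
    show "indicator (A N) \<omega> *\<^sub>R intrinsic_volume (n - k) (upper_cone {w \<omega>}) = indicator (A N) \<omega> *\<^sub>R tile_sum_k (w \<omega>) k"
      using intrinsic_volume_upper_cone[of "w \<omega>" k, OF A_nonzero] assms by (cases "\<omega> \<in> A N") (auto simp: card_n)
  qed
  then show ?thesis by (simp add: \<nu>_def cond_exp_event_def divide_inverse mult.commute)
qed

lemma nu_above: "n < k \<Longrightarrow> \<nu> k N = 0"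
  by (simp add: \<nu>_def cond_exp_event_def intrinsic_volume_above card_n)

lemma nu_0: "\<nu> 0 N = 0"
proof -
  have "(LINT \<omega>:A N|M. intrinsic_volume 0 (upper_cone {w \<omega>})) = (LINT \<omega>:A N|M. 0)"
    unfolding set_lebesgue_integral_def
  proof (rule Bochner_Integration.integral_cong[OF refl])
    fix \<omega>
    have "w \<omega> \<noteq> 0" if "\<omega> \<in> A N" using A_nonzero[OF that, of undefined] by auto
    then show "indicator (A N) \<omega> *\<^sub>R intrinsic_volume 0 (upper_cone {w \<omega>}) = indicator (A N) \<omega> *\<^sub>R 0"
      by (cases "\<omega> \<in> A N") (auto simp: intrinsic_volume_0_upper_cone)
  qed
  then show ?thesis by (simp add: \<nu>_def cond_exp_event_def)
qed

lemma T_total: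
  assumes "N \<le> n"
  shows "(\<Sum>k<n. T k N) = prob (A N)"
proof -
  have "(\<Sum>k<n. T k N) = (\<integral>\<omega>. (\<Sum>k<n. indicator (A N) \<omega> *\<^sub>R tile_sum_k (w \<omega>) k) \<partial>M)"
    unfolding T_def set_lebesgue_integral_def
    by (rule Bochner_Integration.integral_sum[symmetric]) (use tile_sum_integrable assms in \<open>simp add: set_integrable_def\<close>)
  also have "\<dots> = (\<integral>\<omega>. indicator (A N) \<omega> \<partial>M)"
  proof (rule Bochner_Integration.integral_cong[OF refl])
    fix \<omega>
    show "(\<Sum>k<n. indicator (A N) \<omega> *\<^sub>R tile_sum_k (w \<omega>) k) = indicator (A N) \<omega>"
      using tile_total[of "w \<omega>", OF A_nonzero] by (cases "\<omega> \<in> A N") (simp_all add: card_n)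
  qed
  also have "\<dots> = prob (A N)" using A_measurable[OF assms] by simp
  finally show ?thesis .
qed

text \<open>Crofton's formula under the integral. Of the \<open>CARD('p)\<close> columns one is
  replaced by \<open>w\<close>, which leaves \<open>CARD('p) - 1\<close> Gaussian generators; on
  \<open>A N\<close> the vector \<open>w\<close> has entries of both signs, as the formula
  requires.\<close>

lemma separable_pattern_T:
  assumes N: "N \<in> {1..n-1}"
  shows "prob (separable_pattern {1..N}) = 2 * (\<Sum>k | k < CARD('p) - 1 \<and> odd (CARD('p) - 1 - k). T k N)"
proof -
  let ?K = "{k. k < CARD('p) - 1 \<and> odd (CARD('p) - 1 - k)}"
  have fK: "finite ?K" by (rule finite_subset[of _ "{..<CARD('p)}"]) auto
  have Nn: "N \<le> n" using N by auto
  obtain "is" :: "'p list" where "is": "set is = UNIV - {undefined}" "distinct is"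
    using finite_distinct_list[of "UNIV - {undefined :: 'p}"] by auto
  then have len: "length is = CARD('p) - 1" using distinct_card[of "is"] by (simp add: card_Diff_singleton)
  have int: "set_integrable M (A N) (\<lambda>\<omega>. tile_sum_k (w \<omega>) k)" if "k \<in> ?K" for k
    by (rule tile_sum_integrable) (use that pn Nn in auto)
  have comm: "indicator (A N) \<omega> * (2 * (\<Sum>k\<in>?K. tile_sum_k (w \<omega>) k)) = 2 * (\<Sum>k\<in>?K. indicator (A N) \<omega> *\<^sub>R tile_sum_k (w \<omega>) k)" for \<omega>
    by (simp only: real_scaleR_def sum_distrib_left[symmetric] mult.left_commute)
  have "ennreal (prob (separable_pattern {1..N})) = (\<integral>\<^sup>+\<omega>. ennreal (indicator (A N) \<omega> * (2 * (\<Sum>k\<in>?K. tile_sum_k (w \<omega>) k))) \<partial>M)"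
    unfolding separable_pattern_sep_prob[OF Nn "is"(1)]
  proof (rule nn_integral_cong)
    fix \<omega>
    show "indicator (A N) \<omega> * ennreal (sep_prob (w \<omega>) is) = ennreal (indicator (A N) \<omega> * (2 * (\<Sum>k\<in>?K. tile_sum_k (w \<omega>) k)))"
    proof (cases "\<omega> \<in> A N")
      case True
      then obtain i j where "w \<omega> $ i > 0" "w \<omega> $ j < 0" using A_signs N by blast
      from sep_prob_formula[OF "is"(2) A_nonzero[OF True] this] True show ?thesis by (simp add: len)
    qed simp
  qed
  also have "\<dots> = ennreal (\<integral>\<omega>. indicator (A N) \<omega> * (2 * (\<Sum>k\<in>?K. tile_sum_k (w \<omega>) k)) \<partial>M)"
  proof (rule nn_integral_eq_integral)
    have "integrable M (\<lambda>\<omega>. 2 * (\<Sum>k\<in>?K. indicator (A N) \<omega> *\<^sub>R tile_sum_k (w \<omega>) k))"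
      using int unfolding set_integrable_def by (intro integrable_mult_right Bochner_Integration.integrable_sum) auto
    then show "integrable M (\<lambda>\<omega>. indicator (A N) \<omega> * (2 * (\<Sum>k\<in>?K. tile_sum_k (w \<omega>) k)))"
      by (simp only: comm)
    show "AE \<omega> in M. 0 \<le> indicator (A N) \<omega> * (2 * (\<Sum>k\<in>?K. tile_sum_k (w \<omega>) k))"
      by (intro AE_I2 mult_nonneg_nonneg sum_nonneg tile_sum_k_nonneg) auto
  qed
  also have "(\<integral>\<omega>. indicator (A N) \<omega> * (2 * (\<Sum>k\<in>?K. tile_sum_k (w \<omega>) k)) \<partial>M) = 2 * (\<integral>\<omega>. (\<Sum>k\<in>?K. indicator (A N) \<omega> *\<^sub>R tile_sum_k (w \<omega>) k) \<partial>M)"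
    by (simp only: comm integral_mult_right_zero)
  also have "\<dots> = 2 * (\<Sum>k\<in>?K. T k N)"
    unfolding T_def set_lebesgue_integral_def
    by (subst Bochner_Integration.integral_sum) (use int in \<open>auto simp: set_integrable_def\<close>)
  finally show ?thesis
    by (subst (asm) ennreal_inj) (auto intro!: sum_nonneg simp: T_def set_lebesgue_integral_def tile_sum_k_nonneg)
qed

text \<open>The substitution \<open>k = p - 1 - j\<close> turns the dimension
  \<open>n - p + 1 + j\<close> into \<open>n - k\<close>. Terms with \<open>j > p - 1\<close>
  concern dimensions above \<open>n\<close> and vanish, so the infinite sum is a finite one.\<close>

lemma separable_pattern_nu:
  assumes N: "N \<in> {1..n-1}"
  shows "prob (separable_pattern {1..N}) =
    2 * (\<Sum>\<^sub>\<infinity>j\<in>{j. 1 \<le> j \<and> odd j}. \<delta> ^ N * (1 - \<delta>) ^ (n - N) * \<nu> (n - CARD('p) + 1 + j) N)"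
proof -
  let ?p = "CARD('p)"
  have Nn: "N \<le> n" using N by auto
  have p0: "0 < CARD('p)" by (rule zero_less_card_finite)
  \<comment> \<open>If \<open>A N\<close> is a null event, the coefficient on the left is 0, and so
    is the integral over \<open>A N\<close>.\<close>
  have e: "\<delta> ^ N * (1 - \<delta>) ^ (n - N) * \<nu> (n - k) N = T k N" if "k < n" for k
  proof (cases "prob (A N) = 0")
    case True
    have "AE \<omega> in M. \<omega> \<notin> A N" using True A_measurable[OF Nn] by (intro AE_not_in) (simp add: null_sets_def emeasure_eq_measure)
    then have "T k N = (\<integral>\<omega>. 0 \<partial>M)" unfolding T_def set_lebesgue_integral_def
      by (intro integral_cong_AE) (use A_measurable[OF Nn] measurable_compose[OF w_measurable tile_sum_k_measurable] in auto)
    then show ?thesis unfolding prob_A[OF Nn, symmetric] True by simp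
  next
    case False
    then show ?thesis unfolding prob_A[OF Nn, symmetric] nu_eq[OF that, of N] by simp
  qed
  let ?f = "\<lambda>j. \<delta> ^ N * (1 - \<delta>) ^ (n - N) * \<nu> (n - ?p + 1 + j) N"
  have "(\<Sum>\<^sub>\<infinity>j\<in>{j. 1 \<le> j \<and> odd j}. ?f j) = (\<Sum>\<^sub>\<infinity>j\<in>{j. 1 \<le> j \<and> odd j \<and> j \<le> ?p - 1}. ?f j)"
  proof (rule infsum_cong_neutral)
    fix j assume "j \<in> {j. 1 \<le> j \<and> odd j} - {j. 1 \<le> j \<and> odd j \<and> j \<le> ?p - 1}"
    then have "n < n - ?p + 1 + j" using pn by auto
    then show "?f j = 0" by (simp only: nu_above mult_zero_right)
  qed auto
  also have "\<dots> = (\<Sum>j\<in>{j. 1 \<le> j \<and> odd j \<and> j \<le> ?p - 1}. ?f j)"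
    by (rule infsum_finite) (rule finite_subset[of _ "{..?p}"], auto)
  also have "\<dots> = (\<Sum>k | k < ?p - 1 \<and> odd (?p - 1 - k). T k N)"
  proof (rule sum.reindex_bij_witness[where i = "\<lambda>k. ?p - 1 - k" and j = "\<lambda>j. ?p - 1 - j"])
    fix j assume j: "j \<in> {j. 1 \<le> j \<and> odd j \<and> j \<le> ?p - 1}"
    then have 1: "n - ?p + 1 + j = n - (?p - 1 - j)" using pn p0 by auto
    have "?p - 1 - j < n" using pn by auto
    from e[OF this] show "T (?p - 1 - j) N = ?f j" unfolding 1 by (rule sym)
  qed auto
  finally show ?thesis unfolding separable_pattern_T[OF N] by (simp only:)
qed

lemma separation_prob_formula:
  "separation_prob M n x y = \<delta> ^ n + (1 - \<delta>) ^ n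
     + 2 * (\<Sum>N=1..n-1. \<Sum>\<^sub>\<infinity>j\<in>{j. 1 \<le> j \<and> odd j}.
              real (n choose N) * \<delta> ^ N * (1 - \<delta>) ^ (n - N) * \<nu> (n - CARD('p) + 1 + j) N)"
proof -
  have "(\<Sum>N=1..n-1. real (n choose N) * prob (separable_pattern {1..N})) =
     (\<Sum>N=1..n-1. 2 * (\<Sum>\<^sub>\<infinity>j\<in>{j. 1 \<le> j \<and> odd j}.
              real (n choose N) * \<delta> ^ N * (1 - \<delta>) ^ (n - N) * \<nu> (n - CARD('p) + 1 + j) N))"
  proof (rule sum.cong[OF refl])
    fix N assume "N \<in> {1..n-1}"
    have "(\<Sum>\<^sub>\<infinity>j\<in>{j. 1 \<le> j \<and> odd j}. real (n choose N) * \<delta> ^ N * (1 - \<delta>) ^ (n - N) * \<nu> (n - CARD('p) + 1 + j) N) =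
       real (n choose N) * (\<Sum>\<^sub>\<infinity>j\<in>{j. 1 \<le> j \<and> odd j}. \<delta> ^ N * (1 - \<delta>) ^ (n - N) * \<nu> (n - CARD('p) + 1 + j) N)"
      by (subst infsum_cmult_right'[symmetric]) (simp only: mult.assoc)
    then show "real (n choose N) * prob (separable_pattern {1..N}) = 2 * (\<Sum>\<^sub>\<infinity>j\<in>{j. 1 \<le> j \<and> odd j}. real (n choose N) * \<delta> ^ N * (1 - \<delta>) ^ (n - N) * \<nu> (n - CARD('p) + 1 + j) N)"
      unfolding separable_pattern_nu[OF \<open>N \<in> {1..n-1}\<close>] by (simp only: mult.left_commute)
  qed
  then show ?thesis unfolding separation_prob_split by (simp add: sum_distrib_left)
qed

lemma nu_n_sum:
  assumes "N \<le> n" "prob (A N) > 0"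
  shows "\<nu> n N = 1 - (\<Sum>k=1..n-1. \<nu> k N)"
proof -
  have n: "n > 0" using pn by auto
  have "(\<Sum>k=1..n-1. \<nu> k N) = (\<Sum>k=1..n-1. \<nu> (n - k) N)"
    by (rule sum.reindex_bij_witness[where i = "\<lambda>k. n - k" and j = "\<lambda>k. n - k"]) auto
  also have "\<dots> = (\<Sum>k=1..n-1. T k N / prob (A N))"
    by (intro sum.cong refl nu_eq) auto
  finally have e: "(\<Sum>k=1..n-1. \<nu> k N) = (\<Sum>k=1..n-1. T k N / prob (A N))" .
  have "{..<n} = insert 0 {1..n-1}" using n by auto
  then have "(\<Sum>k<n. T k N / prob (A N)) = T 0 N / prob (A N) + (\<Sum>k=1..n-1. T k N / prob (A N))" by simp
  then have "\<nu> n N + (\<Sum>k=1..n-1. \<nu> k N) = (\<Sum>k<n. T k N / prob (A N))"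
    using nu_eq[OF n, of N] e by simp
  also have "\<dots> = 1" using assms by (simp add: sum_divide_distrib[symmetric] T_total)
  finally show ?thesis by simp
qed

end

section \<open>The intrinsic volume of full dimension\<close>

lemma measure_upper_cone:
  assumes "v $ i \<noteq> 0" shows "measure std_gaussian (upper_cone {v :: real ^ 'n::finite}) = tile_sum_k v 0"
proof -
  have "AE z in std_gaussian. z \<in> upper_cone {v} \<longrightarrow> z \<in> upper_cone_int {v}" by (rule AE_upper_cone_int) simp
  then have "measure std_gaussian (upper_cone {v}) = measure std_gaussian (upper_cone_int {v})"
    using upper_cone_int_subset[of "{v}"] closed_upper_cone[of "{v}"] open_upper_cone_int[of "{v}"]
    by (intro measure_eq_AE) (auto elim!: eventually_mono)
  then show ?thesis by (simp add: tile_sum_k_def)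
qed

context separation_model
begin

lemma std_gaussian_reindex:
  "distr (gauss_fam {1..n}) borel (\<lambda>g. \<chi> i. g (idx i)) = (std_gaussian :: (real ^ 'n) measure)"
proof -
  have inj: "inj idx" and r: "range idx = {1..n}" using idx by (auto simp: bij_betw_def)
  have vl: "vec_lambda \<in> borel_measurable (gauss_fam UNIV :: ('n \<Rightarrow> real) measure)"
    by (subst borel_measurable_euclidean_space)
      (auto simp: Basis_vec_def inner_axis intro!: borel_measurable_inner gauss_fam_measurable_comp)
  have m: "(\<lambda>g. \<lambda>i\<in>UNIV. g (idx i)) \<in> measurable (gauss_fam {1..n}) (gauss_fam UNIV :: ('n \<Rightarrow> real) measure)"
    by (rule measurable_restrict) (rule measurable_component_singleton, rule idx_in)
  have "(std_gaussian :: (real ^ 'n) measure) = distr (gauss_fam UNIV) borel vec_lambda" by (rule std_gaussian_vec[symmetric])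
  also have "(gauss_fam UNIV :: ('n \<Rightarrow> real) measure) = distr (gauss_fam {1..n}) (gauss_fam UNIV) (\<lambda>g. \<lambda>i\<in>UNIV. g (idx i))"
    by (rule distr_PiM_reindex[symmetric]) (use inj r prob_space_std_gaussian in auto)
  also have "distr (distr (gauss_fam {1..n}) (gauss_fam UNIV) (\<lambda>g. \<lambda>i\<in>UNIV. g (idx i))) borel vec_lambda =
     distr (gauss_fam {1..n}) borel (\<lambda>g. (\<chi> i. g (idx i)) :: real ^ 'n)"
    by (subst distr_distr[OF vl m]) (simp add: o_def restrict_def)
  finally show ?thesis by simp
qed

text \<open>Division by \<open>v j\<close> keeps an inequality for positive entries and reverses it
  for negative ones, so the admissible \<open>t\<close> lie between two finite families of ratios.
  Such a \<open>t\<close> exists iff every lower bound is below every upper bound.\<close>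

lemma upper_cone_iff_ratio:
  assumes \<omega>: "\<omega> \<in> A N" and N: "N \<in> {1..n-1}"
  shows "(\<chi> i. g (idx i)) \<in> upper_cone {w \<omega>} \<longleftrightarrow> (\<forall>l\<in>{1..N}. \<forall>r\<in>{N+1..n}. g r / v r \<omega> \<le> g l / v l \<omega>)"
proof -
  have v: "\<And>l. l \<in> {1..N} \<Longrightarrow> v l \<omega> > 0" "\<And>r. r \<in> {N+1..n} \<Longrightarrow> v r \<omega> < 0" using \<omega> by (simp_all add: A_def)
  have r: "range idx = {1..n}" using idx by (simp add: bij_betw_def)
  have "(\<chi> i. g (idx i)) \<in> upper_cone {w \<omega>} \<longleftrightarrow> (\<exists>t. \<forall>i. t * v (idx i) \<omega> \<le> g (idx i))"
  proof -
    have "(\<chi> i. g (idx i)) \<in> upper_cone {w \<omega>} \<longleftrightarrow> (\<exists>t. \<forall>i. (t *\<^sub>R w \<omega>) $ i \<le> g (idx i))"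
      unfolding upper_cone_def span_singleton by (simp del: vector_scaleR_component)
    then show ?thesis by (simp add: w_def)
  qed
  also have "\<dots> \<longleftrightarrow> (\<exists>t. \<forall>j\<in>range idx. t * v j \<omega> \<le> g j)" by simp
  also have "\<dots> \<longleftrightarrow> (\<exists>t. (\<forall>l\<in>{1..N}. t \<le> g l / v l \<omega>) \<and> (\<forall>r\<in>{N+1..n}. g r / v r \<omega> \<le> t))"
  proof -
    have "{1..n} = {1..N} \<union> {N+1..n}" using N by auto
    then show ?thesis unfolding r using v by (simp add: ball_Un pos_le_divide_eq neg_divide_le_eq)
  qed
  also have "\<dots> \<longleftrightarrow> (\<forall>l\<in>{1..N}. \<forall>r\<in>{N+1..n}. g r / v r \<omega> \<le> g l / v l \<omega>)"
  proof
    assume *: "\<forall>l\<in>{1..N}. \<forall>r\<in>{N+1..n}. g r / v r \<omega> \<le> g l / v l \<omega>"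
    show "\<exists>t. (\<forall>l\<in>{1..N}. t \<le> g l / v l \<omega>) \<and> (\<forall>r\<in>{N+1..n}. g r / v r \<omega> \<le> t)"
      by (rule exI[of _ "Max ((\<lambda>r. g r / v r \<omega>) ` {N+1..n})"]) (use * N in auto)
  qed (meson order_trans)
  finally show ?thesis .
qed

text \<open>For fixed data the inequality between the ratios says that the Gaussian vector lies in
  the closed cone, whose boundary is a null set; Fubini averages over the data.\<close>

lemma nu_n_gaussian:
  assumes N: "N \<in> {1..n-1}" and "prob (A N) > 0"
  shows "\<nu> n N = \<P>((\<omega>, g) in M \<Otimes>\<^sub>M (\<Pi>\<^sub>M j\<in>{1..n}. std_gaussian).
                    Min ((\<lambda>l. g l / v l \<omega>) ` {1..N}) \<ge> Max ((\<lambda>r. g r / v r \<omega>) ` {N+1..n})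
                    \<bar> \<omega> \<in> A N)"
proof -
  interpret D: prob_space "gauss_fam {1..n} :: (nat \<Rightarrow> real) measure" by (rule prob_space_gauss_fam)
  interpret P: pair_prob_space M "gauss_fam {1..n} :: (nat \<Rightarrow> real) measure" ..
  let ?D = "gauss_fam {1..n} :: (nat \<Rightarrow> real) measure"
  have n: "n > 0" and Nn: "N \<le> n" using N by auto
  have AM: "A N \<in> events" by (rule A_measurable[OF Nn])
  have A_sp: "A N \<subseteq> space M" by (auto simp: A_def)
  have comp: "(\<lambda>p. snd p j) \<in> borel_measurable (M \<Otimes>\<^sub>M ?D)" if "j \<in> {1..n}" for j
    using measurable_compose[OF measurable_snd gauss_fam_measurable_comp[OF that]] .
  have vm: "(\<lambda>p. v j (fst p)) \<in> borel_measurable (M \<Otimes>\<^sub>M ?D)" if "j \<in> {1..n}" for j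
    using measurable_compose[OF measurable_fst v_measurable[OF that]] .
  let ?C = "\<lambda>\<omega> g. \<forall>l\<in>{1..N}. \<forall>r\<in>{N+1..n}. g r / v r \<omega> \<le> g l / v l \<omega>"
  have MM: "Max ((\<lambda>r. g r / v r \<omega>) ` {N+1..n}) \<le> Min ((\<lambda>l. g l / v l \<omega>) ` {1..N}) \<longleftrightarrow> ?C \<omega> g" for \<omega> g
    using N by (subst Max_le_iff) (auto simp: Min_ge_iff)
  define E where "E = {p \<in> space (M \<Otimes>\<^sub>M ?D). ?C (fst p) (snd p) \<and> fst p \<in> A N}"
  have E: "E \<in> sets (M \<Otimes>\<^sub>M ?D)"
  proof -
    have "Measurable.pred (M \<Otimes>\<^sub>M ?D) (\<lambda>p. snd p r / v r (fst p) \<le> snd p l / v l (fst p))" if "l \<in> {1..N}" "r \<in> {N+1..n}" for l r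
    proof -
      have "l \<in> {1..n}" "r \<in> {1..n}" using that N by auto
      note [measurable] = comp[OF this(1)] comp[OF this(2)] vm[OF this(1)] vm[OF this(2)]
      show ?thesis by measurable
    qed
    then have "Measurable.pred (M \<Otimes>\<^sub>M ?D) (\<lambda>p. ?C (fst p) (snd p))" by (intro pred_intros_finite) auto
    moreover have "Measurable.pred (M \<Otimes>\<^sub>M ?D) (\<lambda>p. fst p \<in> A N)" using AM by measurable
    ultimately show ?thesis unfolding E_def by measurable
  qed
  have inner: "(\<integral>\<^sup>+g. indicator E (\<omega>, g) \<partial>?D) = indicator (A N) \<omega> * ennreal (tile_sum_k (w \<omega>) 0)" if "\<omega> \<in> space M" for \<omega>
  proof (cases "\<omega> \<in> A N")
    case True
    have cm: "upper_cone {w \<omega>} \<in> sets borel" by (simp add: closed_upper_cone)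
    have fm: "(\<lambda>g. \<chi> i. g (idx i)) \<in> borel_measurable ?D"
      by (subst borel_measurable_euclidean_space) (auto simp: Basis_vec_def inner_axis idx_in[simplified] intro!: gauss_fam_measurable_comp)
    have "(\<integral>\<^sup>+g. indicator E (\<omega>, g) \<partial>?D) = (\<integral>\<^sup>+g. indicator (upper_cone {w \<omega>}) (\<chi> i. g (idx i)) \<partial>?D)"
      by (intro nn_integral_cong) (simp add: indicator_def E_def True that space_pair_measure upper_cone_iff_ratio[OF True N])
    also have "\<dots> = emeasure (distr ?D borel (\<lambda>g. \<chi> i. g (idx i))) (upper_cone {w \<omega>})"
      by (rule emeasure_distr_nn_integral[OF fm cm, symmetric])
    also have "\<dots> = ennreal (tile_sum_k (w \<omega>) 0)"
    proof -
      interpret g: prob_space "std_gaussian :: (real^'n) measure" by (rule prob_space_std_gaussian)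
      show ?thesis unfolding std_gaussian_reindex by (simp add: g.emeasure_eq_measure measure_upper_cone[OF A_nonzero[OF True]])
    qed
    finally show ?thesis using True by simp
  qed (simp add: E_def indicator_def)
  have "emeasure (M \<Otimes>\<^sub>M ?D) E = (\<integral>\<^sup>+\<omega>. \<integral>\<^sup>+g. indicator E (\<omega>, g) \<partial>?D \<partial>M)"
    using E D.nn_integral_fst[of "indicator E" M] by simp
  also have "\<dots> = (\<integral>\<^sup>+\<omega>. ennreal (indicator (A N) \<omega> *\<^sub>R tile_sum_k (w \<omega>) 0) \<partial>M)"
  proof (rule nn_integral_cong)
    fix \<omega> assume "\<omega> \<in> space M"
    show "(\<integral>\<^sup>+g. indicator E (\<omega>, g) \<partial>?D) = ennreal (indicator (A N) \<omega> *\<^sub>R tile_sum_k (w \<omega>) 0)"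
      unfolding inner[OF \<open>\<omega> \<in> space M\<close>] by (cases "\<omega> \<in> A N") simp_all
  qed
  also have "\<dots> = ennreal (T 0 N)"
    unfolding T_def set_lebesgue_integral_def
    by (rule nn_integral_eq_integral) (use tile_sum_integrable[OF n Nn] in \<open>auto simp: set_integrable_def tile_sum_k_nonneg\<close>)
  finally have num: "P.prob E = T 0 N"
    unfolding measure_def by (simp add: T_def set_lebesgue_integral_def tile_sum_k_nonneg)
  have "P.prob (A N \<times> space ?D) = prob (A N)"
    using D.emeasure_pair_measure_Times[OF AM sets.top[of ?D]] unfolding D.emeasure_space_1 measure_def by simp
  moreover have "{p \<in> space (M \<Otimes>\<^sub>M ?D). case p of (\<omega>, g) \<Rightarrow> \<omega> \<in> A N} = A N \<times> space ?D"
    using A_sp by (auto simp: space_pair_measure)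
  moreover have "{p \<in> space (M \<Otimes>\<^sub>M ?D). (case p of (\<omega>, g) \<Rightarrow> Min ((\<lambda>l. g l / v l \<omega>) ` {1..N}) \<ge> Max ((\<lambda>r. g r / v r \<omega>) ` {N+1..n})) \<and> (case p of (\<omega>, g) \<Rightarrow> \<omega> \<in> A N)} = E"
    unfolding E_def using MM by (auto simp del: Max_le_iff Min_ge_iff)
  ultimately show ?thesis unfolding cond_prob_def using nu_eq[OF n, of N] num by simp
qed

end

section \<open>Integrability over the data and the angle formula\<close>

lemma complex_Phi_imaginary_measurable: "(\<lambda>x. complex_Phi (\<i> * of_real x)) \<in> borel_measurable borel"
  unfolding complex_Phi_imaginary by measurable

text \<open>The exponent \<open>- 1 / 2\<close> is integrable at 0, and the Gaussian density is at
  most 1.\<close>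

lemma inverse_sqrt_moment: "(\<integral>\<^sup>+t. ennreal (indicator {0..1} t * t powr (-1/2)) \<partial>std_gaussian) < \<infinity>"
proof -
  have "((\<lambda>t :: real. t powr (-1/2)) has_integral (1 powr (-1/2 + 1) / (-1/2 + 1))) {0..1}"
    by (rule has_integral_powr_from_0) auto
  then have "(\<integral>\<^sup>+t. ennreal (indicator {0..1} t * t powr (-1/2)) \<partial>lborel) = ennreal (1 powr (-1/2 + 1) / (-1/2 + 1))"
    by (intro nn_integral_has_integral_lebesgue) auto
  moreover have "(\<integral>\<^sup>+t. ennreal (indicator {0..1} t * t powr (-1/2)) \<partial>std_gaussian) \<le> (\<integral>\<^sup>+t. ennreal (indicator {0..1} t * t powr (-1/2)) \<partial>lborel)"
    unfolding std_gaussian_real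
  proof (subst nn_integral_density)
    have "std_normal_density t \<le> 1" for t :: real
    proof -
      have "1 \<le> sqrt (2 * pi)" using pi_gt3 by (simp add: real_le_rsqrt)
      moreover have "exp (- t\<^sup>2 / 2) \<le> 1" by simp
      ultimately have "exp (- t\<^sup>2 / 2) / sqrt (2 * pi) \<le> 1 / 1" by (intro frac_le) simp_all
      then show ?thesis unfolding std_normal_density_def by simp
    qed
    then show "(\<integral>\<^sup>+t. ennreal (std_normal_density t) * ennreal (indicator {0..1} t * t powr (-1/2)) \<partial>lborel) \<le> (\<integral>\<^sup>+t. ennreal (indicator {0..1} t * t powr (-1/2)) \<partial>lborel)"
      by (intro nn_integral_mono) (simp add: ennreal_mult'[symmetric] mult_left_le_one_le)
  qed auto
  ultimately show ?thesis by (simp add: le_less_trans)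
qed

lemma singular_moment: "(\<integral>\<^sup>+t. ennreal ((1 + \<bar>t\<bar>) * (1 + 1 / sqrt \<bar>t\<bar>)) \<partial>std_gaussian) < \<infinity>"
proof -
  interpret g: prob_space "std_gaussian :: real measure" by (rule prob_space_std_gaussian)
  define \<psi> where "\<psi> = (\<lambda>t :: real. indicator {0..1} t * t powr (-1/2))"
  have \<psi>0: "0 \<le> \<psi> t" for t by (simp add: \<psi>_def)
  \<comment> \<open>\<open>\<psi> t + \<psi> (- t)\<close> carries the singularity from both sides;
    outside \<open>[-1, 1]\<close> the inverse square root is at most 1. At 0 the quotient is 0 by
    convention. The constant 4 is a crude bound for all cases.\<close>
  have bound: "(1 + \<bar>t\<bar>) * (1 + 1 / sqrt \<bar>t\<bar>) \<le> 4 * (1 + \<bar>t\<bar> + \<psi> t + \<psi> (- t))" for t :: real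
  proof -
    consider "t = 0" | "t \<noteq> 0" "\<bar>t\<bar> \<le> 1" | "\<bar>t\<bar> > 1" by fastforce
    then show ?thesis
    proof cases
      case 2
      have s: "1 / sqrt \<bar>t\<bar> = \<bar>t\<bar> powr (-1/2)" using 2 by (simp add: powr_minus_divide powr_half_sqrt[symmetric])
      have e: "\<psi> t + \<psi> (- t) = \<bar>t\<bar> powr (-1/2)" using 2 by (cases "t > 0") (auto simp: \<psi>_def indicator_def)
      have "(1 + \<bar>t\<bar>) * (1 + \<bar>t\<bar> powr (-1/2)) \<le> 2 * (1 + \<bar>t\<bar> powr (-1/2))"
        using 2 by (intro mult_right_mono) auto
      also have "\<dots> \<le> 4 * (1 + \<bar>t\<bar> + \<bar>t\<bar> powr (-1/2))" by simp
      finally show ?thesis unfolding s e[symmetric] by (simp only: add.assoc)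
    next
      case 3
      then have "1 / sqrt \<bar>t\<bar> \<le> 1" by simp
      then have "(1 + \<bar>t\<bar>) * (1 + 1 / sqrt \<bar>t\<bar>) \<le> (1 + \<bar>t\<bar>) * 2" by (intro mult_left_mono) auto
      also have "\<dots> \<le> 4 * (1 + \<bar>t\<bar> + 0 + 0)" by simp
      also have "\<dots> \<le> 4 * (1 + \<bar>t\<bar> + \<psi> t + \<psi> (- t))"
        by (intro mult_left_mono add_mono order_refl \<psi>0) simp_all
      finally show ?thesis .
    qed (simp add: \<psi>0)
  qed
  have abs: "(\<integral>\<^sup>+t. ennreal \<bar>t\<bar> \<partial>(std_gaussian :: real measure)) < \<infinity>"
  proof -
    have "integrable (density lborel (\<lambda>x. ennreal (std_normal_density x))) (\<lambda>t :: real. \<bar>t\<bar>)"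
      using integrable_std_normal_moment_abs[of 1] by (subst integrable_density) auto
    then have "integrable std_gaussian (\<lambda>t :: real. \<bar>t\<bar>)" by (simp add: std_gaussian_real)
    then show ?thesis by (simp add: integrable_iff_bounded)
  qed
  have [measurable]: "\<psi> \<in> borel_measurable borel" unfolding \<psi>_def by measurable
  have "(\<integral>\<^sup>+t. ennreal ((1 + \<bar>t\<bar>) * (1 + 1 / sqrt \<bar>t\<bar>)) \<partial>std_gaussian) \<le> (\<integral>\<^sup>+t. ennreal (4 * (1 + \<bar>t\<bar> + \<psi> t + \<psi> (- t))) \<partial>std_gaussian)"
    using bound by (intro nn_integral_mono ennreal_leI)
  also have "\<dots> = (\<integral>\<^sup>+t. 4 * (1 + ennreal \<bar>t\<bar> + ennreal (\<psi> t) + ennreal (\<psi> (- t))) \<partial>std_gaussian)"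
    by (intro nn_integral_cong) (simp add: ennreal_mult' \<psi>0 distrib_left)
  also have "\<dots> = 4 * (1 + (\<integral>\<^sup>+t. ennreal \<bar>t\<bar> \<partial>std_gaussian) + (\<integral>\<^sup>+t. ennreal (\<psi> t) \<partial>std_gaussian) + (\<integral>\<^sup>+t. ennreal (\<psi> (- t)) \<partial>std_gaussian))"
  proof -
    have m: "(\<lambda>t. ennreal \<bar>t\<bar>) \<in> borel_measurable (std_gaussian :: real measure)" "(\<lambda>t. ennreal (\<psi> t)) \<in> borel_measurable std_gaussian"
      "(\<lambda>t. ennreal (\<psi> (- t))) \<in> borel_measurable std_gaussian" by (simp_all cong: measurable_cong_sets)
    show ?thesis using m g.emeasure_space_1 by (simp add: nn_integral_cmult nn_integral_add)
  qed
  also have "(\<integral>\<^sup>+t. ennreal (\<psi> (- t)) \<partial>std_gaussian) = (\<integral>\<^sup>+t. ennreal (\<psi> t) \<partial>std_gaussian)"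
    by (rule nn_integral_std_gaussian_uminus) simp
  also have "4 * (1 + (\<integral>\<^sup>+t. ennreal \<bar>t\<bar> \<partial>std_gaussian) + (\<integral>\<^sup>+t. ennreal (\<psi> t) \<partial>std_gaussian) + (\<integral>\<^sup>+t. ennreal (\<psi> t) \<partial>std_gaussian)) < \<infinity>"
    using abs inverse_sqrt_moment by (simp add: \<psi>_def ennreal_mult_less_top)
  finally show ?thesis .
qed

text \<open>The integrand of the formula for \<open>\<nu>\<close> that belongs to one set of
  coordinates, with \<open>gauss_cdf\<close> for \<open>complex_Phi\<close> at real arguments;
  \<open>Phi_integrand_eq\<close> restores the indices and the notation of the statement.\<close>

definition Phi_integrand :: "real ^ 'n::finite \<Rightarrow> 'n set \<Rightarrow> real \<times> real \<Rightarrow> complex" where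
  "Phi_integrand v S p = Phi_prod v S (fst p) * of_real (\<Prod>i\<in>- S. gauss_cdf (snd p * v $ i / snorm v S))"

lemma Phi_integrand_norm: "norm (Phi_integrand v S p) \<le> norm (Phi_prod v S (fst p))"
proof -
  have "0 \<le> (\<Prod>i\<in>- S. gauss_cdf (snd p * v $ i / snorm v S))" "(\<Prod>i\<in>- S. gauss_cdf (snd p * v $ i / snorm v S)) \<le> 1"
    by (simp_all add: prod_nonneg prod_le_1 gauss_cdf_01)
  then show ?thesis by (simp add: Phi_integrand_def norm_mult mult_left_le del: of_real_prod)
qed

lemma Phi_integrand_measurable: "(\<lambda>q. Phi_integrand (fst q) S (snd q)) \<in> borel_measurable (borel :: ((real ^ 'n::finite) \<times> real \<times> real) measure)"
proof -
  have [measurable]: "(\<lambda>q. snorm (fst q) S) \<in> borel_measurable (borel :: ((real ^ 'n) \<times> real \<times> real) measure)"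
    unfolding snorm_def by (intro borel_measurable_continuous_onI continuous_intros)
  have [measurable]: "(\<lambda>q. fst q $ i) \<in> borel_measurable (borel :: ((real ^ 'n) \<times> real \<times> real) measure)" for i
    by (intro borel_measurable_continuous_onI continuous_intros)
  have [measurable]: "(\<lambda>q. fst (snd q)) \<in> borel_measurable (borel :: ((real ^ 'n) \<times> real \<times> real) measure)"
     "(\<lambda>q. snd (snd q)) \<in> borel_measurable (borel :: ((real ^ 'n) \<times> real \<times> real) measure)"
    by (intro borel_measurable_continuous_onI continuous_intros)+
  note [measurable] = measurable_compose[OF _ complex_Phi_imaginary_measurable]
  have "(\<lambda>q. complex_Phi (\<i> * of_real (fst (snd q) * fst q $ i / snorm (fst q) S))) \<in> borel_measurable (borel :: ((real ^ 'n) \<times> real \<times> real) measure)" for i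
    by (rule measurable_compose[OF _ complex_Phi_imaginary_measurable]) measurable
  then show ?thesis unfolding Phi_integrand_def Phi_prod_def
    by (intro borel_measurable_times borel_measurable_prod borel_measurable_of_real) (simp_all, measurable)
qed

text \<open>The two Gaussian variables separate the integral into the inner and the outer angle.
  Fubini applies because the first factor is integrable and the second lies between 0 and 1.\<close>

lemma tile_eq_integral:
  fixes v :: "real ^ 'n::finite"
  assumes nz: "\<And>i. v $ i \<noteq> 0" and S: "2 \<le> card S"
  shows "(\<integral>p. Phi_integrand v S p \<partial>std_gaussian) = of_real (tile v S)"
proof -
  interpret g: prob_space "std_gaussian :: real measure" by (rule prob_space_std_gaussian)
  interpret gg: pair_prob_space "std_gaussian :: real measure" "std_gaussian :: real measure" ..
  let ?K = "\<lambda>t. \<Prod>i\<in>- S. gauss_cdf (t * v $ i / snorm v S)"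
  have Sne: "S \<noteq> {}" using S by auto
  obtain a where a: "a \<in> S" using Sne by blast
  have "card (S - {a}) \<noteq> 0" using S a by (simp add: card_Diff_singleton)
  then obtain b where b: "b \<in> S" "a \<noteq> b" by (metis Diff_iff all_not_in_conv card.empty singletonI)
  obtain C where C: "(\<integral>\<^sup>+g. ennreal (norm (Phi_prod v S g)) \<partial>std_gaussian) \<le> ennreal C"
    using Phi_prod_bound[where 'n = 'n] nz a b by meson
  have Pm: "Phi_prod v S \<in> borel_measurable borel" by (rule Phi_prod_measurable[OF nz Sne])
  have int: "integrable std_gaussian (Phi_prod v S)"
    using C Pm by (auto simp: integrable_iff_bounded cong: measurable_cong_sets intro: le_less_trans)
  have Km: "?K \<in> borel_measurable borel" by measurable
  have m: "Phi_integrand v S \<in> borel_measurable (std_gaussian \<Otimes>\<^sub>M std_gaussian)"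
    unfolding Phi_integrand_def[abs_def] using Pm Km
    by (intro borel_measurable_times borel_measurable_of_real measurable_compose[OF measurable_fst] measurable_compose[OF measurable_snd])
       (simp_all cong: measurable_cong_sets)
  have fin: "integrable (std_gaussian \<Otimes>\<^sub>M std_gaussian) (Phi_integrand v S)"
    unfolding integrable_iff_bounded
  proof (intro conjI m)
    have "(\<integral>\<^sup>+p. ennreal (norm (Phi_integrand v S p)) \<partial>(std_gaussian \<Otimes>\<^sub>M std_gaussian)) \<le> (\<integral>\<^sup>+p. ennreal (norm (Phi_prod v S (fst p))) \<partial>(std_gaussian \<Otimes>\<^sub>M (std_gaussian :: real measure)))"
      by (intro nn_integral_mono ennreal_leI Phi_integrand_norm)
    also have "\<dots> = (\<integral>\<^sup>+g. \<integral>\<^sup>+t. ennreal (norm (Phi_prod v S (fst (g, t)))) \<partial>(std_gaussian :: real measure) \<partial>std_gaussian)"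
      by (rule g.nn_integral_fst[symmetric]) (intro measurable_compose[OF measurable_fst] measurable_compose[OF _ measurable_ennreal] borel_measurable_norm, use Pm in \<open>simp cong: measurable_cong_sets\<close>)
    also have "\<dots> = (\<integral>\<^sup>+g. ennreal (norm (Phi_prod v S g)) \<partial>std_gaussian)"
      using g.emeasure_space_1 by simp
    also have "\<dots> < \<infinity>" using C by (auto intro: le_less_trans)
    finally show "(\<integral>\<^sup>+p. ennreal (norm (Phi_integrand v S p)) \<partial>(std_gaussian \<Otimes>\<^sub>M std_gaussian)) < \<infinity>" .
  qed
  have "(\<integral>p. Phi_integrand v S p \<partial>std_gaussian) = (\<integral>p. Phi_integrand v S p \<partial>(std_gaussian \<Otimes>\<^sub>M std_gaussian))"
    by (simp only: std_gaussian_pair)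
  also have "\<dots> = (\<integral>g. \<integral>t. Phi_integrand v S (g, t) \<partial>std_gaussian \<partial>std_gaussian)"
    by (rule gg.integral_fst'[OF fin, symmetric])
  also have "\<dots> = (\<integral>g. Phi_prod v S g * of_real (\<integral>t. ?K t \<partial>std_gaussian) \<partial>std_gaussian)"
    by (simp add: Phi_integrand_def del: of_real_prod)
  also have "\<dots> = (\<integral>g. Phi_prod v S g \<partial>std_gaussian) * of_real (\<integral>t. ?K t \<partial>std_gaussian)"
    by (simp del: of_real_prod)
  also have "\<dots> = of_real (inner_angle v S) * of_real (outer_angle v S)"
    by (simp add: inner_angle_eq[OF nz S int] outer_angle_eq[OF nz Sne])
  finally show ?thesis by (simp add: tile_split)
qed

lemma sum_le_prod_one_plus:
  fixes a :: "'i \<Rightarrow> real"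
  assumes "finite I" "\<And>i. i \<in> I \<Longrightarrow> 0 \<le> a i"
  shows "1 + (\<Sum>i\<in>I. a i) \<le> (\<Prod>i\<in>I. 1 + a i)"
  using assms
proof (induction I rule: finite_induct)
  case (insert i I)
  have "1 + (\<Sum>i\<in>insert i I. a i) \<le> (1 + a i) * (1 + (\<Sum>i\<in>I. a i))"
    using insert by (simp add: algebra_simps sum_nonneg)
  also have "\<dots> \<le> (1 + a i) * (\<Prod>i\<in>I. 1 + a i)" using insert by (intro mult_left_mono) auto
  finally show ?case using insert by simp
qed simp

text \<open>The majorant is a product of functions of single coordinates, so its mean factorises
  over the independent \<open>v j\<close>.\<close>

lemma snorm_ratio_bound:
  fixes v :: "real ^ 'n::finite"
  assumes "a \<noteq> b"
  shows "snorm v S / (sqrt \<bar>v $ a\<bar> * sqrt \<bar>v $ b\<bar>) \<le> (\<Prod>i\<in>UNIV. (1 + \<bar>v $ i\<bar>) * (1 + 1 / sqrt \<bar>v $ i\<bar>))"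
proof -
  let ?q = "\<lambda>i. 1 + 1 / sqrt \<bar>v $ i\<bar>"
  have q1: "1 \<le> ?q i" for i by simp
  have "snorm v S \<le> (\<Sum>i\<in>S. \<bar>v $ i\<bar>)"
    using L2_set_le_sum_abs[of "\<lambda>i. v $ i" S] by (simp add: snorm_def L2_set_def)
  also have "\<dots> \<le> (\<Sum>i\<in>UNIV. \<bar>v $ i\<bar>)" by (intro sum_mono2) auto
  also have "\<dots> \<le> (\<Prod>i\<in>UNIV. 1 + \<bar>v $ i\<bar>)" using sum_le_prod_one_plus[of UNIV "\<lambda>i. \<bar>v $ i\<bar>"] by simp
  finally have 1: "snorm v S \<le> (\<Prod>i\<in>UNIV. 1 + \<bar>v $ i\<bar>)" .
  have "1 / sqrt \<bar>v $ a\<bar> * (1 / sqrt \<bar>v $ b\<bar>) \<le> ?q a * ?q b" by (intro mult_mono) simp_all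
  also have "\<dots> = (\<Prod>i\<in>{a, b}. ?q i)" using assms by simp
  also have "\<dots> \<le> (\<Prod>i\<in>UNIV. ?q i)" by (intro prod_mono2) (auto intro: order_trans[OF zero_le_one q1])
  finally have 2: "1 / sqrt \<bar>v $ a\<bar> * (1 / sqrt \<bar>v $ b\<bar>) \<le> (\<Prod>i\<in>UNIV. ?q i)" .
  have "snorm v S / (sqrt \<bar>v $ a\<bar> * sqrt \<bar>v $ b\<bar>) = snorm v S * (1 / sqrt \<bar>v $ a\<bar> * (1 / sqrt \<bar>v $ b\<bar>))" by simp
  also have "\<dots> \<le> (\<Prod>i\<in>UNIV. 1 + \<bar>v $ i\<bar>) * (\<Prod>i\<in>UNIV. ?q i)"
    by (intro mult_mono 1 2 prod_nonneg) auto
  finally show ?thesis by (simp only: prod.distrib)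
qed

context separation_model
begin

text \<open>A label only changes the sign of \<open>x j \<omega> \<bullet> b\<close>, and an even
  function does not see it; the Gaussian law of the covariate then suffices.\<close>

lemma even_moment:
  fixes f :: "real \<Rightarrow> ennreal"
  assumes f[measurable]: "f \<in> borel_measurable borel" and even: "\<And>t. f (- t) = f t" and j: "j \<in> {1..n}"
  shows "(\<integral>\<^sup>+\<omega>. f (v j \<omega>) \<partial>M) = (\<integral>\<^sup>+t. f t \<partial>std_gaussian)"
proof -
  have "(\<integral>\<^sup>+\<omega>. f (v j \<omega>) \<partial>M) = (\<integral>\<^sup>+\<omega>. f (x j \<omega> \<bullet> b) \<partial>M)"
  proof (rule nn_integral_cong)
    fix \<omega> assume "\<omega> \<in> space M"
    from y_values[OF j this] show "f (v j \<omega>) = f (x j \<omega> \<bullet> b)"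
      by (auto simp: v_eq z_def even)
  qed
  also have "\<dots> = (\<integral>\<^sup>+u. f (u \<bullet> b) \<partial>distr M borel (x j))"
    by (rule nn_integral_distr[OF x_measurable[OF j], symmetric]) simp
  also have "\<dots> = (\<integral>\<^sup>+t. f t \<partial>std_gaussian)"
    unfolding gaussian[OF j] by (rule nn_integral_std_gaussian_inner[OF f norm_b])
  finally show ?thesis .
qed

lemma snorm_ratio_moment:
  assumes "a \<noteq> c"
  shows "(\<integral>\<^sup>+\<omega>. ennreal (snorm (w \<omega>) S / (sqrt \<bar>w \<omega> $ a\<bar> * sqrt \<bar>w \<omega> $ c\<bar>)) \<partial>M) < \<infinity>"
proof -
  let ?f = "\<lambda>t. ennreal ((1 + \<bar>t\<bar>) * (1 + 1 / sqrt \<bar>t\<bar>))"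
  have "indep_vars (\<lambda>_. borel) (\<lambda>i. ?f \<circ> v (idx i)) (UNIV :: 'n set)"
    by (rule indep_vars_compose[OF indep_v]) measurable
  then have ind: "indep_vars (\<lambda>_. borel) (\<lambda>i \<omega>. ?f (v (idx i) \<omega>)) (UNIV :: 'n set)" by (simp add: o_def)
  have "(\<integral>\<^sup>+\<omega>. ennreal (snorm (w \<omega>) S / (sqrt \<bar>w \<omega> $ a\<bar> * sqrt \<bar>w \<omega> $ c\<bar>)) \<partial>M) \<le>
     (\<integral>\<^sup>+\<omega>. ennreal (\<Prod>i\<in>UNIV. (1 + \<bar>w \<omega> $ i\<bar>) * (1 + 1 / sqrt \<bar>w \<omega> $ i\<bar>)) \<partial>M)"
    by (intro nn_integral_mono ennreal_leI snorm_ratio_bound assms)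
  also have "\<dots> = (\<integral>\<^sup>+\<omega>. (\<Prod>i\<in>(UNIV :: 'n set). ?f (v (idx i) \<omega>)) \<partial>M)"
    by (intro nn_integral_cong) (simp add: prod_ennreal w_def)
  also have "\<dots> = (\<Prod>i\<in>(UNIV :: 'n set). \<integral>\<^sup>+\<omega>. ?f (v (idx i) \<omega>) \<partial>M)"
    by (rule indep_vars_nn_integral[OF _ ind]) auto
  also have "\<dots> = (\<Prod>i\<in>(UNIV :: 'n set). \<integral>\<^sup>+t. ?f t \<partial>std_gaussian)"
  proof (rule prod.cong[OF refl])
    fix i :: 'n
    show "(\<integral>\<^sup>+\<omega>. ?f (v (idx i) \<omega>) \<partial>M) = (\<integral>\<^sup>+t. ?f t \<partial>std_gaussian)"
      by (rule even_moment[OF _ _ idx_in]) simp_all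
  qed
  also have "\<dots> < \<infinity>" using singular_moment by (simp add: power_less_top_ennreal)
  finally show ?thesis .
qed

text \<open>Integrating out the two Gaussian variables before the data needs absolute integrability
  on the product space: \<open>Phi_prod_bound\<close> controls the inner integral for fixed data,
  and \<open>snorm_ratio_moment\<close> the mean of that bound.\<close>

lemma conditional_angle:
  fixes S :: "'n set"
  assumes N: "N \<in> {1..n-1}" and S: "2 \<le> card S"
  shows "cond_exp_event (M \<Otimes>\<^sub>M std_gaussian) (A N \<times> UNIV) (\<lambda>q. Phi_integrand (w (fst q)) S (snd q)) =
    complex_of_real ((LINT \<omega>:A N|M. tile (w \<omega>) S) / prob (A N))"
proof -
  interpret g: prob_space "std_gaussian :: (real \<times> real) measure" by (rule prob_space_std_gaussian)
  interpret g1: prob_space "std_gaussian :: real measure" by (rule prob_space_std_gaussian)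
  interpret P: pair_prob_space M "std_gaussian :: (real \<times> real) measure" ..
  let ?G = "std_gaussian :: (real \<times> real) measure"
  define F where "F = (\<lambda>q. indicator (A N \<times> UNIV) q *\<^sub>R Phi_integrand (w (fst q)) S (snd q))"
  have Nn: "N \<le> n" using N by auto
  have AM: "A N \<in> events" by (rule A_measurable[OF Nn])
  have Fm: "F \<in> borel_measurable (M \<Otimes>\<^sub>M ?G)"
  proof -
    have "(\<lambda>q. (w (fst q), snd q)) \<in> measurable (M \<Otimes>\<^sub>M ?G) (borel \<Otimes>\<^sub>M borel)"
      by (intro measurable_Pair measurable_compose[OF measurable_fst w_measurable]) (simp cong: measurable_cong_sets)
    then have "(\<lambda>q. (w (fst q), snd q)) \<in> borel_measurable (M \<Otimes>\<^sub>M ?G)" by (simp add: borel_prod)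
    from measurable_compose[OF this Phi_integrand_measurable[of S]]
    have "(\<lambda>q. Phi_integrand (w (fst q)) S (snd q)) \<in> borel_measurable (M \<Otimes>\<^sub>M ?G)" by simp
    then show ?thesis unfolding F_def using AM by (intro borel_measurable_scaleR borel_measurable_indicator) auto
  qed
  obtain a where a: "a \<in> S" using S by fastforce
  have "card (S - {a}) \<noteq> 0" using S a by (simp add: card_Diff_singleton)
  then obtain c where c: "c \<in> S" "a \<noteq> c" by (metis Diff_iff all_not_in_conv card.empty singletonI)
  obtain C where C0: "0 \<le> C" and C: "\<And>u :: real^'n. (\<forall>i. u $ i \<noteq> 0) \<Longrightarrow>
     (\<integral>\<^sup>+g. ennreal (norm (Phi_prod u S g)) \<partial>std_gaussian) \<le> ennreal (C * (snorm u S / (sqrt \<bar>u $ a\<bar> * sqrt \<bar>u $ c\<bar>)))"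
    using Phi_prod_bound[where 'n = 'n] a c by meson
  have bound: "(\<integral>\<^sup>+p. ennreal (norm (F (\<omega>, p))) \<partial>?G) \<le> ennreal C * ennreal (snorm (w \<omega>) S / (sqrt \<bar>w \<omega> $ a\<bar> * sqrt \<bar>w \<omega> $ c\<bar>))" for \<omega>
  proof (cases "\<omega> \<in> A N")
    case True
    have Pm: "Phi_prod (w \<omega>) S \<in> borel_measurable borel" by (rule Phi_prod_measurable[OF A_nonzero[OF True]]) (use a in auto)
    have "(\<integral>\<^sup>+p. ennreal (norm (F (\<omega>, p))) \<partial>?G) \<le> (\<integral>\<^sup>+p. ennreal (norm (Phi_prod (w \<omega>) S (fst p))) \<partial>?G)"
      by (intro nn_integral_mono ennreal_leI) (simp add: F_def True Phi_integrand_norm)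
    also have "\<dots> = (\<integral>\<^sup>+g. \<integral>\<^sup>+t. ennreal (norm (Phi_prod (w \<omega>) S (fst (g, t)))) \<partial>(std_gaussian :: real measure) \<partial>std_gaussian)"
    proof (rule nn_integral_std_gaussian_pair[symmetric])
      have "(fst :: real \<times> real \<Rightarrow> real) \<in> borel_measurable borel" by (intro borel_measurable_continuous_onI continuous_intros)
      from measurable_compose[OF this Pm] show "(\<lambda>p :: real \<times> real. ennreal (norm (Phi_prod (w \<omega>) S (fst p)))) \<in> borel_measurable borel"
        by measurable
    qed
    also have "\<dots> = (\<integral>\<^sup>+g. ennreal (norm (Phi_prod (w \<omega>) S g)) \<partial>std_gaussian)"
      using g1.emeasure_space_1 by simp
    also have "\<dots> \<le> ennreal (C * (snorm (w \<omega>) S / (sqrt \<bar>w \<omega> $ a\<bar> * sqrt \<bar>w \<omega> $ c\<bar>)))"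
      using C A_nonzero[OF True] by blast
    finally show ?thesis unfolding ennreal_mult'[OF C0] .
  qed (simp add: F_def)
  have int: "integrable (M \<Otimes>\<^sub>M ?G) F"
    unfolding integrable_iff_bounded
  proof (intro conjI Fm)
    have "(\<integral>\<^sup>+q. ennreal (norm (F q)) \<partial>(M \<Otimes>\<^sub>M ?G)) = (\<integral>\<^sup>+\<omega>. \<integral>\<^sup>+p. ennreal (norm (F (\<omega>, p))) \<partial>?G \<partial>M)"
      by (rule g.nn_integral_fst[symmetric]) (use Fm in measurable)
    also have "\<dots> \<le> (\<integral>\<^sup>+\<omega>. ennreal C * ennreal (snorm (w \<omega>) S / (sqrt \<bar>w \<omega> $ a\<bar> * sqrt \<bar>w \<omega> $ c\<bar>)) \<partial>M)"
      by (intro nn_integral_mono bound)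
    also have "\<dots> = ennreal C * (\<integral>\<^sup>+\<omega>. ennreal (snorm (w \<omega>) S / (sqrt \<bar>w \<omega> $ a\<bar> * sqrt \<bar>w \<omega> $ c\<bar>)) \<partial>M)"
    proof (rule nn_integral_cmult)
      have [measurable]: "(\<lambda>\<omega>. w \<omega> $ i) \<in> borel_measurable M" for i
        using measurable_compose[OF w_measurable nth_measurable] .
      show "(\<lambda>\<omega>. ennreal (snorm (w \<omega>) S / (sqrt \<bar>w \<omega> $ a\<bar> * sqrt \<bar>w \<omega> $ c\<bar>))) \<in> borel_measurable M"
        unfolding snorm_def by measurable
    qed
    also have "\<dots> < \<infinity>" using snorm_ratio_moment[OF c(2), of S] by (simp add: ennreal_mult_less_top)
    finally show "(\<integral>\<^sup>+q. ennreal (norm (F q)) \<partial>(M \<Otimes>\<^sub>M ?G)) < \<infinity>" .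
  qed
  have "(LINT q:A N \<times> UNIV|M \<Otimes>\<^sub>M ?G. Phi_integrand (w (fst q)) S (snd q)) = integral\<^sup>L (M \<Otimes>\<^sub>M ?G) F"
    by (simp add: set_lebesgue_integral_def F_def)
  also have "\<dots> = (\<integral>\<omega>. \<integral>p. F (\<omega>, p) \<partial>?G \<partial>M)" by (rule P.integral_fst'[OF int, symmetric])
  also have "\<dots> = (\<integral>\<omega>. complex_of_real (indicator (A N) \<omega> *\<^sub>R tile (w \<omega>) S) \<partial>M)"
  proof (rule Bochner_Integration.integral_cong[OF refl])
    fix \<omega>
    show "(\<integral>p. F (\<omega>, p) \<partial>?G) = complex_of_real (indicator (A N) \<omega> *\<^sub>R tile (w \<omega>) S)"
      using tile_eq_integral[of "w \<omega>" S, OF A_nonzero S] by (cases "\<omega> \<in> A N") (simp_all add: F_def)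
  qed
  also have "\<dots> = complex_of_real (LINT \<omega>:A N|M. tile (w \<omega>) S)"
    by (simp only: integral_complex_of_real set_lebesgue_integral_def)
  finally have 1: "(LINT q:A N \<times> UNIV|M \<Otimes>\<^sub>M ?G. Phi_integrand (w (fst q)) S (snd q)) = complex_of_real (LINT \<omega>:A N|M. tile (w \<omega>) S)" .
  have "emeasure (M \<Otimes>\<^sub>M ?G) (A N \<times> space ?G) = emeasure M (A N)"
    using g.emeasure_pair_measure_Times[OF AM sets.top[of ?G]] unfolding g.emeasure_space_1 by simp
  then have "measure (M \<Otimes>\<^sub>M ?G) (A N \<times> UNIV) = prob (A N)" unfolding measure_def by (simp add: space_std_gaussian)
  then show ?thesis unfolding cond_exp_event_def 1 by (simp add: scaleR_conv_of_real divide_inverse mult.commute)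
qed

lemma T_sum_tiles:
  assumes "N \<le> n" "k \<noteq> 0"
  shows "T k N = (\<Sum>S | card S = Suc k. LINT \<omega>:A N|M. tile (w \<omega>) S)"
proof -
  have "set_integrable M (A N) (\<lambda>\<omega>. tile (w \<omega>) S)" for S
  proof -
    interpret g: prob_space "std_gaussian :: (real^'n) measure" by (rule prob_space_std_gaussian)
    have "(\<lambda>\<omega>. tile (w \<omega>) S) \<in> borel_measurable M" using measurable_compose[OF w_measurable tile_measurable] .
    moreover have "norm (indicator (A N) \<omega> *\<^sub>R tile (w \<omega>) S) \<le> 1" for \<omega>
      by (cases "\<omega> \<in> A N") (auto simp: tile_def)
    ultimately show ?thesis unfolding set_integrable_def using A_measurable[OF assms(1)]
      by (intro integrable_const_bound[of _ 1]) auto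
  qed
  then have "(\<integral>\<omega>. (\<Sum>S | card S = Suc k. indicator (A N) \<omega> *\<^sub>R tile (w \<omega>) S) \<partial>M) = (\<Sum>S | card S = Suc k. LINT \<omega>:A N|M. tile (w \<omega>) S)"
    unfolding set_integrable_def set_lebesgue_integral_def by (intro Bochner_Integration.integral_sum)
  then show ?thesis unfolding T_def tile_sum_k_def set_lebesgue_integral_def using assms(2) by (simp add: sum_distrib_left)
qed

lemma Phi_integrand_eq:
  fixes S :: "'n set"
  shows "Phi_integrand (w \<omega>) S (g, g') =
    (\<Prod>j\<in>idx ` S. complex_Phi (\<i> * of_real (g * v j \<omega> / sqrt (\<Sum>j\<in>idx ` S. (v j \<omega>)\<^sup>2))))
  * (\<Prod>j\<in>{1..n} - idx ` S. complex_Phi (of_real (g' * v j \<omega> / sqrt (\<Sum>j\<in>idx ` S. (v j \<omega>)\<^sup>2))))"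
proof -
  have inj: "inj idx" and r: "range idx = {1..n}" using idx by (auto simp: bij_betw_def)
  have injS: "inj_on idx S" for S by (rule inj_on_subset[OF inj]) simp
  have c: "{1..n} - idx ` S = idx ` (- S)" unfolding r[symmetric] by (simp only: image_set_diff[OF inj] Compl_eq_Diff_UNIV)
  have s: "snorm (w \<omega>) S = sqrt (\<Sum>j\<in>idx ` S. (v j \<omega>)\<^sup>2)"
    by (simp add: snorm_def w_def sum.reindex[OF injS])
  show ?thesis unfolding c s[symmetric]
    by (simp add: prod.reindex[OF injS] Phi_integrand_def Phi_prod_def complex_Phi_of_real gauss_cdf_def w_def flip: of_real_mult of_real_divide)
qed

text \<open>A set of \<open>Suc k\<close> coordinates corresponds to the pair \<open>(L, R)\<close>
  obtained by cutting its image under \<open>idx\<close> at \<open>N\<close>; the integrand depends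
  on the union only.\<close>

lemma nu_formula:
  assumes N: "N \<in> {1..n-1}" and k: "k \<in> {1..n-1}"
  shows "complex_of_real (\<nu> (n - k) N) =
     (\<Sum>(L, R) \<in> {(L, R). L \<subseteq> {1..N} \<and> R \<subseteq> {N+1..n} \<and> card L + card R = k + 1}.
        cond_exp_event (M \<Otimes>\<^sub>M std_gaussian) (A N \<times> UNIV)
          (\<lambda>(\<omega>, g :: real, g' :: real).
             (\<Prod>j\<in>L \<union> R. complex_Phi (\<i> * of_real (g * v j \<omega> / sqrt (\<Sum>j\<in>L \<union> R. (v j \<omega>)\<^sup>2))))
           * (\<Prod>j\<in>{1..n} - (L \<union> R). complex_Phi (of_real (g' * v j \<omega> / sqrt (\<Sum>j\<in>L \<union> R. (v j \<omega>)\<^sup>2))))))"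
proof -
  have inj: "inj idx" and r: "range idx = {1..n}" using idx by (auto simp: bij_betw_def)
  have Nn: "N \<le> n" and kn: "k < n" and k0: "k \<noteq> 0" using N k by auto
  define X where "X = (\<lambda>J. cond_exp_event (M \<Otimes>\<^sub>M std_gaussian) (A N \<times> UNIV)
          (\<lambda>(\<omega>, g :: real, g' :: real).
             (\<Prod>j\<in>J. complex_Phi (\<i> * of_real (g * v j \<omega> / sqrt (\<Sum>j\<in>J. (v j \<omega>)\<^sup>2))))
           * (\<Prod>j\<in>{1..n} - J. complex_Phi (of_real (g' * v j \<omega> / sqrt (\<Sum>j\<in>J. (v j \<omega>)\<^sup>2))))))"
  have "complex_of_real (\<nu> (n - k) N) = (\<Sum>S | card S = Suc k. complex_of_real ((LINT \<omega>:A N|M. tile (w \<omega>) S) / prob (A N)))"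
    unfolding nu_eq[OF kn] T_sum_tiles[OF Nn k0] by (simp add: sum_divide_distrib)
  also have "\<dots> = (\<Sum>S | card S = Suc k. X (idx ` S))"
  proof (rule sum.cong[OF refl])
    fix S :: "'n set" assume "S \<in> {S. card S = Suc k}"
    then have S: "2 \<le> card S" using k0 by simp
    have "X (idx ` S) = cond_exp_event (M \<Otimes>\<^sub>M std_gaussian) (A N \<times> UNIV) (\<lambda>q. Phi_integrand (w (fst q)) S (snd q))"
      unfolding X_def by (rule arg_cong[where f = "cond_exp_event _ _"]) (simp add: fun_eq_iff Phi_integrand_eq)
    then show "complex_of_real ((LINT \<omega>:A N|M. tile (w \<omega>) S) / prob (A N)) = X (idx ` S)"
      by (simp only: conditional_angle[OF N S])
  qed
  also have "\<dots> = (\<Sum>(L, R) \<in> {(L, R). L \<subseteq> {1..N} \<and> R \<subseteq> {N+1..n} \<and> card L + card R = k + 1}. X (L \<union> R))"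
  proof (rule sum.reindex_bij_witness[where i = "\<lambda>(L, R). idx -` (L \<union> R)" and j = "\<lambda>S. (idx ` S \<inter> {1..N}, idx ` S \<inter> {N+1..n})"])
    have cover: "J \<inter> {1..N} \<union> J \<inter> {N+1..n} = J" if "J \<subseteq> {1..n}" for J using that by auto
    have sub: "idx ` S \<subseteq> {1..n}" for S using r by auto
    fix S :: "'n set" assume S: "S \<in> {S. card S = Suc k}"
    show "(case (idx ` S \<inter> {1..N}, idx ` S \<inter> {N+1..n}) of (L, R) \<Rightarrow> idx -` (L \<union> R)) = S"
      by (simp only: prod.case cover[OF sub] inj_vimage_image_eq[OF inj])
    have "card (idx ` S \<inter> {1..N}) + card (idx ` S \<inter> {N+1..n}) = card (idx ` S)"
      by (subst card_Un_disjoint[symmetric]) (auto simp only: cover[OF sub], auto)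
    also have "\<dots> = k + 1" using S by (simp add: card_image inj_on_subset[OF inj])
    finally show "(idx ` S \<inter> {1..N}, idx ` S \<inter> {N+1..n}) \<in> {(L, R). L \<subseteq> {1..N} \<and> R \<subseteq> {N+1..n} \<and> card L + card R = k + 1}" by simp
    show "(case (idx ` S \<inter> {1..N}, idx ` S \<inter> {N+1..n}) of (L, R) \<Rightarrow> X (L \<union> R)) = X (idx ` S)"
      by (simp only: prod.case cover[OF sub])
  next
    fix LR assume LR: "LR \<in> {(L, R). L \<subseteq> {1..N} \<and> R \<subseteq> {N+1..n} \<and> card L + card R = k + 1}"
    then obtain L R where e: "LR = (L, R)" and L: "L \<subseteq> {1..N}" and R: "R \<subseteq> {N+1..n}" and ca: "card L + card R = k + 1" by auto
    have img: "idx ` (idx -` (L \<union> R)) = L \<union> R" unfolding image_vimage_eq r using L R Nn by auto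
    have "(L \<union> R) \<inter> {1..N} = L" "(L \<union> R) \<inter> {N+1..n} = R" using L R by auto
    then show "(idx ` (case LR of (L, R) \<Rightarrow> idx -` (L \<union> R)) \<inter> {1..N}, idx ` (case LR of (L, R) \<Rightarrow> idx -` (L \<union> R)) \<inter> {N+1..n}) = LR"
      by (simp only: e prod.case img)
    have "card (idx -` (L \<union> R)) = card (L \<union> R)" by (rule card_vimage_inj[OF inj]) (use L R Nn r in auto)
    also have "\<dots> = card L + card R"
    proof (rule card_Un_disjoint)
      have "{1..N} \<inter> {N+1..n} = {}" by auto
      then show "L \<inter> R = {}" using L R by blast
    qed (use L R finite_subset in blast)+
    finally show "(case LR of (L, R) \<Rightarrow> idx -` (L \<union> R)) \<in> {S. card S = Suc k}" by (simp add: e ca)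
  qed
  finally show ?thesis unfolding X_def .
qed

end

theorem theorem3:
  fixes M :: "'w measure"
    and x :: "nat \<Rightarrow> 'w \<Rightarrow> real ^ 'p" and y :: "nat \<Rightarrow> 'w \<Rightarrow> real"
    and \<beta>s :: "real ^ 'p" and n p :: nat
    and idx :: "'n::finite \<Rightarrow> nat"
    and \<delta> :: real and v :: "nat \<Rightarrow> 'w \<Rightarrow> real" and P :: "'w \<Rightarrow> (real ^ 'n) set"
    and A :: "nat \<Rightarrow> 'w set" and \<nu> :: "nat \<Rightarrow> nat \<Rightarrow> real"
  assumes "prob_space M"
    and "p = CARD('p)" and "1 \<le> p" and "p < n"
    \<comment> \<open>\<open>real ^ 'n\<close> is n-dimensional Euclidean space, its coordinates being numbered 1, ..., n by \<open>idx\<close>\<close>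
    and "bij_betw idx UNIV {1..n}"
    and "\<And>j \<omega>. j \<in> {1..n} \<Longrightarrow> \<omega> \<in> space M \<Longrightarrow> y j \<omega> \<in> {-1, 1}"
    and "prob_space.indep_vars M (\<lambda>_. borel) (\<lambda>j \<omega>. (x j \<omega>, y j \<omega>)) {1..n}"
    and "\<And>i j. i \<in> {1..n} \<Longrightarrow> j \<in> {1..n} \<Longrightarrow>
           distr M borel (\<lambda>\<omega>. (x i \<omega>, y i \<omega>)) = distr M borel (\<lambda>\<omega>. (x j \<omega>, y j \<omega>))"
    and "\<And>j. j \<in> {1..n} \<Longrightarrow> distr M borel (x j) = std_gaussian"
    and "\<beta>s \<noteq> 0"
    and "\<And>j. j \<in> {1..n} \<Longrightarrow>
           AE \<omega> in M. cond_prob_rv M (x j) {\<omega> \<in> space M. y j \<omega> = 1} \<omega>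
                    = cond_prob_rv M (\<lambda>\<omega>. x j \<omega> \<bullet> \<beta>s) {\<omega> \<in> space M. y j \<omega> = 1} \<omega>"
  defines "\<delta> \<equiv> \<P>(\<omega> in M. y 1 \<omega> * (x 1 \<omega> \<bullet> \<beta>s) > 0)"
    and "v \<equiv> \<lambda>j \<omega>. y j \<omega> * (x j \<omega> \<bullet> \<beta>s) / norm \<beta>s"
    and "P \<equiv> \<lambda>\<omega>. span {\<chi> i. v (idx i) \<omega>} + {z. \<forall>i. 0 \<le> z $ i}"
    and "A \<equiv> \<lambda>N. {\<omega> \<in> space M. (\<forall>j\<in>{1..N}. v j \<omega> > 0) \<and> (\<forall>j\<in>{N+1..n}. v j \<omega> < 0)}"
    and "\<nu> \<equiv> \<lambda>k N. cond_exp_event M (A N) (\<lambda>\<omega>. intrinsic_volume k (P \<omega>))"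
  shows
    "separation_prob M n x y = \<delta> ^ n + (1 - \<delta>) ^ n
       + 2 * (\<Sum>N=1..n-1. \<Sum>\<^sub>\<infinity>j\<in>{j. 1 \<le> j \<and> odd j}.
                real (n choose N) * \<delta> ^ N * (1 - \<delta>) ^ (n - N) * \<nu> (n - p + 1 + j) N)
     \<and> (\<forall>N\<in>{1..n-1}. measure M (A N) > 0 \<longrightarrow>
          \<nu> 0 N = 0
        \<comment> \<open>the auxiliary Gaussian variables independent of the data live on a product extension of \<open>M\<close>\<close>
        \<and> (\<forall>k\<in>{1..n-1}. complex_of_real (\<nu> (n - k) N) =
             (\<Sum>(L, R) \<in> {(L, R). L \<subseteq> {1..N} \<and> R \<subseteq> {N+1..n} \<and> card L + card R = k + 1}.
                cond_exp_event (M \<Otimes>\<^sub>M std_gaussian) (A N \<times> UNIV)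
                  (\<lambda>(\<omega>, g :: real, g' :: real).
                     (\<Prod>j\<in>L \<union> R. complex_Phi (\<i> * of_real (g * v j \<omega> / sqrt (\<Sum>j\<in>L \<union> R. (v j \<omega>)\<^sup>2))))
                   * (\<Prod>j\<in>{1..n} - (L \<union> R). complex_Phi (of_real (g' * v j \<omega> / sqrt (\<Sum>j\<in>L \<union> R. (v j \<omega>)\<^sup>2)))))))
        \<and> \<nu> n N = \<P>((\<omega>, g) in M \<Otimes>\<^sub>M (\<Pi>\<^sub>M j\<in>{1..n}. std_gaussian).
                    Min ((\<lambda>l. g l / v l \<omega>) ` {1..N}) \<ge> Max ((\<lambda>r. g r / v r \<omega>) ` {N+1..n})
                    \<bar> \<omega> \<in> A N)
        \<and> \<nu> n N = 1 - (\<Sum>k=1..n-1. \<nu> k N))"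
proof -
  interpret m: separation_model M x y \<beta>s n idx
  proof (rule separation_model.intro[OF assms(1)], rule separation_model_axioms.intro)
    show "CARD('p) < n" using \<open>p < n\<close> unfolding assms(2) .
  qed (fact assms)+
  have p: "p = CARD('p)" by fact
  have v: "m.v = v" unfolding assms(13) m.v_def[abs_def] ..
  have \<delta>: "m.\<delta> = \<delta>" unfolding assms(12) m.\<delta>_def ..
  have A: "m.A N = A N" for N unfolding assms(15) m.A_def v ..
  have "P \<omega> = upper_cone {m.w \<omega>}" for \<omega> unfolding assms(14) P_eq_upper_cone m.w_def v ..
  then have \<nu>: "m.\<nu> k N = \<nu> k N" for k N unfolding assms(16) m.\<nu>_def A by simp
  show ?thesis
  proof (intro conjI ballI impI)
    show "separation_prob M n x y = \<delta> ^ n + (1 - \<delta>) ^ n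
       + 2 * (\<Sum>N=1..n-1. \<Sum>\<^sub>\<infinity>j\<in>{j. 1 \<le> j \<and> odd j}.
                real (n choose N) * \<delta> ^ N * (1 - \<delta>) ^ (n - N) * \<nu> (n - p + 1 + j) N)"
      using m.separation_prob_formula unfolding p \<delta> \<nu> .
  next
    fix N assume N: "N \<in> {1..n-1}" and pos: "measure M (A N) > 0"
    show "\<nu> 0 N = 0" using m.nu_0[of N] unfolding \<nu> .
    show "\<nu> n N = \<P>((\<omega>, g) in M \<Otimes>\<^sub>M (\<Pi>\<^sub>M j\<in>{1..n}. std_gaussian).
                    Min ((\<lambda>l. g l / v l \<omega>) ` {1..N}) \<ge> Max ((\<lambda>r. g r / v r \<omega>) ` {N+1..n})
                    \<bar> \<omega> \<in> A N)"
      using m.nu_n_gaussian[OF N pos[folded A]] unfolding \<nu> v A .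
    show "\<nu> n N = 1 - (\<Sum>k=1..n-1. \<nu> k N)"
      using m.nu_n_sum[OF _ pos[folded A]] N unfolding \<nu> by auto
    fix k assume k: "k \<in> {1..n-1}"
    show "complex_of_real (\<nu> (n - k) N) =
             (\<Sum>(L, R) \<in> {(L, R). L \<subseteq> {1..N} \<and> R \<subseteq> {N+1..n} \<and> card L + card R = k + 1}.
                cond_exp_event (M \<Otimes>\<^sub>M std_gaussian) (A N \<times> UNIV)
                  (\<lambda>(\<omega>, g :: real, g' :: real).
                     (\<Prod>j\<in>L \<union> R. complex_Phi (\<i> * of_real (g * v j \<omega> / sqrt (\<Sum>j\<in>L \<union> R. (v j \<omega>)\<^sup>2))))
                   * (\<Prod>j\<in>{1..n} - (L \<union> R). complex_Phi (of_real (g' * v j \<omega> / sqrt (\<Sum>j\<in>L \<union> R. (v j \<omega>)\<^sup>2))))))"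
      using m.nu_formula[OF N k] unfolding \<nu> v A .
  qed
qed

end
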